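(* Let $\mathbf{q} = (q_0, \ldots, q_{m-1}) \in (K^* )^m$ and $\zeta = q_0\cdots q_{m-1}$. If $\zeta$ is not a root of unity then $\operatorname{HH}^*(\Lambda_{\mathbf{q}})/\mathcal{N} \cong K$. If $\zeta$ is a root of unity, then $\operatorname{HH}^*(\Lambda_{\mathbf{q}})/\mathcal{N}$ is a finitely generated commutative $K$-algebra of Krull dimension $2$.
   Context: Let $K$ be a field, $m \geqslant 1$, $\mathcal{Q}$ the quiver with vertices $0, \ldots, m-1$ (indices modulo $m$), arrows $a_i: i\to i+1$, $\bar a_i: i+1\to i$; paths written left to right. For $\mathbf{q}\in(K^* )^m$, $\Lambda_{\mathbf{q}} = K\mathcal{Q}/I_{\mathbf{q}}$ with $I_{\mathbf{q}}$ generated by $a_ia_{i+1}$, $\bar a_{i-1}\bar a_{i-2}$, $q_ia_i\bar a_i - \bar a_{i-1}a_{i-1}$ ($i=0,\dots,m-1$). $\operatorname{HH}^*(\Gamma) = \bigoplus_{n\ge0}\operatorname{Ext}^n_{\Gamma^e}(\Gamma,\Gamma)$ is the Hochschild cohomology ring with Yoneda product, $\Gamma^e=\Gamma^{\mathrm{op}}\otimes_K\Gamma$, and $\mathcal{N}$ is the ideal of $\operatorname{HH}^*(\Gamma)$ generated by all homogeneous nilpotent elements. *)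

theory Defs
  imports "HOL-Algebra.Algebra" "HOL-Library.Extended_Nat"
begin

text \<open>Arrows: Aa i is a_i : i -> i+1, Ab i is abar_i : i+1 -> i (indices mod m).\<close>
datatype arr = Aa nat | Ab nat

fun arr_idx :: "arr \<Rightarrow> nat" where
  "arr_idx (Aa i) = i" | "arr_idx (Ab i) = i"

fun arr_src :: "nat \<Rightarrow> arr \<Rightarrow> nat" where
  "arr_src m (Aa i) = i mod m" | "arr_src m (Ab i) = (i + 1) mod m"

fun arr_tgt :: "nat \<Rightarrow> arr \<Rightarrow> nat" where
  "arr_tgt m (Aa i) = (i + 1) mod m" | "arr_tgt m (Ab i) = i mod m"

text \<open>A path is a pair (starting vertex, list of arrows), written left to right.\<close>
type_synonym path = "nat \<times> arr list"

fun valid_from :: "nat \<Rightarrow> nat \<Rightarrow> arr list \<Rightarrow> bool" where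
  "valid_from m v [] = (v < m)"
| "valid_from m v (a # as) =
     (v < m \<and> arr_idx a < m \<and> arr_src m a = v \<and> valid_from m (arr_tgt m a) as)"

fun path_end :: "nat \<Rightarrow> nat \<Rightarrow> arr list \<Rightarrow> nat" where
  "path_end m v [] = v"
| "path_end m v (a # as) = path_end m (arr_tgt m a) as"

definition valid_path :: "nat \<Rightarrow> path \<Rightarrow> bool" where
  "valid_path m p = valid_from m (fst p) (snd p)"

definition path_conc :: "nat \<Rightarrow> path \<Rightarrow> path \<Rightarrow> path option" where
  "path_conc m p r =
     (if path_end m (fst p) (snd p) = fst r then Some (fst p, snd p @ snd r) else None)"

definition supp :: "('x \<Rightarrow> 'k::zero) \<Rightarrow> 'x set" where
  "supp f = {x. f x \<noteq> 0}"

definition path_alg :: "nat \<Rightarrow> (path \<Rightarrow> 'k::field) ring" where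
  "path_alg m = \<lparr>carrier = {f. finite (supp f) \<and> (\<forall>x. f x \<noteq> 0 \<longrightarrow> valid_path m x)},
      monoid.mult = (\<lambda>f g. \<lambda>z. \<Sum>x\<in>supp f. \<Sum>y\<in>supp g.
                  if path_conc m x y = Some z then f x * g y else 0),
      one = (\<lambda>z. if snd z = [] \<and> fst z < m then 1 else 0),
      ring.zero = (\<lambda>z. 0),
      ring.add = (\<lambda>f g. \<lambda>z. f z + g z)\<rparr>"

definition path_smul :: "'k::field \<Rightarrow> (path \<Rightarrow> 'k) \<Rightarrow> (path \<Rightarrow> 'k)" where
  "path_smul c f = (\<lambda>z. c * f z)"

definition pdelta :: "path \<Rightarrow> (path \<Rightarrow> 'k::field)" where
  "pdelta p = (\<lambda>z. if z = p then 1 else 0)"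

text \<open>Generators of I_q, for i = 0..m-1:
  a_i a_{i+1},  abar_{i-1} abar_{i-2},  q_i a_i abar_i - abar_{i-1} a_{i-1}.\<close>
definition rel_gens :: "nat \<Rightarrow> (nat \<Rightarrow> 'k::field) \<Rightarrow> (path \<Rightarrow> 'k) set" where
  "rel_gens m q =
     (\<Union>i\<in>{..<m}.
       { pdelta (i, [Aa i, Aa ((i + 1) mod m)]),
         pdelta (i, [Ab ((i + m - 1) mod m), Ab ((i + 2 * m - 2) mod m)]),
         (\<lambda>z. q i * pdelta (i, [Aa i, Ab i]) z
              - pdelta (i, [Ab ((i + m - 1) mod m), Aa ((i + m - 1) mod m)]) z) })"

definition rel_ideal :: "nat \<Rightarrow> (nat \<Rightarrow> 'k::field) \<Rightarrow> (path \<Rightarrow> 'k) set" where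
  "rel_ideal m q = genideal (path_alg m) (rel_gens m q)"

definition quot_smul ::
  "('a, 'b) ring_scheme \<Rightarrow> 'a set \<Rightarrow> ('k \<Rightarrow> 'a \<Rightarrow> 'a) \<Rightarrow> 'k \<Rightarrow> 'a set \<Rightarrow> 'a set" where
  "quot_smul R I sm c Y = a_r_coset R I (sm c (SOME x. x \<in> Y))"

definition Lam :: "nat \<Rightarrow> (nat \<Rightarrow> 'k::field) \<Rightarrow> (path \<Rightarrow> 'k) set ring" where
  "Lam m q = path_alg m Quot rel_ideal m q"

definition Lam_smul :: "nat \<Rightarrow> (nat \<Rightarrow> 'k::field) \<Rightarrow> 'k \<Rightarrow> (path \<Rightarrow> 'k) set \<Rightarrow> (path \<Rightarrow> 'k) set" where
  "Lam_smul m q = quot_smul (path_alg m) (rel_ideal m q) path_smul"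

definition hcochains :: "('a, 'b) ring_scheme \<Rightarrow> ('k \<Rightarrow> 'a \<Rightarrow> 'a) \<Rightarrow> nat \<Rightarrow> ('a list \<Rightarrow> 'a) set" where
  "hcochains R sm n = {f.
     (\<forall>xs. length xs = n \<and> set xs \<subseteq> carrier R \<longrightarrow> f xs \<in> carrier R) \<and>
     (\<forall>xs. \<not> (length xs = n \<and> set xs \<subseteq> carrier R) \<longrightarrow> f xs = \<zero>\<^bsub>R\<^esub>) \<and>
     (\<forall>us vs x y c d. length us + length vs + 1 = n \<and> set us \<subseteq> carrier R \<and>
        set vs \<subseteq> carrier R \<and> x \<in> carrier R \<and> y \<in> carrier R \<longrightarrow>
        f (us @ [sm c x \<oplus>\<^bsub>R\<^esub> sm d y] @ vs) =
        sm c (f (us @ [x] @ vs)) \<oplus>\<^bsub>R\<^esub> sm d (f (us @ [y] @ vs)))}"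

definition hsign :: "('a, 'b) ring_scheme \<Rightarrow> nat \<Rightarrow> 'a \<Rightarrow> 'a" where
  "hsign R k y = (if even k then y else \<ominus>\<^bsub>R\<^esub> y)"

definition hdiff :: "('a, 'b) ring_scheme \<Rightarrow> nat \<Rightarrow> ('a list \<Rightarrow> 'a) \<Rightarrow> ('a list \<Rightarrow> 'a)" where
  "hdiff R n f = (\<lambda>xs. if length xs = Suc n \<and> set xs \<subseteq> carrier R then
      (xs ! 0 \<otimes>\<^bsub>R\<^esub> f (tl xs))
      \<oplus>\<^bsub>R\<^esub> (finsum R (\<lambda>i. hsign R i
              (f (take (i - 1) xs @ [xs ! (i - 1) \<otimes>\<^bsub>R\<^esub> xs ! i] @ drop (i + 1) xs))) {1..n})
      \<oplus>\<^bsub>R\<^esub> hsign R (Suc n) (f (take n xs) \<otimes>\<^bsub>R\<^esub> xs ! n)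
    else \<zero>\<^bsub>R\<^esub>)"

definition zcoch :: "('a, 'b) ring_scheme \<Rightarrow> ('a list \<Rightarrow> 'a)" where
  "zcoch R = (\<lambda>xs. \<zero>\<^bsub>R\<^esub>)"

definition hcocycles :: "('a, 'b) ring_scheme \<Rightarrow> ('k \<Rightarrow> 'a \<Rightarrow> 'a) \<Rightarrow> nat \<Rightarrow> ('a list \<Rightarrow> 'a) set" where
  "hcocycles R sm n = {f \<in> hcochains R sm n. hdiff R n f = zcoch R}"

definition hcobound :: "('a, 'b) ring_scheme \<Rightarrow> ('k \<Rightarrow> 'a \<Rightarrow> 'a) \<Rightarrow> nat \<Rightarrow> ('a list \<Rightarrow> 'a) set" where
  "hcobound R sm n = (if n = 0 then {zcoch R} else hdiff R (n - 1) ` hcochains R sm (n - 1))"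

definition cocycle_ring ::
  "('a, 'b) ring_scheme \<Rightarrow> ('k \<Rightarrow> 'a \<Rightarrow> 'a) \<Rightarrow> (nat \<Rightarrow> 'a list \<Rightarrow> 'a) ring" where
  "cocycle_ring R sm = \<lparr>
     carrier = {F. (\<forall>n. F n \<in> hcocycles R sm n) \<and> finite {n. F n \<noteq> zcoch R}},
     monoid.mult = (\<lambda>F G. \<lambda>n xs. if length xs = n \<and> set xs \<subseteq> carrier R then
               finsum R (\<lambda>p. F p (take p xs) \<otimes>\<^bsub>R\<^esub> G (n - p) (drop p xs)) {0..n}
             else \<zero>\<^bsub>R\<^esub>),
     one = (\<lambda>n xs. if n = 0 \<and> xs = [] then \<one>\<^bsub>R\<^esub> else \<zero>\<^bsub>R\<^esub>),
     ring.zero = (\<lambda>n. zcoch R),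
     ring.add = (\<lambda>F G. \<lambda>n xs. F n xs \<oplus>\<^bsub>R\<^esub> G n xs)\<rparr>"

definition coboundary_ideal ::
  "('a, 'b) ring_scheme \<Rightarrow> ('k \<Rightarrow> 'a \<Rightarrow> 'a) \<Rightarrow> (nat \<Rightarrow> 'a list \<Rightarrow> 'a) set" where
  "coboundary_ideal R sm = {F \<in> carrier (cocycle_ring R sm). \<forall>n. F n \<in> hcobound R sm n}"

definition cocycle_smul :: "('k \<Rightarrow> 'a \<Rightarrow> 'a) \<Rightarrow> 'k \<Rightarrow> (nat \<Rightarrow> 'a list \<Rightarrow> 'a) \<Rightarrow> (nat \<Rightarrow> 'a list \<Rightarrow> 'a)" where
  "cocycle_smul sm c F = (\<lambda>n xs. sm c (F n xs))"

text \<open>The Hochschild cohomology ring HH^*(R) = (direct sum of HH^n) with cup (= Yoneda) product.\<close>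
definition HH :: "('a, 'b) ring_scheme \<Rightarrow> ('k \<Rightarrow> 'a \<Rightarrow> 'a) \<Rightarrow> (nat \<Rightarrow> 'a list \<Rightarrow> 'a) set ring" where
  "HH R sm = cocycle_ring R sm Quot coboundary_ideal R sm"

definition HH_smul :: "('a, 'b) ring_scheme \<Rightarrow> ('k \<Rightarrow> 'a \<Rightarrow> 'a) \<Rightarrow> 'k
     \<Rightarrow> (nat \<Rightarrow> 'a list \<Rightarrow> 'a) set \<Rightarrow> (nat \<Rightarrow> 'a list \<Rightarrow> 'a) set" where
  "HH_smul R sm = quot_smul (cocycle_ring R sm) (coboundary_ideal R sm) (cocycle_smul sm)"

definition HH_homogeneous :: "('a, 'b) ring_scheme \<Rightarrow> ('k \<Rightarrow> 'a \<Rightarrow> 'a)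
     \<Rightarrow> (nat \<Rightarrow> 'a list \<Rightarrow> 'a) set \<Rightarrow> bool" where
  "HH_homogeneous R sm Y \<longleftrightarrow> Y \<in> carrier (HH R sm) \<and>
     (\<exists>n F. F \<in> Y \<and> (\<forall>k. k \<noteq> n \<longrightarrow> F k = zcoch R))"

definition nilpotent_elem :: "('c, 'd) ring_scheme \<Rightarrow> 'c \<Rightarrow> bool" where
  "nilpotent_elem S x \<longleftrightarrow> x \<in> carrier S \<and> (\<exists>k::nat. k > 0 \<and> x [^]\<^bsub>S\<^esub> k = \<zero>\<^bsub>S\<^esub>)"

definition HH_nil :: "('a, 'b) ring_scheme \<Rightarrow> ('k \<Rightarrow> 'a \<Rightarrow> 'a) \<Rightarrow> (nat \<Rightarrow> 'a list \<Rightarrow> 'a) set set" where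
  "HH_nil R sm = genideal (HH R sm) {Y. HH_homogeneous R sm Y \<and> nilpotent_elem (HH R sm) Y}"

definition HH_red :: "('a, 'b) ring_scheme \<Rightarrow> ('k \<Rightarrow> 'a \<Rightarrow> 'a) \<Rightarrow> (nat \<Rightarrow> 'a list \<Rightarrow> 'a) set set ring" where
  "HH_red R sm = HH R sm Quot HH_nil R sm"

definition HH_red_smul :: "('a, 'b) ring_scheme \<Rightarrow> ('k \<Rightarrow> 'a \<Rightarrow> 'a) \<Rightarrow> 'k
     \<Rightarrow> (nat \<Rightarrow> 'a list \<Rightarrow> 'a) set set \<Rightarrow> (nat \<Rightarrow> 'a list \<Rightarrow> 'a) set set" where
  "HH_red_smul R sm = quot_smul (HH R sm) (HH_nil R sm) (HH_smul R sm)"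

definition field_ring :: "'k::field ring" where
  "field_ring = \<lparr>carrier = UNIV, monoid.mult = (*), one = 1, ring.zero = 0, ring.add = (+)\<rparr>"

definition kalg_iso_to_K :: "('c, 'd) ring_scheme \<Rightarrow> ('k::field \<Rightarrow> 'c \<Rightarrow> 'c) \<Rightarrow> bool" where
  "kalg_iso_to_K S sm \<longleftrightarrow> (\<exists>\<phi>. bij_betw \<phi> (UNIV :: 'k set) (carrier S) \<and>
      \<phi> \<in> ring_hom field_ring S \<and> (\<forall>c x. \<phi> (c * x) = sm c (\<phi> x)))"

inductive_set kalg_generated :: "('c, 'd) ring_scheme \<Rightarrow> ('k \<Rightarrow> 'c \<Rightarrow> 'c) \<Rightarrow> 'c set \<Rightarrow> 'c set"
  for S sm G where
  gen: "x \<in> G \<Longrightarrow> x \<in> kalg_generated S sm G"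
| one: "\<one>\<^bsub>S\<^esub> \<in> kalg_generated S sm G"
| add: "x \<in> kalg_generated S sm G \<Longrightarrow> y \<in> kalg_generated S sm G \<Longrightarrow> x \<oplus>\<^bsub>S\<^esub> y \<in> kalg_generated S sm G"
| mult: "x \<in> kalg_generated S sm G \<Longrightarrow> y \<in> kalg_generated S sm G \<Longrightarrow> x \<otimes>\<^bsub>S\<^esub> y \<in> kalg_generated S sm G"
| smul: "x \<in> kalg_generated S sm G \<Longrightarrow> sm c x \<in> kalg_generated S sm G"

definition finitely_generated_kalg :: "('c, 'd) ring_scheme \<Rightarrow> ('k \<Rightarrow> 'c \<Rightarrow> 'c) \<Rightarrow> bool" where
  "finitely_generated_kalg S sm \<longleftrightarrow>
     (\<exists>G. finite G \<and> G \<subseteq> carrier S \<and> kalg_generated S sm G = carrier S)"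

definition prime_chain :: "('c, 'd) ring_scheme \<Rightarrow> (nat \<Rightarrow> 'c set) \<Rightarrow> nat \<Rightarrow> bool" where
  "prime_chain S P n \<longleftrightarrow> (\<forall>i\<le>n. primeideal (P i) S) \<and> (\<forall>i<n. P i \<subset> P (Suc i))"

definition krull_dim :: "('c, 'd) ring_scheme \<Rightarrow> enat" where
  "krull_dim S = (SUP n \<in> {n. \<exists>P. prime_chain S P n}. enat n)"

end

theory Submission
  imports Defs "HOL-Number_Theory.Cong" "HOL-Computational_Algebra.Polynomial"
begin

text \<open>Evaluating a Hochschild cocycle on the elements of the Koszul coalgebra (words in \<open>a\<close> and \<open>\<bar>a\<close> subject to
  the quadratic dual relations), reducing the values modulo the radical and rescaling gives a ring homomorphism
  from \<open>HH\<^sup>*\<close> to \<open>K[x, y]\<close>: a Koszul element with \<open>s\<close> letters \<open>a\<close> and \<open>t\<close> letters \<open>\<bar>a\<close> contributes to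
  \<open>x\<^sup>s y\<^sup>t\<close>. A cocycle that vanishes on all Koszul elements is a coboundary, by a zigzag along a contraction of the
  Koszul complex. Since the third power of the radical is zero, the cube of a homogeneous class in the kernel vanishes; hence
  the kernel is the ideal of nilpotents. The cocycle condition on the \<open>e\<^sub>i\<close>-components confines the image to the
  span of the monomials with exponents in a submonoid \<open>SS\<close>, and cup products of skew derivations realise all of them.
  The monoid is trivial if \<open>\<zeta>\<close> is not a root of unity; otherwise it contains powers of \<open>x\<close> and of \<open>y\<close> and is
  periodic, so the monoid algebra is finitely generated. Its Krull dimension is at least 2 because of the
  evaluations at \<open>y = 0\<close> and at the origin, and at most 2 because any three polynomials in two variables are algebraically dependent.\<close>

section \<open>The algebra in coordinates and its bar differential\<close>

text \<open>The cochains are all K-multilinear maps, neither normalised nor relative to the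
  vertices. Evaluation on Koszul elements is explicit and respects products, because Koszul elements
  are tensors closed under deconcatenation; a chain map in the opposite direction has no convenient
  closed form. What it would provide is obtained otherwise: injectivity up to coboundaries by a
  double complex with the bar differential in one direction and the Koszul differential in the
  other, surjectivity by cocycles written down on arbitrary arguments. Vertices are integers because
  a Koszul element with \<open>s\<close> letters \<open>a\<close> and \<open>t\<close> letters
  \<open>abar\<close> runs from \<open>i\<close> to \<open>i + s - t\<close>; for small
  \<open>m\<close> the end vertex modulo \<open>m\<close> does not determine \<open>s - t\<close>,
  so the start vertex and \<open>s\<close> are recorded separately. The constants of the Koszul
  elements are ratios of one quasi-periodic function \<open>Kp\<close>. Its multiplier over one turn
  of the quiver is, up to sign, the inverse of \<zeta>, and so \<zeta> decides which exponents
  occur.\<close>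

text \<open>Coordinates of an element of the algebra at the basis \<open>e\<^sub>i\<close> (\<open>KE\<close>), \<open>a\<^sub>i : i \<rightarrow> i + 1\<close> (\<open>KA\<close>),
  \<open>\<bar>a\<^sub>i\<^sub>-\<^sub>1 : i \<rightarrow> i - 1\<close> (\<open>KB\<close>) and \<open>a\<^sub>i \<bar>a\<^sub>i\<close> (\<open>KP\<close>), all indexed by their source \<open>i\<close>. Vertices are
  integers, and elements of the algebra are the families that are periodic modulo \<open>m\<close> (the set \<open>V\<close> below).\<close>

datatype kind = KE | KA | KB | KP

datatype 'k el = El (cf: "kind \<Rightarrow> int \<Rightarrow> 'k")

instantiation el :: (ab_group_add) ab_group_add
begin
definition "0 = El (\<lambda>k i. 0)"
definition "x + y = El (\<lambda>k i. cf x k i + cf y k i)"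
definition "- x = El (\<lambda>k i. - cf x k i)"
definition "x - y = El (\<lambda>k i. cf x k i - cf y k i)"
instance
  by standard (simp_all add: zero_el_def plus_el_def uminus_el_def minus_el_def algebra_simps el.expand)
end

lemma cf_simps [simp]: "cf 0 k i = 0" "cf (x + y) k i = cf x k i + cf y k i"
  "cf (- x) k i = - cf x k i" "cf (x - y) k i = cf x k i - cf y k i"
  by (simp_all add: zero_el_def plus_el_def uminus_el_def minus_el_def)

lemma el_eqI: "(\<And>i. cf x KE i = cf y KE i) \<Longrightarrow> (\<And>i. cf x KA i = cf y KA i) \<Longrightarrow> (\<And>i. cf x KB i = cf y KB i)
   \<Longrightarrow> (\<And>i. cf x KP i = cf y KP i) \<Longrightarrow> x = y"
  by (rule el.expand, rule ext, rule ext, rename_tac k i, case_tac k) simp_all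

lemma el_eqI': "(\<And>k i. cf x k i = cf y k i) \<Longrightarrow> x = y"
  by (rule el_eqI)

definition scl :: "'k::field \<Rightarrow> 'k el \<Rightarrow> 'k el" where
  "scl c x = El (\<lambda>k i. c * cf x k i)"

lemma scl_app [simp]: "cf (scl c x) k i = c * cf x k i"
  by (simp add: scl_def)

lemma scl_simps [simp]: "scl 0 x = 0" "scl 1 x = x" "scl c 0 = 0" "scl c (scl d x) = scl (c * d) x"
  by (rule el_eqI'; simp add: mult.assoc)+

lemma scl_add: "scl c (x + y) = scl c x + scl c y" "scl (c + d) x = scl c x + scl d x"
  by (rule el_eqI'; simp add: algebra_simps)+

lemma scl_minus: "scl c (- x) = - scl c x" "scl (- c) x = - scl c x" "scl c (x - y) = scl c x - scl c y"
  by (rule el_eqI'; simp add: algebra_simps)+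

lemma cf_sum: "cf (\<Sum>a\<in>A. f a) k i = (\<Sum>a\<in>A. cf (f a) k i)"
  by (induction A rule: infinite_finite_induct) auto

locale qv =
  fixes m :: nat and q :: "nat \<Rightarrow> 'k::field"
  assumes m1: "m \<ge> 1" and q0: "\<forall>i<m. q i \<noteq> 0"
begin

definition Q :: "int \<Rightarrow> 'k" where "Q i = q (nat (i mod int m))"

lemma Q_nz [simp]: "Q i \<noteq> 0"
  using m1 q0 by (simp add: Q_def nat_less_iff)

lemma Q_shift [simp]: "Q (i + int m) = Q i"
  by (simp add: Q_def)

text \<open>At the vertex \<open>i\<close> the path \<open>abar a\<close> equals \<open>q_i\<close>
  times \<open>a abar\<close>, whence the factor \<open>Q i\<close> in the \<open>KP\<close>
  coordinate; paths of length three vanish.\<close>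

definition mul :: "'k el \<Rightarrow> 'k el \<Rightarrow> 'k el" (infixl "\<star>" 70) where
  "x \<star> y = El (\<lambda>k i. case k of
      KE \<Rightarrow> cf x KE i * cf y KE i
    | KA \<Rightarrow> cf x KE i * cf y KA i + cf x KA i * cf y KE (i + 1)
    | KB \<Rightarrow> cf x KE i * cf y KB i + cf x KB i * cf y KE (i - 1)
    | KP \<Rightarrow> cf x KE i * cf y KP i + cf x KP i * cf y KE i + cf x KA i * cf y KB (i + 1) + Q i * cf x KB i * cf y KA (i - 1))"

lemma mul_app [simp]:
  "cf (x \<star> y) KE i = cf x KE i * cf y KE i"
  "cf (x \<star> y) KA i = cf x KE i * cf y KA i + cf x KA i * cf y KE (i + 1)"
  "cf (x \<star> y) KB i = cf x KE i * cf y KB i + cf x KB i * cf y KE (i - 1)"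
  "cf (x \<star> y) KP i = cf x KE i * cf y KP i + cf x KP i * cf y KE i + cf x KA i * cf y KB (i + 1) + Q i * cf x KB i * cf y KA (i - 1)"
  by (simp_all add: mul_def)

lemma mul_assoc: "(x \<star> y) \<star> z = x \<star> (y \<star> z)"
  by (rule el_eqI) (simp_all add: algebra_simps)

lemma mul_distrib: "(x + y) \<star> z = x \<star> z + y \<star> z" "x \<star> (y + z) = x \<star> y + x \<star> z"
  by (rule el_eqI; simp add: algebra_simps)+

lemma mul_minus: "(- x) \<star> z = - (x \<star> z)" "x \<star> (- z) = - (x \<star> z)"
  "(x - y) \<star> z = x \<star> z - y \<star> z" "x \<star> (y - z) = x \<star> y - x \<star> z"
  by (rule el_eqI; simp add: algebra_simps)+

lemma mul_scl: "scl c x \<star> z = scl c (x \<star> z)" "x \<star> scl c z = scl c (x \<star> z)"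
  by (rule el_eqI; simp add: algebra_simps)+

lemma mul_0 [simp]: "0 \<star> x = 0" "x \<star> 0 = 0"
  by (rule el_eqI; simp)+

definition one1 :: "'k el" where "one1 = El (\<lambda>k i. if k = KE then 1 else 0)"

lemma mul_1 [simp]: "one1 \<star> x = x" "x \<star> one1 = x"
  by (rule el_eqI; simp add: one1_def)+

definition V :: "'k el set" where "V = {x. \<forall>k i. cf x k (i + int m) = cf x k i}"

lemma V_D: "x \<in> V \<Longrightarrow> cf x k (i + int m) = cf x k i"
  by (simp add: V_def)

lemma V_D': "x \<in> V \<Longrightarrow> [i = j] (mod int m) \<Longrightarrow> cf x k i = cf x k j"
proof -
  assume x: "x \<in> V" and "[i = j] (mod int m)"
  then obtain c where c: "i = j + c * int m"
    by (metis cong_iff_lin cong_sym mult.commute)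
  have *: "cf x k (j + int n * int m) = cf x k j" for n j
  proof (induction n)
    case (Suc n)
    have "j + int (Suc n) * int m = (j + int n * int m) + int m" by (simp add: algebra_simps)
    then show ?case using V_D[OF x] Suc by metis
  qed simp
  show ?thesis
  proof (cases "c \<ge> 0")
    case True
    then show ?thesis using *[of j "nat c"] c by simp
  next
    case False
    then show ?thesis using *[of i "nat (- c)"] c by simp
  qed
qed

lemma V_cl [simp]: "0 \<in> V" "one1 \<in> V" "x \<in> V \<Longrightarrow> y \<in> V \<Longrightarrow> x + y \<in> V" "x \<in> V \<Longrightarrow> - x \<in> V"
  "x \<in> V \<Longrightarrow> y \<in> V \<Longrightarrow> x - y \<in> V" "x \<in> V \<Longrightarrow> scl c x \<in> V"
  by (auto simp: V_def one1_def)

lemma V_mul [simp]: "x \<in> V \<Longrightarrow> y \<in> V \<Longrightarrow> x \<star> y \<in> V"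
proof -
  assume x: "x \<in> V" and y: "y \<in> V"
  have s: "cf z k (i + int m + 1) = cf z k (i + 1)" "cf z k (i + int m - 1) = cf z k (i - 1)" if "z \<in> V" for z k i
    using V_D[OF that, of k "i + 1"] V_D[OF that, of k "i - 1"] by (simp_all add: algebra_simps)
  have "cf (x \<star> y) k (i + int m) = cf (x \<star> y) k i" for k i
    using s[OF x] s[OF y] V_D[OF x] V_D[OF y] by (cases k) simp_all
  then show ?thesis by (simp add: V_def)
qed

lemma V_sum [simp]: "(\<And>a. a \<in> A \<Longrightarrow> f a \<in> V) \<Longrightarrow> (\<Sum>a\<in>A. f a) \<in> V"
  by (induction A rule: infinite_finite_induct) auto

section \<open>Periodic basis elements and their products\<close>

definition dl :: "int \<Rightarrow> int \<Rightarrow> 'k" where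
  "dl i j = (if [j = i] (mod int m) then 1 else 0)"

lemma dl_simps [simp]: "dl i i = 1" "dl (i + int m) j = dl i j" "dl i (j + int m) = dl i j"
  "dl (i + 1) (j + 1) = dl i j" "dl (i - 1) (j - 1) = dl i j" "dl i j * dl i j = dl i j" "dl i j * (dl i j * x) = dl i j * x"
proof -
  show "dl (i - 1) (j - 1) = dl i j"
    using cong_add_rcancel[of "j - 1" 1 "i - 1" "int m"] by (simp add: dl_def)
qed (simp_all add: dl_def cong_def cong_add_rcancel[unfolded cong_def])

definition bs :: "kind \<Rightarrow> int \<Rightarrow> 'k el" where
  "bs k i = El (\<lambda>k' j. if k' = k then dl i j else 0)"

lemma bs_app [simp]: "cf (bs k i) k' j = (if k' = k then dl i j else 0)"
  by (simp add: bs_def)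

lemma bs_V [simp]: "bs k i \<in> V"
  by (auto simp: V_def)

lemma bs_shift [simp]: "bs k (i + int m) = bs k i"
  by (rule el_eqI') simp

abbreviation "ee \<equiv> bs KE" abbreviation "aa \<equiv> bs KA" abbreviation "bb \<equiv> bs KB" abbreviation "pp \<equiv> bs KP"

lemma Q_cong: "[i = j] (mod int m) \<Longrightarrow> Q i = Q j"
  by (simp add: Q_def cong_def)

lemma dl_Q: "Q j * dl i j = Q i * dl i j" "dl i j = 0 \<or> Q j = Q i"
  by (auto simp: dl_def intro: Q_cong)

lemma bs_mult [simp]:
  "aa i \<star> aa j = 0" "bb i \<star> bb j = 0"
  "aa i \<star> bb (i + 1) = pp i" "bb i \<star> aa (i - 1) = scl (Q i) (pp i)"
  "pp i \<star> aa j = 0" "pp i \<star> bb j = 0" "aa i \<star> pp j = 0" "bb i \<star> pp j = 0" "pp i \<star> pp j = 0"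
  "aa i \<star> ee (i + 1) = aa i" "bb i \<star> ee (i - 1) = bb i" "pp i \<star> ee i = pp i"
  "ee i \<star> ee i = ee i" "ee i \<star> aa i = aa i" "ee i \<star> bb i = bb i" "ee i \<star> pp i = pp i"
  by (rule el_eqI; simp add: dl_Q mult.assoc)+

lemma dl_V: "x \<in> V \<Longrightarrow> dl j i = 0 \<or> cf x k i = cf x k j"
  by (auto simp: dl_def dest: V_D')

text \<open>Coordinates are indexed by sources, so \<open>ee j\<close> on the left keeps exactly the
  four coordinates at \<open>j\<close>. Reductions to basis elements rest on this expansion.\<close>

lemma ee_mul: "x \<in> V \<Longrightarrow> ee j \<star> x = scl (cf x KE j) (ee j) + scl (cf x KA j) (aa j) + scl (cf x KB j) (bb j) + scl (cf x KP j) (pp j)"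
  by (rule el_eqI) (simp_all add: dl_V mult.commute)

text \<open>A coboundary splits as \<open>x f(ys) + rr f (x # ys)\<close>; on functions of all arguments \<open>rr\<close> is itself
  a differential and commutes with left multiplications, so it serves as the bar differential.\<close>

definition mrg :: "'k el \<Rightarrow> ('k el list \<Rightarrow> 'k el) \<Rightarrow> 'k el list \<Rightarrow> 'k el" where
  "mrg x f ys = (case ys of [] \<Rightarrow> f [] \<star> x | y # zs \<Rightarrow> f ((x \<star> y) # zs))"

lemma mrg_simps [simp]: "mrg x f [] = f [] \<star> x" "mrg x f (y # zs) = f ((x \<star> y) # zs)"
  by (simp_all add: mrg_def)

fun rr :: "('k el list \<Rightarrow> 'k el) \<Rightarrow> 'k el list \<Rightarrow> 'k el" where
  "rr f [] = 0"
| "rr f (x # ys) = - mrg x f ys - rr (\<lambda>l. f (x # l)) ys"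

text \<open>Multilinearity is stated by peeling off the first argument, which is the recursion
  pattern of \<open>rr\<close> and of evaluation on Koszul elements. Values outside lists of length
  \<open>n\<close> over \<open>V\<close> are left open.\<close>

fun ml :: "nat \<Rightarrow> ('k el list \<Rightarrow> 'k el) \<Rightarrow> bool" where
  "ml 0 f = (f [] \<in> V)"
| "ml (Suc n) f = ((\<forall>x\<in>V. ml n (\<lambda>l. f (x # l))) \<and>
     (\<forall>x\<in>V. \<forall>y\<in>V. \<forall>c d. \<forall>ys. length ys = n \<and> set ys \<subseteq> V \<longrightarrow>
        f ((scl c x + scl d y) # ys) = scl c (f (x # ys)) + scl d (f (y # ys))))"

lemma ml_SucI: "(\<And>x. x \<in> V \<Longrightarrow> ml n (\<lambda>l. f (x # l))) \<Longrightarrow>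
  (\<And>x y c d ys. x \<in> V \<Longrightarrow> y \<in> V \<Longrightarrow> length ys = n \<Longrightarrow> set ys \<subseteq> V \<Longrightarrow>
     f ((scl c x + scl d y) # ys) = scl c (f (x # ys)) + scl d (f (y # ys))) \<Longrightarrow> ml (Suc n) f"
  by simp

lemma ml_lin: "ml (Suc n) f \<Longrightarrow> x \<in> V \<Longrightarrow> y \<in> V \<Longrightarrow> length ys = n \<Longrightarrow> set ys \<subseteq> V \<Longrightarrow>
   f ((scl c x + scl d y) # ys) = scl c (f (x # ys)) + scl d (f (y # ys))"
  by simp

lemma ml_Cons: "ml (Suc n) f \<Longrightarrow> x \<in> V \<Longrightarrow> ml n (\<lambda>l. f (x # l))"
  by simp

lemma ml_V: "ml n f \<Longrightarrow> length ys = n \<Longrightarrow> set ys \<subseteq> V \<Longrightarrow> f ys \<in> V"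
proof (induction n arbitrary: f ys)
  case (Suc n)
  then obtain x zs where ys: "ys = x # zs" by (auto simp: length_Suc_conv)
  show ?case using Suc.IH[of "\<lambda>l. f (x # l)" zs] Suc.prems ys by simp
qed simp

declare ml.simps(2) [simp del]

lemma ml_cong: "(\<And>ys. length ys = n \<Longrightarrow> set ys \<subseteq> V \<Longrightarrow> f ys = g ys) \<Longrightarrow> ml n f \<Longrightarrow> ml n g"
proof (induction n arbitrary: f g)
  case (Suc n)
  show ?case
  proof (rule ml_SucI)
    show "ml n (\<lambda>l. g (x # l))" if x: "x \<in> V" for x
      by (rule Suc.IH[of "\<lambda>l. f (x # l)"]) (use Suc.prems x ml_Cons in auto)
    have "g (x # ys) = f (x # ys)" if "x \<in> V" "length ys = n" "set ys \<subseteq> V" for x ys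
      using Suc.prems(1)[of "x # ys"] that by simp
    then show "g ((scl c x + scl d y) # ys) = scl c (g (x # ys)) + scl d (g (y # ys))"
      if "x \<in> V" "y \<in> V" "length ys = n" "set ys \<subseteq> V" for x y c d ys
      using ml_lin[OF Suc.prems(2) that, of c d] that by simp
  qed
qed auto

lemma ml_0 [simp]: "ml n (\<lambda>_. 0)"
  by (induction n) (auto simp: ml.simps(2))

lemma ml_add: "ml n f \<Longrightarrow> ml n g \<Longrightarrow> ml n (\<lambda>l. f l + g l)"
proof (induction n arbitrary: f g)
  case (Suc n)
  show ?case
  proof (rule ml_SucI)
    show "ml n (\<lambda>l. f (x # l) + g (x # l))" if "x \<in> V" for x
      by (rule Suc.IH) (use Suc.prems that ml_Cons in auto)
    show "f ((scl c x + scl d y) # ys) + g ((scl c x + scl d y) # ys) = scl c (f (x # ys) + g (x # ys)) + scl d (f (y # ys) + g (y # ys))"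
      if "x \<in> V" "y \<in> V" "length ys = n" "set ys \<subseteq> V" for x y c d ys
      using ml_lin[OF Suc.prems(1) that, of c d] ml_lin[OF Suc.prems(2) that, of c d] by (simp add: scl_add algebra_simps)
  qed
qed auto

lemma ml_scl: "ml n f \<Longrightarrow> ml n (\<lambda>l. scl b (f l))"
proof (induction n arbitrary: f)
  case (Suc n)
  show ?case
  proof (rule ml_SucI)
    show "ml n (\<lambda>l. scl b (f (x # l)))" if "x \<in> V" for x
      by (rule Suc.IH) (use Suc.prems that ml_Cons in auto)
    show "scl b (f ((scl c x + scl d y) # ys)) = scl c (scl b (f (x # ys))) + scl d (scl b (f (y # ys)))"
      if "x \<in> V" "y \<in> V" "length ys = n" "set ys \<subseteq> V" for x y c d ys
      using ml_lin[OF Suc.prems(1) that, of c d] by (simp add: scl_add mult.commute)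
  qed
qed auto

lemma ml_minus: "ml n f \<Longrightarrow> ml n (\<lambda>l. - f l)"
  using ml_scl[of n f "-1"] by (simp add: scl_minus)

lemma ml_lmul: "b \<in> V \<Longrightarrow> ml n f \<Longrightarrow> ml n (\<lambda>l. b \<star> f l)"
proof (induction n arbitrary: f)
  case (Suc n)
  show ?case
  proof (rule ml_SucI)
    show "ml n (\<lambda>l. b \<star> f (x # l))" if "x \<in> V" for x
      by (rule Suc.IH) (use Suc.prems that ml_Cons in auto)
    show "b \<star> f ((scl c x + scl d y) # ys) = scl c (b \<star> f (x # ys)) + scl d (b \<star> f (y # ys))"
      if "x \<in> V" "y \<in> V" "length ys = n" "set ys \<subseteq> V" for x y c d ys
      using ml_lin[OF Suc.prems(2) that, of c d] by (simp add: mul_distrib mul_scl)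
  qed
qed auto

lemma ml_lin_add: "ml (Suc n) f \<Longrightarrow> x \<in> V \<Longrightarrow> y \<in> V \<Longrightarrow> length ys = n \<Longrightarrow> set ys \<subseteq> V \<Longrightarrow>
   f ((x + y) # ys) = f (x # ys) + f (y # ys)"
  using ml_lin[of n f x y ys 1 1] by simp

lemma ml_lin_scl: "ml (Suc n) f \<Longrightarrow> x \<in> V \<Longrightarrow> length ys = n \<Longrightarrow> set ys \<subseteq> V \<Longrightarrow>
   f (scl c x # ys) = scl c (f (x # ys))"
  using ml_lin[of n f x x ys c 0] by simp

lemma ml_lin_0: "ml (Suc n) f \<Longrightarrow> length ys = n \<Longrightarrow> set ys \<subseteq> V \<Longrightarrow> f (0 # ys) = 0"
  using ml_lin_scl[of n f 0 ys 0] by simp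

section \<open>Linearity of the bar differential and the vanishing of its square\<close>

lemma rr_cong: "(\<And>ys. length ys = n \<Longrightarrow> set ys \<subseteq> V \<Longrightarrow> f ys = g ys) \<Longrightarrow> length ys = Suc n \<Longrightarrow> set ys \<subseteq> V
   \<Longrightarrow> rr f ys = rr g ys"
proof (induction n arbitrary: f g ys)
  case 0
  then show ?case by (auto simp: length_Suc_conv)
next
  case (Suc n)
  then obtain x y zs where ys: "ys = x # y # zs" by (auto simp: length_Suc_conv)
  have "rr (\<lambda>l. f (x # l)) (y # zs) = rr (\<lambda>l. g (x # l)) (y # zs)"
    by (rule Suc.IH) (use Suc.prems ys in auto)
  moreover have "f ((x \<star> y) # zs) = g ((x \<star> y) # zs)"
    using Suc.prems ys by auto
  ultimately show ?case by (simp add: ys)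
qed

lemma rr_add: "rr (\<lambda>l. f l + g l) ys = rr f ys + rr g ys"
proof (induction ys arbitrary: f g)
  case (Cons x ys)
  show ?case using Cons[of "\<lambda>l. f (x # l)" "\<lambda>l. g (x # l)"] by (cases ys) (simp_all add: mul_distrib)
qed simp

lemma rr_scl: "rr (\<lambda>l. scl c (f l)) ys = scl c (rr f ys)"
proof (induction ys arbitrary: f)
  case (Cons x ys)
  show ?case using Cons[of "\<lambda>l. f (x # l)"] by (cases ys) (simp_all add: mul_scl scl_minus)
qed simp

lemma rr_0 [simp]: "rr (\<lambda>_. 0) ys = 0"
  using rr_scl[of 0 "\<lambda>_. 0" ys] by simp

lemma rr_minus: "rr (\<lambda>l. - f l) ys = - rr f ys"
  using rr_scl[of "-1" f ys] by (simp add: scl_minus)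

lemma rr_lmul: "rr (\<lambda>l. c \<star> f l) ys = c \<star> rr f ys"
proof (induction ys arbitrary: f)
  case (Cons x ys)
  show ?case using Cons[of "\<lambda>l. f (x # l)"] by (cases ys) (simp_all add: mul_assoc mul_minus)
qed simp

text \<open>By associativity it makes no difference whether \<open>x\<close> is merged into the
  first argument before or after that argument is merged with its successor.\<close>

lemma rr_mrg: "rr (mrg x f) (y # zs) = rr f ((x \<star> y) # zs)"
  by (cases zs) (simp_all add: mul_assoc)

lemma rr_mrg': "ys \<noteq> [] \<Longrightarrow> rr (mrg x f) ys = mrg x (rr f) ys"
  by (cases ys) (simp_all add: rr_mrg del: rr.simps)

text \<open>Peeling off \<open>x\<close> twice leaves two mixed terms, which cancel because
  \<open>rr\<close> commutes with merging \<open>x\<close>; the term in which \<open>x\<close> stays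
  put is the induction hypothesis.\<close>

lemma rr_rr: "rr (rr f) xs = 0"
proof (induction xs arbitrary: f)
  case (Cons x xs)
  show ?case
  proof (cases xs)
    case Nil
    then show ?thesis by simp
  next
    case (Cons y zs)
    have "rr (\<lambda>l. rr f (x # l)) (y # zs) = rr (\<lambda>l. - mrg x f l + - rr (\<lambda>l. f (x # l)) l) (y # zs)"
      by simp
    also have "\<dots> = - rr (mrg x f) (y # zs) - rr (rr (\<lambda>l. f (x # l))) (y # zs)"
      by (simp only: rr_add rr_minus) simp
    also have "rr (rr (\<lambda>l. f (x # l))) (y # zs) = 0" using Cons.IH Cons by simp
    also have "rr (mrg x f) (y # zs) = rr f ((x \<star> y) # zs)" by (rule rr_mrg)
    finally show ?thesis using Cons by simp
  qed
qed simp

lemma ml_mrg: "ml (Suc n) f \<Longrightarrow> x \<in> V \<Longrightarrow> ml (Suc n) (mrg x f)"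
  by (rule ml_SucI) (auto simp: mul_distrib mul_scl ml_lin ml_Cons)

lemma ml_mrg0: "ml 0 f \<Longrightarrow> x \<in> V \<Longrightarrow> ml 0 (mrg x f)"
  by auto

lemma mrg_lin: "ml n f \<Longrightarrow> x \<in> V \<Longrightarrow> y \<in> V \<Longrightarrow> length ys = n \<Longrightarrow> set ys \<subseteq> V \<Longrightarrow>
  mrg (scl c x + scl d y) f ys = scl c (mrg x f ys) + scl d (mrg y f ys)"
  by (cases ys; cases n) (auto simp: mul_distrib mul_scl ml_lin)

lemma ml_rr: "ml n f \<Longrightarrow> ml (Suc n) (rr f)"
proof (induction n arbitrary: f)
  case 0
  then show ?case by (auto simp: mul_distrib mul_scl scl_add scl_minus ml.simps(2))
next
  case (Suc n)
  have 1: "ml (Suc n) (\<lambda>l. rr f (x # l))" if x: "x \<in> V" for x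
  proof -
    have "ml (Suc n) (\<lambda>l. - mrg x f l + - rr (\<lambda>l. f (x # l)) l)"
      by (intro ml_add ml_minus ml_mrg Suc.IH ml_Cons[OF Suc.prems] Suc.prems x)
    then show ?thesis by simp
  qed
  have 2: "rr f ((scl c x + scl d y) # ys) = scl c (rr f (x # ys)) + scl d (rr f (y # ys))"
    if x: "x \<in> V" and y: "y \<in> V" and ys: "length ys = Suc n" "set ys \<subseteq> V" for x y c d ys
  proof -
    have "rr (\<lambda>l. f ((scl c x + scl d y) # l)) ys = rr (\<lambda>l. scl c (f (x # l)) + scl d (f (y # l))) ys"
      by (rule rr_cong[of n]) (use ml_lin[OF Suc.prems x y] ys in auto)
    also have "\<dots> = scl c (rr (\<lambda>l. f (x # l)) ys) + scl d (rr (\<lambda>l. f (y # l)) ys)"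
      by (simp add: rr_add rr_scl)
    finally show ?thesis
      using mrg_lin[OF Suc.prems x y ys, of c d] by (simp add: scl_minus scl_add)
  qed
  show ?case by (rule ml_SucI) (use 1 2 in blast)+
qed

end

section \<open>Koszul elements\<close>

context qv
begin

text \<open>The solution on all integers of \<open>K (i + 1) = - K i / Q i\<close> with value 1 at
  0. Later constants are ratios of its values, so the choice of base point does not affect
  them.\<close>

definition Kp :: "int \<Rightarrow> 'k" where
  "Kp i = (if i \<ge> 0 then \<Prod>l\<in>{0..<i}. - inverse (Q l) else \<Prod>l\<in>{i..<0}. - Q l)"

lemma Kp_Suc: "Kp (i + 1) = - Kp i / Q i"
proof -
  consider "i \<ge> 0" | "i = -1" | "i < -1" by linarith
  then show ?thesis
  proof cases
    case 1
    then have "{0..<i + 1} = insert i {0..<i}" by auto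
    with 1 show ?thesis by (simp add: Kp_def field_simps)
  next
    case 2
    have "{-1..<0::int} = {-1}" by auto
    with 2 show ?thesis by (simp add: Kp_def)
  next
    case 3
    then have "{i..<0} = insert i {i + 1..<0}" by auto
    with 3 show ?thesis by (simp add: Kp_def)
  qed
qed

lemma Kp_nz [simp]: "Kp i \<noteq> 0"
  by (simp add: Kp_def)

lemma Kp_pred: "Kp (i - 1) = - Kp i * Q (i - 1)"
  using Kp_Suc[of "i - 1"] by (simp add: field_simps)

text \<open>Both sides solve the same first-order recursion in \<open>i\<close>, because
  \<open>Q\<close> is periodic. \<open>Kp\<close> itself is only quasi-periodic, with multiplier
  \<open>Kp (int m)\<close>.\<close>

lemma Kp_shift: "Kp (i + int m) = Kp i * Kp (int m)"
proof (induction i rule: int_induct[where k = 0])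
  case base
  show ?case by (simp add: Kp_def)
next
  case (step1 i)
  have "Kp (i + 1 + int m) = Kp ((i + int m) + 1)" by (simp add: algebra_simps)
  then show ?case using step1 by (simp add: Kp_Suc)
next
  case (step2 i)
  have "Kp (i - 1 + int m) = Kp ((i + int m) - 1)" by (simp add: algebra_simps)
  moreover have "Q (i - 1 + int m) = Q (i - 1)" by (rule Q_shift)
  then have "Q (i + int m - 1) = Q (i - 1)" by (simp add: algebra_simps)
  ultimately show ?case using step2 by (simp add: Kp_pred)
qed

text \<open>The relation \<open>q\<^sub>i a\<^sub>i \<bar>a\<^sub>i = \<bar>a\<^sub>i\<^sub>-\<^sub>1 a\<^sub>i\<^sub>-\<^sub>1\<close> makes \<open>a \<bar>a\<close> and \<open>\<bar>a a\<close> proportional in the Koszul dual with ratio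
  \<open>- 1 / Q i\<close>; moving \<open>\<bar>a\<close> from the end of a word with \<open>s\<close> letters \<open>a\<close> to its front costs the factor \<open>kap i s\<close>.\<close>

definition kap :: "int \<Rightarrow> int \<Rightarrow> 'k" where "kap i s = Kp (i + s) / Kp i"

lemma kap_0 [simp]: "kap i 0 = 1"
  by (simp add: kap_def)

lemma kap_nz [simp]: "kap i s \<noteq> 0"
  by (simp add: kap_def)

lemma kap_add: "kap i (s + t) = kap i s * kap (i + s) t"
  by (simp add: kap_def algebra_simps)

lemma kap_shift: "kap (i + int m) s = kap i s"
proof -
  have "Kp (i + int m + s) = Kp (i + s) * Kp (int m)"
    using Kp_shift[of "i + s"] by (simp add: algebra_simps)
  then show ?thesis by (simp add: kap_def Kp_shift)
qed

text \<open>This identity makes the two occurrences of \<open>pp i\<close> cancel when adjacent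
  letters of a Koszul element are multiplied.\<close>

lemma kap_left: "kap i s * Q i = - kap (i + 1) (s - 1)"
  by (simp add: kap_def Kp_Suc)

text \<open>\<open>ev n F i s\<close> evaluates \<open>F\<close> on the element of the Koszul coalgebra of degree \<open>n\<close> that starts at the
  vertex \<open>i\<close> and contains \<open>s\<close> letters \<open>a\<close>, normalised so that \<open>a\<^sup>s \<bar>a\<^sup>n\<^sup>-\<^sup>s\<close> has coefficient 1.\<close>

primrec ev :: "nat \<Rightarrow> ('k el list \<Rightarrow> 'k el) \<Rightarrow> int \<Rightarrow> int \<Rightarrow> 'k el" where
  "ev 0 F i s = (if s = 0 then F [] else 0)"
| "ev (Suc n) F i s = ev n (\<lambda>w. F (aa i # w)) (i + 1) (s - 1) + scl (kap i s) (ev n (\<lambda>w. F (bb i # w)) (i - 1) s)"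

lemma ev_cong: "(\<And>w. length w = n \<Longrightarrow> set w \<subseteq> V \<Longrightarrow> F w = G w) \<Longrightarrow> ev n F i s = ev n G i s"
proof (induction n arbitrary: F G i s)
  case (Suc n)
  have "ev n (\<lambda>w. F (v # w)) j t = ev n (\<lambda>w. G (v # w)) j t" if "v \<in> V" for v j t
    by (rule Suc.IH) (use Suc.prems that in simp)
  then show ?case by simp
qed simp

lemma ev_add: "ev n (\<lambda>w. F w + G w) i s = ev n F i s + ev n G i s"
  by (induction n arbitrary: F G i s) (simp_all add: scl_add add_ac)

lemma ev_scl: "ev n (\<lambda>w. scl c (F w)) i s = scl c (ev n F i s)"
  by (induction n arbitrary: F i s) (simp_all add: scl_add mult.commute)

lemma ev_0 [simp]: "ev n (\<lambda>_. 0) i s = 0"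
  using ev_scl[of n 0 "\<lambda>_. 0"] by simp

lemma ev_minus: "ev n (\<lambda>w. - F w) i s = - ev n F i s"
  using ev_scl[of n "-1" F] by (simp add: scl_minus)

lemma ev_diff: "ev n (\<lambda>w. F w - G w) i s = ev n F i s - ev n G i s"
  using ev_add[of n F "\<lambda>w. - G w"] by (simp add: ev_minus)

lemma ev_lmul: "ev n (\<lambda>w. c \<star> F w) i s = c \<star> ev n F i s"
  by (induction n arbitrary: F i s) (simp_all add: mul_distrib mul_scl)

lemma ev_rmul: "ev n (\<lambda>w. F w \<star> c) i s = ev n F i s \<star> c"
  by (induction n arbitrary: F i s) (simp_all add: mul_distrib mul_scl)

lemma ev_V: "(\<And>w. length w = n \<Longrightarrow> set w \<subseteq> V \<Longrightarrow> F w \<in> V) \<Longrightarrow> ev n F i s \<in> V"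
  by (induction n arbitrary: F i s) simp_all

lemma ev_range: "s < 0 \<or> s > int n \<Longrightarrow> ev n F i s = 0"
  by (induction n arbitrary: F i s) auto

lemma ev_shift: "ev n F (i + int m) s = ev n F i s"
proof (induction n arbitrary: F i s)
  case (Suc n)
  have "i + int m + 1 = (i + 1) + int m" "i + int m - 1 = (i - 1) + int m" by simp_all
  then show ?case by (simp only: ev.simps Suc.IH bs_shift kap_shift)
qed simp

text \<open>Merging the first two letters of a Koszul element gives zero: \<open>a a\<close> and
  \<open>abar abar\<close> vanish, while \<open>a abar\<close> and \<open>abar a\<close> produce
  multiples of \<open>pp i\<close> with opposite coefficients by \<open>kap_left\<close>.\<close>

lemma ev_inner:
  assumes "ml (Suc n + k) f" "length ys = k" "set ys \<subseteq> V"
  shows "ev (Suc n) (\<lambda>w. mrg (aa i) f (w @ ys)) (i + 1) (s - 1)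
    + scl (kap i s) (ev (Suc n) (\<lambda>w. mrg (bb i) f (w @ ys)) (i - 1) s) = 0"
proof -
  have z: "ev n (\<lambda>w. f (0 # w @ ys)) j t = 0" for j t
    using ev_cong[of n "\<lambda>w. f (0 # w @ ys)" "\<lambda>_. 0" j t] ml_lin_0[of "n + k" f] assms by simp
  have p: "ev n (\<lambda>w. f (scl c (pp i) # w @ ys)) j t = scl c (ev n (\<lambda>w. f (pp i # w @ ys)) j t)" for c j t
    using ev_cong[of n "\<lambda>w. f (scl c (pp i) # w @ ys)" "\<lambda>w. scl c (f (pp i # w @ ys))" j t]
      ml_lin_scl[of "n + k" f "pp i" _ c] assms by (simp add: ev_scl)
  show ?thesis
    by (simp add: z p kap_left scl_minus)
qed

text \<open>All merges inside the Koszul element vanish by \<open>ev_inner\<close>, so besides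
  \<open>rr\<close> on \<open>ys\<close> only the last letter being merged into \<open>ys\<close>
  survives. The element ends at \<open>j\<close>; its last letter is \<open>a\<close> from
  \<open>j - 1\<close> or \<open>abar\<close> from \<open>j + 1\<close>. The latter has coefficient
  1 by the normalisation, and \<open>Kp (i + s) / Kp j\<close> is the cost of moving a final
  \<open>a\<close> past all letters \<open>abar\<close>.\<close>

lemma ev_rr:
  assumes "ml (n + k) f" "length ys = k" "set ys \<subseteq> V" "j = i + 2 * s - int (Suc n)"
  shows "ev (Suc n) (\<lambda>w. rr f (w @ ys)) i s = scl ((-1) ^ Suc n)
     (ev (Suc n) (\<lambda>w. rr (\<lambda>l. f (w @ l)) ys) i s
      + (scl (Kp (i + s) / Kp j) (ev n (\<lambda>w. mrg (aa (j - 1)) (\<lambda>l. f (w @ l)) ys) i (s - 1))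
         + ev n (\<lambda>w. mrg (bb (j + 1)) (\<lambda>l. f (w @ l)) ys) i s))"
  using assms
proof (induction n arbitrary: f i s j)
  case 0
  then show ?case by (auto simp: scl_minus scl_add add.commute[of 1 i])
next
  case (Suc n)
  define G where "G v = (\<lambda>l. f (v # l))" for v
  have ml: "ml (n + k) (G v)" if "v \<in> V" for v
    using Suc.prems(1) that ml_Cons[of "n + k" f v] by (simp add: G_def)
  have 1: "ev (Suc n) (\<lambda>w. rr f (v # w @ ys)) l t = - ev (Suc n) (\<lambda>w. mrg v f (w @ ys)) l t - ev (Suc n) (\<lambda>w. rr (G v) (w @ ys)) l t" for v l t
    by (simp only: rr.simps ev_diff ev_minus G_def)
  define R where "R F l t = scl (Kp (l + t) / Kp j) (ev n (\<lambda>w. mrg (aa (j - 1)) (\<lambda>l. F (w @ l)) ys) l (t - 1))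
         + ev n (\<lambda>w. mrg (bb (j + 1)) (\<lambda>l. F (w @ l)) ys) l t" for F l t
  have a: "ev (Suc n) (\<lambda>w. rr (G (aa i)) (w @ ys)) (i + 1) (s - 1)
     = scl ((-1) ^ Suc n) (ev (Suc n) (\<lambda>w. rr (\<lambda>l. G (aa i) (w @ l)) ys) (i + 1) (s - 1) + R (G (aa i)) (i + 1) (s - 1))"
    unfolding R_def by (rule Suc.IH[OF ml]) (use Suc.prems in simp_all)
  have b: "ev (Suc n) (\<lambda>w. rr (G (bb i)) (w @ ys)) (i - 1) s
     = scl ((-1) ^ Suc n) (ev (Suc n) (\<lambda>w. rr (\<lambda>l. G (bb i) (w @ l)) ys) (i - 1) s + R (G (bb i)) (i - 1) s)"
    unfolding R_def by (rule Suc.IH[OF ml]) (use Suc.prems in simp_all)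
  \<comment> \<open>Splitting off a first \<open>abar\<close> and then a last \<open>a\<close>, or
    in the other order, must give the same coefficient.\<close>
  have k: "kap i s * Kp (s + (i - 1)) / Kp j = Kp (i + s) * kap i (s - 1) / Kp j"
    by (simp add: kap_def algebra_simps)
  have R: "R (G (aa i)) (i + 1) (s - 1) + scl (kap i s) (R (G (bb i)) (i - 1) s) =
      scl (Kp (i + s) / Kp j) (ev (Suc n) (\<lambda>w. mrg (aa (j - 1)) (\<lambda>l. f (w @ l)) ys) i (s - 1))
         + ev (Suc n) (\<lambda>w. mrg (bb (j + 1)) (\<lambda>l. f (w @ l)) ys) i s"
    by (simp add: R_def scl_add k add_ac G_def)
  have "ev (Suc (Suc n)) (\<lambda>w. rr f (w @ ys)) i s =
     ev (Suc n) (\<lambda>w. rr f (aa i # w @ ys)) (i + 1) (s - 1) + scl (kap i s) (ev (Suc n) (\<lambda>w. rr f (bb i # w @ ys)) (i - 1) s)"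
    by (simp only: ev.simps(2)[of "Suc n"] append_Cons)
  also have "\<dots> = - (ev (Suc n) (\<lambda>w. mrg (aa i) f (w @ ys)) (i + 1) (s - 1)
    + scl (kap i s) (ev (Suc n) (\<lambda>w. mrg (bb i) f (w @ ys)) (i - 1) s))
    - (ev (Suc n) (\<lambda>w. rr (G (aa i)) (w @ ys)) (i + 1) (s - 1) + scl (kap i s) (ev (Suc n) (\<lambda>w. rr (G (bb i)) (w @ ys)) (i - 1) s))"
    unfolding 1 by (simp only: scl_minus scl_add) (simp del: ev.simps)
  also have "\<dots> = - (ev (Suc n) (\<lambda>w. rr (G (aa i)) (w @ ys)) (i + 1) (s - 1) + scl (kap i s) (ev (Suc n) (\<lambda>w. rr (G (bb i)) (w @ ys)) (i - 1) s))"
    using ev_inner[of n k f ys i s] Suc.prems by (simp del: ev.simps)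
  also have "\<dots> = scl ((-1) ^ Suc (Suc n)) (ev (Suc (Suc n)) (\<lambda>w. rr (\<lambda>l. f (w @ l)) ys) i s
      + (R (G (aa i)) (i + 1) (s - 1) + scl (kap i s) (R (G (bb i)) (i - 1) s)))"
    unfolding a b ev.simps(2)[of "Suc n"] by (simp add: scl_add scl_minus G_def add_ac mult.commute del: ev.simps)
  finally show ?case unfolding R .
qed

end

section \<open>A contraction of the Koszul complex\<close>

context qv
begin

definition valid :: "nat \<Rightarrow> 'k el list \<Rightarrow> bool" where
  "valid n ys \<longleftrightarrow> length ys = n \<and> set ys \<subseteq> V"

lemma valid_simps [simp]: "valid 0 ys \<longleftrightarrow> ys = []" "valid (Suc n) (y # ys) \<longleftrightarrow> y \<in> V \<and> valid n ys" "\<not> valid (Suc n) []"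
  by (auto simp: valid_def)

definition coc :: "nat \<Rightarrow> ('k el list \<Rightarrow> 'k el) \<Rightarrow> bool" where
  "coc n f \<longleftrightarrow> ml n f \<and> (\<forall>x\<in>V. \<forall>ys. valid n ys \<longrightarrow> x \<star> f ys + rr f (x # ys) = 0)"

text \<open>The index is the degree of the primitive, so \<open>f\<close> has degree
  \<open>n + 1\<close>.\<close>

definition cob :: "nat \<Rightarrow> ('k el list \<Rightarrow> 'k el) \<Rightarrow> bool" where
  "cob n f \<longleftrightarrow> (\<exists>h. ml n h \<and> (\<forall>x\<in>V. \<forall>ys. valid n ys \<longrightarrow> f (x # ys) = x \<star> h ys + rr h (x # ys)))"

lemma bs_mult' [simp]:
  "aa (i - 1) \<star> ee i = aa (i - 1)" "bb (i + 1) \<star> ee i = bb (i + 1)"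
  "aa (i - 1) \<star> bb i = pp (i - 1)" "bb (i + 1) \<star> aa i = scl (Q (i + 1)) (pp (i + 1))"
  using bs_mult(10)[of "i - 1"] bs_mult(11)[of "i + 1"] bs_mult(3)[of "i - 1"] bs_mult(4)[of "i + 1"] by simp_all

text \<open>\<open>F i s\<close> is a cochain on Koszul elements of degree \<open>p\<close> whose
  values are multilinear functions of \<open>k + 1\<close> further arguments. The last condition
  says that only the part of the first further argument starting at the end vertex
  \<open>i + 2 * s - int p\<close> matters, as for a tensor product over the vertices.\<close>

definition TC :: "nat \<Rightarrow> nat \<Rightarrow> (int \<Rightarrow> int \<Rightarrow> 'k el list \<Rightarrow> 'k el) \<Rightarrow> bool" where
  "TC p k F \<longleftrightarrow> (\<forall>i s ys. (s < 0 \<or> s > int p) \<longrightarrow> F i s ys = 0)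
     \<and> (\<forall>i s. ml (Suc k) (F i s))
     \<and> (\<forall>i s ys. F (i + int m) s ys = F i s ys)
     \<and> (\<forall>i s ys. valid (Suc k) ys \<longrightarrow> mrg (ee (i + 2 * s - int p)) (F i s) ys = F i s ys)"

lemma TC_D:
  assumes "TC p k F"
  shows "s < 0 \<Longrightarrow> F i s ys = 0" "s > int p \<Longrightarrow> F i s ys = 0" "ml (Suc k) (F i s)" "F (i + int m) s ys = F i s ys"
    "valid (Suc k) ys \<Longrightarrow> mrg (ee (i + 2 * s - int p)) (F i s) ys = F i s ys"
  using assms by (auto simp: TC_def)

lemma lin4:
  assumes "ml (Suc k) f" "valid k xs" "a \<in> V" "b \<in> V" "c \<in> V" "d \<in> V"
  shows "f ((scl \<alpha> a + scl \<beta> b + scl \<gamma> c + scl \<delta> d) # xs) =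
    scl \<alpha> (f (a # xs)) + scl \<beta> (f (b # xs)) + scl \<gamma> (f (c # xs)) + scl \<delta> (f (d # xs))"
proof -
  have x: "length xs = k" "set xs \<subseteq> V" using assms(2) by (auto simp: valid_def)
  show ?thesis using assms by (simp add: ml_lin_add[OF assms(1)] ml_lin_scl[OF assms(1)] x)
qed

lemma TC_basis:
  assumes F: "TC p k F" and y: "y \<in> V" "valid k xs" and j: "j = i + 2 * s - int p"
  shows "F i s (y # xs) = scl (cf y KE j) (F i s (ee j # xs)) + scl (cf y KA j) (F i s (aa j # xs))
     + scl (cf y KB j) (F i s (bb j # xs)) + scl (cf y KP j) (F i s (pp j # xs))"
proof -
  have "F i s (y # xs) = F i s ((ee j \<star> y) # xs)"
    using TC_D(5)[OF F, of "y # xs" i s] y j by simp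
  then show ?thesis
    by (simp add: ee_mul[OF y(1)] lin4[OF TC_D(3)[OF F] y(2)])
qed

text \<open>The Koszul differential: the first letter leaves to the left as a factor, the last one
  is merged into the next argument, with the coefficients found in \<open>ev_rr\<close>.\<close>

definition DD :: "nat \<Rightarrow> (int \<Rightarrow> int \<Rightarrow> 'k el list \<Rightarrow> 'k el) \<Rightarrow> int \<Rightarrow> int \<Rightarrow> 'k el list \<Rightarrow> 'k el" where
  "DD p F i s ys = (let j = i + 2 * s - int (Suc p) in
     aa i \<star> F (i + 1) (s - 1) ys + scl (kap i s) (bb i \<star> F (i - 1) s ys)
     + scl ((-1) ^ Suc p) (scl (Kp (i + s) / Kp j) (mrg (aa (j - 1)) (F i (s - 1)) ys) + mrg (bb (j + 1)) (F i s) ys))"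

lemma DD_j: "j = i + 2 * s - int (Suc p) \<Longrightarrow> DD p F i s ys = aa i \<star> F (i + 1) (s - 1) ys + scl (kap i s) (bb i \<star> F (i - 1) s ys)
     + scl ((-1) ^ Suc p) (scl (Kp (i + s) / Kp j) (mrg (aa (j - 1)) (F i (s - 1)) ys) + mrg (bb (j + 1)) (F i s) ys)"
  by (simp add: DD_def Let_def)

lemma mrg_mrg: "ys \<noteq> [] \<Longrightarrow> mrg x (mrg y f) ys = mrg (y \<star> x) f ys"
  by (cases ys) (simp_all add: mul_assoc)

lemma valid_ne: "valid (Suc k) ys \<Longrightarrow> ys \<noteq> []"
  by auto

lemma DD_TC:
  assumes F: "TC p k F" shows "TC (Suc p) k (DD p F)"
proof -
  have sh: "Kp (i + int m + a) / Kp (i + int m + b) = Kp (i + a) / Kp (i + b)" for i a b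
    using Kp_shift[of "i + a"] Kp_shift[of "i + b"] by (simp add: algebra_simps)
  have "DD p F i s ys = 0" if "s < 0 \<or> s > int (Suc p)" for i s ys
    using that TC_D(1,2)[OF F] by (cases ys) (auto simp: DD_def Let_def)
  moreover have "ml (Suc k) (DD p F i s)" for i s
    unfolding DD_def Let_def by (intro ml_add ml_scl ml_mrg ml_lmul TC_D(3)[OF F] bs_V)
  moreover have "DD p F (i + int m) s ys = DD p F i s ys" for i s ys
  proof -
    have f: "F (i + int m) s = F i s" for i s using TC_D(4)[OF F] by auto
    have f': "F (i + int m + 1) s = F (i + 1) s" "F (i + int m - 1) s = F (i - 1) s" for s
      using f[of "i + 1" s] f[of "i - 1" s] by (simp_all add: algebra_simps)
    define c where "c = 2 * s - int (Suc p)"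
    have b: "bs k (i + int m + c + d) = bs k (i + c + d)" for k d
      using bs_shift[of k "i + c + d"] by (simp add: algebra_simps)
    have "DD p F (i + int m) s ys = aa i \<star> F (i + 1) (s - 1) ys + scl (kap i s) (bb i \<star> F (i - 1) s ys)
     + scl ((-1) ^ Suc p) (scl (Kp (i + int m + s) / Kp (i + int m + c)) (mrg (aa (i + int m + c + (-1))) (F i (s - 1)) ys)
       + mrg (bb (i + int m + c + 1)) (F i s) ys)"
      by (subst DD_j[of "i + int m + c"]) (simp_all add: c_def f f' kap_shift)
    also have "\<dots> = DD p F i s ys"
      unfolding sh b by (subst DD_j[of "i + c"]) (simp_all add: c_def)
    finally show ?thesis .
  qed
  moreover have "mrg (ee (i + 2 * s - int (Suc p))) (DD p F i s) ys = DD p F i s ys" if ys: "valid (Suc k) ys" for i s ys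
  proof -
    define j where "j = i + 2 * s - int (Suc p)"
    have 1: "mrg (ee j) (F (i + 1) (s - 1)) ys = F (i + 1) (s - 1) ys"
      using TC_D(5)[OF F ys, of "i + 1" "s - 1"] by (simp add: j_def algebra_simps)
    have 2: "mrg (ee j) (F (i - 1) s) ys = F (i - 1) s ys"
      using TC_D(5)[OF F ys, of "i - 1" s] by (simp add: j_def algebra_simps)
    have "mrg (ee j) (DD p F i s) ys = aa i \<star> mrg (ee j) (F (i + 1) (s - 1)) ys + scl (kap i s) (bb i \<star> mrg (ee j) (F (i - 1) s) ys)
     + scl ((-1) ^ Suc p) (scl (Kp (i + s) / Kp j) (mrg (ee j) (mrg (aa (j - 1)) (F i (s - 1))) ys) + mrg (ee j) (mrg (bb (j + 1)) (F i s)) ys)"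
      using valid_ne[OF ys] by (cases ys) (simp_all add: DD_j[OF j_def] )
    also have "\<dots> = DD p F i s ys"
      unfolding 1 2 mrg_mrg[OF valid_ne[OF ys]] by (simp add: DD_j[OF j_def])
    finally show ?thesis by (simp add: j_def)
  qed
  ultimately show ?thesis unfolding TC_def by blast
qed

text \<open>The left linear contraction of the Koszul bimodule complex: \<open>y = a, a\<bar>a\<close> has its letter \<open>a\<close> absorbed
  into the Koszul element, and for Koszul elements without \<open>a\<close> also \<open>\<bar>a\<close> is absorbed.\<close>

definition LL :: "nat \<Rightarrow> (int \<Rightarrow> int \<Rightarrow> 'k el list \<Rightarrow> 'k el) \<Rightarrow> int \<Rightarrow> int \<Rightarrow> 'k el list \<Rightarrow> 'k el" where
  "LL p F i s ys = (case ys of [] \<Rightarrow> 0 | y # xs \<Rightarrow> (let j = i + 2 * s - int p; e = (-1) ^ Suc p in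
     if s < 0 \<or> y \<notin> V then 0 else
       scl (e * Kp (j + 1) / Kp (i + s + 1)) (scl (cf y KA j) (F i (s + 1) (ee (j + 1) # xs)) + scl (cf y KP j) (F i (s + 1) (bb (j + 1) # xs)))
       + (if s = 0 then scl (e * cf y KB j) (F i 0 (ee (j - 1) # xs))
             - scl (Kp (j + 1) / Kp (i + 1) * cf y KP j) (aa i \<star> F (i + 1) 0 (ee j # xs)) else 0)))"

text \<open>The coefficients invert those with which \<open>DD\<close> merges the last letter. The
  extra term at \<open>pp j\<close> for \<open>s = 0\<close> compensates for \<open>abar\<close>
  also being absorbed there: without it, \<open>DD\<close> of \<open>LL\<close> would retain a term
  \<open>aa i \<star> F (i + 1) 0\<close> on arguments starting with \<open>abar\<close> at
  \<open>s = 1\<close>.\<close>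

lemma LL_basis:
  assumes "j = i + 2 * s - int p"
  shows "LL p F i s (ee j # xs) = 0"
   "s < 0 \<Longrightarrow> LL p F i s ys = 0"
   "s \<ge> 0 \<Longrightarrow> LL p F i s (aa j # xs) = scl ((-1) ^ Suc p * Kp (j + 1) / Kp (i + s + 1)) (F i (s + 1) (ee (j + 1) # xs))"
   "s > 0 \<Longrightarrow> LL p F i s (bb j # xs) = 0"
   "s = 0 \<Longrightarrow> LL p F i s (bb j # xs) = scl ((-1) ^ Suc p) (F i 0 (ee (j - 1) # xs))"
   "s > 0 \<Longrightarrow> LL p F i s (pp j # xs) = scl ((-1) ^ Suc p * Kp (j + 1) / Kp (i + s + 1)) (F i (s + 1) (bb (j + 1) # xs))"
   "s = 0 \<Longrightarrow> LL p F i s (pp j # xs) = scl ((-1) ^ Suc p * Kp (j + 1) / Kp (i + 1)) (F i 1 (bb (j + 1) # xs))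
       - scl (Kp (j + 1) / Kp (i + 1)) (aa i \<star> F (i + 1) 0 (ee j # xs))"
   "y \<in> V \<Longrightarrow> LL p F i s (scl c y # xs) = scl c (LL p F i s (y # xs))"
   "LL p F i s (0 # xs) = 0"
  unfolding LL_def Let_def assms[symmetric]
  by (cases ys; simp add: scl_add scl_minus mult_ac)+

lemma ml_SucI': "(\<And>x. x \<in> V \<Longrightarrow> ml n (\<lambda>l. f (x # l))) \<Longrightarrow>
  (\<And>x y c d ys. x \<in> V \<Longrightarrow> y \<in> V \<Longrightarrow> valid n ys \<Longrightarrow>
     f ((scl c x + scl d y) # ys) = scl c (f (x # ys)) + scl d (f (y # ys))) \<Longrightarrow> ml (Suc n) f"
  by (rule ml_SucI) (auto simp: valid_def)

lemma LL_TC: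
  assumes F: "TC (Suc p) k F" shows "TC p k (LL p F)"
proof -
  note mlF = TC_D(3)[OF F]
  have sh: "Kp (i + int m + a) / Kp (i + int m + b) = Kp (i + a) / Kp (i + b)" for i a b
    using Kp_shift[of "i + a"] Kp_shift[of "i + b"] by (simp add: algebra_simps)
  have "LL p F i s ys = 0" if "s < 0 \<or> s > int p" for i s ys
    using that TC_D(1,2)[OF F] by (cases ys) (auto simp: LL_def Let_def)
  moreover have "ml (Suc k) (LL p F i s)" for i s
  proof (rule ml_SucI')
    show "ml k (\<lambda>l. LL p F i s (x # l))" if "x \<in> V" for x
    proof -
      have d: "ml k f \<Longrightarrow> ml k g \<Longrightarrow> ml k (\<lambda>l. f l - g l)" for f g
        using ml_add[OF _ ml_minus, of k f g] by simp
      show ?thesis unfolding LL_def Let_def list.case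
        by (cases "s < 0"; cases "s = 0"; simp add: that del: scl_simps(4) ml.simps)
          (intro ml_add ml_scl d ml_lmul ml_Cons[OF mlF] bs_V)+
    qed
    show "LL p F i s ((scl c x + scl d y) # ys) = scl c (LL p F i s (x # ys)) + scl d (LL p F i s (y # ys))" if "x \<in> V" "y \<in> V" for x y c d ys
      unfolding LL_def Let_def list.case using that by (intro el_eqI') (simp add: algebra_simps del: mul_app)
  qed
  moreover have "LL p F (i + int m) s ys = LL p F i s ys" for i s ys
  proof -
    have f: "F (i + int m) s = F i s" for i s using TC_D(4)[OF F] by auto
    have f': "F (i + int m + 1) s = F (i + 1) s" "F (i + int m - 1) s = F (i - 1) s" for s
      using f[of "i + 1" s] f[of "i - 1" s] by (simp_all add: algebra_simps)
    define c where "c = 2 * s - int p"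
    have j: "i + int m + 2 * s - int p = (i + c) + int m" "i + 2 * s - int p = i + c" by (simp_all add: c_def)
    have b: "bs k (i + c + int m) = bs k (i + c)" "bs k (i + c + int m + 1) = bs k (i + c + 1)" 
         "bs k (i + c + int m - 1) = bs k (i + c - 1)" for k
      using bs_shift[of k "i + c"] bs_shift[of k "i + c + 1"] bs_shift[of k "i + c - 1"] by (simp_all add: algebra_simps)
    have K: "Kp (i + c + int m + 1) / Kp (i + int m + s + 1) = Kp (i + c + 1) / Kp (i + s + 1)"
       "Kp (i + c + int m + 1) / Kp (i + int m + 1) = Kp (i + c + 1) / Kp (i + 1)"
      using sh[of i "c + 1" "s + 1"] sh[of i "c + 1" 1] by (simp_all add: algebra_simps)
    show ?thesis
    proof (cases ys)
      case (Cons y xs)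
      show ?thesis
      proof (cases "y \<in> V")
        case True
        then have "cf y k (i + c + int m) = cf y k (i + c)" for k by (rule V_D)
        then show ?thesis unfolding LL_def Let_def j Cons list.case b f f' K times_divide_eq_right[symmetric] by simp
      next
        case False
        then show ?thesis by (simp add: LL_def Let_def Cons)
      qed
    qed (simp add: LL_def)
  qed
  moreover have "mrg (ee (i + 2 * s - int p)) (LL p F i s) ys = LL p F i s ys" if ys: "valid (Suc k) ys" for i s ys
  proof -
    obtain y xs where "ys = y # xs" using ys by (cases ys) auto
    then show ?thesis using ys by (simp add: LL_def Let_def)
  qed
  ultimately show ?thesis unfolding TC_def by blast
qed

lemma solve_Z:
  fixes e c d :: 'k
  assumes "U + scl c Y + scl (- e) (scl d Z + W) = 0" "e * e = 1" "d \<noteq> 0"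
  shows "Z = scl (e / d) U + scl (e * c / d) Y + scl (- (1 / d)) W"
proof -
  have "scl (e / d) (U + scl c Y + scl (- e) (scl d Z + W)) = scl (e / d) U + scl (e * c / d) Y - scl (e * e / d) W - scl (e * e) Z"
    using assms(3) by (simp add: scl_add scl_minus)
  then show ?thesis using assms by (simp add: scl_minus algebra_simps)
qed

text \<open>This is the homotopy identity restricted to closed families. Both sides satisfy
  \<open>TC\<close>, so comparing them at the four basis elements at the end vertex \<open>j\<close>
  suffices; at \<open>ee j\<close> no closedness is used, and for the others it expresses values of
  \<open>F\<close> through neighbouring Koszul elements.\<close>

lemma LL_contraction:
  assumes F: "TC (Suc p) k F"
    and D: "\<And>i s ys. valid (Suc k) ys \<Longrightarrow> DD (Suc p) F i s ys = 0"
    and ys: "valid (Suc k) ys"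
  shows "DD p (LL p F) i s ys = F i s ys"
proof -
  obtain y xs where y: "ys = y # xs" "y \<in> V" "valid k xs"
    using ys by (cases ys) auto
  define e :: 'k where "e = (-1) ^ Suc p"
  have ee1: "e * e = 1" by (simp add: e_def power_mult_distrib[symmetric])
  define j where "j = i + 2 * s - int (Suc p)"
  note F0 = TC_D(1)[OF F] and LB = LL_basis[where F = F and p = p, folded e_def]
  have DL: "DD p (LL p F) i s (z # xs) = aa i \<star> LL p F (i + 1) (s - 1) (z # xs) + scl (kap i s) (bb i \<star> LL p F (i - 1) s (z # xs))
     + scl e (scl (Kp (i + s) / Kp j) (LL p F i (s - 1) ((aa (j - 1) \<star> z) # xs)) + LL p F i s ((bb (j + 1) \<star> z) # xs))" for z
    by (simp add: DD_j[OF j_def] e_def)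
  have D': "aa i \<star> F (i + 1) (t - 1) (z # xs) + scl (kap i t) (bb i \<star> F (i - 1) t (z # xs))
     + scl (- e) (scl (Kp (i + t) / Kp l) (F i (t - 1) ((aa (l - 1) \<star> z) # xs)) + F i t ((bb (l + 1) \<star> z) # xs)) = 0"
    if "z \<in> V" "l = i + 2 * t - int (Suc (Suc p))" for i l t z
    using D[of "z # xs" i t] that y by (simp add: DD_j[of l] e_def)
  have Z: "F i (t - 1) ((aa (l - 1) \<star> z) # xs) =
     scl (e * Kp l / Kp (i + t)) (aa i \<star> F (i + 1) (t - 1) (z # xs)) + scl (e * Kp l / Kp i) (bb i \<star> F (i - 1) t (z # xs))
      + scl (- Kp l / Kp (i + t)) (F i t ((bb (l + 1) \<star> z) # xs))"
    if "z \<in> V" "l = i + 2 * t - int (Suc (Suc p))" for i l t z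
    using solve_Z[OF D'[OF that] ee1] by (simp add: kap_def field_simps)
  have l0: "F i t (0 # xs) = 0" for i t
    using ml_lin_0[OF TC_D(3)[OF F]] y by (simp add: valid_def)
  have l0': "LL p F i t (0 # xs) = 0" for i t
    by (rule LB(9)[OF refl])
  have b1: "DD p (LL p F) i s (ee j # xs) = F i s (ee j # xs)"
  proof -
    consider "s < 0" | "s = 0" | "s > 0" by linarith
    then show ?thesis
    proof cases
      case 1
      then show ?thesis unfolding DL by (simp add: LB(2)[OF refl] F0)
    next
      case 2
      have "LL p F (i - 1) s (ee j # xs) = 0" by (rule LB(1)) (simp add: j_def)
      moreover have "LL p F i s (bb (j + 1) # xs) = scl e (F i 0 (ee (j + 1 - 1) # xs))"
        by (rule LB(5)) (use 2 in \<open>simp_all add: j_def\<close>)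
      ultimately show ?thesis unfolding DL using 2 ee1 by (simp add: LB(2)[OF refl])
    next
      case 3
      have "LL p F (i - 1) s (ee j # xs) = 0" by (rule LB(1)) (simp add: j_def)
      moreover have "LL p F (i + 1) (s - 1) (ee j # xs) = 0" by (rule LB(1)) (simp add: j_def)
      moreover have "LL p F i s (bb (j + 1) # xs) = 0"
        by (rule LB(4)) (use 3 in \<open>simp_all add: j_def\<close>)
      moreover have "LL p F i (s - 1) (aa (j - 1) # xs) = scl (e * Kp (j - 1 + 1) / Kp (i + (s - 1) + 1)) (F i (s - 1 + 1) (ee (j - 1 + 1) # xs))"
        by (rule LB(3)) (use 3 in \<open>simp_all add: j_def\<close>)
      ultimately show ?thesis unfolding DL using ee1 by simp
    qed
  qed
  have b2: "DD p (LL p F) i s (bb j # xs) = F i s (bb j # xs)"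
  proof -
    consider "s < 0" | "s = 0" | "s = 1" | "s > 1" by linarith
    then show ?thesis
    proof cases
      case 1
      then show ?thesis unfolding DL by (simp add: LB(2)[OF refl] F0)
    next
      case 2
      have "LL p F (i - 1) s (bb j # xs) = scl e (F (i - 1) 0 (ee (j - 1) # xs))"
        by (rule LB(5)) (use 2 in \<open>simp_all add: j_def\<close>)
      moreover have "bb i \<star> F (i - 1) 0 (ee (j - 1) # xs) - scl e (F i 0 (bb j # xs)) = 0"
      proof -
        have jj: "j - 1 = i + 2 * 0 - int (Suc (Suc p))" using 2 by (simp add: j_def)
        show ?thesis using D'[OF bs_V[of KE "j - 1"] jj] bs_mult'(2)[of "j - 1"] by (simp add: F0 scl_minus scl_add)
      qed
      then have "scl e (bb i \<star> F (i - 1) 0 (ee (j - 1) # xs)) = scl e (scl e (F i 0 (bb j # xs)))"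
        by simp
      ultimately show ?thesis unfolding DL using 2 ee1 by (simp add: LB(2)[OF refl] l0' mul_scl)
    next
      case 3
      have "LL p F (i - 1) s (bb j # xs) = 0"
        by (rule LB(4)) (use 3 in \<open>simp_all add: j_def\<close>)
      moreover have "LL p F (i + 1) (s - 1) (bb j # xs) = scl e (F (i + 1) 0 (ee (j - 1) # xs))"
        by (rule LB(5)) (use 3 in \<open>simp_all add: j_def\<close>)
      \<comment> \<open>The subtracted term cancels the contribution of the \<open>abar\<close>
        absorbed in the previous equation.\<close>
      moreover have "LL p F i (s - 1) (pp (j - 1) # xs) = scl (e * Kp (j - 1 + 1) / Kp (i + 1)) (F i 1 (bb (j - 1 + 1) # xs))
       - scl (Kp (j - 1 + 1) / Kp (i + 1)) (aa i \<star> F (i + 1) 0 (ee (j - 1) # xs))"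
        by (rule LB(7)) (use 3 in \<open>simp_all add: j_def\<close>)
      ultimately show ?thesis unfolding DL using 3 ee1 by (simp add: l0' mul_scl scl_minus scl_add)
    next
      case 4
      have "LL p F (i - 1) s (bb j # xs) = 0"
        by (rule LB(4)) (use 4 in \<open>simp_all add: j_def\<close>)
      moreover have "LL p F (i + 1) (s - 1) (bb j # xs) = 0"
        by (rule LB(4)) (use 4 in \<open>simp_all add: j_def\<close>)
      moreover have "LL p F i (s - 1) (pp (j - 1) # xs) = scl (e * Kp (j - 1 + 1) / Kp (i + (s - 1) + 1)) (F i (s - 1 + 1) (bb (j - 1 + 1) # xs))"
        by (rule LB(6)) (use 4 in \<open>simp_all add: j_def\<close>)
      ultimately show ?thesis unfolding DL using 4 ee1 by (simp add: l0' mul_scl scl_minus scl_add)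
    qed
  qed
  \<comment> \<open>Closedness determines the value of \<open>F\<close> on an argument beginning
    with \<open>a\<close> from values in which that argument has lost its leading \<open>a\<close>
    or begins with \<open>abar\<close>; in the last two terms the Koszul element has one more
    \<open>a\<close>.\<close>
  have Zj: "F i s ((aa j \<star> z) # xs) =
     scl (e * Kp (j + 1) / Kp (i + s + 1)) (aa i \<star> F (i + 1) s (z # xs)) + scl (e * Kp (j + 1) / Kp i) (bb i \<star> F (i - 1) (s + 1) (z # xs))
      + scl (- Kp (j + 1) / Kp (i + s + 1)) (F i (s + 1) ((bb (j + 2) \<star> z) # xs))" if "z \<in> V" for z
  proof -
    have j1: "j + 1 = i + 2 * (s + 1) - int (Suc (Suc p))" by (simp add: j_def)
    have j2: "j + 1 + 1 = j + 2" "j + 1 - 1 = j" "s + 1 - 1 = s" "i + (s + 1) = i + s + 1" by simp_all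
    show ?thesis using Z[OF that j1] unfolding j2 .
  qed
  have kk: "kap i s * (e * Kp (j + 1) / Kp (i + s)) = e * Kp (j + 1) / Kp i"
    by (simp add: kap_def)
  have kQ: "Kp (j + 2) * Q (j + 1) = - Kp (j + 1)"
    using Kp_Suc[of "j + 1"] by (simp add: add_ac)
  have iQ: "Kp (i + 1) * Q i = - Kp i"
    by (simp add: Kp_Suc)
  have b3: "DD p (LL p F) i s (aa j # xs) = F i s (aa j # xs)"
  proof (cases "s < 0")
    case True
    have "F i s (aa j # xs) = 0" using True by (simp add: F0)
    with True show ?thesis unfolding DL by (simp add: LB(2)[OF refl])
  next
    case s0: False
    have R: "F i s (aa j # xs) = scl (e * Kp (j + 1) / Kp (i + s + 1)) (aa i \<star> F (i + 1) s (ee (j + 1) # xs))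
       + scl (e * Kp (j + 1) / Kp i) (bb i \<star> F (i - 1) (s + 1) (ee (j + 1) # xs))
      + scl (- Kp (j + 1) / Kp (i + s + 1)) (F i (s + 1) (bb (j + 2) # xs))"
      using Zj[of "ee (j + 1)"] bs_mult'(2)[of "j + 1"] bs_mult(10)[of j] by (simp add: add.assoc)
    have 2: "LL p F (i - 1) s (aa j # xs) = scl (e * Kp (j + 1) / Kp (i - 1 + s + 1)) (F (i - 1) (s + 1) (ee (j + 1) # xs))"
      by (rule LB(3)) (use s0 in \<open>simp_all add: j_def\<close>)
    show ?thesis
    proof (cases "s = 0")
      case True
      have "LL p F i s (pp (j + 1) # xs) = scl (e * Kp (j + 1 + 1) / Kp (i + 1)) (F i 1 (bb (j + 1 + 1) # xs))
       - scl (Kp (j + 1 + 1) / Kp (i + 1)) (aa i \<star> F (i + 1) 0 (ee (j + 1) # xs))"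
        by (rule LB(7)) (use True in \<open>simp_all add: j_def\<close>)
      moreover have "e * (Q (j + 1) * (e * Kp (j + 2) / Kp (i + 1))) = - Kp (j + 1) / Kp (i + 1)"
        using kQ ee1 by (simp add: field_simps)
      moreover have "e * (Q (j + 1) * (Kp (j + 2) / Kp (i + 1))) = - (e * Kp (j + 1) / Kp (i + 1))"
        using kQ by (simp add: field_simps)
      ultimately show ?thesis unfolding DL R using True 2
        by (simp add: LB(2)[OF refl] l0' LB(8)[OF refl] mul_scl scl_minus scl_add add.assoc[of _ 1 1])
    next
      case False
      have "LL p F i s (pp (j + 1) # xs) = scl (e * Kp (j + 1 + 1) / Kp (i + s + 1)) (F i (s + 1) (bb (j + 1 + 1) # xs))"
        by (rule LB(6)) (use s0 False in \<open>simp_all add: j_def\<close>)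
      moreover have "LL p F (i + 1) (s - 1) (aa j # xs) = scl (e * Kp (j + 1) / Kp (i + 1 + (s - 1) + 1)) (F (i + 1) (s - 1 + 1) (ee (j + 1) # xs))"
        by (rule LB(3)) (use s0 False in \<open>simp_all add: j_def\<close>)
      moreover have "e * (Q (j + 1) * (e * Kp (j + 2) / Kp (i + s + 1))) = - Kp (j + 1) / Kp (i + s + 1)"
        using kQ ee1 by (simp add: field_simps)
      ultimately show ?thesis unfolding DL R using 2 kk
        by (simp add: LB(8)[OF refl] l0' mul_scl scl_minus scl_add add.assoc[of _ 1 1])
    qed
  qed
  have b4: "DD p (LL p F) i s (pp j # xs) = F i s (pp j # xs)"
  proof (cases "s < 0")
    case True
    have "F i s (pp j # xs) = 0" using True by (simp add: F0)
    with True show ?thesis unfolding DL by (simp add: LB(2)[OF refl] l0')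
  next
    case s0: False
    have R: "F i s (pp j # xs) = scl (e * Kp (j + 1) / Kp (i + s + 1)) (aa i \<star> F (i + 1) s (bb (j + 1) # xs))
       + scl (e * Kp (j + 1) / Kp i) (bb i \<star> F (i - 1) (s + 1) (bb (j + 1) # xs))"
      using Zj[of "bb (j + 1)"] by (simp add: l0)
    show ?thesis
    proof (cases "s = 0")
      case True
      have 2: "LL p F (i - 1) s (pp j # xs) = scl (e * Kp (j + 1) / Kp (i - 1 + 1)) (F (i - 1) 1 (bb (j + 1) # xs))
       - scl (Kp (j + 1) / Kp (i - 1 + 1)) (aa (i - 1) \<star> F (i - 1 + 1) 0 (ee j # xs))"
        by (rule LB(7)) (use True in \<open>simp_all add: j_def\<close>)
      have "bb (i + 1) \<star> F i 0 (ee j # xs) - scl e (F (i + 1) 0 (bb (j + 1) # xs)) = 0"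
      proof -
        have jj: "j = (i + 1) + 2 * 0 - int (Suc (Suc p))" using True by (simp add: j_def)
        show ?thesis using D'[OF bs_V[of KE j] jj] by (simp add: F0 scl_minus scl_add)
      qed
      then have "scl e (aa i \<star> (bb (i + 1) \<star> F i 0 (ee j # xs))) = scl e (aa i \<star> scl e (F (i + 1) 0 (bb (j + 1) # xs)))"
        by simp
      \<comment> \<open>Closedness without letters \<open>a\<close> turns a leading
        \<open>abar\<close> of the argument into a left factor. Hence the term with
        \<open>aa i\<close> and the correction term of \<open>LL\<close> are both multiples of
        \<open>pp i \<star> F i 0 (ee j # xs)\<close>.\<close>
      then have X: "aa i \<star> F (i + 1) 0 (bb (j + 1) # xs) = scl e (pp i \<star> F i 0 (ee j # xs))"
        using ee1 by (simp add: mul_assoc[symmetric] mul_scl)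
      have B: "bb i \<star> (aa (i - 1) \<star> F i 0 (ee j # xs)) = scl (Q i) (pp i \<star> F i 0 (ee j # xs))"
        by (simp add: mul_assoc[symmetric] mul_scl)
      have "Kp (j + 1) / Kp i * Q i = - (Kp (j + 1) / Kp (i + 1))"
      proof -
        have i': "Kp i = - (Kp (i + 1) * Q i)" using iQ by simp
        show ?thesis unfolding i' by simp
      qed
      moreover have "scl (e * Kp (j + 1) / Kp (i + s + 1)) (aa i \<star> F (i + 1) s (bb (j + 1) # xs)) = scl (Kp (j + 1) / Kp (i + 1)) (pp i \<star> F i 0 (ee j # xs))"
      proof -
        have "e * Kp (j + 1) / Kp (i + 1) * e = (e * e) * (Kp (j + 1) / Kp (i + 1))" by simp
        then show ?thesis using ee1 True unfolding True add_0_right X scl_simps(4) by (simp only: mult_1)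
      qed
      ultimately show ?thesis unfolding DL R using True 2
        by (simp add: B LB(2)[OF refl] l0' mul_scl mul_minus scl_minus scl_add)
    next
      case False
      have 2: "LL p F (i - 1) s (pp j # xs) = scl (e * Kp (j + 1) / Kp (i - 1 + s + 1)) (F (i - 1) (s + 1) (bb (j + 1) # xs))"
        by (rule LB(6)) (use s0 False in \<open>simp_all add: j_def\<close>)
      have 1: "aa i \<star> LL p F (i + 1) (s - 1) (pp j # xs) = scl (e * Kp (j + 1) / Kp (i + s + 1)) (aa i \<star> F (i + 1) s (bb (j + 1) # xs))"
      proof (cases "s = 1")
        case True
        have "LL p F (i + 1) (s - 1) (pp j # xs) = scl (e * Kp (j + 1) / Kp (i + 1 + 1)) (F (i + 1) 1 (bb (j + 1) # xs))
           - scl (Kp (j + 1) / Kp (i + 1 + 1)) (aa (i + 1) \<star> F (i + 1 + 1) 0 (ee j # xs))"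
          by (rule LB(7)) (use True in \<open>simp_all add: j_def\<close>)
        then show ?thesis using True by (simp add: mul_scl mul_minus mul_assoc[symmetric])
      next
        case False
        have "LL p F (i + 1) (s - 1) (pp j # xs) = scl (e * Kp (j + 1) / Kp (i + 1 + (s - 1) + 1)) (F (i + 1) (s - 1 + 1) (bb (j + 1) # xs))"
          by (rule LB(6)) (use s0 False \<open>s \<noteq> 0\<close> in \<open>simp_all add: j_def\<close>)
        then show ?thesis by (simp add: mul_scl)
      qed
      show ?thesis unfolding DL R using kk by (simp add: 1 2 l0' mul_scl)
    qed
  qed
  have T: "TC (Suc p) k (DD p (LL p F))" by (intro DD_TC LL_TC F)
  show ?thesis
    unfolding y(1) TC_basis[OF T y(2,3) j_def] TC_basis[OF F y(2,3) j_def] b1 b2 b3 b4 ..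
qed

end

section \<open>Cocycles that vanish on Koszul elements are coboundaries\<close>

context qv
begin

lemma rr_ev: "rr (\<lambda>l. ev n (\<lambda>w. G w l) i s) ys = ev n (\<lambda>w. rr (G w) ys) i s"
  by (induction n arbitrary: G i s) (simp_all add: rr_add rr_scl)

lemma ml_ev: "(\<And>w. length w = n \<Longrightarrow> set w \<subseteq> V \<Longrightarrow> ml k (G w)) \<Longrightarrow> ml k (\<lambda>l. ev n (\<lambda>w. G w l) i s)"
proof (induction n arbitrary: G i s)
  case (Suc n)
  show ?case by (simp, intro ml_add ml_scl Suc.IH) (use Suc.prems in auto)
next
  case 0
  then show ?case by (cases "s = 0") auto
qed

lemma ml_append: "ml (length w + k) f \<Longrightarrow> set w \<subseteq> V \<Longrightarrow> ml k (\<lambda>l. f (w @ l))"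
proof (induction w arbitrary: f)
  case (Cons x w)
  show ?case using Cons.IH[of "\<lambda>l. f (x # l)"] Cons.prems ml_Cons by simp
qed simp

lemma ml_mrg': "ml k f \<Longrightarrow> x \<in> V \<Longrightarrow> ml k (mrg x f)"
  using ml_mrg ml_mrg0 by (cases k) blast+

lemma mrg_ev: "mrg x (\<lambda>l. ev n (\<lambda>w. G w l) i s) ys = ev n (\<lambda>w. mrg x (G w) ys) i s"
  by (cases ys) (simp_all add: ev_rmul)

lemma ee_cf: "cf (ee i \<star> z) k i = cf z k i"
  by (cases k) simp_all

text \<open>Row \<open>i\<close>, the coordinates with source \<open>i\<close>, is taken from
  \<open>g i\<close>. Families depending on the start vertex thus become one function into the
  algebra; periodicity in \<open>i\<close> keeps its values in \<open>V\<close>.\<close>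

lemma ml_glue:
  assumes "\<And>i. ml n (g i)" "\<And>i ys. valid n ys \<Longrightarrow> g (i + int m) ys = g i ys"
  shows "ml n (\<lambda>l. El (\<lambda>k i. cf (g i l) k i))"
  using assms
proof (induction n arbitrary: g)
  case 0
  have "cf (g i []) k (i + int m) = cf (g i []) k i" for i k
    by (rule V_D) (use 0 in simp)
  then show ?case using 0 by (simp add: V_def)
next
  case (Suc n)
  show ?case
  proof (rule ml_SucI)
    show "ml n (\<lambda>l. El (\<lambda>k i. cf (g i (x # l)) k i))" if "x \<in> V" for x
      by (rule Suc.IH) (use Suc.prems that ml_Cons in auto)
  qed (rule el_eqI', simp add: ml_lin[OF Suc.prems(1)])
qed

text \<open>\<open>rr\<close> multiplies values only from the right, and right multiplication does
  not mix rows of different sources.\<close>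

lemma rr_glue: "(\<And>l k. cf (h l) k i = cf (g l) k i) \<Longrightarrow> cf (rr h ys) k i = cf (rr g ys) k i"
proof (induction ys arbitrary: h g)
  case (Cons x ys)
  have "cf (mrg x h ys) k i = cf (mrg x g ys) k i"
    using Cons.prems by (cases ys; cases k) simp_all
  then show ?case using Cons.IH[of "\<lambda>l. h (x # l)" "\<lambda>l. g (x # l)"] Cons.prems by simp
qed simp

lemma TC_add_scl:
  assumes F: "TC p k F" and G: "TC p k G"
  shows "TC p k (\<lambda>i s ys. F i s ys + scl c (G i s ys))"
  unfolding TC_def
proof (intro conjI allI impI)
  show "F i s ys + scl c (G i s ys) = 0" if "s < 0 \<or> s > int p" for i s ys
    using that TC_D(1,2)[OF F] TC_D(1,2)[OF G] by auto
  show "ml (Suc k) (\<lambda>ys. F i s ys + scl c (G i s ys))" for i s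
    by (intro ml_add ml_scl TC_D(3)[OF F] TC_D(3)[OF G])
  show "F (i + int m) s ys + scl c (G (i + int m) s ys) = F i s ys + scl c (G i s ys)" for i s ys
    by (simp add: TC_D(4)[OF F] TC_D(4)[OF G])
  show "mrg (ee (i + 2 * s - int p)) (\<lambda>ys. F i s ys + scl c (G i s ys)) ys = F i s ys + scl c (G i s ys)"
    if ys: "valid (Suc k) ys" for i s ys
    using TC_D(5)[OF F ys, of i s] TC_D(5)[OF G ys, of i s] ys by (cases ys) simp_all
qed

lemma DD_add_scl:
  assumes "ys \<noteq> []"
  shows "DD p (\<lambda>i s ys. F i s ys + scl c (G i s ys)) i s ys = DD p F i s ys + scl c (DD p G i s ys)"
proof (rule el_eqI')
  obtain y xs where ys: "ys = y # xs" using assms by (cases ys) auto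
  show "cf (DD p (\<lambda>i s ys. F i s ys + scl c (G i s ys)) i s ys) k l = cf (DD p F i s ys + scl c (DD p G i s ys)) k l" for k l
    unfolding DD_def Let_def ys mrg_simps mul_distrib mul_scl by (simp add: algebra_simps del: mul_app)
qed

context
  fixes N f
  assumes f: "coc (Suc N) f" and f0: "\<And>i s. ev (Suc N) f i s = 0"
begin

text \<open>The zigzag: \<open>kk p\<close> evaluates the first \<open>p\<close> arguments of \<open>f\<close> on Koszul elements, so it leads from \<open>f\<close>
  to the Koszul values of \<open>f\<close>, which are zero.\<close>

definition kk :: "nat \<Rightarrow> int \<Rightarrow> int \<Rightarrow> 'k el list \<Rightarrow> 'k el" where
  "kk p i s ys = mrg (ee (i + 2 * s - int p)) (\<lambda>l. ev p (\<lambda>w. f (w @ l)) i s) ys"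

lemma kk_j: "j = i + 2 * s - int p \<Longrightarrow> kk p i s ys = ev p (\<lambda>w. mrg (ee j) (\<lambda>l. f (w @ l)) ys) i s"
  by (simp add: kk_def mrg_ev)

lemma mlf: "ml (Suc N) f"
  using f by (simp add: coc_def)

lemma ml_ev_f: "p + k = Suc N \<Longrightarrow> ml k (\<lambda>l. ev p (\<lambda>w. f (w @ l)) i s)"
  by (rule ml_ev, rule ml_append) (use mlf in auto)

lemma TC_kk: assumes "p + Suc k = Suc N" shows "TC p k (kk p)"
  unfolding TC_def
proof (intro conjI allI impI)
  show "kk p i s ys = 0" if "s < 0 \<or> s > int p" for i s ys
    using that by (cases ys) (simp_all add: kk_def ev_range)
  show "ml (Suc k) (kk p i s)" for i s
    unfolding kk_def[abs_def] by (intro ml_mrg' ml_ev_f assms bs_V)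
  show "kk p (i + int m) s ys = kk p i s ys" for i s ys
    using bs_shift[of KE "i + 2 * s - int p"] by (simp add: kk_def ev_shift algebra_simps)
  show "mrg (ee (i + 2 * s - int p)) (kk p i s) ys = kk p i s ys" if "valid (Suc k) ys" for i s ys
    using mrg_mrg[OF valid_ne[OF that], of "ee (i + 2 * s - int p)" "ee (i + 2 * s - int p)"] by (simp add: kk_def[abs_def])
qed

text \<open>This is the cocycle condition of \<open>f\<close> with its first \<open>p + 1\<close>
  slots filled by a Koszul element: what survives \<open>ev_rr\<close> is the Koszul differential of
  \<open>kk p\<close> and the bar differential of \<open>kk (Suc p)\<close>.\<close>

lemma DD_kk:
  assumes p: "p + Suc k = Suc N" and ys: "valid (Suc k) ys"
  shows "DD p (kk p) i s ys + scl ((-1) ^ Suc p) (rr (kk (Suc p) i s) ys) = 0"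
proof -
  obtain y xs where y: "ys = y # xs" "y \<in> V" "valid k xs"
    using ys by (cases ys) auto
  define j where "j = i + 2 * s - int (Suc p)"
  \<comment> \<open>The first remaining argument is cut down to start at the end vertex
    \<open>j\<close>, which builds in the factor \<open>ee\<close> from the definition of
    \<open>kk\<close>.\<close>
  define ys' where "ys' = (ee j \<star> y) # xs"
  have ys': "length ys' = Suc k" "set ys' \<subseteq> V" using y by (auto simp: ys'_def valid_def)
  have "ev (Suc p) (\<lambda>w. hd w \<star> f (tl w @ ys') + rr f (w @ ys')) i s = ev (Suc p) (\<lambda>_. 0) i s"
  proof (rule ev_cong)
    fix w :: "'k el list" assume w: "length w = Suc p" "set w \<subseteq> V"
    then obtain v w' where vw: "w = v # w'" by (cases w) auto
    then show "hd w \<star> f (tl w @ ys') + rr f (w @ ys') = 0"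
      using f ys' w p by (simp add: coc_def valid_def del: rr.simps)
  qed
  then have 0: "ev (Suc p) (\<lambda>w. hd w \<star> f (tl w @ ys')) i s + ev (Suc p) (\<lambda>w. rr f (w @ ys')) i s = 0"
    by (simp only: ev_add ev_0)
  have 1: "ev (Suc p) (\<lambda>w. hd w \<star> f (tl w @ ys')) i s = aa i \<star> kk p (i + 1) (s - 1) ys + scl (kap i s) (bb i \<star> kk p (i - 1) s ys)"
    using kk_j[of j "i + 1" "s - 1" p ys] kk_j[of j "i - 1" s p ys] by (simp add: j_def ev_lmul y ys'_def)
  have 2: "ev p (\<lambda>w. mrg (aa (j - 1)) (\<lambda>l. f (w @ l)) ys') i (s - 1) = mrg (aa (j - 1)) (kk p i (s - 1)) ys"
  proof -
    have "kk p i (s - 1) (aa (j - 1) \<star> y # xs) = ev p (\<lambda>w. mrg (ee (j - 1)) (\<lambda>l. f (w @ l)) (aa (j - 1) \<star> y # xs)) i (s - 1)"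
      by (rule kk_j) (simp add: j_def)
    then show ?thesis by (simp add: y ys'_def mul_assoc[symmetric])
  qed
  have 3: "ev p (\<lambda>w. mrg (bb (j + 1)) (\<lambda>l. f (w @ l)) ys') i s = mrg (bb (j + 1)) (kk p i s) ys"
  proof -
    have "kk p i s (bb (j + 1) \<star> y # xs) = ev p (\<lambda>w. mrg (ee (j + 1)) (\<lambda>l. f (w @ l)) (bb (j + 1) \<star> y # xs)) i s"
      by (rule kk_j) (simp add: j_def)
    then show ?thesis by (simp add: y ys'_def mul_assoc[symmetric])
  qed
  have "rr (kk (Suc p) i s) ys = rr (mrg (ee j) (\<lambda>l. ev (Suc p) (\<lambda>w. f (w @ l)) i s)) ys"
    by (simp add: kk_def[abs_def] j_def del: ev.simps)
  also have "\<dots> = rr (\<lambda>l. ev (Suc p) (\<lambda>w. f (w @ l)) i s) ys'"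
    unfolding y ys'_def by (rule rr_mrg)
  also have "\<dots> = ev (Suc p) (\<lambda>w. rr (\<lambda>l. f (w @ l)) ys') i s"
    by (rule rr_ev)
  finally have 4: "ev (Suc p) (\<lambda>w. rr (\<lambda>l. f (w @ l)) ys') i s = rr (kk (Suc p) i s) ys" by simp
  have 5: "ev (Suc p) (\<lambda>w. rr f (w @ ys')) i s = scl ((-1) ^ Suc p)
     (rr (kk (Suc p) i s) ys + (scl (Kp (i + s) / Kp j) (mrg (aa (j - 1)) (kk p i (s - 1)) ys) + mrg (bb (j + 1)) (kk p i s) ys))"
    by (subst ev_rr[where k = "Suc k" and j = j]) (use mlf p ys' j_def 2 3 4 in simp_all)
  show ?thesis using 0 unfolding 1 5 DD_j[OF j_def] scl_add by (simp add: add_ac)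
qed

text \<open>Moving down from \<open>p = N\<close>, each \<open>kk p\<close> is corrected by an
  \<open>rr\<close>-exact term, which \<open>rr\<close> does not see, until it is closed for
  \<open>DD\<close>. The correction is the \<open>LL\<close>-primitive of the closed family found in
  degree \<open>p + 1\<close>.\<close>

lemma descent:
  assumes "p + Suc k = Suc N"
  shows "\<exists>F. TC p k F \<and> (\<forall>i s ys. valid (Suc k) ys \<longrightarrow> DD p F i s ys = 0)
     \<and> (\<forall>i s ys. valid (Suc (Suc k)) ys \<longrightarrow> rr (F i s) ys = rr (kk p i s) ys)"
  using assms
proof (induction k arbitrary: p)
  case 0
  have "DD p (kk p) i s ys = 0" if ys: "valid (Suc 0) ys" for i s ys
  proof -
    obtain y where y: "ys = [y]" using ys by (cases ys) auto
    \<comment> \<open>Here all slots of \<open>f\<close> are filled, and the assumption that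
      \<open>f\<close> vanishes on Koszul elements starts the descent.\<close>
    have "kk (Suc p) i s [] = 0" using f0 0 by (simp add: kk_def del: ev.simps)
    then have "rr (kk (Suc p) i s) ys = 0" by (simp add: y)
    then show ?thesis using DD_kk[OF 0 ys, of i s] by simp
  qed
  then show ?case using TC_kk[OF 0] by blast
next
  case (Suc k)
  then obtain F where F: "TC (Suc p) k F" "\<And>i s ys. valid (Suc k) ys \<Longrightarrow> DD (Suc p) F i s ys = 0"
     "\<And>i s ys. valid (Suc (Suc k)) ys \<Longrightarrow> rr (F i s) ys = rr (kk (Suc p) i s) ys"
    using Suc.IH[of "Suc p"] by auto
  define l where "l = LL p F"
  have l: "TC p k l" unfolding l_def by (rule LL_TC[OF F(1)])
  have Dl: "DD p l i s ys = F i s ys" if "valid (Suc k) ys" for i s ys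
    unfolding l_def by (rule LL_contraction[OF F(1,2) that])
  define e :: 'k where "e = (-1) ^ Suc p"
  \<comment> \<open>\<open>DD\<close> commutes with \<open>rr\<close> and \<open>DD p l = F\<close>,
    so the added term contributes \<open>rr (F i s)\<close>, that is
    \<open>rr (kk (Suc p) i s)\<close>. By \<open>DD_kk\<close> this cancels
    \<open>DD p (kk p)\<close>.\<close>
  define G where "G i s ys = kk p i s ys + scl e (rr (l i s) ys)" for i s ys
  have shl: "length ys = Suc k \<Longrightarrow> set ys \<subseteq> V \<Longrightarrow> valid (Suc k) ys" for ys by (simp add: valid_def)
  have vl: "valid n ys \<Longrightarrow> length ys = n" "valid n ys \<Longrightarrow> set ys \<subseteq> V" for ys n by (simp_all add: valid_def)
  have "TC p (Suc k) (\<lambda>i s. rr (l i s))"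
    unfolding TC_def
  proof (intro conjI allI impI)
    show "rr (l i s) ys = 0" if "s < 0 \<or> s > int p" for i s ys
    proof -
      have "l i s = (\<lambda>_. 0)" using TC_D(1,2)[OF l] that by auto
      then show ?thesis by simp
    qed
    show "ml (Suc (Suc k)) (rr (l i s))" for i s by (intro ml_rr TC_D(3)[OF l])
    have "l (i + int m) s = l i s" for i s using TC_D(4)[OF l] by auto
    then show "rr (l (i + int m) s) ys = rr (l i s) ys" for i s ys by simp
    show "mrg (ee (i + 2 * s - int p)) (rr (l i s)) ys = rr (l i s) ys" if ys: "valid (Suc (Suc k)) ys" for i s ys
    proof -
      have "mrg (ee (i + 2 * s - int p)) (rr (l i s)) ys = rr (mrg (ee (i + 2 * s - int p)) (l i s)) ys"
        by (rule rr_mrg'[symmetric]) (rule valid_ne[OF ys])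
      also have "\<dots> = rr (l i s) ys"
        by (rule rr_cong[of "Suc k"]) (use ys TC_D(5)[OF l] shl vl in auto)
      finally show ?thesis .
    qed
  qed
  then have TG: "TC p (Suc k) G"
    unfolding G_def[abs_def] by (rule TC_add_scl[OF TC_kk[OF Suc.prems]])
  moreover have "DD p G i s ys = 0" if ys: "valid (Suc (Suc k)) ys" for i s ys
  proof -
    have ne: "ys \<noteq> []" by (rule valid_ne[OF ys])
    define j where "j = i + 2 * s - int (Suc p)"
    have "DD p G i s ys = DD p (kk p) i s ys + scl e (DD p (\<lambda>i s. rr (l i s)) i s ys)"
      unfolding G_def[abs_def] by (rule DD_add_scl[OF ne])
    also have "DD p (\<lambda>i s. rr (l i s)) i s ys = rr (DD p l i s) ys"
      unfolding DD_j[OF j_def, abs_def] rr_add rr_scl rr_lmul rr_mrg'[OF ne] ..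
    also have "\<dots> = rr (F i s) ys"
      by (rule rr_cong[of "Suc k"]) (use ys Dl shl vl in auto)
    also have "\<dots> = rr (kk (Suc p) i s) ys" by (rule F(3)[OF ys])
    finally show ?thesis using DD_kk[OF Suc.prems ys, of i s] by (simp add: e_def)
  qed
  moreover have "rr (G i s) ys = rr (kk p i s) ys" for i s ys
    by (simp add: G_def[abs_def] rr_add rr_scl rr_rr)
  ultimately show ?case by blast
qed

text \<open>At \<open>p = 0\<close> a \<open>DD\<close>-closed family is left linear in its first
  argument. It is therefore determined by its values at the idempotents, and gluing these gives the
  primitive \<open>h\<close>.\<close>

lemma koszul_exact: "cob N f"
proof -
  obtain F where F: "TC 0 N F" "\<And>i s ys. valid (Suc N) ys \<Longrightarrow> DD 0 F i s ys = 0"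
     "\<And>i s ys. valid (Suc (Suc N)) ys \<Longrightarrow> rr (F i s) ys = rr (kk 0 i s) ys"
    using descent[of 0 N] by auto
  define g where "g i l = F i 0 (ee i # l)" for i l
  define h where "h l = El (\<lambda>k i. cf (g i l) k i)" for l
  have ah: "F i 0 (aa i # ys) = aa i \<star> g (i + 1) ys" and bh: "F i 0 (bb i # ys) = bb i \<star> g (i - 1) ys"
    and ph: "F i 0 (pp i # ys) = aa i \<star> (bb (i + 1) \<star> g i ys)" if ys: "valid N ys" for i ys
  proof -
    note F0 = TC_D(1,2)[OF F(1)]
    \<comment> \<open>In Koszul degree 0, closedness at \<open>s = 1\<close> and at
      \<open>s = 0\<close> lets a left factor \<open>a\<close>, respectively \<open>abar\<close>,
      leave the first argument.\<close>
    have A: "aa i \<star> F (i + 1) 0 (y # ys) = F i 0 ((aa i \<star> y) # ys)" if "y \<in> V" for i y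
      using F(2)[of "y # ys" i 1] that ys by (simp add: DD_def F0 scl_minus scl_add add.commute[of 1 i])
    have B: "bb i \<star> F (i - 1) 0 (y # ys) = F i 0 ((bb i \<star> y) # ys)" if "y \<in> V" for i y
      using F(2)[of "y # ys" i 0] that ys by (simp add: DD_def F0 scl_minus scl_add)
    show "F i 0 (aa i # ys) = aa i \<star> g (i + 1) ys" "F i 0 (bb i # ys) = bb i \<star> g (i - 1) ys"
      using A[OF bs_V, of i KE "i + 1"] B[OF bs_V, of i KE "i - 1"] by (simp_all add: g_def)
    show "F i 0 (pp i # ys) = aa i \<star> (bb (i + 1) \<star> g i ys)"
      using A[OF bs_V, of i KB "i + 1"] B[OF bs_V, of "i + 1" KE i] by (simp add: g_def)
  qed
  have "ml N h" unfolding h_def[abs_def]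
  proof (rule ml_glue)
    show "ml N (g i)" for i unfolding g_def[abs_def] by (rule ml_Cons[OF TC_D(3)[OF F(1)] bs_V])
    show "g (i + int m) ys = g i ys" for i ys
      using TC_D(4)[OF F(1)] by (simp add: g_def)
  qed
  moreover have "f (x # ys) = x \<star> h ys + rr h (x # ys)" if x: "x \<in> V" and ys: "valid N ys" for x ys
  proof (rule el_eqI')
    fix k i
    have len: "length ys = N" "set ys \<subseteq> V" using ys by (auto simp: valid_def)
    \<comment> \<open>Since \<open>rr\<close> of \<open>F i 0\<close> agrees with \<open>rr\<close>
      of \<open>mrg (ee i) f\<close>, the cocycle condition of \<open>f\<close> at a leading
      \<open>ee i\<close> yields row \<open>i\<close> of \<open>f\<close>.\<close>
    have "rr (F i 0) (ee i # x # ys) = rr (kk 0 i 0) (ee i # x # ys)"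
      by (rule F(3)) (use x ys in simp)
    also have "\<dots> = rr f ((ee i \<star> ee i) # x # ys)"
    proof -
      have "kk 0 i 0 = mrg (ee i) f" by (rule ext) (simp add: kk_def)
      then show ?thesis by (simp only: rr_mrg)
    qed
    also have "\<dots> = - (ee i \<star> f (x # ys))"
      using f x ys by (simp add: coc_def eq_neg_iff_add_eq_0 add.commute del: rr.simps)
    finally have "ee i \<star> f (x # ys) = F i 0 ((ee i \<star> x) # ys) + rr (g i) (x # ys)"
      by (simp add: g_def[abs_def]) (metis (no_types, lifting) add.inverse_inverse minus_add_distrib diff_conv_add_uminus)
    then have "cf (f (x # ys)) k i = cf (F i 0 ((ee i \<star> x) # ys)) k i + cf (rr (g i) (x # ys)) k i"
      by (metis cf_simps(2) ee_cf)
    moreover have "cf (F i 0 ((ee i \<star> x) # ys)) k i = cf (x \<star> h ys) k i"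
    proof -
      have "F i 0 ((ee i \<star> x) # ys) = scl (cf x KE i) (g i ys) + scl (cf x KA i) (aa i \<star> g (i + 1) ys)
        + scl (cf x KB i) (bb i \<star> g (i - 1) ys) + scl (cf x KP i) (aa i \<star> (bb (i + 1) \<star> g i ys))"
        unfolding ee_mul[OF x] lin4[OF TC_D(3)[OF F(1)] ys bs_V bs_V bs_V bs_V] ah[OF ys] bh[OF ys] ph[OF ys] g_def ..
      then show ?thesis by (cases k) (simp_all add: h_def)
    qed
    moreover have "cf (rr (g i) (x # ys)) k i = cf (rr h (x # ys)) k i"
      by (rule rr_glue) (simp add: h_def)
    ultimately show "cf (f (x # ys)) k i = cf (x \<star> h ys + rr h (x # ys)) k i" by simp
  qed
  ultimately show ?thesis unfolding cob_def by blast
qed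

end

end

section \<open>Values of cocycles on Koszul elements\<close>

context qv
begin

lemma ev_coc:
  assumes f: "coc n f" and k: "Suc p + k = Suc n" and ys: "length ys = k" "set ys \<subseteq> V"
    and j: "j = i + 2 * s - int (Suc p)"
  shows "aa i \<star> ev p (\<lambda>w. f (w @ ys)) (i + 1) (s - 1) + scl (kap i s) (bb i \<star> ev p (\<lambda>w. f (w @ ys)) (i - 1) s)
     + scl ((-1) ^ Suc p) (ev (Suc p) (\<lambda>w. rr (\<lambda>l. f (w @ l)) ys) i s
      + (scl (Kp (i + s) / Kp j) (ev p (\<lambda>w. mrg (aa (j - 1)) (\<lambda>l. f (w @ l)) ys) i (s - 1))
         + ev p (\<lambda>w. mrg (bb (j + 1)) (\<lambda>l. f (w @ l)) ys) i s)) = 0"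
proof -
  have "ev (Suc p) (\<lambda>w. hd w \<star> f (tl w @ ys) + rr f (w @ ys)) i s = ev (Suc p) (\<lambda>_. 0) i s"
  proof (rule ev_cong)
    fix w :: "'k el list" assume w: "length w = Suc p" "set w \<subseteq> V"
    then obtain v w' where vw: "w = v # w'" by (cases w) auto
    then show "hd w \<star> f (tl w @ ys) + rr f (w @ ys) = 0"
      using f ys w k by (simp add: coc_def valid_def del: rr.simps)
  qed
  then have "ev (Suc p) (\<lambda>w. hd w \<star> f (tl w @ ys)) i s + ev (Suc p) (\<lambda>w. rr f (w @ ys)) i s = 0"
    by (simp only: ev_add ev_0)
  moreover have "ev (Suc p) (\<lambda>w. rr f (w @ ys)) i s = scl ((-1) ^ Suc p) (ev (Suc p) (\<lambda>w. rr (\<lambda>l. f (w @ l)) ys) i s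
      + (scl (Kp (i + s) / Kp j) (ev p (\<lambda>w. mrg (aa (j - 1)) (\<lambda>l. f (w @ l)) ys) i (s - 1))
         + ev p (\<lambda>w. mrg (bb (j + 1)) (\<lambda>l. f (w @ l)) ys) i s))"
    by (rule ev_rr[where k = k]) (use f k ys j in \<open>simp_all add: coc_def\<close>)
  ultimately show ?thesis by (simp add: ev_lmul del: ev.simps(2)) (simp add: ev_lmul)
qed

text \<open>Test the cocycle condition with the trailing argument \<open>ee k\<close>: the last
  letter times \<open>ee k\<close> is zero unless \<open>k\<close> is the end vertex, and the terms
  with an outer left letter have no \<open>KE\<close> part. For cochains over K this locality is a
  consequence of the cocycle condition.\<close>

lemma KE_off:
  assumes f: "coc (Suc p) f" and k: "\<not> [k = i + 2 * s - int (Suc p)] (mod int m)"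
  shows "cf (ev (Suc p) f i s) KE k = 0"
proof -
  define j where "j = i + 2 * s - int (Suc p)"
  have "dl j k = 0" using k by (simp add: dl_def j_def)
  then have "aa (j - 1) \<star> ee k = 0" "bb (j + 1) \<star> ee k = 0"
  proof -
    have "\<not> [k = j] (mod int m)" using k by (simp add: j_def)
    then have "\<And>l. dl (j - 1) l * dl k (l + 1) = 0" "\<And>l. dl (j + 1) l * dl k (l - 1) = 0"
      by (auto simp: dl_def) (metis cong_add_rcancel cong_sym cong_trans diff_add_cancel add_diff_cancel)+
    then show "aa (j - 1) \<star> ee k = 0" "bb (j + 1) \<star> ee k = 0"
      by (intro el_eqI; simp)+
  qed
  moreover have "ev p (\<lambda>w. f (w @ [0])) i s = 0" for s
  proof -
    have "ev p (\<lambda>w. f (w @ [0])) i s = ev p (\<lambda>_. 0) i s"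
    proof (rule ev_cong)
      fix w :: "'k el list" assume "length w = p" "set w \<subseteq> V"
      then have "ml (Suc 0) (\<lambda>l. f (w @ l))" using ml_append[of w "Suc 0" f] f by (simp add: coc_def)
      then show "f (w @ [0]) = 0" using ml_lin_0[of 0 "\<lambda>l. f (w @ l)" "[]"] by simp
    qed
    then show ?thesis by simp
  qed
  moreover have "rr (\<lambda>l. f (w @ l)) [ee k] = - (f w \<star> ee k)" for w by simp
  moreover have "ev (Suc p) (\<lambda>w. - (f w \<star> ee k)) i s = - (ev (Suc p) f i s \<star> ee k)"
    by (simp only: ev_minus ev_rmul)
  ultimately have "aa i \<star> ev p (\<lambda>w. f (w @ [ee k])) (i + 1) (s - 1) + scl (kap i s) (bb i \<star> ev p (\<lambda>w. f (w @ [ee k])) (i - 1) s)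
     + scl ((-1) ^ Suc p) (- (ev (Suc p) f i s \<star> ee k)) = 0"
    using ev_coc[OF f, of p 1 "[ee k]" j i s] by (simp only: j_def mrg_simps) (simp del: ev.simps(2))
  then have "cf (aa i \<star> ev p (\<lambda>w. f (w @ [ee k])) (i + 1) (s - 1) + scl (kap i s) (bb i \<star> ev p (\<lambda>w. f (w @ [ee k])) (i - 1) s)
     + scl ((-1) ^ Suc p) (- (ev (Suc p) f i s \<star> ee k))) KE k = 0" by (simp only: cf_simps)
  then show ?thesis by (simp del: ev.simps(2))
qed

lemma ev_V': "ml n f \<Longrightarrow> ev n f i s \<in> V"
  by (rule ev_V) (rule ml_V)

definition ph :: "nat \<Rightarrow> ('k el list \<Rightarrow> 'k el) \<Rightarrow> int \<Rightarrow> int \<Rightarrow> 'k" where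
  "ph n f i s = cf (ev n f i s) KE i"

lemma ph_shift: "coc n f \<Longrightarrow> ph n f (i + int m) s = ph n f i s"
  using V_D[OF ev_V', of n f] by (simp add: ph_def ev_shift coc_def)

lemma ph_range: "s < 0 \<or> s > int n \<Longrightarrow> ph n f i s = 0"
  by (simp add: ph_def ev_range)

lemma kap_cong: "[i = j] (mod int m) \<Longrightarrow> kap i t = kap j t"
proof -
  assume "[i = j] (mod int m)"
  moreover have "El (\<lambda>k i. kap i t) \<in> V" by (simp add: V_def kap_shift)
  ultimately show ?thesis using V_D'[of "El (\<lambda>k i. kap i t)" i j] by simp
qed

lemma ph_rec:
  assumes f: "coc n f" and st: "[2 * s = int n] (mod int m)"
  shows "ph n f (i + 1) s = (-1) ^ n * kap (i + 1) (int n - s) * ph n f i s" (is ?A)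
    and "ph n f (i + 1) s = (-1) ^ n * kap (i + 1) s * ph n f i s" (is ?B)
proof -
  \<comment> \<open>The displacement of the Koszul element. Being a multiple of \<open>m\<close> it
    may be dropped in \<open>kap\<close> and \<open>dl\<close>, but not in
    \<open>Kp\<close>.\<close>
  define d where "d = 2 * s - int n"
  obtain c where c: "d = int m * c"
    using st by (metis cong_iff_dvd_diff d_def dvdE)
  have dk: "dl (i + d) i = 1" for i
    by (simp add: dl_def c cong_def)
  have kd: "kap (i + d) t = kap i t" for i t
    by (rule kap_cong) (simp add: c cong_def)
  have ev_0: "ev (Suc n) (\<lambda>w. rr (\<lambda>l. f (w @ l)) []) i s = 0" for i s by (simp only: rr.simps ev_0)
  \<comment> \<open>Koszul elements with one more letter \<open>a\<close>: in the \<open>KA\<close>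
    coordinate only the splittings with an outer \<open>a\<close> remain.\<close>
  have 1: "aa i \<star> ev n f (i + 1) s + scl (kap i (s + 1)) (bb i \<star> ev n f (i - 1) (s + 1))
     + scl ((-1) ^ Suc n) (scl (Kp (i + s + 1) / Kp (i + d + 1)) (ev n f i s \<star> aa (i + d)) + ev n f i (s + 1) \<star> bb (i + d + 2)) = 0"
    using ev_coc[OF f, of n 0 "[]" "i + d + 1" i "s + 1"] unfolding ev_0 by (simp add: d_def ev_rmul add.assoc)
  have "cf (ev n f (i + 1) s) KE (i + 1) + (-1) ^ Suc n * (Kp (i + s + 1) / Kp (i + d + 1) * (cf (ev n f i s) KE i * dl (i + d) i)) = 0"
    using arg_cong[OF 1, of "\<lambda>x. cf x KA i"] by (simp only: cf_simps scl_app mul_app bs_app) simp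
  then have "ph n f (i + 1) s = (-1) ^ n * (Kp (i + s + 1) / Kp (i + d + 1)) * ph n f i s"
    by (simp add: ph_def dk)
  moreover have "Kp (i + s + 1) / Kp (i + d + 1) = kap (i + 1) (int n - s)"
    using kd[of "i + 1" "int n - s"] by (simp add: kap_def d_def algebra_simps)
  ultimately show ?A by simp
  define l where "l = i + 1"
  \<comment> \<open>Koszul elements with one more letter \<open>abar\<close>: the \<open>KB\<close>
    coordinate sees only an outer \<open>abar\<close>.\<close>
  have 2: "aa l \<star> ev n f (l + 1) (s - 1) + scl (kap l s) (bb l \<star> ev n f (l - 1) s)
     + scl ((-1) ^ Suc n) (scl (Kp (l + s) / Kp (l + d - 1)) (ev n f l (s - 1) \<star> aa (l + d - 2)) + ev n f l s \<star> bb (l + d)) = 0"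
    using ev_coc[OF f, of n 0 "[]" "l + d - 1" l s] unfolding ev_0 by (simp add: d_def ev_rmul algebra_simps)
  have "kap l s * cf (ev n f (l - 1) s) KE (l - 1) + (-1) ^ Suc n * (cf (ev n f l s) KE l * dl (l + d) l) = 0"
    using arg_cong[OF 2, of "\<lambda>x. cf x KB l"] by (simp only: cf_simps scl_app mul_app bs_app) simp
  then have "kap l s * ph n f i s = (-1) ^ n * ph n f l s" by (simp add: ph_def dk l_def)
  then have "(-1) ^ n * (kap l s * ph n f i s) = (-1) ^ n * ((-1) ^ n * ph n f l s)" by simp
  also have "\<dots> = ph n f l s" by (simp add: mult.assoc[symmetric] power_mult_distrib[symmetric])
  finally show ?B by (simp add: l_def mult.assoc)
qed

text \<open>The structure constant of the comultiplication: \<open>t\<close> letters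
  \<open>abar\<close>, standing after \<open>a\<close> letters \<open>a\<close> from the vertex
  \<open>i\<close>, are moved past \<open>x\<close> further letters \<open>a\<close>, one at a
  time.\<close>

definition cC :: "int \<Rightarrow> int \<Rightarrow> nat \<Rightarrow> int \<Rightarrow> 'k" where
  "cC i a t x = (\<Prod>k<t. kap (i + a - int k) x)"

lemma cC_Suc: "cC i a (Suc t) x = kap (i + a) x * cC (i - 1) a t x"
  unfolding cC_def prod.lessThan_Suc_shift by (simp add: algebra_simps)

lemma cC_shift: "cC i (a + 1) t x = cC (i + 1) a t x"
  unfolding cC_def by (simp add: algebra_simps)

lemma mul_sum: "(\<Sum>a\<in>A. f a) \<star> z = (\<Sum>a\<in>A. f a \<star> z)" "z \<star> (\<Sum>a\<in>A. f a) = (\<Sum>a\<in>A. z \<star> f a)"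
  by (induction A rule: infinite_finite_induct; simp add: mul_distrib)+

lemma scl_sum: "scl c (\<Sum>a\<in>A. f a) = (\<Sum>a\<in>A. scl c (f a))"
  by (induction A rule: infinite_finite_induct) (simp_all add: scl_add)

text \<open>Koszul elements form a subcoalgebra for deconcatenation: cutting after \<open>p\<close>
  letters gives pairs of Koszul elements, indexed by the number \<open>a\<close> of letters
  \<open>a\<close> in the left part. The right part starts where the left part ends.\<close>

lemma ev_cup:
  "ev (p + r) (\<lambda>w. f (take p w) \<star> g (drop p w)) i s =
    (\<Sum>a\<le>p. scl (cC i (int a) (p - a) (s - int a)) (ev p f i (int a) \<star> ev r g (i + 2 * int a - int p) (s - int a)))"
proof (induction p arbitrary: f i s)
  case 0
  then show ?case by (simp add: ev_lmul cC_def)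
next
  case (Suc p)
  let ?G = "\<lambda>a. ev r g (i + 2 * int a - int (Suc p)) (s - int a)"
  have sh: "cC i (1 + int x) t y = cC (1 + i) (int x) t y" for x t y
    using cC_shift[of i "int x" t y] by (simp add: add.commute)
  have 1: "ev (p + r) (\<lambda>w. f (aa i # take p w) \<star> g (drop p w)) (i + 1) (s - 1) =
    (\<Sum>a\<le>p. scl (cC i (int (Suc a)) (Suc p - Suc a) (s - int (Suc a))) (ev p (\<lambda>w. f (aa i # w)) (i + 1) (int a) \<star> ?G (Suc a)))"
    unfolding Suc.IH[of "\<lambda>w. f (aa i # w)"]
    by (rule sum.cong) (simp_all add: sh algebra_simps)
  also have "\<dots> = (\<Sum>a\<le>Suc p. scl (cC i (int a) (Suc p - a) (s - int a)) (ev p (\<lambda>w. f (aa i # w)) (i + 1) (int a - 1) \<star> ?G a))"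
    unfolding sum.atMost_Suc_shift by (simp add: ev_range)
  finally have A: "ev (p + r) (\<lambda>w. f (aa i # take p w) \<star> g (drop p w)) (i + 1) (s - 1) = \<dots>" .
  have "scl (kap i s) (ev (p + r) (\<lambda>w. f (bb i # take p w) \<star> g (drop p w)) (i - 1) s) =
    (\<Sum>a\<le>p. scl (cC i (int a) (Suc p - a) (s - int a)) (scl (kap i (int a)) (ev p (\<lambda>w. f (bb i # w)) (i - 1) (int a)) \<star> ?G a))"
    unfolding Suc.IH[of "\<lambda>w. f (bb i # w)"] scl_sum
  proof (rule sum.cong)
    fix a assume a: "a \<in> {..p}"
    have "kap i s = kap i (int a) * kap (i + int a) (s - int a)" using kap_add[of i "int a" "s - int a"] by simp
    then have "kap i s * cC (i - 1) (int a) (p - a) (s - int a) = cC i (int a) (Suc p - a) (s - int a) * kap i (int a)"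
      using a by (simp add: Suc_diff_le cC_Suc)
    moreover have j: "i - 1 + 2 * int a - int p = i + 2 * int a - int (Suc p)" by simp
    ultimately show "scl (kap i s) (scl (cC (i - 1) (int a) (p - a) (s - int a))
            (ev p (\<lambda>w. f (bb i # w)) (i - 1) (int a) \<star> ev r g (i - 1 + 2 * int a - int p) (s - int a))) =
         scl (cC i (int a) (Suc p - a) (s - int a)) (scl (kap i (int a)) (ev p (\<lambda>w. f (bb i # w)) (i - 1) (int a)) \<star> ?G a)"
      unfolding j by (simp add: mul_scl)
  qed simp
  also have "\<dots> = (\<Sum>a\<le>Suc p. scl (cC i (int a) (Suc p - a) (s - int a)) (scl (kap i (int a)) (ev p (\<lambda>w. f (bb i # w)) (i - 1) (int a)) \<star> ?G a))"
    by (simp add: ev_range)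
  finally have B: "scl (kap i s) (ev (p + r) (\<lambda>w. f (bb i # take p w) \<star> g (drop p w)) (i - 1) s) = \<dots>" .
  have "ev (Suc p + r) (\<lambda>w. f (take (Suc p) w) \<star> g (drop (Suc p) w)) i s
     = ev (p + r) (\<lambda>w. f (aa i # take p w) \<star> g (drop p w)) (i + 1) (s - 1)
      + scl (kap i s) (ev (p + r) (\<lambda>w. f (bb i # take p w) \<star> g (drop p w)) (i - 1) s)" by simp
  also have "\<dots> = (\<Sum>a\<le>Suc p. scl (cC i (int a) (Suc p - a) (s - int a)) (ev (Suc p) f i (int a) \<star> ?G a))"
    unfolding A B sum.distrib[symmetric] scl_add[symmetric] mul_distrib[symmetric] by simp
  finally show ?case .
qed

text \<open>\<open>u i\<close> is the \<open>e\<close>-component of a cocycle on the Koszul element at \<open>i\<close> with \<open>s\<close> letters \<open>a\<close> and \<open>t\<close> letters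
  \<open>\<bar>a\<close>. The two recursions are the coefficients at \<open>a\<close> and \<open>\<bar>a\<close> of the cocycle condition on the Koszul elements
  of the next degree.\<close>

definition SS :: "(nat \<times> nat) set" where
  "SS = {(s, t). [int s = int t] (mod int m) \<and> (\<exists>u. \<forall>i. u i \<noteq> 0 \<and> u (i + int m) = u i \<and>
      u (i + 1) = (-1) ^ (s + t) * kap (i + 1) (int s) * u i \<and> u (i + 1) = (-1) ^ (s + t) * kap (i + 1) (int t) * u i)}"

lemma SS_kap: "(s, t) \<in> SS \<Longrightarrow> kap i (int s) = kap i (int t)"
proof -
  assume "(s, t) \<in> SS"
  then obtain u where u: "\<And>i. u i \<noteq> 0 \<and> u (i + 1) = (-1) ^ (s + t) * kap (i + 1) (int s) * u i \<and> u (i + 1) = (-1) ^ (s + t) * kap (i + 1) (int t) * u i"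
    unfolding SS_def by blast
  have "(-1) ^ (s + t) * kap (i - 1 + 1) (int s) * u (i - 1) = (-1) ^ (s + t) * kap (i - 1 + 1) (int t) * u (i - 1)"
    using u[of "i - 1"] by metis
  then show ?thesis using u[of "i - 1"] by simp
qed

lemma SS_cong: "(s, t) \<in> SS \<Longrightarrow> [int s = int t] (mod int m)"
  by (simp add: SS_def)

text \<open>A nonzero \<open>KE\<close> value at the start vertex forces a closed walk, by
  \<open>KE_off\<close>; the recursions then carry nonvanishing to all vertices in both directions,
  so the values themselves serve as \<open>u\<close>.\<close>

lemma ph_SS:
  assumes f: "coc (s + t) f" and nz: "ph (s + t) f i0 (int s) \<noteq> 0"
  shows "(s, t) \<in> SS"
proof -
  have st: "[int s = int t] (mod int m)"
  proof (cases "s + t")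
    case (Suc p)
    have "[i0 = i0 + 2 * int s - int (Suc p)] (mod int m)"
      using KE_off[of p f i0 i0 "int s"] nz f Suc by (auto simp: ph_def simp del: ev.simps(2))
    then have "[i0 + 2 * int s - int (s + t) = i0] (mod int m)" by (simp only: Suc cong_sym_eq)
    then show ?thesis by (simp add: cong_iff_dvd_diff)
  qed simp
  then have st': "[2 * int s = int (s + t)] (mod int m)"
    by (simp add: cong_iff_dvd_diff)
  define u where "u i = ph (s + t) f i (int s)" for i
  have u1: "u (i + 1) = (-1) ^ (s + t) * kap (i + 1) (int s) * u i" for i
    unfolding u_def by (rule ph_rec(2)[OF f st'])
  have u2: "u (i + 1) = (-1) ^ (s + t) * kap (i + 1) (int t) * u i" for i
    unfolding u_def using ph_rec(1)[OF f st'] by simp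
  have u3: "u (i + int m) = u i" for i
    unfolding u_def by (rule ph_shift[OF f])
  have "u i \<noteq> 0" for i
  proof (induction i rule: int_induct[where k = i0])
    case base
    show ?case using nz by (simp add: u_def)
  next
    case (step1 i)
    then show ?case using u1[of i] by simp
  next
    case (step2 i)
    then show ?case using u1[of "i - 1"] by auto
  qed
  then show ?thesis using st u1 u2 u3 unfolding SS_def by blast
qed

text \<open>The rescaling that turns the comultiplication of Koszul elements into \<open>x\<^sup>s y\<^sup>t x\<^sup>s\<^sup>' y\<^sup>t\<^sup>' = x\<^sup>s\<^sup>+\<^sup>s\<^sup>' y\<^sup>t\<^sup>+\<^sup>t\<^sup>'\<close>.\<close>

definition gam :: "nat \<Rightarrow> 'k" where "gam t = (\<Prod>k<t. kap 1 (int k))"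

lemma gam_nz [simp]: "gam t \<noteq> 0"
  by (simp add: gam_def)

lemma kap_prod: "kap i (int t) = (\<Prod>j<t. kap (i + int j) 1)"
proof (induction t)
  case (Suc t)
  have "kap i (int (Suc t)) = kap i (int t) * kap (i + int t) 1"
    using kap_add[of i "int t" 1] by (simp add: add.commute)
  then show ?case using Suc by simp
qed simp

text \<open>The moving cost of two blocks of letters is a coboundary with potential
  \<open>gam\<close>. In the induction on \<open>t2\<close>, the new factor
  \<open>kap 1 (int (t1 + t2))\<close> splits into the one for \<open>t2\<close> and a product that
  \<open>kap_prod\<close> distributes over \<open>j\<close>.\<close>

lemma gam_add: "gam (t1 + t2) = gam t1 * gam t2 * (\<Prod>j<t1. kap (1 + int j) (int t2))"
proof (induction t2)
  case 0
  then show ?case by (simp add: gam_def)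
next
  case (Suc t2)
  have "kap (1 + int j) (int (Suc t2)) = kap (1 + int j) (int t2) * kap (1 + int t2 + int j) 1" for j
    using kap_add[of "1 + int j" "int t2" 1] by (simp add: algebra_simps)
  then have 1: "(\<Prod>j<t1. kap (1 + int j) (int (Suc t2))) = (\<Prod>j<t1. kap (1 + int j) (int t2)) * kap (1 + int t2) (int t1)"
    by (simp only: prod.distrib kap_prod[of "1 + int t2" t1])
  have 2: "gam (Suc n) = gam n * kap 1 (int n)" for n by (simp add: gam_def)
  have 3: "kap 1 (int (t1 + t2)) = kap 1 (int t2) * kap (1 + int t2) (int t1)"
    using kap_add[of 1 "int t2" "int t1"] by (simp add: add.commute)
  show ?case unfolding 1 add_Suc_right 2 Suc.IH 3 by (simp add: mult_ac)
qed

text \<open>Congruence of \<open>a\<close> and \<open>t1\<close> aligns the vertices, and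
  \<open>SS_kap\<close> replaces \<open>b\<close> by \<open>t2\<close>. The structure constant then
  depends on \<open>t1\<close> and \<open>t2\<close> alone and has the form treated in
  \<open>gam_add\<close>.\<close>

lemma cC_SS:
  assumes 1: "(a, t1) \<in> SS" and 2: "(b, t2) \<in> SS"
  shows "cC 0 (int a) t1 (int b) = gam (t1 + t2) / (gam t1 * gam t2)"
proof -
  have "cC 0 (int a) t1 (int b) = (\<Prod>k<t1. kap (1 + int (t1 - Suc k)) (int t2))"
    unfolding cC_def
  proof (rule prod.cong)
    fix k assume "k \<in> {..<t1}"
    then have "int a - int k - (1 + int (t1 - Suc k)) = int a - int t1" by auto
    then have "[int a - int k = 1 + int (t1 - Suc k)] (mod int m)"
      using SS_cong[OF 1] unfolding cong_iff_dvd_diff by simp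
    then show "kap (0 + int a - int k) (int b) = kap (1 + int (t1 - Suc k)) (int t2)"
      using SS_kap[OF 2] kap_cong by simp
  qed simp
  also have "\<dots> = (\<Prod>j<t1. kap (1 + int j) (int t2))"
    by (rule prod.nat_diff_reindex)
  finally show ?thesis by (simp add: gam_add)
qed

end

section \<open>Cocycles from skew derivations\<close>

context qv
begin

text \<open>For \<open>(s, t) \<in> SS\<close> a cocycle is the cup product of \<open>s\<close> copies of the skew derivation \<open>dx\<close> (\<open>\<partial>/\<partial>a\<close>) and
  \<open>t\<close> copies of \<open>dy\<close> (\<open>\<partial>/\<partial>\<bar>a\<close>). These are cocycles with values in bimodules twisted by automorphisms
  that rotate the quiver; \<open>tw s t\<close> is the resulting twist, which is inner exactly for \<open>(s, t) \<in> SS\<close>.\<close>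

definition sg :: "'k el \<Rightarrow> 'k el" where
  "sg x = El (\<lambda>k i. case k of KE \<Rightarrow> cf x KE (i - 1) | KA \<Rightarrow> - cf x KA (i - 1)
     | KB \<Rightarrow> Q (i - 1) * cf x KB (i - 1) | KP \<Rightarrow> - Q i * cf x KP (i - 1))"

definition dx :: "'k el \<Rightarrow> 'k el" where
  "dx x = El (\<lambda>k i. case k of KE \<Rightarrow> cf x KA (i - 1) | KB \<Rightarrow> cf x KP (i - 1) | _ \<Rightarrow> 0)"

definition ta :: "'k el \<Rightarrow> 'k el" where
  "ta x = El (\<lambda>k i. case k of KE \<Rightarrow> cf x KE (i + 1) | KA \<Rightarrow> cf x KA (i + 1) / Q (i + 1)
     | KB \<Rightarrow> - cf x KB (i + 1) | KP \<Rightarrow> - cf x KP (i + 1) / Q (i + 1))"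

definition dy :: "'k el \<Rightarrow> 'k el" where
  "dy x = El (\<lambda>k i. case k of KE \<Rightarrow> cf x KB (i + 1) | KA \<Rightarrow> cf x KP (i + 1) / Q (i + 1) | _ \<Rightarrow> 0)"

definition tw :: "nat \<Rightarrow> nat \<Rightarrow> 'k el \<Rightarrow> 'k el" where
  "tw s t x = El (\<lambda>k i. let d = int t - int s in case k of KE \<Rightarrow> cf x KE (i + d)
     | KA \<Rightarrow> (-1) ^ (s + t) * (Kp (i + 1 + int t) / Kp (i + 1)) * cf x KA (i + d)
     | KB \<Rightarrow> (-1) ^ (s + t) * (Kp (i + d) / Kp (i + int t)) * cf x KB (i + d)
     | KP \<Rightarrow> Kp (i + d + 1) / Kp (i + 1) * cf x KP (i + d))"

lemma sg_ta_app [simp]: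
  "cf (sg x) KE i = cf x KE (i - 1)" "cf (sg x) KA i = - cf x KA (i - 1)"
  "cf (sg x) KB i = Q (i - 1) * cf x KB (i - 1)" "cf (sg x) KP i = - Q i * cf x KP (i - 1)"
  "cf (dx x) KE i = cf x KA (i - 1)" "cf (dx x) KA i = 0" "cf (dx x) KB i = cf x KP (i - 1)" "cf (dx x) KP i = 0"
  "cf (ta x) KE i = cf x KE (i + 1)" "cf (ta x) KA i = cf x KA (i + 1) / Q (i + 1)"
  "cf (ta x) KB i = - cf x KB (i + 1)" "cf (ta x) KP i = - cf x KP (i + 1) / Q (i + 1)"
  "cf (dy x) KE i = cf x KB (i + 1)" "cf (dy x) KB i = 0" "cf (dy x) KA i = cf x KP (i + 1) / Q (i + 1)" "cf (dy x) KP i = 0"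
  by (simp_all add: sg_def dx_def ta_def dy_def)

lemma tw_app:
  "cf (tw s t x) KE i = cf x KE (i + (int t - int s))"
  "cf (tw s t x) KA i = (-1) ^ (s + t) * (Kp (i + 1 + int t) / Kp (i + 1)) * cf x KA (i + (int t - int s))"
  "cf (tw s t x) KB i = (-1) ^ (s + t) * (Kp (i + (int t - int s)) / Kp (i + int t)) * cf x KB (i + (int t - int s))"
  "cf (tw s t x) KP i = Kp (i + (int t - int s) + 1) / Kp (i + 1) * cf x KP (i + (int t - int s))"
  by (simp_all add: tw_def Let_def)

lemma dx_mul: "dx (x \<star> y) = dx x \<star> y + sg x \<star> dx y"
  by (rule el_eqI) (simp_all add: algebra_simps)

lemma dy_mul: "dy (x \<star> y) = dy x \<star> y + ta x \<star> dy y"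
  by (rule el_eqI) (simp_all add: field_simps)

lemma tw_0: "tw 0 0 x = x"
  by (rule el_eqI) (simp_all add: tw_app)

text \<open>With \<open>tw_0\<close> and \<open>tw_ta\<close> this identifies \<open>tw s t\<close>
  as \<open>s\<close> applications of \<open>sg\<close> followed by \<open>t\<close> applications of
  \<open>ta\<close>; multiplicativity is inherited from the factors, while the closed form is
  compared with an inner automorphism.\<close>

lemma tw_sg: "tw s t (sg x) = tw (Suc s) t x"
proof (rule el_eqI)
  fix i
  define l where "l = i + (int t - int (Suc s))"
  have l: "i + (int t - int s) = l + 1" by (simp add: l_def)
  show "cf (tw s t (sg x)) KE i = cf (tw (Suc s) t x) KE i" "cf (tw s t (sg x)) KA i = cf (tw (Suc s) t x) KA i"
   "cf (tw s t (sg x)) KB i = cf (tw (Suc s) t x) KB i" 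
    unfolding tw_app l l_def[symmetric] by (simp_all add: Kp_Suc)
  have "Kp (l + 1 + 1) * Q (l + 1) = - Kp (l + 1)" unfolding Kp_Suc[of "l + 1"] by simp
  then show "cf (tw s t (sg x)) KP i = cf (tw (Suc s) t x) KP i"
    unfolding tw_app l l_def[symmetric] by (simp add: field_simps)
qed

lemma tw_ta: "tw 0 t (ta x) = tw 0 (Suc t) x"
proof (rule el_eqI)
  fix i
  have l: "i + (int (Suc t) - int 0) = i + int t + 1" "i + (int t - int 0) = i + int t" "i + 1 + int (Suc t) = i + int t + 1 + 1"
     "i + 1 + int t = i + int t + 1" "i + int (Suc t) = i + int t + 1" by simp_all
  show "cf (tw 0 t (ta x)) KE i = cf (tw 0 (Suc t) x) KE i" "cf (tw 0 t (ta x)) KB i = cf (tw 0 (Suc t) x) KB i"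
    unfolding tw_app l by simp_all
  show "cf (tw 0 t (ta x)) KA i = cf (tw 0 (Suc t) x) KA i" "cf (tw 0 t (ta x)) KP i = cf (tw 0 (Suc t) x) KP i"
    unfolding tw_app l Kp_Suc[of "i + int t + 1"] by simp_all
qed

lemma tw_add: "tw s t (x + y) = tw s t x + tw s t y"
  by (rule el_eqI) (simp_all add: tw_app algebra_simps add_divide_distrib)

lemma tw_scl: "tw s t (scl c x) = scl c (tw s t x)"
  by (rule el_eqI) (simp_all add: tw_app)

lemma sg_mul: "sg (x \<star> y) = sg x \<star> sg y"
  by (rule el_eqI) (simp_all add: algebra_simps)

lemma ta_mul: "ta (x \<star> y) = ta x \<star> ta y"
  by (rule el_eqI) (simp_all add: field_simps)

lemma tw_mul: "tw s t (x \<star> y) = tw s t x \<star> tw s t y"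
proof (induction s arbitrary: x y)
  case 0
  show ?case
    by (induction t arbitrary: x y) (simp_all add: tw_0 tw_ta[symmetric] ta_mul)
qed (simp add: tw_sg[symmetric] sg_mul)

lemma Q_shift': "Q (i + int m + 1) = Q (i + 1)" "Q (i + int m - 1) = Q (i - 1)"
  using Q_shift[of "i + 1"] Q_shift[of "i - 1"] by (simp_all add: algebra_simps)

lemma V_D2: "x \<in> V \<Longrightarrow> cf x k (i + int m + 1) = cf x k (i + 1)" "x \<in> V \<Longrightarrow> cf x k (i + int m - 1) = cf x k (i - 1)"
  using V_D[of x k "i + 1"] V_D[of x k "i - 1"] by (simp_all add: algebra_simps)

lemma sg_V: "x \<in> V \<Longrightarrow> sg x \<in> V" "x \<in> V \<Longrightarrow> dx x \<in> V" "x \<in> V \<Longrightarrow> ta x \<in> V" "x \<in> V \<Longrightarrow> dy x \<in> V"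
  unfolding V_def by (safe; case_tac k; simp add: V_D2[unfolded V_def] Q_shift')+

lemma tw_V: "x \<in> V \<Longrightarrow> tw s t x \<in> V"
proof (induction s arbitrary: x)
  case 0
  then show ?case
    by (induction t arbitrary: x) (simp_all add: tw_0 tw_ta[symmetric] sg_V)
qed (simp add: tw_sg[symmetric] sg_V)

text \<open>These are the cocycles with values in the algebra whose left action is twisted by
  \<phi>.\<close>

definition tc :: "('k el \<Rightarrow> 'k el) \<Rightarrow> nat \<Rightarrow> ('k el list \<Rightarrow> 'k el) \<Rightarrow> bool" where
  "tc \<phi> n f \<longleftrightarrow> ml n f \<and> (\<forall>x\<in>V. \<forall>ys. valid n ys \<longrightarrow> \<phi> x \<star> f ys + rr f (x # ys) = 0)"

text \<open>This is the cup product of a skew derivation with a twisted cocycle. The term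
  \<open>d x\<close> times \<open>y\<close> from the skew Leibniz rule cancels against the bar
  differential of \<open>f\<close>, and the remaining one carries the composed twist.\<close>

lemma tc_Suc:
  assumes f: "tc \<phi> n f"
    and \<phi>: "\<And>x y. \<phi> (x \<star> y) = \<phi> x \<star> \<phi> y" "\<And>x y. \<phi> (x + y) = \<phi> x + \<phi> y" "\<And>c x. \<phi> (scl c x) = scl c (\<phi> x)" "\<And>x. x \<in> V \<Longrightarrow> \<phi> x \<in> V"
    and d: "\<And>x y. d (x \<star> y) = d x \<star> y + \<delta> x \<star> d y" "\<And>x y. d (x + y) = d x + d y" "\<And>c x. d (scl c x) = scl c (d x)" "\<And>x. x \<in> V \<Longrightarrow> d x \<in> V"
  shows "tc (\<phi> \<circ> \<delta>) (Suc n) (\<lambda>ys. case ys of [] \<Rightarrow> 0 | x # xs \<Rightarrow> \<phi> (d x) \<star> f xs)"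
  unfolding tc_def
proof (intro conjI ballI allI impI)
  let ?g = "\<lambda>ys. case ys of [] \<Rightarrow> 0 | x # xs \<Rightarrow> \<phi> (d x) \<star> f xs"
  show "ml (Suc n) ?g"
    by (rule ml_SucI) (use f in \<open>auto simp: tc_def d \<phi> mul_distrib mul_scl intro!: ml_lmul\<close>)
  fix x ys assume x: "x \<in> V" and ys: "valid (Suc n) ys"
  then obtain y zs where y: "ys = y # zs" "y \<in> V" "valid n zs" by (cases ys) auto
  have "\<phi> y \<star> f zs + rr f (y # zs) = 0" using f y by (simp add: tc_def del: rr.simps)
  then have r: "rr f (y # zs) = - (\<phi> y \<star> f zs)" by (simp add: eq_neg_iff_add_eq_0 add.commute del: rr.simps)
  have "rr ?g (x # ys) = - (\<phi> (d (x \<star> y)) \<star> f zs) - rr (\<lambda>l. \<phi> (d x) \<star> f l) (y # zs)"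
    by (simp add: y)
  also have "\<dots> = - (\<phi> (d (x \<star> y)) \<star> f zs) + \<phi> (d x) \<star> (\<phi> y \<star> f zs)"
    unfolding rr_lmul r by (simp add: mul_minus)
  also have "\<dots> = - (\<phi> (\<delta> x) \<star> (\<phi> (d y) \<star> f zs))"
    by (simp add: d \<phi> mul_distrib mul_assoc)
  finally show "(\<phi> \<circ> \<delta>) x \<star> ?g ys + rr ?g (x # ys) = 0" by (simp add: y)
qed

fun xy :: "nat \<Rightarrow> nat \<Rightarrow> 'k el list \<Rightarrow> 'k el" where
  "xy 0 0 = (\<lambda>_. one1)"
| "xy 0 (Suc t) = (\<lambda>ys. case ys of [] \<Rightarrow> 0 | x # xs \<Rightarrow> tw 0 t (dy x) \<star> xy 0 t xs)"
| "xy (Suc s) t = (\<lambda>ys. case ys of [] \<Rightarrow> 0 | x # xs \<Rightarrow> tw s t (dx x) \<star> xy s t xs)"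

lemma d_lin: "dx (x + y) = dx x + dx y" "dx (scl c x) = scl c (dx x)" "dy (x + y) = dy x + dy y" "dy (scl c x) = scl c (dy x)"
  by (rule el_eqI; simp add: add_divide_distrib)+

lemma tc_xy: "tc (tw s t) (s + t) (xy s t)"
proof (induction s)
  case 0
  show ?case
  proof (induction t)
    case 0
    show ?case by (simp add: tc_def tw_0)
  next
    case (Suc t)
    have "tc (tw 0 t \<circ> ta) (Suc (0 + t)) (xy 0 (Suc t))"
      unfolding xy.simps
      by (rule tc_Suc[OF Suc]) (simp_all add: tw_mul tw_add tw_scl tw_V dy_mul d_lin sg_V)
    moreover have "tw 0 t \<circ> ta = tw 0 (Suc t)" by (rule ext) (simp add: tw_ta)
    ultimately show ?case by simp
  qed
next
  case (Suc s)
  have "tc (tw s t \<circ> sg) (Suc (s + t)) (xy (Suc s) t)"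
    unfolding xy.simps
    by (rule tc_Suc[OF Suc]) (simp_all add: tw_mul tw_add tw_scl tw_V dx_mul d_lin sg_V)
  moreover have "tw s t \<circ> sg = tw (Suc s) t" by (rule ext) (simp add: tw_sg)
  ultimately show ?case by simp
qed

lemma dx_bs: "dx (aa i) = ee (i + 1)" "dx (bb i) = 0" "dy (aa i) = 0" "dy (bb i) = ee (i - 1)"
proof -
  have "dl i (l - 1) = dl (i + 1) l" "dl i (l + 1) = dl (i - 1) l" for l
    using dl_simps(4)[of i "l - 1"] dl_simps(5)[of i "l + 1"] by simp_all
  then show "dx (aa i) = ee (i + 1)" "dx (bb i) = 0" "dy (aa i) = 0" "dy (bb i) = ee (i - 1)"
    by (auto intro!: el_eqI)
qed

text \<open>\<open>dx\<close> kills \<open>abar\<close> and \<open>dy\<close> kills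
  \<open>a\<close>. Hence only the word with all \<open>s\<close> letters \<open>a\<close> in front
  contributes, and its coefficient is 1 by normalisation.\<close>

lemma ev_xy: "cf (ev (s + t) (xy s t) i r) KE (i + int s - int t) = (if r = int s then 1 else 0)"
proof (induction s arbitrary: i r)
  case 0
  show ?case
  proof (induction t arbitrary: i r)
    case 0
    show ?case by (simp add: one1_def)
  next
    case (Suc t)
    have "tw 0 t 0 = 0" using tw_scl[of 0 t 0 0] by simp
    moreover have "i + (int t - (1 + int t)) = i - 1" by simp
    ultimately show ?case
      using Suc.IH[of "i - 1" r] by (simp add: dx_bs ev_lmul tw_app algebra_simps)
  qed
next
  case (Suc s)
  have "tw s t 0 = 0" using tw_scl[of s t 0 0] by simp
  moreover have j: "i + int (Suc s) - int t = i + 1 + int s - int t" by simp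
  ultimately show ?case unfolding j
    using Suc.IH[of "i + 1" "r - 1"] by (auto simp: dx_bs ev_lmul tw_app)
qed

text \<open>The function \<open>u\<close> witnessing membership in \<open>SS\<close> gives a
  diagonal unit \<open>U\<close> with \<open>U \<star> tw s t x = x \<star> U\<close>, so
  multiplying by \<open>U\<close> from the left untwists the cocycle. Dividing by \<open>u 0\<close>
  normalises the value at the vertex 0.\<close>

lemma exists_cocycle:
  assumes "(s, t) \<in> SS"
  shows "\<exists>f. coc (s + t) f \<and> (\<forall>r. ph (s + t) f 0 r = (if r = int s then 1 else 0))"
proof -
  obtain u where st: "[int s = int t] (mod int m)" and u: "\<And>i. u i \<noteq> 0" "\<And>i. u (i + int m) = u i"
    "\<And>i. u (i + 1) = (-1) ^ (s + t) * kap (i + 1) (int s) * u i" "\<And>i. u (i + 1) = (-1) ^ (s + t) * kap (i + 1) (int t) * u i"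
    using assms unfolding SS_def mem_Collect_eq case_prod_conv by metis
  define U where "U = El (\<lambda>k i. if k = KE then u i / u 0 else 0)"
  have U: "U \<in> V" by (auto simp: U_def V_def u(2))
  define d where "d = int t - int s"
  have xd: "cf x k (i + d) = cf x k i" if "x \<in> V" for x k i
    by (rule V_D'[OF that]) (use st in \<open>simp add: d_def cong_iff_dvd_diff dvd_diff_commute\<close>)
  \<comment> \<open>Equality of the two recursions in \<open>SS\<close> makes \<open>Kp\<close>
    invariant under the displacement, which mere congruence modulo \<open>m\<close> would not
    give.\<close>
  have Kd: "Kp (i + d) = Kp i" for i
    using SS_kap[OF assms, of "i - int s"] by (simp add: kap_def d_def algebra_simps)
  have e2: "(-1) ^ (s + t) * ((-1) ^ (s + t) * c) = (c :: 'k)" for c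
    by (simp add: mult.assoc[symmetric] power_mult_distrib[symmetric])
  have UA: "u i * ((-1) ^ (s + t) * (Kp (i + 1 + int t) / Kp (i + 1))) = u (i + 1)" for i
    using u(4)[of i] by (simp add: kap_def mult_ac)
  have UB: "u i * ((-1) ^ (s + t) * (Kp i / Kp (i + int t))) = u (i - 1)" for i
    using u(4)[of "i - 1"] by (simp add: kap_def e2)
  have tw: "U \<star> tw s t x = x \<star> U" if x: "x \<in> V" for x
  proof (rule el_eqI)
    fix i
    show "cf (U \<star> tw s t x) KE i = cf (x \<star> U) KE i"
      by (simp add: U_def tw_app d_def[symmetric] xd[OF x])
    show "cf (U \<star> tw s t x) KA i = cf (x \<star> U) KA i"
      using UA[of i, symmetric] by (simp add: U_def tw_app d_def[symmetric] xd[OF x] mult_ac)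
    show "cf (U \<star> tw s t x) KB i = cf (x \<star> U) KB i"
      using UB[of i, symmetric] by (simp add: U_def tw_app d_def[symmetric] xd[OF x] Kd mult_ac)
    show "cf (U \<star> tw s t x) KP i = cf (x \<star> U) KP i"
      using Kd[of "i + 1"] xd[OF x, of KP i] by (simp add: U_def tw_app d_def[symmetric] algebra_simps)
  qed
  define f where "f = (\<lambda>ys. U \<star> xy s t ys)"
  have "coc (s + t) f"
    unfolding coc_def f_def
  proof (intro conjI ballI allI impI)
    show "ml (s + t) (\<lambda>ys. U \<star> xy s t ys)"
      using tc_xy U by (auto simp: tc_def intro: ml_lmul)
    fix x ys assume x: "x \<in> V" and ys: "valid (s + t) ys"
    have "x \<star> (U \<star> xy s t ys) + rr (\<lambda>ys. U \<star> xy s t ys) (x # ys) = U \<star> (tw s t x \<star> xy s t ys + rr (xy s t) (x # ys))"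
      unfolding rr_lmul by (simp only: mul_distrib mul_assoc[symmetric] tw[OF x])
    then show "x \<star> (U \<star> xy s t ys) + rr (\<lambda>ys. U \<star> xy s t ys) (x # ys) = 0"
      using tc_xy[of s t] x ys by (simp only: tc_def mul_0)
  qed
  moreover have "ph (s + t) f 0 r = (if r = int s then 1 else 0)" for r
  proof -
    have "ev (s + t) (xy s t) 0 r \<in> V" by (rule ev_V') (use tc_xy in \<open>simp add: tc_def\<close>)
    then have "cf (ev (s + t) (xy s t) 0 r) KE 0 = cf (ev (s + t) (xy s t) 0 r) KE (0 + int s - int t)"
      by (rule V_D') (use st in \<open>simp add: cong_iff_dvd_diff dvd_diff_commute\<close>)
    then show ?thesis using u(1) unfolding ev_xy by (simp add: ph_def f_def ev_lmul U_def)
  qed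
  ultimately show ?thesis by blast
qed

section \<open>The exponent monoid and the order of \<zeta>\<close>

definition zeta :: 'k where "zeta = (\<Prod>i<m. q i)"

lemma Kp_m: "Kp (int m) * zeta = (-1) ^ m"
proof -
  have "(\<Prod>l\<in>{0..<int m}. - inverse (Q l)) = (\<Prod>i<m. - inverse (q i))"
    by (rule prod.reindex_bij_witness[of _ int nat]) (auto simp: Q_def)
  then have "Kp (int m) * zeta = (\<Prod>i<m. - inverse (q i) * q i)"
    by (simp only: Kp_def zeta_def prod.distrib) simp
  also have "\<dots> = (\<Prod>i<m. - 1)" by (rule prod.cong) (use q0 in auto)
  finally show ?thesis by simp
qed

lemma Kp_shift_n: "Kp (i + int n * int m) = Kp i * Kp (int m) ^ n"
proof (induction n)
  case (Suc n)
  have "i + int (Suc n) * int m = (i + int n * int m) + int m" by (simp add: algebra_simps)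
  then have "Kp (i + int (Suc n) * int m) = Kp (i + int n * int m) * Kp (int m)" by (simp only: Kp_shift)
  then show ?case using Suc by simp
qed simp

text \<open>Over \<open>2 * n\<close> turns \<open>Kp\<close> is multiplied by
  \<open>Kp (int m) ^ (2 * n)\<close>; the factor 2 removes the sign in \<open>Kp_m\<close>.\<close>

lemma kap_period:
  assumes "zeta ^ n = 1"
  shows "kap i (int (2 * n * m)) = 1"
proof -
  have "(Kp (int m) * zeta) ^ (2 * n) = ((-1) ^ m) ^ (2 * n)" by (simp only: Kp_m)
  also have "\<dots> = 1" by (metis minus_one_power_iff power_mult power_one power2_minus)
  finally have "Kp (int m) ^ (2 * n) = 1"
    using assms by (simp only: power_mult_distrib mult.commute[of 2 n] power_mult[of zeta]) simp
  then show ?thesis using Kp_shift_n[of i "2 * n"] by (simp add: kap_def)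
qed

lemma SS_00: "(0, 0) \<in> SS"
  unfolding SS_def by (auto intro!: exI[of _ "\<lambda>_. 1"])

text \<open>After a full period every factor of the recursions equals 1, so the constant function is
  a witness.\<close>

lemma SS_period:
  assumes "zeta ^ n = 1" shows "(2 * n * m, 0) \<in> SS" "(0, 2 * n * m) \<in> SS"
proof -
  have "(-1 :: 'k) ^ (2 * n * m) = 1" by (simp add: power_mult)
  then show "(2 * n * m, 0) \<in> SS" "(0, 2 * n * m) \<in> SS"
    unfolding SS_def using kap_period[OF assms] by (auto intro!: exI[of _ "\<lambda>_. 1"] simp: cong_def simp del: of_nat_mult)
qed

lemma SS_sub:
  assumes z: "zeta ^ n = 1" shows "(s + 2 * n * m, t) \<in> SS \<Longrightarrow> (s, t) \<in> SS" "(s, t + 2 * n * m) \<in> SS \<Longrightarrow> (s, t) \<in> SS"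
proof -
  have k: "kap i (int (r + 2 * n * m)) = kap i (int r)" for i r
    using kap_add[of i "int r" "int (2 * n * m)"] kap_period[OF z] by simp
  have e: "(-1 :: 'k) ^ (r + 2 * n * m) = (-1) ^ r" for r by (simp add: power_add power_mult)
  have e1: "(-1 :: 'k) ^ (s + 2 * n * m + t) = (-1) ^ (s + t)" "(-1 :: 'k) ^ (s + (t + 2 * n * m)) = (-1) ^ (s + t)"
    using e[of "s + t"] by (simp_all add: add_ac)
  have c: "[int (r + 2 * n * m) = x] (mod int m) \<longleftrightarrow> [int r = x] (mod int m)" 
     "[x = int (r + 2 * n * m)] (mod int m) \<longleftrightarrow> [x = int r] (mod int m)" for r x by (simp_all add: cong_def)
  show "(s + 2 * n * m, t) \<in> SS \<Longrightarrow> (s, t) \<in> SS" "(s, t + 2 * n * m) \<in> SS \<Longrightarrow> (s, t) \<in> SS"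
    unfolding SS_def mem_Collect_eq case_prod_conv e1 k c by assumption+
qed

text \<open>Each of the \<open>s\<close> unit steps inside \<open>kap\<close> runs once around the
  quiver as \<open>i\<close> varies and contributes the multiplier of \<open>Kp\<close>.\<close>

lemma kap_cycle: "(\<Prod>i<m. kap (int i + 1) (int s)) = Kp (int m) ^ s"
proof (induction s)
  case (Suc s)
  have "kap (int i + 1) (int (Suc s)) = kap (int i + 1) (int s) * kap (1 + int s + int i) 1" for i
    using kap_add[of "int i + 1" "int s" 1] by (simp add: add_ac)
  moreover have "kap (1 + int s) (int m) = Kp (int m)"
    using Kp_shift[of "1 + int s"] by (simp add: kap_def)
  ultimately show ?case using Suc kap_prod[of "1 + int s" m] by (simp add: prod.distrib)
qed simp

text \<open>Multiplying either recursion once around the quiver and using periodicity of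
  \<open>u\<close> gives \<open>Kp (int m) ^ r\<close> up to sign equal to 1, hence a power of
  \<zeta> equal to 1 unless \<open>r\<close> is zero. This applies to both exponents
  separately.\<close>

lemma SS_trivial:
  assumes nz: "\<not> (\<exists>n::nat. n > 0 \<and> zeta ^ n = 1)"
  shows "SS = {(0, 0)}"
proof -
  have z: "r = 0" if u: "\<And>i. u i \<noteq> 0" "\<And>i. u (i + int m) = u i" "\<And>i. u (i + 1) = (-1) ^ l * kap (i + 1) (int r) * u i"
    for r l and u :: "int \<Rightarrow> 'k"
  proof -
    have "u (int n) = (\<Prod>i<n. (-1) ^ l * kap (int i + 1) (int r)) * u 0" for n
    proof (induction n)
      case (Suc n)
      have "int (Suc n) = int n + 1" by simp
      then have "u (int (Suc n)) = (-1) ^ l * kap (int n + 1) (int r) * u (int n)" by (simp only: u(3))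
      then show ?case using Suc by simp
    qed simp
    then have "u (int m) = ((-1) ^ l) ^ m * Kp (int m) ^ r * u 0"
      by (simp add: prod.distrib kap_cycle)
    then have "((-1) ^ l) ^ m * Kp (int m) ^ r = 1" using u(1)[of 0] u(2)[of 0] by simp
    then have "zeta ^ r = ((-1) ^ l) ^ m * Kp (int m) ^ r * zeta ^ r" by simp
    also have "\<dots> = ((-1) ^ l) ^ m * ((-1) ^ m) ^ r"
      by (simp only: mult.assoc power_mult_distrib[symmetric] Kp_m)
    \<comment> \<open>Squaring eliminates the signs, whatever the parities of \<open>l\<close>,
      \<open>m\<close> and \<open>r\<close>.\<close>
    finally have "zeta ^ (2 * r) = (((-1) ^ l) ^ m * ((-1) ^ m) ^ r) ^ 2"
      by (simp only: mult.commute[of 2 r] power_mult)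
    also have "\<dots> = 1"
    proof -
      have "((-1 :: 'k) ^ a) ^ b = (-1) ^ (a * b)" for a b by (simp add: power_mult)
      then have "((-1 :: 'k) ^ l) ^ m * ((-1) ^ m) ^ r = (-1) ^ (l * m + m * r)" by (simp only: power_add)
      moreover have "((-1 :: 'k) ^ a)\<^sup>2 = 1" for a by (simp add: power2_eq_square power_mult_distrib[symmetric])
      ultimately show ?thesis by (simp only:)
    qed
    finally have z1: "zeta ^ (2 * r) = 1" .
    show "r = 0"
    proof (rule ccontr)
      assume "r \<noteq> 0"
      then have "2 * r > 0 \<and> zeta ^ (2 * r) = 1" using z1 by simp
      then show False using nz by (meson exI)
    qed
  qed
  show ?thesis
  proof (intro equalityI subsetI)
    fix p assume "p \<in> SS"
    moreover obtain s t where p: "p = (s, t)" by fastforce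
    ultimately obtain u where u0: "\<And>i. u i \<noteq> 0 \<and> u (i + int m) = u i \<and>
      u (i + 1) = (-1) ^ (s + t) * kap (i + 1) (int s) * u i \<and> u (i + 1) = (-1) ^ (s + t) * kap (i + 1) (int t) * u i"
      unfolding SS_def by blast
    have u: "u i \<noteq> 0" "u (i + int m) = u i"
      "u (i + 1) = (-1) ^ (s + t) * kap (i + 1) (int s) * u i" "u (i + 1) = (-1) ^ (s + t) * kap (i + 1) (int t) * u i" for i
      using u0[of i] by blast+
    show "p \<in> {(0, 0)}" using z[OF u(1,2,3)] z[OF u(1,2,4)] p by simp
  qed (use SS_00 in auto)
qed

end

section \<open>Cup products in the bar complex\<close>

context qv
begin

definition cup :: "nat \<Rightarrow> ('k el list \<Rightarrow> 'k el) \<Rightarrow> ('k el list \<Rightarrow> 'k el) \<Rightarrow> 'k el list \<Rightarrow> 'k el" where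
  "cup p f g l = f (take p l) \<star> g (drop p l)"

lemma ml_cup: "ml p f \<Longrightarrow> ml r g \<Longrightarrow> ml (p + r) (cup p f g)"
proof (induction p arbitrary: f)
  case 0
  then show ?case by (simp add: cup_def[abs_def] ml_lmul)
next
  case (Suc p)
  have "ml (Suc (p + r)) (cup (Suc p) f g)"
  proof (rule ml_SucI)
    fix x assume "x \<in> V"
    then have "ml (p + r) (cup p (\<lambda>l. f (x # l)) g)" by (intro Suc.IH ml_Cons[OF Suc.prems(1)] Suc.prems(2))
    then show "ml (p + r) (\<lambda>l. cup (Suc p) f g (x # l))" by (simp add: cup_def[abs_def])
  next
    fix x y c d and ys :: "'k el list" assume "x \<in> V" "y \<in> V" "length ys = p + r" "set ys \<subseteq> V"
    moreover then have "set (take p ys) \<subseteq> V" by (meson order_trans set_take_subset)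
    ultimately show "cup (Suc p) f g ((scl c x + scl d y) # ys) = scl c (cup (Suc p) f g (x # ys)) + scl d (cup (Suc p) f g (y # ys))"
      using ml_lin[OF Suc.prems(1), of x y "take p ys" c d] by (simp add: cup_def mul_distrib mul_scl)
  qed
  then show ?case by simp
qed

text \<open>This is the Leibniz rule for \<open>rr\<close>. The merge across the cut supplies the
  left multiplication that \<open>rr g\<close> lacks, so that the second factor receives its full
  differential.\<close>

lemma rr_cup: "length xs > p \<Longrightarrow> rr (cup p f g) xs =
   rr f (take (Suc p) xs) \<star> g (drop (Suc p) xs)
    + scl ((-1) ^ p) (f (take p xs) \<star> (hd (drop p xs) \<star> g (drop (Suc p) xs) + rr g (drop p xs)))"
proof (induction p arbitrary: f xs)
  case 0
  then obtain x zs where xs: "xs = x # zs" by (cases xs) auto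
  have "rr (cup 0 f g) xs = f [] \<star> rr g xs" by (simp only: cup_def[abs_def] take_0 drop_0 rr_lmul)
  then show ?case by (simp add: xs mul_distrib mul_minus mul_assoc del: rr.simps(2)) (simp add: mul_minus mul_assoc)
next
  case (Suc p)
  then obtain x y zs where xs: "xs = x # y # zs" by (cases xs; cases "tl xs") auto
  have "rr (cup (Suc p) f g) xs = - cup (Suc p) f g ((x \<star> y) # zs) - rr (cup p (\<lambda>l. f (x # l)) g) (y # zs)"
    by (simp add: xs cup_def[abs_def] del: rr.simps(2)) (simp only: rr.simps(2)[of _ x] mrg_simps take_Suc_Cons drop_Suc_Cons)
  also have "rr (cup p (\<lambda>l. f (x # l)) g) (y # zs) = rr (\<lambda>l. f (x # l)) (take (Suc p) (y # zs)) \<star> g (drop (Suc p) (y # zs))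
    + scl ((-1) ^ p) (f (x # take p (y # zs)) \<star> (hd (drop p (y # zs)) \<star> g (drop (Suc p) (y # zs)) + rr g (drop p (y # zs))))"
    by (rule Suc.IH) (use Suc.prems xs in simp)
  finally show ?case
    by (simp add: xs cup_def mul_distrib mul_minus scl_minus scl_add)
qed

lemma valid_take_drop: "valid (p + r) ys \<Longrightarrow> valid p (take p ys) \<and> valid r (drop p ys)"
  by (auto simp: valid_def dest: in_set_takeD in_set_dropD)

definition dd :: "('k el list \<Rightarrow> 'k el) \<Rightarrow> 'k el list \<Rightarrow> 'k el" where
  "dd f xs = hd xs \<star> f (tl xs) + rr f xs"

lemma coc_dd: "coc n f \<longleftrightarrow> ml n f \<and> (\<forall>xs. valid (Suc n) xs \<longrightarrow> dd f xs = 0)"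
proof -
  have "(\<forall>xs. valid (Suc n) xs \<longrightarrow> dd f xs = 0) \<longleftrightarrow> (\<forall>x\<in>V. \<forall>ys. valid n ys \<longrightarrow> x \<star> f ys + rr f (x # ys) = 0)"
  proof (intro iffI ballI allI impI)
    fix xs assume *: "\<forall>x\<in>V. \<forall>ys. valid n ys \<longrightarrow> x \<star> f ys + rr f (x # ys) = 0" and "valid (Suc n) xs"
    then show "dd f xs = 0" by (cases xs) (auto simp: dd_def simp del: rr.simps)
  next
    fix x ys assume *: "\<forall>xs. valid (Suc n) xs \<longrightarrow> dd f xs = 0" and "x \<in> V" "valid n ys"
    then show "x \<star> f ys + rr f (x # ys) = 0" using *[rule_format, of "x # ys"] by (simp add: dd_def del: rr.simps)
  qed
  then show ?thesis by (simp add: coc_def)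
qed

lemma cob_dd: "cob n f \<longleftrightarrow> (\<exists>h. ml n h \<and> (\<forall>xs. valid (Suc n) xs \<longrightarrow> f xs = dd h xs))"
proof -
  have "(\<forall>xs. valid (Suc n) xs \<longrightarrow> f xs = dd h xs) \<longleftrightarrow> (\<forall>x\<in>V. \<forall>ys. valid n ys \<longrightarrow> f (x # ys) = x \<star> h ys + rr h (x # ys))" for h
  proof (intro iffI ballI allI impI)
    fix xs assume *: "\<forall>x\<in>V. \<forall>ys. valid n ys \<longrightarrow> f (x # ys) = x \<star> h ys + rr h (x # ys)" and "valid (Suc n) xs"
    then show "f xs = dd h xs" by (cases xs) (auto simp: dd_def simp del: rr.simps)
  next
    fix x ys assume *: "\<forall>xs. valid (Suc n) xs \<longrightarrow> f xs = dd h xs" and "x \<in> V" "valid n ys"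
    then show "f (x # ys) = x \<star> h ys + rr h (x # ys)" using *[rule_format, of "x # ys"] by (simp add: dd_def del: rr.simps)
  qed
  then show ?thesis by (simp add: cob_def)
qed

lemma dd_cup:
  assumes "length xs = Suc (p + r)"
  shows "dd (cup p f g) xs = dd f (take (Suc p) xs) \<star> g (drop (Suc p) xs)
    + scl ((-1) ^ p) (f (take p xs) \<star> dd g (drop p xs))"
proof -
  obtain x ys where xs: "xs = x # ys" using assms by (cases xs) auto
  have "tl (drop p xs) = drop (Suc p) xs" by (simp add: drop_Suc tl_drop)
  then show ?thesis
    using rr_cup[of p xs f g] assms by (simp add: dd_def mul_distrib mul_assoc cup_def xs del: rr.simps)
qed

lemma coc_cup:
  assumes f: "coc p f" and g: "coc r g" shows "coc (p + r) (cup p f g)"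
  unfolding coc_dd
proof (intro conjI allI impI)
  show "ml (p + r) (cup p f g)" using f g by (intro ml_cup) (auto simp: coc_def)
  fix xs assume xs: "valid (Suc (p + r)) xs"
  then have "valid (Suc p) (take (Suc p) xs)" "valid (Suc r) (drop p xs)"
    using valid_take_drop[of "Suc p" r xs] valid_take_drop[of p "Suc r" xs] by auto
  then show "dd (cup p f g) xs = 0"
    using f g xs dd_cup[of xs p r f g] by (simp add: coc_dd valid_def)
qed

lemma cob_cup1:
  assumes f: "cob p f" and g: "coc r g" shows "cob (p + r) (cup (Suc p) f g)"
proof -
  obtain h where h: "ml p h" "\<And>xs. valid (Suc p) xs \<Longrightarrow> f xs = dd h xs" using f by (auto simp: cob_dd)
  have "cup (Suc p) f g xs = dd (cup p h g) xs" if xs: "valid (Suc (p + r)) xs" for xs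
  proof -
    have "valid (Suc p) (take (Suc p) xs)" "valid (Suc r) (drop p xs)"
      using xs valid_take_drop[of "Suc p" r xs] valid_take_drop[of p "Suc r" xs] by auto
    then show ?thesis using h g xs dd_cup[of xs p r h g] by (simp add: coc_dd valid_def cup_def)
  qed
  moreover have "ml (p + r) (cup p h g)" using h g by (intro ml_cup) (auto simp: coc_def)
  ultimately show ?thesis unfolding cob_dd by blast
qed

lemma dd_scl: "dd (\<lambda>l. scl c (f l)) xs = scl c (dd f xs)"
  by (simp add: dd_def rr_scl mul_scl scl_add)

lemma dd_add: "dd (\<lambda>l. f l + g l) xs = dd f xs + dd g xs"
  by (simp add: dd_def rr_add mul_distrib)

text \<open>The Leibniz rule moves the differential past \<open>f\<close> with the sign
  \<open>(-1) ^ p\<close>, which is built into the primitive.\<close>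

lemma cob_cup2:
  assumes f: "coc p f" and g: "cob r g" shows "cob (p + r) (cup p f g)"
proof -
  obtain h where h: "ml r h" "\<And>xs. valid (Suc r) xs \<Longrightarrow> g xs = dd h xs" using g by (auto simp: cob_dd)
  have e: "(-1 :: 'k) ^ p * (-1) ^ p = 1" by (simp add: power_mult_distrib[symmetric])
  have "cup p f g xs = dd (\<lambda>l. scl ((-1) ^ p) (cup p f h l)) xs" if xs: "valid (Suc (p + r)) xs" for xs
  proof -
    have "valid (Suc p) (take (Suc p) xs)" "valid (Suc r) (drop p xs)"
      using xs valid_take_drop[of "Suc p" r xs] valid_take_drop[of p "Suc r" xs] by auto
    then have "g (drop p xs) = dd h (drop p xs)" "dd f (take (Suc p) xs) = 0" using h(2) f by (auto simp: coc_dd)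
    then show ?thesis unfolding dd_scl using xs dd_cup[of xs p r f h] e by (simp add: valid_def cup_def[of p f g])
  qed
  moreover have "ml (p + r) (\<lambda>l. scl ((-1) ^ p) (cup p f h l))" using h f by (intro ml_scl ml_cup) (auto simp: coc_def)
  ultimately show ?thesis unfolding cob_dd by blast
qed

lemma coc_0 [simp]: "coc n (\<lambda>_. 0)" 
  by (simp add: coc_def)

lemma coc_add: "coc n f \<Longrightarrow> coc n g \<Longrightarrow> coc n (\<lambda>l. f l + g l)"
  by (simp add: coc_dd ml_add dd_add)

lemma coc_scl: "coc n f \<Longrightarrow> coc n (\<lambda>l. scl c (f l))"
  by (simp add: coc_dd ml_scl dd_scl)

lemma coc_sum: "(\<And>a. a \<in> A \<Longrightarrow> coc n (f a)) \<Longrightarrow> coc n (\<lambda>l. \<Sum>a\<in>A. f a l)"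
  by (induction A rule: infinite_finite_induct) (auto intro: coc_add)

lemma cob_0 [simp]: "cob n (\<lambda>_. 0)"
proof -
  have "\<forall>xs. valid (Suc n) xs \<longrightarrow> 0 = dd (\<lambda>_. 0) xs" by (simp add: dd_def)
  then show ?thesis unfolding cob_dd by (intro exI[of _ "\<lambda>_. 0"]) simp
qed

lemma cob_add: "cob n f \<Longrightarrow> cob n g \<Longrightarrow> cob n (\<lambda>l. f l + g l)"
  unfolding cob_dd by (metis (lifting) dd_add ml_add)

lemma cob_scl: "cob n f \<Longrightarrow> cob n (\<lambda>l. scl c (f l))"
  unfolding cob_dd by (metis (lifting) dd_scl ml_scl)

section \<open>Comparison with the Hochschild complex of the coordinate ring\<close>

definition CLr :: "'k el ring" where
  "CLr = \<lparr>carrier = V, monoid.mult = (\<star>), one = one1, ring.zero = 0, ring.add = (+)\<rparr>"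

lemma CLr_simps [simp]: "carrier CLr = V" "monoid.mult CLr = (\<star>)" "one CLr = one1" "ring.zero CLr = 0" "ring.add CLr = (+)"
  by (simp_all add: CLr_def)

lemma CLr_ring: "ring CLr"
proof (rule ringI)
  show "abelian_group CLr"
    by (rule abelian_groupI) (auto simp: add_ac intro: exI[of _ "- x" for x] bexI[of _ "- x" for x])
  show "Group.monoid CLr" by (rule monoidI) (auto simp: mul_assoc)
qed (auto simp: mul_distrib)

lemma CLr_uminus: "x \<in> V \<Longrightarrow> a_inv CLr x = - x"
  using ring.ring_simprules(9,16)[OF CLr_ring] abelian_group.minus_equality[OF ring.is_abelian_group[OF CLr_ring], of "- x" x] by simp

lemma CLr_finsum: "finite A \<Longrightarrow> (\<And>a. a \<in> A \<Longrightarrow> f a \<in> V) \<Longrightarrow> finsum CLr f A = (\<Sum>a\<in>A. f a)"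
proof (induction A rule: finite_induct)
  case empty
  interpret ring CLr by (rule CLr_ring)
  show ?case by simp
next
  case (insert a A)
  interpret ring CLr by (rule CLr_ring)
  have "f \<in> A \<rightarrow> carrier CLr" "f a \<in> carrier CLr" using insert by auto
  then show ?case using insert finsum_insert[OF insert(1,2)] by simp
qed

lemma CLr_hsign: "x \<in> V \<Longrightarrow> hsign CLr n x = scl ((-1) ^ n) x"
  by (simp add: hsign_def CLr_uminus scl_minus)

text \<open>The first merge is split off the alternating sum; shifting the index in the rest costs
  one sign, as in the recursion of \<open>rr\<close>.\<close>

lemma hdiff_rr: "length xs = Suc n \<Longrightarrow>
   (\<Sum>i = 1..n. scl ((-1) ^ i) (f (take (i - 1) xs @ [xs ! (i - 1) \<star> xs ! i] @ drop (i + 1) xs)))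
     + scl ((-1) ^ Suc n) (f (take n xs) \<star> xs ! n) = rr f xs"
proof (induction n arbitrary: f xs)
  case 0
  then obtain x where "xs = [x]" by (auto simp: length_Suc_conv)
  then show ?case by (simp add: scl_minus)
next
  case (Suc n)
  then obtain x y zs where xs: "xs = x # y # zs" by (auto simp: length_Suc_conv)
  let ?g = "\<lambda>i. scl ((-1) ^ i) (f (take (i - 1) xs @ [xs ! (i - 1) \<star> xs ! i] @ drop (i + 1) xs))"
  let ?h = "\<lambda>i. scl ((-1) ^ i) (f (x # take (i - 1) (y # zs) @ [(y # zs) ! (i - 1) \<star> (y # zs) ! i] @ drop (i + 1) (y # zs)))"
  have "(\<Sum>i = 1..Suc n. ?g i) = ?g 1 + (\<Sum>i = 1..n. ?g (Suc i))"
    by (rule trans[OF sum.atLeast_Suc_atMost arg_cong2[where f = "(+)", OF refl sum.shift_bounds_cl_Suc_ivl]]) simp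
  also have "(\<Sum>i = 1..n. ?g (Suc i)) = (\<Sum>i = 1..n. - ?h i)"
  proof (rule sum.cong)
    fix i assume "i \<in> {1..n}"
    then obtain j where "i = Suc j" by (cases i) auto
    then show "?g (Suc i) = - ?h i" by (simp add: xs scl_minus)
  qed simp
  also have "\<dots> = - (\<Sum>i = 1..n. ?h i)" by (simp add: sum_negf)
  finally have s: "(\<Sum>i = 1..Suc n. ?g i) = ?g 1 - (\<Sum>i = 1..n. ?h i)" by simp
  have "(\<Sum>i = 1..n. ?h i) + scl ((-1) ^ Suc n) (f (x # take n (y # zs)) \<star> (y # zs) ! n) = rr (\<lambda>l. f (x # l)) (y # zs)"
    using Suc.IH[of "y # zs" "\<lambda>l. f (x # l)"] Suc.prems xs by simp
  then have h: "(\<Sum>i = 1..n. ?h i) = rr (\<lambda>l. f (x # l)) (y # zs) - scl ((-1) ^ Suc n) (f (x # take n (y # zs)) \<star> (y # zs) ! n)"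
    by (simp add: eq_diff_eq del: rr.simps)
  have "?g 1 = - f ((x \<star> y) # zs)" by (simp add: xs scl_minus)
  moreover have "rr f xs = - f ((x \<star> y) # zs) - rr (\<lambda>l. f (x # l)) (y # zs)" by (simp add: xs)
  ultimately show ?case unfolding s h by (simp add: xs scl_minus del: rr.simps)
qed

text \<open>Linearity in an inner slot follows from \<open>ml\<close> by fixing the arguments to its
  left; conversely, fixing the first argument shifts all slots by one.\<close>

lemma hcochains_CLr: "f \<in> hcochains CLr scl n \<longleftrightarrow> ml n f \<and> (\<forall>xs. \<not> valid n xs \<longrightarrow> f xs = 0)"
proof -
  have "ml n f" if "\<forall>xs. length xs = n \<and> set xs \<subseteq> V \<longrightarrow> f xs \<in> V"
    "\<forall>us vs x y c d. length us + length vs + 1 = n \<and> set us \<subseteq> V \<and> set vs \<subseteq> V \<and> x \<in> V \<and> y \<in> V \<longrightarrow>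
        f (us @ [scl c x + scl d y] @ vs) = scl c (f (us @ [x] @ vs)) + scl d (f (us @ [y] @ vs))"
    using that
  proof (induction n arbitrary: f)
    case (Suc n)
    show ?case
    proof (rule ml_SucI)
      fix x assume x: "x \<in> V"
      show "ml n (\<lambda>l. f (x # l))"
      proof (rule Suc.IH)
        show "\<forall>xs. length xs = n \<and> set xs \<subseteq> V \<longrightarrow> f (x # xs) \<in> V" using Suc.prems(1) x by simp
        show "\<forall>us vs xa y c d. length us + length vs + 1 = n \<and> set us \<subseteq> V \<and> set vs \<subseteq> V \<and> xa \<in> V \<and> y \<in> V \<longrightarrow>
           f (x # us @ [scl c xa + scl d y] @ vs) = scl c (f (x # us @ [xa] @ vs)) + scl d (f (x # us @ [y] @ vs))"
        proof (intro allI impI)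
          fix us vs xa y c d assume "length us + length vs + 1 = n \<and> set us \<subseteq> V \<and> set vs \<subseteq> V \<and> xa \<in> V \<and> y \<in> V"
          then show "f (x # us @ [scl c xa + scl d y] @ vs) = scl c (f (x # us @ [xa] @ vs)) + scl d (f (x # us @ [y] @ vs))"
            using Suc.prems(2)[rule_format, of "x # us" vs xa y c d] x by simp
        qed
      qed
    next
      fix x y c d and ys :: "'k el list" assume "x \<in> V" "y \<in> V" "length ys = n" "set ys \<subseteq> V"
      then show "f ((scl c x + scl d y) # ys) = scl c (f (x # ys)) + scl d (f (y # ys))"
        using Suc.prems(2)[rule_format, of "[]" ys x y c d] by simp
    qed
  qed simp
  moreover have "f (us @ [scl c x + scl d y] @ vs) = scl c (f (us @ [x] @ vs)) + scl d (f (us @ [y] @ vs))"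
    if "ml n f" "length us + length vs + 1 = n \<and> set us \<subseteq> V \<and> set vs \<subseteq> V \<and> x \<in> V \<and> y \<in> V" for us vs x y c d
  proof -
    have "ml (Suc (length vs)) (\<lambda>l. f (us @ l))" by (rule ml_append) (use that in auto)
    from ml_lin[OF this, of x y vs c d] that show ?thesis by simp
  qed
  moreover have "f xs \<in> V" if "ml n f" "length xs = n \<and> set xs \<subseteq> V" for xs
    using ml_V that by blast
  ultimately show ?thesis unfolding hcochains_def valid_def mem_Collect_eq CLr_simps by blast
qed

lemma hdiff_CLr:
  assumes f: "ml n f" and xs: "valid (Suc n) xs"
  shows "hdiff CLr n f xs = dd f xs"
proof -
  have l: "length xs = Suc n" "set xs \<subseteq> V" using xs by (auto simp: valid_def)
  have v: "xs ! i \<in> V" if "i \<le> n" for i using l that by auto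
  have st: "set (take i xs) \<subseteq> V" "set (drop i xs) \<subseteq> V" for i
    using l by (auto dest: in_set_takeD in_set_dropD)
  have c: "f (take (i - 1) xs @ [xs ! (i - 1) \<star> xs ! i] @ drop (i + 1) xs) \<in> V" if "i \<in> {1..n}" for i
    by (rule ml_V[OF f]) (use that l v st in auto)
  have cn: "f (take n xs) \<star> xs ! n \<in> V" by (intro V_mul ml_V[OF f] v) (use l st in auto)
  have "finsum CLr (\<lambda>i. hsign CLr i (f (take (i - 1) xs @ [xs ! (i - 1) \<star> xs ! i] @ drop (i + 1) xs))) {1..n}
     = (\<Sum>i = 1..n. hsign CLr i (f (take (i - 1) xs @ [xs ! (i - 1) \<star> xs ! i] @ drop (i + 1) xs)))"
    by (rule CLr_finsum) (use c CLr_hsign in auto)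
  also have "\<dots> = (\<Sum>i = 1..n. scl ((-1) ^ i) (f (take (i - 1) xs @ [xs ! (i - 1) \<star> xs ! i] @ drop (i + 1) xs)))"
    by (rule sum.cong) (use CLr_hsign c in auto)
  finally have s: "finsum CLr (\<lambda>i. hsign CLr i (f (take (i - 1) xs @ [xs ! (i - 1) \<star> xs ! i] @ drop (i + 1) xs))) {1..n} = \<dots>" .
  have "hdiff CLr n f xs = xs ! 0 \<star> f (tl xs) + finsum CLr (\<lambda>i. hsign CLr i (f (take (i - 1) xs @ [xs ! (i - 1) \<star> xs ! i] @ drop (i + 1) xs))) {1..n}
    + scl ((-1) ^ Suc n) (f (take n xs) \<star> xs ! n)"
    using l CLr_hsign[OF cn, of "Suc n"] by (simp add: hdiff_def)
  also have "\<dots> = dd f xs"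
    unfolding s dd_def hdiff_rr[OF l(1), symmetric] using l by (cases xs) (simp_all add: add.assoc)
  finally show ?thesis .
qed

lemma hdiff_invalid: "\<not> valid (Suc n) xs \<Longrightarrow> hdiff CLr n f xs = 0"
  by (auto simp: hdiff_def valid_def)

lemma hcocycles_CLr: "f \<in> hcocycles CLr scl n \<longleftrightarrow> coc n f \<and> (\<forall>xs. \<not> valid n xs \<longrightarrow> f xs = 0)"
proof -
  have "hdiff CLr n f = zcoch CLr \<longleftrightarrow> (\<forall>xs. valid (Suc n) xs \<longrightarrow> dd f xs = 0)" if "ml n f"
    using hdiff_CLr[OF that] hdiff_invalid[of n _ f] by (auto simp: fun_eq_iff zcoch_def) metis
  then show ?thesis unfolding hcocycles_def mem_Collect_eq hcochains_CLr coc_dd by blast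
qed

text \<open>\<open>hcochains\<close> requires the value zero on improper argument lists while
  \<open>ml\<close> ignores them; truncation mediates between the two.\<close>

definition tr :: "nat \<Rightarrow> ('k el list \<Rightarrow> 'k el) \<Rightarrow> 'k el list \<Rightarrow> 'k el" where
  "tr n f xs = (if valid n xs then f xs else 0)"

lemma ml_tr: "ml n f \<Longrightarrow> ml n (tr n f)"
  by (rule ml_cong[of n f]) (auto simp: tr_def valid_def)

lemma dd_cong: "(\<And>ys. valid n ys \<Longrightarrow> f ys = g ys) \<Longrightarrow> valid (Suc n) xs \<Longrightarrow> dd f xs = dd g xs"
  using rr_cong[of n f g xs] by (cases xs) (auto simp: dd_def valid_def simp del: rr.simps)

lemma coc_cong: "(\<And>ys. valid n ys \<Longrightarrow> f ys = g ys) \<Longrightarrow> coc n f \<Longrightarrow> coc n g"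
  unfolding coc_dd using dd_cong[of n f g] ml_cong[of n f g] by (auto simp: valid_def)

lemma hcobound_CLr_Suc: "f \<in> hcobound CLr scl (Suc n) \<longleftrightarrow> cob n f \<and> (\<forall>xs. \<not> valid (Suc n) xs \<longrightarrow> f xs = 0)"
proof
  assume "f \<in> hcobound CLr scl (Suc n)"
  then obtain h where "f = hdiff CLr n h" "h \<in> hcochains CLr scl n" by (auto simp: hcobound_def)
  then show "cob n f \<and> (\<forall>xs. \<not> valid (Suc n) xs \<longrightarrow> f xs = 0)"
    using hdiff_CLr hdiff_invalid unfolding cob_dd hcochains_CLr by auto
next
  assume f: "cob n f \<and> (\<forall>xs. \<not> valid (Suc n) xs \<longrightarrow> f xs = 0)"
  then obtain h where h: "ml n h" "\<And>xs. valid (Suc n) xs \<Longrightarrow> f xs = dd h xs" by (auto simp: cob_dd)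
  have "f xs = hdiff CLr n (tr n h) xs" for xs
  proof (cases "valid (Suc n) xs")
    case True
    have "dd h xs = dd (tr n h) xs" by (rule dd_cong[OF _ True]) (simp add: tr_def)
    then show ?thesis using hdiff_CLr[OF ml_tr[OF h(1)] True] h(2)[OF True] by simp
  qed (use f hdiff_invalid in simp)
  then have "f = hdiff CLr n (tr n h)" by auto
  moreover have "tr n h \<in> hcochains CLr scl n" unfolding hcochains_CLr using ml_tr[OF h(1)] by (simp add: tr_def)
  ultimately show "f \<in> hcobound CLr scl (Suc n)" by (auto simp: hcobound_def)
qed

end

section \<open>The cocycle ring and its coboundary ideal\<close>

context qv
begin

lemma ev_sum: "ev n (\<lambda>w. \<Sum>a\<in>A. F a w) i s = (\<Sum>a\<in>A. ev n (F a) i s)"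
  by (induction A rule: infinite_finite_induct) (simp_all add: ev_add)

lemma ev_tr: "ev n (tr n f) i s = ev n f i s"
  by (rule ev_cong) (simp add: tr_def valid_def)

lemma ev_i_cong: "[i = j] (mod int m) \<Longrightarrow> ev n f i s = ev n f j s"
proof (rule el_eqI')
  fix k l assume "[i = j] (mod int m)"
  moreover have "El (\<lambda>_ i. cf (ev n f i s) k l) \<in> V" by (simp add: V_def ev_shift)
  ultimately show "cf (ev n f i s) k l = cf (ev n f j s) k l"
    using V_D'[of "El (\<lambda>_ i. cf (ev n f i s) k l)" i j] by simp
qed

text \<open>On a Koszul element every surviving term of a coboundary has an arrow as outer factor
  and so lies in the radical.\<close>

lemma ev_dd_KE: assumes "ml n h" shows "cf (ev (Suc n) (dd h) i s) KE k = 0"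
proof -
  have 1: "ev (Suc n) (\<lambda>w. hd w \<star> h (tl w)) i s = aa i \<star> ev n h (i + 1) (s - 1) + scl (kap i s) (bb i \<star> ev n h (i - 1) s)"
    by (simp add: ev_lmul)
  define j where "j = i + 2 * s - int (Suc n)"
  have "ev (Suc n) (\<lambda>w. rr h (w @ [])) i s = scl ((-1) ^ Suc n) (ev (Suc n) (\<lambda>w. rr (\<lambda>l. h (w @ l)) []) i s
      + (scl (Kp (i + s) / Kp j) (ev n (\<lambda>w. mrg (aa (j - 1)) (\<lambda>l. h (w @ l)) []) i (s - 1))
         + ev n (\<lambda>w. mrg (bb (j + 1)) (\<lambda>l. h (w @ l)) []) i s))"
    by (rule ev_rr[where k = 0]) (use assms in \<open>simp_all add: j_def\<close>)
  then have 2: "ev (Suc n) (rr h) i s = scl ((-1) ^ Suc n) (scl (Kp (i + s) / Kp j) (ev n h i (s - 1) \<star> aa (j - 1)) + ev n h i s \<star> bb (j + 1))"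
    by (simp only: rr.simps(1) ev_0 append_Nil2 mrg_simps ev_rmul add_0_left)
  show ?thesis unfolding dd_def[abs_def] ev_add 1 2 by simp
qed

text \<open>The mirror image of \<open>KE_off\<close>: a leading argument \<open>ee k\<close> is
  incompatible with the first letter unless \<open>k\<close> is the start vertex, and what is left
  is a coboundary up to terms in the radical.\<close>

lemma KE_off_left:
  assumes f: "coc (Suc p) f" and k: "\<not> [k = i] (mod int m)"
  shows "cf (ev (Suc p) f i s) KE k = 0"
proof -
  define h where "h = (\<lambda>l. f (ee k # l))"
  have mlf: "ml (Suc p) f" using f by (simp add: coc_def)
  have h: "ml p h" unfolding h_def by (rule ml_Cons[OF mlf bs_V])
  have "dl k l * dl i l = 0" for l
    using k by (auto simp: dl_def) (meson cong_sym cong_trans)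
  then have z: "ee k \<star> aa i = 0" "ee k \<star> bb i = 0" by (auto intro!: el_eqI)
  have f0: "ev p (\<lambda>w. f (0 # w)) j t = 0" for j t
    using ev_cong[of p "\<lambda>w. f (0 # w)" "\<lambda>_. 0" j t] ml_lin_0[OF mlf] by simp
  have "ev (Suc p) (\<lambda>w. ee k \<star> f w - mrg (ee k) f w - rr h w) i s = ev (Suc p) (\<lambda>_. 0) i s"
  proof (rule ev_cong)
    fix w :: "'k el list" assume "length w = Suc p" "set w \<subseteq> V"
    then have "dd f (ee k # w) = 0" using f by (simp add: coc_dd valid_def)
    then show "ee k \<star> f w - mrg (ee k) f w - rr h w = 0" by (simp add: dd_def h_def algebra_simps)
  qed
  then have "ee k \<star> ev (Suc p) f i s - ev (Suc p) (mrg (ee k) f) i s - ev (Suc p) (rr h) i s = 0"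
    by (simp only: ev_diff ev_lmul ev_0)
  moreover have "ev (Suc p) (mrg (ee k) f) i s = 0" by (simp add: z f0)
  ultimately have e: "ee k \<star> ev (Suc p) f i s = ev (Suc p) (rr h) i s" by (simp del: ev.simps)
  have "cf (ev (Suc p) (rr h) i s) KE k = cf (ev (Suc p) (dd h) i s) KE k"
    unfolding dd_def[abs_def] ev_add by (simp add: ev_lmul)
  also have "\<dots> = 0" by (rule ev_dd_KE[OF h])
  finally show ?thesis using arg_cong[OF e, of "\<lambda>x. cf x KE k"] by (simp del: ev.simps)
qed

lemma ph_all_0:
  assumes f: "coc n f" and s: "[2 * s = int n] (mod int m)" and z: "ph n f 0 s = 0"
  shows "ph n f i s = 0"
proof (induction i rule: int_induct[where k = 0])
  case (step2 i)
  then show ?case using ph_rec(2)[OF f s, of "i - 1"] by simp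
qed (use z ph_rec(2)[OF f s] in auto)

text \<open>\<open>rad\<close> describes the radical and \<open>soc\<close> the span of the elements
  \<open>pp i\<close>; the latter contains products of two radical elements and is annihilated by a
  third.\<close>

definition rad :: "'k el \<Rightarrow> bool" where "rad x \<longleftrightarrow> (\<forall>k. cf x KE k = 0)"
definition soc :: "'k el \<Rightarrow> bool" where "soc x \<longleftrightarrow> (\<forall>k. cf x KE k = 0 \<and> cf x KA k = 0 \<and> cf x KB k = 0)"

text \<open>The values at the vertex 0 control those at all vertices for closed walks, and other
  walks have no \<open>KE\<close> coordinate in positive degree.\<close>

lemma rad_ev:
  assumes f: "coc n f" and z: "\<And>s. ph n f 0 s = 0"
  shows "rad (ev n f i s)"
  unfolding rad_def
proof
  fix k
  have ev: "ev n f i s \<in> V" by (rule ev_V') (use f in \<open>simp add: coc_def\<close>)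
  show "cf (ev n f i s) KE k = 0"
  proof (cases n)
    case 0
    then show ?thesis using ph_all_0[OF f, of 0 k] z[of 0] by (auto simp: ph_def)
  next
    case (Suc p)
    \<comment> \<open>A \<open>KE\<close> coordinate at \<open>k\<close> requires \<open>k\<close>
      to be both start and end vertex; in that case the Koszul element is a closed walk.\<close>
    show ?thesis
    proof (cases "[k = i] (mod int m) \<and> [k = i + 2 * s - int n] (mod int m)")
      case True
      then have "[i = i + 2 * s - int n] (mod int m)" by (meson cong_sym cong_trans)
      then have "[2 * s = int n] (mod int m)" by (simp add: cong_iff_dvd_diff dvd_diff_commute)
      then have "ph n f i s = 0" by (rule ph_all_0[OF f _ z])
      then show ?thesis using V_D'[OF ev, of k i KE] True by (simp add: ph_def)
    next
      case False
      then show ?thesis using KE_off[of p f k i s] KE_off_left[of p f k i s] f Suc by auto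
    qed
  qed
qed

lemma soc_sum: "(\<And>a. a \<in> A \<Longrightarrow> soc (f a)) \<Longrightarrow> soc (\<Sum>a\<in>A. f a)"
  unfolding soc_def by (simp add: cf_sum)

section \<open>The ring of finite sums of cocycles in coordinates\<close>

definition CC :: "(nat \<Rightarrow> 'k el list \<Rightarrow> 'k el) ring" where "CC = cocycle_ring CLr scl"
definition BB :: "(nat \<Rightarrow> 'k el list \<Rightarrow> 'k el) set" where "BB = coboundary_ideal CLr scl"

definition supp0 :: "nat \<Rightarrow> ('k el list \<Rightarrow> 'k el) \<Rightarrow> bool" where "supp0 n f \<longleftrightarrow> (\<forall>xs. \<not> valid n xs \<longrightarrow> f xs = 0)"

lemma CC_carrier: "F \<in> carrier CC \<longleftrightarrow> (\<forall>n. coc n (F n) \<and> supp0 n (F n)) \<and> finite {n. F n \<noteq> (\<lambda>_. 0)}"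
  by (simp add: CC_def cocycle_ring_def hcocycles_CLr zcoch_def supp0_def)

lemma CC_D: assumes "F \<in> carrier CC" shows "coc n (F n)" "supp0 n (F n)" "finite {n. F n \<noteq> (\<lambda>_. 0)}" "ml n (F n)"
  using assms by (auto simp: CC_carrier coc_def)

lemma CC_add: "F \<oplus>\<^bsub>CC\<^esub> G = (\<lambda>n xs. F n xs + G n xs)"
  by (simp add: CC_def cocycle_ring_def)

lemma CC_zero: "\<zero>\<^bsub>CC\<^esub> = (\<lambda>n xs. 0)"
  by (simp add: CC_def cocycle_ring_def zcoch_def)

lemma CC_one: "\<one>\<^bsub>CC\<^esub> = (\<lambda>n xs. if n = 0 \<and> xs = [] then one1 else 0)"
  by (intro ext) (simp add: CC_def cocycle_ring_def)

lemma take_drop_V: "set xs \<subseteq> V \<Longrightarrow> set (take p xs) \<subseteq> V \<and> set (drop p xs) \<subseteq> V"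
  by (auto dest: in_set_takeD in_set_dropD)

lemma CC_mult:
  assumes F: "F \<in> carrier CC" and G: "G \<in> carrier CC"
  shows "F \<otimes>\<^bsub>CC\<^esub> G = (\<lambda>n. tr n (\<lambda>xs. \<Sum>p\<le>n. cup p (F p) (G (n - p)) xs))"
proof (intro ext)
  fix n xs
  have "finsum CLr (\<lambda>p. F p (take p xs) \<star> G (n - p) (drop p xs)) {0..n} = (\<Sum>p\<in>{0..n}. F p (take p xs) \<star> G (n - p) (drop p xs))"
    if "length xs = n" "set xs \<subseteq> V"
  proof (rule CLr_finsum)
    fix p assume "p \<in> {0..n}"
    then show "F p (take p xs) \<star> G (n - p) (drop p xs) \<in> V"
      by (intro V_mul ml_V[OF CC_D(4)[OF F]] ml_V[OF CC_D(4)[OF G]]) (use that take_drop_V in auto)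
  qed simp
  then show "(F \<otimes>\<^bsub>CC\<^esub> G) n xs = tr n (\<lambda>xs. \<Sum>p\<le>n. cup p (F p) (G (n - p)) xs) xs"
    by (simp add: CC_def cocycle_ring_def tr_def valid_def cup_def atLeast0AtMost)
qed

lemma coc_tr: "coc n f \<Longrightarrow> coc n (tr n f)"
  by (rule coc_cong[of n f]) (simp_all add: tr_def)

lemma CC_mult_closed: assumes F: "F \<in> carrier CC" and G: "G \<in> carrier CC" shows "F \<otimes>\<^bsub>CC\<^esub> G \<in> carrier CC"
  unfolding CC_mult[OF assms] CC_carrier
proof (intro conjI allI)
  fix n
  show "coc n (tr n (\<lambda>xs. \<Sum>p\<le>n. cup p (F p) (G (n - p)) xs))"
  proof (intro coc_tr coc_sum)
    fix p assume "p \<in> {..n}"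
    then show "coc n (cup p (F p) (G (n - p)))" using coc_cup[OF CC_D(1)[OF F, of p] CC_D(1)[OF G, of "n - p"]] by simp
  qed
  show "supp0 n (tr n (\<lambda>xs. \<Sum>p\<le>n. cup p (F p) (G (n - p)) xs))" by (simp add: supp0_def tr_def)
next
  obtain a where a: "\<And>n. n > a \<Longrightarrow> F n = (\<lambda>_. 0)" using CC_D(3)[OF F] by (metis (mono_tags, lifting) finite_nat_set_iff_bounded_le leD mem_Collect_eq)
  obtain b where b: "\<And>n. n > b \<Longrightarrow> G n = (\<lambda>_. 0)" using CC_D(3)[OF G] by (metis (mono_tags, lifting) finite_nat_set_iff_bounded_le leD mem_Collect_eq)
  have "tr n (\<lambda>xs. \<Sum>p\<le>n. cup p (F p) (G (n - p)) xs) = (\<lambda>_. 0)" if n: "n > a + b" for n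
  proof -
    have "cup p (F p) (G (n - p)) xs = 0" for p xs
    proof (cases "p > a")
      case False
      then have "n - p > b" using n by simp
      then show ?thesis using b by (simp add: cup_def)
    qed (use a in \<open>simp add: cup_def\<close>)
    then show ?thesis by (simp add: tr_def fun_eq_iff)
  qed
  then have "{n. tr n (\<lambda>xs. \<Sum>p\<le>n. cup p (F p) (G (n - p)) xs) \<noteq> (\<lambda>_. 0)} \<subseteq> {..a + b}"
    by (auto simp: not_less[symmetric])
  then show "finite {n. tr n (\<lambda>xs. \<Sum>p\<le>n. cup p (F p) (G (n - p)) xs) \<noteq> (\<lambda>_. 0)}"
    by (rule finite_subset) simp
qed

lemma CC_assoc:
  assumes F: "F \<in> carrier CC" and G: "G \<in> carrier CC" and H: "H \<in> carrier CC"
  shows "(F \<otimes>\<^bsub>CC\<^esub> G) \<otimes>\<^bsub>CC\<^esub> H = F \<otimes>\<^bsub>CC\<^esub> (G \<otimes>\<^bsub>CC\<^esub> H)"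
proof (intro ext)
  fix n xs
  show "((F \<otimes>\<^bsub>CC\<^esub> G) \<otimes>\<^bsub>CC\<^esub> H) n xs = (F \<otimes>\<^bsub>CC\<^esub> (G \<otimes>\<^bsub>CC\<^esub> H)) n xs"
  proof (cases "valid n xs")
    case True
    \<comment> \<open>\<open>F\<close> takes the first \<open>a\<close> arguments, \<open>G\<close>
      the next \<open>b\<close> and \<open>H\<close> the rest. Both bracketings sum this over
      \<open>a + b \<le> n\<close>.\<close>
    define f where "f a b = F a (take a xs) \<star> (G b (take b (drop a xs)) \<star> H (n - a - b) (drop (a + b) xs))" for a b
    have len: "length xs = n" "set xs \<subseteq> V" using True by (auto simp: valid_def)
    have "((F \<otimes>\<^bsub>CC\<^esub> G) \<otimes>\<^bsub>CC\<^esub> H) n xs = (\<Sum>p\<le>n. \<Sum>a\<le>p. f a (p - a))"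
      unfolding CC_mult[OF CC_mult_closed[OF F G] H] unfolding CC_mult[OF F G]
    proof (simp add: tr_def True cup_def mul_sum, intro sum.cong refl, goal_cases)
      case (1 p)
      then have "valid p (take p xs)" using len take_drop_V by (auto simp: valid_def)
      then show ?case using 1 by (auto simp: mul_sum f_def mul_assoc drop_take min_def intro!: sum.cong)
    qed
    also have "\<dots> = (\<Sum>(a, b)\<in>{(i, j). i + j \<le> n}. f a b)"
      by (rule sum.triangle_reindex_eq[symmetric])
    also have "{(i, j). i + j \<le> n} = (SIGMA a:{..n}. {..n - a})" by auto
    also have "(\<Sum>(a, b)\<in>(SIGMA a:{..n}. {..n - a}). f a b) = (\<Sum>a\<le>n. \<Sum>b\<le>n - a. f a b)"
      by (rule sum.Sigma[symmetric]) auto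
    also have "\<dots> = (F \<otimes>\<^bsub>CC\<^esub> (G \<otimes>\<^bsub>CC\<^esub> H)) n xs"
      unfolding CC_mult[OF F CC_mult_closed[OF G H]] unfolding CC_mult[OF G H]
    proof (simp add: tr_def True cup_def, intro sum.cong refl, goal_cases)
      case (1 a)
      then have "valid (n - a) (drop a xs)" using len take_drop_V by (auto simp: valid_def)
      then show ?case by (simp add: mul_sum f_def add.commute)
    qed
    finally show ?thesis .
  next
    case False
    then show ?thesis unfolding CC_mult[OF CC_mult_closed[OF F G] H] CC_mult[OF F CC_mult_closed[OF G H]] by (simp add: tr_def)
  qed
qed

lemma CC_zero_closed: "\<zero>\<^bsub>CC\<^esub> \<in> carrier CC"
  by (simp add: CC_carrier CC_zero supp0_def)

lemma CC_one_closed: "\<one>\<^bsub>CC\<^esub> \<in> carrier CC"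
proof -
  have "coc n (\<lambda>xs. if n = 0 \<and> xs = [] then one1 else 0)" for n
    by (cases n) (auto simp: coc_def)
  moreover have "{n. \<one>\<^bsub>CC\<^esub> n \<noteq> (\<lambda>_. 0)} \<subseteq> {0}" by (auto simp: CC_one)
  then have "finite {n. \<one>\<^bsub>CC\<^esub> n \<noteq> (\<lambda>_. 0)}" by (rule finite_subset) simp
  ultimately show ?thesis unfolding CC_carrier by (auto simp: CC_one supp0_def)
qed

lemma CC_add_closed: "F \<in> carrier CC \<Longrightarrow> G \<in> carrier CC \<Longrightarrow> F \<oplus>\<^bsub>CC\<^esub> G \<in> carrier CC"
proof -
  assume F: "F \<in> carrier CC" and G: "G \<in> carrier CC"
  have "{n. (\<lambda>xs. F n xs + G n xs) \<noteq> (\<lambda>_. 0)} \<subseteq> {n. F n \<noteq> (\<lambda>_. 0)} \<union> {n. G n \<noteq> (\<lambda>_. 0)}" by auto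
  then have "finite {n. (\<lambda>xs. F n xs + G n xs) \<noteq> (\<lambda>_. 0)}"
    using CC_D(3)[OF F] CC_D(3)[OF G] by (meson finite_UnI finite_subset)
  then show ?thesis using CC_D(1,2)[OF F] CC_D(1,2)[OF G] by (auto simp: CC_carrier CC_add supp0_def intro: coc_add)
qed

definition csm :: "'k \<Rightarrow> (nat \<Rightarrow> 'k el list \<Rightarrow> 'k el) \<Rightarrow> nat \<Rightarrow> 'k el list \<Rightarrow> 'k el" where
  "csm c F = (\<lambda>n xs. scl c (F n xs))"

lemma csm_closed: "F \<in> carrier CC \<Longrightarrow> csm c F \<in> carrier CC"
proof -
  assume F: "F \<in> carrier CC"
  have "{n. csm c F n \<noteq> (\<lambda>_. 0)} \<subseteq> {n. F n \<noteq> (\<lambda>_. 0)}" by (auto simp: csm_def)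
  then have "finite {n. csm c F n \<noteq> (\<lambda>_. 0)}" using CC_D(3)[OF F] by (rule finite_subset)
  then show ?thesis using CC_D(1,2)[OF F] by (auto simp: CC_carrier csm_def supp0_def intro: coc_scl)
qed

lemma csm_neg: "csm (-1) F \<oplus>\<^bsub>CC\<^esub> F = \<zero>\<^bsub>CC\<^esub>"
  by (simp add: csm_def CC_add CC_zero scl_minus)

lemma CC_ring: "ring CC"
proof (rule ringI)
  show "abelian_group CC"
  proof (rule abelian_groupI)
    fix F assume F: "F \<in> carrier CC"
    show "\<exists>G\<in>carrier CC. G \<oplus>\<^bsub>CC\<^esub> F = \<zero>\<^bsub>CC\<^esub>"
      by (rule bexI[of _ "csm (-1) F"]) (use csm_closed[OF F] csm_neg in simp_all)
  qed (auto simp: CC_add_closed CC_zero_closed, auto simp: CC_add CC_zero add_ac)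
  show "Group.monoid CC"
  proof (rule monoidI)
    fix F assume F: "F \<in> carrier CC"
    have tF: "tr n (F n) = F n" for n using CC_D(2)[OF F, of n] by (auto simp: tr_def supp0_def fun_eq_iff)
    have "(\<one>\<^bsub>CC\<^esub> \<otimes>\<^bsub>CC\<^esub> F) n = tr n (F n)" for n
    proof -
      have "(\<Sum>p\<le>n. cup p (\<one>\<^bsub>CC\<^esub> p) (F (n - p)) xs) = F n xs" for xs
        by (subst sum.remove[of _ 0]) (auto simp: CC_one cup_def)
      then show ?thesis unfolding CC_mult[OF CC_one_closed F] by simp
    qed
    then show "\<one>\<^bsub>CC\<^esub> \<otimes>\<^bsub>CC\<^esub> F = F" using tF by auto
    have "(F \<otimes>\<^bsub>CC\<^esub> \<one>\<^bsub>CC\<^esub>) n = tr n (F n)" for n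
    proof -
      have "(\<Sum>p\<le>n. cup p (F p) (\<one>\<^bsub>CC\<^esub> (n - p)) xs) = F n xs" if "length xs = n" for xs
        by (subst sum.remove[of _ n]) (use that in \<open>auto simp: CC_one cup_def intro!: sum.neutral\<close>)
      then show ?thesis unfolding CC_mult[OF F CC_one_closed] by (auto simp: tr_def valid_def)
    qed
    then show "F \<otimes>\<^bsub>CC\<^esub> \<one>\<^bsub>CC\<^esub> = F" using tF by auto
  qed (simp_all add: CC_mult_closed CC_one_closed CC_assoc)
  fix F G H assume c: "F \<in> carrier CC" "G \<in> carrier CC" "H \<in> carrier CC"
  show "(F \<oplus>\<^bsub>CC\<^esub> G) \<otimes>\<^bsub>CC\<^esub> H = F \<otimes>\<^bsub>CC\<^esub> H \<oplus>\<^bsub>CC\<^esub> G \<otimes>\<^bsub>CC\<^esub> H"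
    unfolding CC_mult[OF CC_add_closed[OF c(1,2)] c(3)] unfolding CC_mult[OF c(1,3)] CC_mult[OF c(2,3)] 
    by (auto simp: CC_add tr_def cup_def mul_distrib sum.distrib fun_eq_iff)
  show "H \<otimes>\<^bsub>CC\<^esub> (F \<oplus>\<^bsub>CC\<^esub> G) = H \<otimes>\<^bsub>CC\<^esub> F \<oplus>\<^bsub>CC\<^esub> H \<otimes>\<^bsub>CC\<^esub> G"
    unfolding CC_mult[OF c(3) CC_add_closed[OF c(1,2)]] unfolding CC_mult[OF c(3,1)] CC_mult[OF c(3,2)] 
    by (auto simp: CC_add tr_def cup_def mul_distrib sum.distrib fun_eq_iff)
qed

section \<open>Coboundaries form an ideal\<close>

definition cobd :: "nat \<Rightarrow> ('k el list \<Rightarrow> 'k el) \<Rightarrow> bool" where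
  "cobd n f \<longleftrightarrow> (case n of 0 \<Rightarrow> f [] = 0 | Suc N \<Rightarrow> cob N f)"

lemma BB_iff: "F \<in> BB \<longleftrightarrow> F \<in> carrier CC \<and> (\<forall>n. cobd n (F n))"
proof -
  have "F n \<in> hcobound CLr scl n \<longleftrightarrow> cobd n (F n)" if "F \<in> carrier CC" for n
  proof (cases n)
    case 0
    have "F 0 = (\<lambda>_. 0) \<longleftrightarrow> F 0 [] = 0"
    proof
      assume "F 0 [] = 0"
      then have "F 0 xs = 0" for xs using CC_D(2)[OF that, of 0] by (cases "xs = []") (auto simp: supp0_def)
      then show "F 0 = (\<lambda>_. 0)" by blast
    qed simp
    then show ?thesis using 0 by (simp add: hcobound_def cobd_def zcoch_def)
  next
    case (Suc N)
    then show ?thesis using CC_D(2)[OF that, of n] by (simp add: hcobound_CLr_Suc cobd_def supp0_def)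
  qed
  then show ?thesis unfolding BB_def coboundary_ideal_def CC_def[symmetric] by auto
qed

lemma cobd_add: "cobd n f \<Longrightarrow> cobd n g \<Longrightarrow> cobd n (\<lambda>l. f l + g l)"
  by (auto simp: cobd_def cob_add split: nat.splits)

lemma cobd_scl: "cobd n f \<Longrightarrow> cobd n (\<lambda>l. scl c (f l))"
  by (auto simp: cobd_def cob_scl split: nat.splits)

lemma cobd_0: "cobd n (\<lambda>_. 0)"
  by (auto simp: cobd_def split: nat.splits)

lemma cobd_sum: "(\<And>a. a \<in> A \<Longrightarrow> cobd n (f a)) \<Longrightarrow> cobd n (\<lambda>l. \<Sum>a\<in>A. f a l)"
  by (induction A rule: infinite_finite_induct) (auto intro: cobd_add cobd_0)

lemma cob_cong: "(\<And>ys. valid (Suc n) ys \<Longrightarrow> f ys = g ys) \<Longrightarrow> cob n f \<Longrightarrow> cob n g"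
  by (force simp: cob_dd)

lemma cobd_tr: "cobd n f \<Longrightarrow> cobd n (tr n f)"
proof (cases n)
  case (Suc N)
  assume "cobd n f"
  then show ?thesis using cob_cong[of N f "tr n f"] Suc by (simp add: cobd_def tr_def)
qed (simp add: cobd_def tr_def)

lemma cobd_cup1: "cobd p f \<Longrightarrow> coc r g \<Longrightarrow> cobd (p + r) (cup p f g)"
proof (cases p)
  case 0
  assume "cobd p f" "coc r g"
  then have "cup p f g = (\<lambda>_. 0)" using 0 by (simp add: cobd_def cup_def fun_eq_iff)
  then show ?thesis by (simp add: cobd_0)
qed (simp add: cobd_def cob_cup1)

lemma cobd_cup2: "coc p f \<Longrightarrow> cobd r g \<Longrightarrow> cobd (p + r) (cup p f g)"
proof (cases r)
  case 0
  assume f: "coc p f" and g: "cobd r g"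
  have z: "cup p f g xs = 0" if "length xs = p" for xs
    using that g 0 by (simp add: cup_def cobd_def)
  show ?thesis
  proof (cases p)
    case (Suc N)
    have "cob N (cup p f g)" by (rule cob_cong[OF _ cob_0]) (use z Suc in \<open>simp add: valid_def\<close>)
    then show ?thesis using 0 Suc by (simp add: cobd_def)
  qed (use z 0 in \<open>simp add: cobd_def\<close>)
qed (simp add: cobd_def cob_cup2)

lemma BB_ideal: "ideal BB CC"
proof (rule idealI[OF CC_ring])
  interpret ring CC by (rule CC_ring)
  show "subgroup BB (add_monoid CC)"
  proof (rule group.subgroupI[OF add.is_group])
    show "BB \<subseteq> carrier (add_monoid CC)" by (auto simp: BB_iff)
    have "\<zero>\<^bsub>CC\<^esub> \<in> BB" by (simp add: BB_iff CC_zero_closed) (simp add: CC_zero cobd_0)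
    then show "BB \<noteq> {}" by auto
    fix F assume F: "F \<in> BB"
    then have Fc: "F \<in> carrier CC" by (simp add: BB_iff)
    have "\<ominus>\<^bsub>CC\<^esub> F = csm (-1) F" using minus_equality[OF csm_neg Fc csm_closed[OF Fc]] by blast
    moreover have "csm (-1) F \<in> BB" using F csm_closed[OF Fc] by (simp add: BB_iff) (simp add: csm_def cobd_scl)
    ultimately show "inv\<^bsub>add_monoid CC\<^esub> F \<in> BB" by (simp add: a_inv_def)
    fix G assume G: "G \<in> BB"
    then show "F \<otimes>\<^bsub>add_monoid CC\<^esub> G \<in> BB" using F CC_add_closed[of F G] by (simp add: BB_iff) (simp add: CC_add cobd_add)
  qed
  fix F G assume F: "F \<in> BB" and G: "G \<in> carrier CC"
  then have Fc: "F \<in> carrier CC" by (simp add: BB_iff)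
  show "G \<otimes>\<^bsub>CC\<^esub> F \<in> BB"
    unfolding BB_iff
  proof (intro conjI allI CC_mult_closed G Fc)
    fix n
    show "cobd n ((G \<otimes>\<^bsub>CC\<^esub> F) n)" unfolding CC_mult[OF G Fc]
    proof (intro cobd_tr cobd_sum)
      fix p assume "p \<in> {..n}"
      then show "cobd n (cup p (G p) (F (n - p)))"
        using cobd_cup2[OF CC_D(1)[OF G, of p], of "n - p" "F (n - p)"] F by (simp add: BB_iff)
    qed
  qed
  show "F \<otimes>\<^bsub>CC\<^esub> G \<in> BB"
    unfolding BB_iff
  proof (intro conjI allI CC_mult_closed G Fc)
    fix n
    show "cobd n ((F \<otimes>\<^bsub>CC\<^esub> G) n)" unfolding CC_mult[OF Fc G]
    proof (intro cobd_tr cobd_sum)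
      fix p assume "p \<in> {..n}"
      then show "cobd n (cup p (F p) (G (n - p)))"
        using cobd_cup1[OF _ CC_D(1)[OF G, of "n - p"], of p "F p"] F by (simp add: BB_iff)
    qed
  qed
qed

end

section \<open>The homomorphism to polynomials in two variables\<close>

context qv
begin

definition pc :: "(nat \<Rightarrow> 'k el list \<Rightarrow> 'k el) \<Rightarrow> nat \<Rightarrow> nat \<Rightarrow> 'k" where
  "pc F s t = ph (s + t) (F (s + t)) 0 (int s) / gam t"

text \<open>The \<open>KE\<close> coordinate is multiplicative, so the comultiplication gives a
  convolution with constants \<open>cC\<close>. A nonzero summand has both bidegrees in
  \<open>SS\<close>, where \<open>cC_SS\<close> turns the constant into a quotient of values of
  \<open>gam\<close>.\<close>

lemma ph_cup:
  assumes f: "coc p f" and g: "coc r g"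
  shows "ph (p + r) (cup p f g) 0 (int s) = (\<Sum>a\<le>p. if a \<le> s \<and> s - a \<le> r then
      gam (p + r - s) * (ph p f 0 (int a) / gam (p - a)) * (ph r g 0 (int (s - a)) / gam (r - (s - a))) else 0)"
proof -
  have "ph (p + r) (cup p f g) 0 (int s) = (\<Sum>a\<le>p. cC 0 (int a) (p - a) (int s - int a) *
     (cf (ev p f 0 (int a)) KE 0 * cf (ev r g (2 * int a - int p) (int s - int a)) KE 0))"
    using ev_cup[of p r f g 0 "int s"] by (simp add: ph_def cup_def[abs_def] cf_sum)
  also have "\<dots> = (\<Sum>a\<le>p. if a \<le> s \<and> s - a \<le> r then
      gam (p + r - s) * (ph p f 0 (int a) / gam (p - a)) * (ph r g 0 (int (s - a)) / gam (r - (s - a))) else 0)"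
  proof (rule sum.cong)
    fix a assume a: "a \<in> {..p}"
    \<comment> \<open>Summands with impossible letter counts or a vanishing left value are zero on
      both sides; in the others the left walk is closed, so the right one starts again at 0 modulo
      \<open>m\<close>.\<close>
    show "cC 0 (int a) (p - a) (int s - int a) * (cf (ev p f 0 (int a)) KE 0 * cf (ev r g (2 * int a - int p) (int s - int a)) KE 0)
      = (if a \<le> s \<and> s - a \<le> r then gam (p + r - s) * (ph p f 0 (int a) / gam (p - a)) * (ph r g 0 (int (s - a)) / gam (r - (s - a))) else 0)"
    proof (cases "a \<le> s \<and> s - a \<le> r \<and> ph p f 0 (int a) \<noteq> 0")
      case False
      have "ev r g i (int s - int a) = 0" if "\<not> (a \<le> s \<and> s - a \<le> r)" for i
        by (rule ev_range) (use that in linarith)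
      then show ?thesis using False by (auto simp: ph_def)
    next
      case True
      have 1: "(a, p - a) \<in> SS" by (rule ph_SS[of a "p - a" f 0]) (use True f a in auto)
      have "[2 * int a - int p = 0] (mod int m)"
        using SS_cong[OF 1] a by (simp add: cong_iff_dvd_diff of_nat_diff)
      then have e: "ev r g (2 * int a - int p) (int s - int a) = ev r g 0 (int (s - a))"
        using True by (simp add: ev_i_cong of_nat_diff)
      show ?thesis
      proof (cases "ph r g 0 (int (s - a)) = 0")
        case z: True
        then have z': "cf (ev r g 0 (int (s - a))) KE 0 = 0" by (simp only: ph_def)
        show ?thesis unfolding e z z' by (simp only: mult_zero_right div_0 if_cancel)
      next
        case False
        have 2: "(s - a, r - (s - a)) \<in> SS" by (rule ph_SS[of "s - a" "r - (s - a)" g 0]) (use True False g in auto)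
        have "p - a + (r - (s - a)) = p + r - s" using True a by auto
        then have "cC 0 (int a) (p - a) (int s - int a) = gam (p + r - s) / (gam (p - a) * gam (r - (s - a)))"
          using cC_SS[OF 1 2] True by (simp add: of_nat_diff)
        then show ?thesis unfolding e using True by (simp add: ph_def)
      qed
    qed
  qed simp
  finally show ?thesis .
qed

lemma pc_mult:
  assumes F: "F \<in> carrier CC" and G: "G \<in> carrier CC"
  shows "pc (F \<otimes>\<^bsub>CC\<^esub> G) s t = (\<Sum>j\<le>t. \<Sum>i\<le>s. pc F i j * pc G (s - i) (t - j))"
proof -
  define n where "n = s + t"
  \<comment> \<open>Extension by zero lets the sum over the degree \<open>p\<close> and the letter
    count \<open>a\<close> be reindexed by \<open>(a, p - a)\<close> and cut down to the rectangle
    of a two-variable Cauchy product.\<close>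
  define h where "h i j = (if i \<le> s \<and> j \<le> t then pc F i j * pc G (s - i) (t - j) else 0)" for i j
  have "ph n ((F \<otimes>\<^bsub>CC\<^esub> G) n) 0 (int s) = (\<Sum>p\<le>n. ph n (cup p (F p) (G (n - p))) 0 (int s))"
    unfolding CC_mult[OF F G] ph_def ev_tr by (simp add: ev_sum cf_sum)
  also have "\<dots> = (\<Sum>p\<le>n. \<Sum>a\<le>p. gam t * h a (p - a))"
  proof (rule sum.cong)
    fix p assume p: "p \<in> {..n}"
    have "ph n (cup p (F p) (G (n - p))) 0 (int s) = (\<Sum>a\<le>p. if a \<le> s \<and> s - a \<le> n - p then
      gam t * (ph p (F p) 0 (int a) / gam (p - a)) * (ph (n - p) (G (n - p)) 0 (int (s - a)) / gam (n - p - (s - a))) else 0)"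
    proof -
      have *: "p + (n - p) = n" "n - s = t" using p by (auto simp: n_def)
      show ?thesis using ph_cup[OF CC_D(1)[OF F, of p] CC_D(1)[OF G, of "n - p"], of s] unfolding * .
    qed
    also have "\<dots> = (\<Sum>a\<le>p. gam t * h a (p - a))"
    proof (rule sum.cong)
      fix a assume a: "a \<in> {..p}"
      have 1: "s - a \<le> n - p \<longleftrightarrow> p - a \<le> t" if "a \<le> s" using that p a by (auto simp: n_def)
      have 2: "n - p - (s - a) = t - (p - a)" "s - a + (t - (p - a)) = n - p" "a + (p - a) = p" if "a \<le> s" "p - a \<le> t"
        using that p a by (auto simp: n_def)
      show "(if a \<le> s \<and> s - a \<le> n - p then
        gam t * (ph p (F p) 0 (int a) / gam (p - a)) * (ph (n - p) (G (n - p)) 0 (int (s - a)) / gam (n - p - (s - a))) else 0) = gam t * h a (p - a)"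
        using 1 2 by (auto simp: h_def pc_def)
    qed simp
    finally show "ph n (cup p (F p) (G (n - p))) 0 (int s) = (\<Sum>a\<le>p. gam t * h a (p - a))" .
  qed simp
  also have "\<dots> = gam t * (\<Sum>(i, j)\<in>{(i, j). i + j \<le> n}. h i j)"
    by (simp add: sum.triangle_reindex_eq sum_distrib_left)
  also have "(\<Sum>(i, j)\<in>{(i, j). i + j \<le> n}. h i j) = (\<Sum>(i, j)\<in>{..s} \<times> {..t}. h i j)"
  proof (rule sum.mono_neutral_right)
    have "{(i, j). i + j \<le> n} \<subseteq> {..n} \<times> {..n}" by auto
    then show "finite {(i, j). i + j \<le> n}" by (rule finite_subset) simp
  qed (auto simp: n_def h_def split: if_splits)
  also have "\<dots> = (\<Sum>i\<le>s. \<Sum>j\<le>t. h i j)" by (rule sum.cartesian_product[symmetric])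
  also have "\<dots> = (\<Sum>j\<le>t. \<Sum>i\<le>s. h i j)" by (rule sum.swap)
  also have "\<dots> = (\<Sum>j\<le>t. \<Sum>i\<le>s. pc F i j * pc G (s - i) (t - j))" by (simp add: h_def)
  finally show ?thesis by (simp add: pc_def n_def)
qed

lemma pc_BB: "F \<in> BB \<Longrightarrow> pc F s t = 0"
proof -
  assume F: "F \<in> BB"
  then have c: "cobd (s + t) (F (s + t))" by (simp add: BB_iff)
  have "ph (s + t) (F (s + t)) 0 (int s) = 0"
  proof (cases "s + t")
    case 0
    then show ?thesis using c by (simp add: cobd_def ph_def)
  next
    case (Suc N)
    then obtain h where h: "ml N h" "\<And>xs. valid (Suc N) xs \<Longrightarrow> F (s + t) xs = dd h xs"
      using c by (auto simp: cobd_def cob_dd)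
    have "ev (Suc N) (F (s + t)) 0 (int s) = ev (Suc N) (dd h) 0 (int s)"
      by (rule ev_cong) (use h in \<open>simp add: valid_def\<close>)
    then show ?thesis using ev_dd_KE[OF h(1)] unfolding ph_def Suc by (simp del: ev.simps)
  qed
  then show ?thesis by (simp add: pc_def)
qed

lemma cube_BB:
  assumes F: "F \<in> carrier CC" and z: "\<And>s t. pc F s t = 0"
  shows "F \<otimes>\<^bsub>CC\<^esub> (F \<otimes>\<^bsub>CC\<^esub> F) \<in> BB"
proof -
  have "ph n (F n) 0 s = 0" for n s
  proof (cases "0 \<le> s \<and> s \<le> int n")
    case True
    then obtain a where a: "s = int a" "a \<le> n" by (metis nat_0_le nat_int_comparison(3) of_nat_le_iff)
    then show ?thesis using z[of a "n - a"] by (simp add: pc_def)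
  qed (use ph_range in auto)
  then have r: "rad (ev n (F n) i s)" for n i s by (rule rad_ev[OF CC_D(1)[OF F]])
  have e: "ev n ((G \<otimes>\<^bsub>CC\<^esub> H) n) i s = (\<Sum>p\<le>n. \<Sum>a\<le>p. scl (cC i (int a) (p - a) (s - int a)) (ev p (G p) i (int a) \<star> ev (n - p) (H (n - p)) (i + 2 * int a - int p) (s - int a)))"
    if "G \<in> carrier CC" "H \<in> carrier CC" for G H n i s
    unfolding CC_mult[OF that] ev_tr ev_sum
  proof (rule sum.cong)
    fix p assume "p \<in> {..n}"
    then show "ev n (cup p (G p) (H (n - p))) i s = (\<Sum>a\<le>p. scl (cC i (int a) (p - a) (s - int a)) (ev p (G p) i (int a) \<star> ev (n - p) (H (n - p)) (i + 2 * int a - int p) (s - int a)))"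
      using ev_cup[of p "n - p" "G p" "H (n - p)" i s] by (simp add: cup_def[abs_def])
  qed simp
  have FF: "F \<otimes>\<^bsub>CC\<^esub> F \<in> carrier CC" by (rule CC_mult_closed[OF F F])
  have rr: "soc (scl c (x \<star> y))" if "rad x" "rad y" for c x y using that by (simp add: rad_def soc_def)
  have rs: "scl c (x \<star> y) = 0" if "rad x" "soc y" for c x y
    by (rule el_eqI) (use that in \<open>simp_all add: rad_def soc_def\<close>)
  have s: "soc (ev n ((F \<otimes>\<^bsub>CC\<^esub> F) n) i s)" for n i s
    unfolding e[OF F F] by (intro soc_sum rr r)
  have 0: "ev n ((F \<otimes>\<^bsub>CC\<^esub> (F \<otimes>\<^bsub>CC\<^esub> F)) n) i s = 0" for n i s
    unfolding e[OF F FF] by (intro sum.neutral ballI rs r s)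
  have FFF: "F \<otimes>\<^bsub>CC\<^esub> (F \<otimes>\<^bsub>CC\<^esub> F) \<in> carrier CC" by (rule CC_mult_closed[OF F FF])
  have "cobd n ((F \<otimes>\<^bsub>CC\<^esub> (F \<otimes>\<^bsub>CC\<^esub> F)) n)" for n
  proof (cases n)
    \<comment> \<open>In degree 0 evaluation is the value itself; \<open>koszul_exact\<close>
      handles the positive degrees.\<close>
    case 0
    then show ?thesis using \<open>\<And>s n i. ev n ((F \<otimes>\<^bsub>CC\<^esub> (F \<otimes>\<^bsub>CC\<^esub> F)) n) i s = 0\<close>[of 0 0 0] by (simp add: cobd_def)
  next
    case (Suc N)
    then show ?thesis using koszul_exact[of N "(F \<otimes>\<^bsub>CC\<^esub> (F \<otimes>\<^bsub>CC\<^esub> F)) n"] 0[of n] CC_D(1)[OF FFF, of n] by (simp add: cobd_def del: ev.simps)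
  qed
  then show ?thesis using FFF by (simp add: BB_iff)
qed

text \<open>The inner variable is \<open>x\<close> and counts \<open>a\<close>, the outer one is
  \<open>y\<close> and counts \<open>abar\<close>.\<close>

definition Psi :: "(nat \<Rightarrow> 'k el list \<Rightarrow> 'k el) \<Rightarrow> 'k poly poly" where
  "Psi F = (\<Sum>n\<in>{n. F n \<noteq> (\<lambda>_. 0)}. \<Sum>s\<le>n. Polynomial.monom (Polynomial.monom (pc F s (n - s)) s) (n - s))"

lemma coeff_Psi:
  assumes F: "F \<in> carrier CC"
  shows "Polynomial.coeff (Polynomial.coeff (Psi F) t) s = pc F s t"
proof -
  let ?A = "{n. F n \<noteq> (\<lambda>_. 0)}"
  have fin: "finite ?A" by (rule CC_D(3)[OF F])
  have z: "pc F s t = 0" if "s + t \<notin> ?A" using that by (simp add: pc_def ph_def)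
  have "Polynomial.coeff (Polynomial.coeff (Psi F) t) s = (\<Sum>n\<in>?A. \<Sum>a\<le>n. if n - a = t \<and> a = s then pc F a (n - a) else 0)"
    by (simp add: Psi_def Polynomial.coeff_sum if_distrib[of "\<lambda>x. Polynomial.coeff x s"] cong: if_cong)
      (intro sum.cong refl, auto)
  also have "\<dots> = (\<Sum>n\<in>?A. if n = s + t then pc F s t else 0)"
  proof (rule sum.cong)
    fix n
    have "(\<Sum>a\<le>n. if n - a = t \<and> a = s then pc F a (n - a) else 0) = (\<Sum>a\<le>n. if a = s then (if n - s = t then pc F s t else 0) else 0)"
      by (rule sum.cong) auto
    also have "\<dots> = (if n = s + t then pc F s t else 0)" by auto
    finally show "(\<Sum>a\<le>n. if n - a = t \<and> a = s then pc F a (n - a) else 0) = (if n = s + t then pc F s t else 0)" .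
  qed simp
  also have "\<dots> = pc F s t" using fin z by auto
  finally show ?thesis .
qed

lemma pp_eqI: "(\<And>s t. Polynomial.coeff (Polynomial.coeff p t) s = Polynomial.coeff (Polynomial.coeff r t) s) \<Longrightarrow> p = (r :: 'k poly poly)"
  by (intro poly_eqI) auto

lemma coeff2_mult: "Polynomial.coeff (Polynomial.coeff (p * r) t) s =
    (\<Sum>j\<le>t. \<Sum>i\<le>s. Polynomial.coeff (Polynomial.coeff p j) i * Polynomial.coeff (Polynomial.coeff r (t - j)) (s - i))"
  for p r :: "'k poly poly"
  by (simp add: Polynomial.coeff_mult Polynomial.coeff_sum)

lemma Psi_mult: "F \<in> carrier CC \<Longrightarrow> G \<in> carrier CC \<Longrightarrow> Psi (F \<otimes>\<^bsub>CC\<^esub> G) = Psi F * Psi G"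
  by (rule pp_eqI) (simp add: coeff_Psi CC_mult_closed coeff2_mult pc_mult)

lemma Psi_add: "F \<in> carrier CC \<Longrightarrow> G \<in> carrier CC \<Longrightarrow> Psi (F \<oplus>\<^bsub>CC\<^esub> G) = Psi F + Psi G"
  by (rule pp_eqI) (simp add: coeff_Psi CC_add_closed, simp add: pc_def CC_add ph_def ev_add add_divide_distrib)

lemma Psi_csm: "F \<in> carrier CC \<Longrightarrow> Psi (csm c F) = Polynomial.smult [:c:] (Psi F)"
  by (rule pp_eqI) (simp add: coeff_Psi csm_closed, simp add: pc_def csm_def ph_def ev_scl)

lemma Psi_one: "Psi \<one>\<^bsub>CC\<^esub> = 1"
proof (rule pp_eqI)
  fix s t
  have "pc \<one>\<^bsub>CC\<^esub> s t = (if s = 0 \<and> t = 0 then 1 else 0)"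
    by (cases "s + t = 0") (auto simp: pc_def CC_one ph_def gam_def one1_def)
  then show "Polynomial.coeff (Polynomial.coeff (Psi \<one>\<^bsub>CC\<^esub>) t) s = Polynomial.coeff (Polynomial.coeff 1 t) s"
    by (auto simp: coeff_Psi CC_one_closed)
qed

lemma Psi_BB: "F \<in> BB \<Longrightarrow> Psi F = 0"
  by (rule pp_eqI) (simp add: coeff_Psi BB_iff, simp add: pc_BB BB_iff)

lemma Psi_cube: "F \<in> carrier CC \<Longrightarrow> Psi F = 0 \<Longrightarrow> F \<otimes>\<^bsub>CC\<^esub> (F \<otimes>\<^bsub>CC\<^esub> F) \<in> BB"
  by (rule cube_BB) (use coeff_Psi[of F] in auto)

definition sup_SS :: "'k poly poly \<Rightarrow> bool" where
  "sup_SS p \<longleftrightarrow> (\<forall>s t. Polynomial.coeff (Polynomial.coeff p t) s \<noteq> 0 \<longrightarrow> (s, t) \<in> SS)"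

lemma Psi_SS: "F \<in> carrier CC \<Longrightarrow> sup_SS (Psi F)"
  unfolding sup_SS_def by (auto simp: coeff_Psi pc_def intro!: ph_SS[OF CC_D(1)])

definition xymon :: "nat \<Rightarrow> nat \<Rightarrow> 'k poly poly" where
  "xymon s t = Polynomial.monom (Polynomial.monom 1 s) t"

lemma coeff_xymon: "Polynomial.coeff (Polynomial.coeff (xymon s t) t') s' = (if s = s' \<and> t = t' then 1 else 0)"
  by (simp add: xymon_def)

lemma xymon_image: assumes "(s, t) \<in> SS" shows "xymon s t \<in> Psi ` carrier CC"
proof -
  obtain f where f: "coc (s + t) f" "\<And>r. ph (s + t) f 0 r = (if r = int s then 1 else 0)"
    using exists_cocycle[OF assms] by auto
  \<comment> \<open>The factor \<open>gam t\<close> undoes the division in \<open>pc\<close>, so the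
    image is the monomial with coefficient 1.\<close>
  define F where "F n = (if n = s + t then tr n (\<lambda>l. scl (gam t) (f l)) else (\<lambda>_. 0))" for n
  have "{n. F n \<noteq> (\<lambda>_. 0)} \<subseteq> {s + t}" by (auto simp: F_def)
  then have fin: "finite {n. F n \<noteq> (\<lambda>_. 0)}" by (rule finite_subset) simp
  have F: "F \<in> carrier CC"
    unfolding CC_carrier using f(1) fin by (auto simp: F_def supp0_def tr_def intro: coc_tr coc_scl)
  have "pc F s' t' = (if s = s' \<and> t = t' then 1 else 0)" for s' t'
  proof (cases "s' + t' = s + t")
    case True
    have "pc F s' t' = gam t * ph (s + t) f 0 (int s') / gam t'"
      by (simp add: pc_def F_def True ph_def ev_tr ev_scl)
    then show ?thesis using True by (auto simp: f(2))
  qed (auto simp: pc_def F_def ph_def)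
  then have "Psi F = xymon s t" by (intro pp_eqI) (simp add: coeff_Psi[OF F] coeff_xymon)
  then show ?thesis using imageI[OF F, of Psi] by simp
qed

lemma pp_sum: "p = (\<Sum>t\<le>Polynomial.degree p. \<Sum>s\<le>Polynomial.degree (Polynomial.coeff p t). Polynomial.smult [:Polynomial.coeff (Polynomial.coeff p t) s:] (xymon s t))"
  for p :: "'k poly poly"
proof -
  have "Polynomial.monom c t = (\<Sum>s\<le>Polynomial.degree c. Polynomial.smult [:Polynomial.coeff c s:] (xymon s t))" for c :: "'k poly" and t
  proof -
    have "Polynomial.monom c t = Polynomial.monom (\<Sum>s\<le>Polynomial.degree c. Polynomial.monom (Polynomial.coeff c s) s) t"
      by (simp only: poly_as_sum_of_monoms)
    also have "\<dots> = (\<Sum>s\<le>Polynomial.degree c. Polynomial.monom (Polynomial.monom (Polynomial.coeff c s) s) t)"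
      by (rule monom_sum)
    also have "\<dots> = (\<Sum>s\<le>Polynomial.degree c. Polynomial.smult [:Polynomial.coeff c s:] (xymon s t))"
      by (simp add: xymon_def smult_monom)
    finally show ?thesis .
  qed
  then show ?thesis using poly_as_sum_of_monoms[of p] by simp
qed

lemma Psi_image: "Psi ` carrier CC = {p. sup_SS p}"
proof (intro equalityI subsetI)
  fix p assume "p \<in> {p. sup_SS p}"
  then have p: "sup_SS p" by simp
  have add: "x + y \<in> Psi ` carrier CC" if xy: "x \<in> Psi ` carrier CC" "y \<in> Psi ` carrier CC" for x y
  proof -
    obtain F where F: "F \<in> carrier CC" "x = Psi F" using xy(1) by (rule imageE) simp
    obtain G where G: "G \<in> carrier CC" "y = Psi G" using xy(2) by (rule imageE) simp
    show ?thesis using imageI[OF CC_add_closed[OF F(1) G(1)], of Psi] by (simp add: Psi_add[OF F(1) G(1)] F(2) G(2))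
  qed
  have zero: "0 \<in> Psi ` carrier CC"
    using imageI[OF CC_zero_closed, of Psi] by (simp add: Psi_def CC_zero)
  have sum: "(\<Sum>a\<in>A. f a) \<in> Psi ` carrier CC" if "\<And>a. a \<in> A \<Longrightarrow> f a \<in> Psi ` carrier CC" for A :: "nat set" and f
    using that by (induction A rule: infinite_finite_induct) (auto simp: zero intro: add)
  have "Polynomial.smult [:Polynomial.coeff (Polynomial.coeff p t) s:] (xymon s t) \<in> Psi ` carrier CC" for s t
  proof (cases "Polynomial.coeff (Polynomial.coeff p t) s = 0")
    case True
    then show ?thesis using zero by simp
  next
    case False
    then have "xymon s t \<in> Psi ` carrier CC" using p by (intro xymon_image) (simp add: sup_SS_def)
    then obtain F where F: "F \<in> carrier CC" "xymon s t = Psi F" by (rule imageE) simp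
    show ?thesis using imageI[OF csm_closed[OF F(1)], of Psi] by (simp add: Psi_csm[OF F(1)] F(2))
  qed
  then have "(\<Sum>t\<le>Polynomial.degree p. \<Sum>s\<le>Polynomial.degree (Polynomial.coeff p t). Polynomial.smult [:Polynomial.coeff (Polynomial.coeff p t) s:] (xymon s t)) \<in> Psi ` carrier CC"
    by (intro sum)
  then show "p \<in> Psi ` carrier CC" by (simp only: pp_sum[symmetric])
qed (auto simp: Psi_SS)

definition hcomp :: "nat \<Rightarrow> (nat \<Rightarrow> 'k el list \<Rightarrow> 'k el) \<Rightarrow> nat \<Rightarrow> 'k el list \<Rightarrow> 'k el" where
  "hcomp n F = (\<lambda>k. if k = n then F k else (\<lambda>_. 0))"

lemma hcomp_closed: "F \<in> carrier CC \<Longrightarrow> hcomp n F \<in> carrier CC"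
proof -
  assume F: "F \<in> carrier CC"
  have "{k. hcomp n F k \<noteq> (\<lambda>_. 0)} \<subseteq> {n}" by (auto simp: hcomp_def)
  then have "finite {k. hcomp n F k \<noteq> (\<lambda>_. 0)}" by (rule finite_subset) simp
  then show ?thesis using CC_D(1,2)[OF F] by (auto simp: CC_carrier hcomp_def supp0_def)
qed

lemma hcomp_Psi: "F \<in> carrier CC \<Longrightarrow> Psi F = 0 \<Longrightarrow> Psi (hcomp n F) = 0"
proof (rule pp_eqI)
  fix s t assume F: "F \<in> carrier CC" "Psi F = 0"
  have "pc F s t = 0" using coeff_Psi[OF F(1), of t s] F(2) by simp
  then have "pc (hcomp n F) s t = 0" by (cases "s + t = n") (auto simp: pc_def hcomp_def ph_def)
  then show "Polynomial.coeff (Polynomial.coeff (Psi (hcomp n F)) t) s = Polynomial.coeff (Polynomial.coeff 0 t) s"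
    by (simp add: coeff_Psi hcomp_closed F)
qed

end

section \<open>Transport of Hochschild cocycles along an isomorphism\<close>

text \<open>The inverse is named so that \<open>kiso_sym\<close> gives a second instance with the
  roles exchanged; every transfer lemma is then available in both directions.\<close>

locale kiso = R: ring R + S: ring S
  for R :: "('a, 'b) ring_scheme" and S :: "('c, 'd) ring_scheme" +
  fixes smR :: "'k \<Rightarrow> 'a \<Rightarrow> 'a" and smS :: "'k \<Rightarrow> 'c \<Rightarrow> 'c" and th :: "'a \<Rightarrow> 'c" and th' :: "'c \<Rightarrow> 'a"
  assumes cl: "x \<in> carrier R \<Longrightarrow> th x \<in> carrier S" "y \<in> carrier S \<Longrightarrow> th' y \<in> carrier R"
    and inv: "x \<in> carrier R \<Longrightarrow> th' (th x) = x" "y \<in> carrier S \<Longrightarrow> th (th' y) = y"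
    and hom: "x \<in> carrier R \<Longrightarrow> x' \<in> carrier R \<Longrightarrow> th (x \<oplus>\<^bsub>R\<^esub> x') = th x \<oplus>\<^bsub>S\<^esub> th x'"
      "x \<in> carrier R \<Longrightarrow> x' \<in> carrier R \<Longrightarrow> th (x \<otimes>\<^bsub>R\<^esub> x') = th x \<otimes>\<^bsub>S\<^esub> th x'"
      "th \<one>\<^bsub>R\<^esub> = \<one>\<^bsub>S\<^esub>"
    and smcl: "x \<in> carrier R \<Longrightarrow> smR c x \<in> carrier R" "y \<in> carrier S \<Longrightarrow> smS c y \<in> carrier S"
    and smhom: "x \<in> carrier R \<Longrightarrow> th (smR c x) = smS c (th x)"
begin

lemma kiso_sym: "kiso S R smS smR th' th"
proof
  fix x y assume xy: "x \<in> carrier S" "y \<in> carrier S"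
  show "th' (x \<oplus>\<^bsub>S\<^esub> y) = th' x \<oplus>\<^bsub>R\<^esub> th' y" "th' (x \<otimes>\<^bsub>S\<^esub> y) = th' x \<otimes>\<^bsub>R\<^esub> th' y"
    using inv(1)[of "th' x \<oplus>\<^bsub>R\<^esub> th' y"] inv(1)[of "th' x \<otimes>\<^bsub>R\<^esub> th' y"] xy by (simp_all add: hom cl inv)
  show "th' (smS c x) = smR c (th' x)" for c
    using inv(1)[of "smR c (th' x)"] xy by (simp add: smhom cl inv smcl)
next
  show "th' \<one>\<^bsub>S\<^esub> = \<one>\<^bsub>R\<^esub>" using inv(1)[of "\<one>\<^bsub>R\<^esub>"] hom(3) by simp
qed (auto simp: cl inv smcl)

lemma th_zero [simp]: "th \<zero>\<^bsub>R\<^esub> = \<zero>\<^bsub>S\<^esub>"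
proof -
  have "th \<zero>\<^bsub>R\<^esub> \<oplus>\<^bsub>S\<^esub> th \<zero>\<^bsub>R\<^esub> = th \<zero>\<^bsub>R\<^esub>" using hom(1)[of "\<zero>\<^bsub>R\<^esub>" "\<zero>\<^bsub>R\<^esub>"] by simp
  then show ?thesis using cl(1)[OF R.zero_closed] by (metis S.add.r_cancel_one')
qed

lemma th_minus: "x \<in> carrier R \<Longrightarrow> th (\<ominus>\<^bsub>R\<^esub> x) = \<ominus>\<^bsub>S\<^esub> th x"
proof -
  assume x: "x \<in> carrier R"
  have "th (\<ominus>\<^bsub>R\<^esub> x) \<oplus>\<^bsub>S\<^esub> th x = \<zero>\<^bsub>S\<^esub>" using hom(1)[of "\<ominus>\<^bsub>R\<^esub> x" x] x by (simp add: R.l_neg)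
  then show ?thesis using S.minus_equality x cl by auto
qed

lemma th_hsign: "x \<in> carrier R \<Longrightarrow> th (hsign R n x) = hsign S n (th x)"
  by (simp add: hsign_def th_minus)

lemma hsign_closed: "x \<in> carrier R \<Longrightarrow> hsign R n x \<in> carrier R"
  by (simp add: hsign_def)

lemma th_finsum: "finite A \<Longrightarrow> (\<And>a. a \<in> A \<Longrightarrow> f a \<in> carrier R) \<Longrightarrow> th (finsum R f A) = finsum S (\<lambda>a. th (f a)) A"
proof (induction A rule: finite_induct)
  case (insert a A)
  have f: "f \<in> A \<rightarrow> carrier R" "f a \<in> carrier R" "(\<lambda>a. th (f a)) \<in> A \<rightarrow> carrier S" using insert cl by auto
  then show ?case using insert by (simp add: hom cl R.finsum_closed)
qed simp

text \<open>Conjugation by the isomorphism, reset to zero off the carrier as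
  \<open>hcochains\<close> demands.\<close>

definition pu :: "('a list \<Rightarrow> 'a) \<Rightarrow> 'c list \<Rightarrow> 'c" where
  "pu f ys = (if set ys \<subseteq> carrier S then th (f (map th' ys)) else \<zero>\<^bsub>S\<^esub>)"

lemma set_map_cl: "set ys \<subseteq> carrier S \<Longrightarrow> set (map th' ys) \<subseteq> carrier R"
  using cl by auto

lemma hcochains_D:
  assumes "f \<in> hcochains R smR n"
  shows "f xs \<in> carrier R" "\<not> (length xs = n \<and> set xs \<subseteq> carrier R) \<Longrightarrow> f xs = \<zero>\<^bsub>R\<^esub>"
    "length us + length vs + 1 = n \<Longrightarrow> set us \<subseteq> carrier R \<Longrightarrow> set vs \<subseteq> carrier R \<Longrightarrow> x \<in> carrier R \<Longrightarrow> y \<in> carrier R \<Longrightarrow>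
        f (us @ [smR c x \<oplus>\<^bsub>R\<^esub> smR d y] @ vs) = smR c (f (us @ [x] @ vs)) \<oplus>\<^bsub>R\<^esub> smR d (f (us @ [y] @ vs))"
proof -
  have 1: "length xs = n \<and> set xs \<subseteq> carrier R \<Longrightarrow> f xs \<in> carrier R" 
    and 2: "\<not> (length xs = n \<and> set xs \<subseteq> carrier R) \<Longrightarrow> f xs = \<zero>\<^bsub>R\<^esub>" for xs
    using assms unfolding hcochains_def mem_Collect_eq by (blast, meson)
  show "f xs \<in> carrier R" using 1 2 R.zero_closed by metis
  show "\<not> (length xs = n \<and> set xs \<subseteq> carrier R) \<Longrightarrow> f xs = \<zero>\<^bsub>R\<^esub>" by (rule 2)
  show "length us + length vs + 1 = n \<Longrightarrow> set us \<subseteq> carrier R \<Longrightarrow> set vs \<subseteq> carrier R \<Longrightarrow> x \<in> carrier R \<Longrightarrow> y \<in> carrier R \<Longrightarrow>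
        f (us @ [smR c x \<oplus>\<^bsub>R\<^esub> smR d y] @ vs) = smR c (f (us @ [x] @ vs)) \<oplus>\<^bsub>R\<^esub> smR d (f (us @ [y] @ vs))"
    using assms unfolding hcochains_def mem_Collect_eq by (elim conjE allE[of _ us] allE[of _ vs] allE[of _ x] allE[of _ y] allE[of _ c] allE[of _ d]) simp
qed

lemma pu_cochain: assumes f: "f \<in> hcochains R smR n" shows "pu f \<in> hcochains S smS n"
  unfolding hcochains_def mem_Collect_eq
proof (intro conjI allI impI)
  fix xs :: "'c list"
  show "pu f xs \<in> carrier S" by (simp add: pu_def cl hcochains_D[OF f])
  assume "\<not> (length xs = n \<and> set xs \<subseteq> carrier S)"
  then show "pu f xs = \<zero>\<^bsub>S\<^esub>" using hcochains_D(2)[OF f, of "map th' xs"] by (auto simp: pu_def)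
next
  fix us vs :: "'c list" and x y c d
  assume a: "length us + length vs + 1 = n \<and> set us \<subseteq> carrier S \<and> set vs \<subseteq> carrier S \<and> x \<in> carrier S \<and> y \<in> carrier S"
  interpret sy: kiso S R smS smR th' th by (rule kiso_sym)
  have "f (map th' us @ [smR c (th' x) \<oplus>\<^bsub>R\<^esub> smR d (th' y)] @ map th' vs)
    = smR c (f (map th' us @ [th' x] @ map th' vs)) \<oplus>\<^bsub>R\<^esub> smR d (f (map th' us @ [th' y] @ map th' vs))"
    by (rule hcochains_D(3)[OF f]) (use a cl in auto)
  then show "pu f (us @ [smS c x \<oplus>\<^bsub>S\<^esub> smS d y] @ vs) = smS c (pu f (us @ [x] @ vs)) \<oplus>\<^bsub>S\<^esub> smS d (pu f (us @ [y] @ vs))"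
    using a by (simp add: pu_def sy.hom sy.smhom smcl hom smhom hcochains_D[OF f])
qed

lemma map_th': "set xs \<subseteq> carrier R \<Longrightarrow> map th' (map th xs) = xs"
  by (induction xs) (auto simp: inv)

lemma pu_hdiff: assumes f: "f \<in> hcochains R smR n" shows "pu (hdiff R n f) = hdiff S n (pu f)"
proof
  fix ys :: "'c list"
  interpret sy: kiso S R smS smR th' th by (rule kiso_sym)
  show "pu (hdiff R n f) ys = hdiff S n (pu f) ys"
  proof (cases "length ys = Suc n \<and> set ys \<subseteq> carrier S")
    case False
    then show ?thesis by (auto simp: pu_def hdiff_def)
  next
    case True
    note fc = hcochains_D(1)[OF f]
    define xs where "xs = map th' ys"
    have xs: "length xs = Suc n" "set xs \<subseteq> carrier R" using True cl by (auto simp: xs_def)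
    have xi: "xs ! i \<in> carrier R" "xs ! i = th' (ys ! i)" "th (xs ! i) = ys ! i" "ys ! i \<in> carrier S" if "i \<le> n" for i
    proof -
      show "ys ! i \<in> carrier S" using True that by auto
      then show "xs ! i \<in> carrier R" "xs ! i = th' (ys ! i)" "th (xs ! i) = ys ! i" using True that cl inv by (auto simp: xs_def)
    qed
    have st: "set (take i ys) \<subseteq> carrier S" "set (drop i ys) \<subseteq> carrier S" "set (tl ys) \<subseteq> carrier S" for i
      using True by (auto dest: in_set_takeD in_set_dropD) (metis list.set_sel(2) list.size(3) nat.distinct(1) subsetD)
    let ?A = "\<lambda>i. f (take (i - 1) xs @ [xs ! (i - 1) \<otimes>\<^bsub>R\<^esub> xs ! i] @ drop (i + 1) xs)"
    have A: "th (?A i) = pu f (take (i - 1) ys @ [ys ! (i - 1) \<otimes>\<^bsub>S\<^esub> ys ! i] @ drop (i + 1) ys)" if "i \<in> {1..n}" for i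
    proof -
      have "i - 1 \<le> n" "i \<le> n" using that by auto
      then show ?thesis using st xi by (simp add: pu_def xs_def take_map drop_map sy.hom del: map_map)
    qed
    have fs: "th (finsum R (\<lambda>i. hsign R i (?A i)) {1..n}) = finsum S (\<lambda>i. hsign S i (pu f (take (i - 1) ys @ [ys ! (i - 1) \<otimes>\<^bsub>S\<^esub> ys ! i] @ drop (i + 1) ys))) {1..n}"
    proof -
      have "th (finsum R (\<lambda>i. hsign R i (?A i)) {1..n}) = finsum S (\<lambda>i. th (hsign R i (?A i))) {1..n}"
        by (rule th_finsum) (auto simp: hsign_closed fc)
      also have "\<dots> = finsum S (\<lambda>i. hsign S i (pu f (take (i - 1) ys @ [ys ! (i - 1) \<otimes>\<^bsub>S\<^esub> ys ! i] @ drop (i + 1) ys))) {1..n}"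
      proof (rule S.finsum_cong', simp)
        show "(\<lambda>i. hsign S i (pu f (take (i - 1) ys @ [ys ! (i - 1) \<otimes>\<^bsub>S\<^esub> ys ! i] @ drop (i + 1) ys))) \<in> {1..n} \<rightarrow> carrier S"
          using fc cl by (auto intro!: sy.hsign_closed simp: pu_def)
        fix i assume i: "i \<in> {1..n}"
        show "th (hsign R i (?A i)) = hsign S i (pu f (take (i - 1) ys @ [ys ! (i - 1) \<otimes>\<^bsub>S\<^esub> ys ! i] @ drop (i + 1) ys))"
          unfolding A[OF i, symmetric] by (rule th_hsign[OF fc])
      qed
      finally show ?thesis .
    qed
    have fin: "finsum R (\<lambda>i. hsign R i (?A i)) {1..n} \<in> carrier R"
      by (rule R.finsum_closed) (auto simp: hsign_closed fc)
    have "pu (hdiff R n f) ys = th ((xs ! 0 \<otimes>\<^bsub>R\<^esub> f (tl xs)) \<oplus>\<^bsub>R\<^esub> finsum R (\<lambda>i. hsign R i (?A i)) {1..n}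
       \<oplus>\<^bsub>R\<^esub> hsign R (Suc n) (f (take n xs) \<otimes>\<^bsub>R\<^esub> xs ! n))"
      using True xs by (simp add: pu_def hdiff_def xs_def)
    also have "\<dots> = (ys ! 0 \<otimes>\<^bsub>S\<^esub> th (f (tl xs))) \<oplus>\<^bsub>S\<^esub> th (finsum R (\<lambda>i. hsign R i (?A i)) {1..n})
       \<oplus>\<^bsub>S\<^esub> hsign S (Suc n) (th (f (take n xs)) \<otimes>\<^bsub>S\<^esub> ys ! n)"
      using xi fc fin by (simp add: hom th_hsign hsign_closed del: One_nat_def)
    also have "\<dots> = hdiff S n (pu f) ys"
      unfolding fs using True st by (simp add: hdiff_def pu_def xs_def map_tl take_map)
    finally show ?thesis .
  qed
qed

lemma pu_inv: "f \<in> hcochains S smS n \<Longrightarrow> pu (kiso.pu R th' th f) = f"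
proof
  fix ys assume f: "f \<in> hcochains S smS n"
  interpret sy: kiso S R smS smR th' th by (rule kiso_sym)
  show "pu (sy.pu f) ys = f ys"
  proof (cases "set ys \<subseteq> carrier S")
    case True
    have "pu (sy.pu f) ys = th (th' (f (map th (map th' ys))))"
      using True set_map_cl[OF True] by (simp add: pu_def sy.pu_def del: map_map)
    then show ?thesis using sy.map_th'[OF True] inv(2) sy.hcochains_D(1)[OF f] by simp
  next
    case False
    then show ?thesis using sy.hcochains_D(2)[OF f, of ys] by (auto simp: pu_def)
  qed
qed

lemma pu_zcoch: "pu (zcoch R) = zcoch S"
  by (auto simp: pu_def zcoch_def)

lemma pu_cocycle: "f \<in> hcocycles R smR n \<Longrightarrow> pu f \<in> hcocycles S smS n"
  using pu_cochain[of f n] pu_hdiff[of f n] pu_zcoch by (auto simp: hcocycles_def)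

lemma pu_cobound: "f \<in> hcobound R smR n \<Longrightarrow> pu f \<in> hcobound S smS n"
  using pu_zcoch pu_cochain pu_hdiff by (auto simp: hcobound_def split: if_splits)

definition U :: "(nat \<Rightarrow> 'a list \<Rightarrow> 'a) \<Rightarrow> nat \<Rightarrow> 'c list \<Rightarrow> 'c" where
  "U F = (\<lambda>n. pu (F n))"

lemma C_D: assumes "F \<in> carrier (cocycle_ring R smR)"
  shows "F n \<in> hcocycles R smR n" "F n \<in> hcochains R smR n" "finite {n. F n \<noteq> zcoch R}" "F n xs \<in> carrier R"
  using assms hcochains_D(1)[of "F n" n xs] by (auto simp: cocycle_ring_def hcocycles_def)

lemma U_closed: "F \<in> carrier (cocycle_ring R smR) \<Longrightarrow> U F \<in> carrier (cocycle_ring S smS)"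
proof -
  assume F: "F \<in> carrier (cocycle_ring R smR)"
  have "{n. U F n \<noteq> zcoch S} \<subseteq> {n. F n \<noteq> zcoch R}" using pu_zcoch by (auto simp: U_def)
  then have "finite {n. U F n \<noteq> zcoch S}" using C_D(3)[OF F] by (rule finite_subset)
  then show ?thesis using C_D(1)[OF F] pu_cocycle by (simp add: cocycle_ring_def U_def)
qed

lemma U_inv: "F \<in> carrier (cocycle_ring S smS) \<Longrightarrow> U (kiso.U R th' th F) = F"
proof -
  assume F: "F \<in> carrier (cocycle_ring S smS)"
  interpret sy: kiso S R smS smR th' th by (rule kiso_sym)
  show ?thesis using pu_inv[OF sy.C_D(2)[OF F]] by (simp add: U_def sy.U_def)
qed

lemma U_add: "F \<in> carrier (cocycle_ring R smR) \<Longrightarrow> G \<in> carrier (cocycle_ring R smR) \<Longrightarrow>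
   U (F \<oplus>\<^bsub>cocycle_ring R smR\<^esub> G) = U F \<oplus>\<^bsub>cocycle_ring S smS\<^esub> U G"
proof (intro ext)
  fix n ys assume F: "F \<in> carrier (cocycle_ring R smR)" and G: "G \<in> carrier (cocycle_ring R smR)"
  show "U (F \<oplus>\<^bsub>cocycle_ring R smR\<^esub> G) n ys = (U F \<oplus>\<^bsub>cocycle_ring S smS\<^esub> U G) n ys"
    using hom(1)[OF C_D(4)[OF F] C_D(4)[OF G]] by (simp add: U_def cocycle_ring_def pu_def)
qed

lemma U_mult: assumes F: "F \<in> carrier (cocycle_ring R smR)" and G: "G \<in> carrier (cocycle_ring R smR)"
  shows "U (F \<otimes>\<^bsub>cocycle_ring R smR\<^esub> G) = U F \<otimes>\<^bsub>cocycle_ring S smS\<^esub> U G"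
proof (intro ext)
  fix n and ys :: "'c list"
  interpret sy: kiso S R smS smR th' th by (rule kiso_sym)
  show "U (F \<otimes>\<^bsub>cocycle_ring R smR\<^esub> G) n ys = (U F \<otimes>\<^bsub>cocycle_ring S smS\<^esub> U G) n ys"
  proof (cases "length ys = n \<and> set ys \<subseteq> carrier S")
    case False
    then show ?thesis by (auto simp: U_def cocycle_ring_def pu_def)
  next
    case True
    have st: "set (take i ys) \<subseteq> carrier S" "set (drop i ys) \<subseteq> carrier S" for i
      using True by (auto dest: in_set_takeD in_set_dropD)
    have "U (F \<otimes>\<^bsub>cocycle_ring R smR\<^esub> G) n ys = th (finsum R (\<lambda>p. F p (take p (map th' ys)) \<otimes>\<^bsub>R\<^esub> G (n - p) (drop p (map th' ys))) {0..n})"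
      using True set_map_cl[of ys] by (simp add: U_def cocycle_ring_def pu_def)
    also have "\<dots> = finsum S (\<lambda>p. th (F p (take p (map th' ys)) \<otimes>\<^bsub>R\<^esub> G (n - p) (drop p (map th' ys)))) {0..n}"
      by (rule th_finsum) (auto simp: C_D[OF F] C_D[OF G])
    also have "\<dots> = finsum S (\<lambda>p. U F p (take p ys) \<otimes>\<^bsub>S\<^esub> U G (n - p) (drop p ys)) {0..n}"
      by (rule S.finsum_cong') (auto simp: U_def pu_def st hom cl C_D[OF F] C_D[OF G] take_map drop_map)
    also have "\<dots> = (U F \<otimes>\<^bsub>cocycle_ring S smS\<^esub> U G) n ys"
      using True by (simp add: cocycle_ring_def)
    finally show ?thesis .
  qed
qed

lemma U_one: "U \<one>\<^bsub>cocycle_ring R smR\<^esub> = \<one>\<^bsub>cocycle_ring S smS\<^esub>"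
  by (auto simp: U_def cocycle_ring_def pu_def fun_eq_iff hom)

lemma U_zero: "U \<zero>\<^bsub>cocycle_ring R smR\<^esub> = \<zero>\<^bsub>cocycle_ring S smS\<^esub>"
  by (auto simp: U_def cocycle_ring_def pu_zcoch)

lemma U_hom: "U \<in> ring_hom (cocycle_ring R smR) (cocycle_ring S smS)"
  by (rule ring_hom_memI) (auto simp: U_closed U_mult U_add U_one)

lemma U_image: "U ` carrier (cocycle_ring R smR) = carrier (cocycle_ring S smS)"
proof (intro equalityI subsetI)
  fix F assume F: "F \<in> carrier (cocycle_ring S smS)"
  interpret sy: kiso S R smS smR th' th by (rule kiso_sym)
  show "F \<in> U ` carrier (cocycle_ring R smR)"
    using imageI[OF sy.U_closed[OF F], of U] U_inv[OF F] by simp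
qed (auto simp: U_closed)

lemma U_inj: "inj_on U (carrier (cocycle_ring R smR))"
proof (rule inj_on_inverseI)
  interpret sy: kiso S R smS smR th' th by (rule kiso_sym)
  fix F assume "F \<in> carrier (cocycle_ring R smR)"
  then show "sy.U (U F) = F" by (rule sy.U_inv)
qed

lemma U_coboundary: assumes F: "F \<in> carrier (cocycle_ring R smR)"
  shows "U F \<in> coboundary_ideal S smS \<longleftrightarrow> F \<in> coboundary_ideal R smR"
proof -
  interpret sy: kiso S R smS smR th' th by (rule kiso_sym)
  have "U F \<in> coboundary_ideal S smS" if "F \<in> coboundary_ideal R smR"
    using that U_closed pu_cobound by (simp add: coboundary_ideal_def U_def)
  moreover have "sy.U (U F) \<in> coboundary_ideal R smR" if "U F \<in> coboundary_ideal S smS"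
    using that sy.U_closed sy.pu_cobound by (simp add: coboundary_ideal_def sy.U_def)
  ultimately show ?thesis using sy.U_inv[OF F] by auto
qed

lemma U_smul: "F \<in> carrier (cocycle_ring R smR) \<Longrightarrow> (\<And>c. smS c \<zero>\<^bsub>S\<^esub> = \<zero>\<^bsub>S\<^esub>) \<Longrightarrow> U (cocycle_smul smR c F) = cocycle_smul smS c (U F)"
  by (auto simp: U_def cocycle_smul_def pu_def fun_eq_iff smhom C_D)

text \<open>The ring axioms are verified on the coordinate side and carried to the quotient of the
  path algebra by the inverse isomorphism.\<close>

lemma cocycle_ring_transfer:
  assumes "ring (cocycle_ring S smS)" shows "ring (cocycle_ring R smR)"
proof -
  interpret sy: kiso S R smS smR th' th by (rule kiso_sym)
  interpret C: ring "cocycle_ring S smS" by (rule assms)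
  have "sy.U \<in> ring_iso (cocycle_ring S smS) (cocycle_ring R smR)"
    using sy.U_hom sy.U_image sy.U_inj by (simp add: ring_iso_def bij_betw_def)
  then have "ring ((cocycle_ring R smR) \<lparr>zero := sy.U \<zero>\<^bsub>cocycle_ring S smS\<^esub>\<rparr>)"
    by (rule C.ring_iso_imp_img_ring)
  then show ?thesis unfolding sy.U_zero by simp
qed

end

section \<open>The quiver algebra in coordinates\<close>

lemma path_end_append: "path_end m v (l @ l') = path_end m (path_end m v l) l'"
  by (induction l arbitrary: v) auto

lemma valid_from_append: "valid_from m v (l @ l') \<longleftrightarrow> valid_from m v l \<and> valid_from m (path_end m v l) l'"
proof (induction l arbitrary: v)
  case Nil
  show ?case by (cases l') auto
qed auto

lemma valid_from_start: "valid_from m v l \<Longrightarrow> v < m"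
  by (cases l) auto

lemma valid_from_end: "valid_from m v l \<Longrightarrow> path_end m v l < m"
  by (induction l arbitrary: v) auto

section \<open>The path algebra is a ring\<close>

lemma PA_simps:
  "carrier (path_alg m) = {f. finite (supp f) \<and> (\<forall>x. f x \<noteq> 0 \<longrightarrow> valid_path m x)}"
  "one (path_alg m) = (\<lambda>z. if snd z = [] \<and> fst z < m then 1 else 0)"
  "ring.zero (path_alg m) = (\<lambda>z. 0)" "ring.add (path_alg m) = (\<lambda>f g z. f z + g z)"
  by (simp_all add: path_alg_def)

lemma PA_D: "f \<in> carrier (path_alg m) \<Longrightarrow> finite (supp f)" "f \<in> carrier (path_alg m) \<Longrightarrow> f (v, l) \<noteq> 0 \<Longrightarrow> valid_from m v l"
  by (auto simp: PA_simps valid_path_def)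

text \<open>The pairs of paths that concatenate to a given path correspond to its cutting positions,
  which replaces the double sum over supports.\<close>

lemma PA_mult:
  assumes f: "finite (supp f)" and g: "finite (supp g)"
  shows "(f \<otimes>\<^bsub>path_alg m\<^esub> g) (v, l) = (\<Sum>k\<le>length l. f (v, take k l) * g (path_end m v (take k l), drop k l))"
proof -
  let ?P = "\<lambda>k. ((v, take k l), (path_end m v (take k l), drop k l))"
  let ?A = "supp f \<times> supp g"
  have "(f \<otimes>\<^bsub>path_alg m\<^esub> g) (v, l) = (\<Sum>(x, y)\<in>?A. if path_conc m x y = Some (v, l) then f x * g y else 0)"
    by (simp add: path_alg_def sum.cartesian_product)
  also have "\<dots> = (\<Sum>(x, y)\<in>?P ` {..length l}. f x * g y)"
  proof (rule sum.mono_neutral_cong)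
    show "finite ?A" using f g by simp
    show "\<And>i. i \<in> ?P ` {..length l} - ?A \<Longrightarrow> (case i of (x, y) \<Rightarrow> f x * g y) = 0" by (auto simp: supp_def)
    show "(case i of (x, y) \<Rightarrow> if path_conc m x y = Some (v, l) then f x * g y else 0) = 0" if i: "i \<in> ?A - ?P ` {..length l}" for i
    proof -
      obtain x y where xy: "i = (x, y)" by (cases i)
      have "path_conc m x y \<noteq> Some (v, l)"
      proof
        assume c: "path_conc m x y = Some (v, l)"
        obtain a b c' d where [simp]: "x = (a, b)" "y = (c', d)" by (cases x, cases y)
        have "i = ?P (length b)" using c by (auto simp: path_conc_def xy split: if_splits)
        moreover have "length b \<le> length l" using c by (auto simp: path_conc_def split: if_splits)
        ultimately show False using i by blast
      qed
      then show ?thesis by (simp add: xy)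
    qed
    show "\<And>x. x \<in> ?A \<inter> ?P ` {..length l} \<Longrightarrow> (case x of (x, y) \<Rightarrow> if path_conc m x y = Some (v, l) then f x * g y else 0) = (case x of (x, y) \<Rightarrow> f x * g y)"
      by (auto simp: path_conc_def)
  qed simp
  also have "\<dots> = (\<Sum>k\<le>length l. f (v, take k l) * g (path_end m v (take k l), drop k l))"
  proof (subst sum.reindex)
    show "inj_on ?P {..length l}"
      by (rule inj_on_inverseI[of _ "\<lambda>p. length (snd (fst p))"]) simp
  qed simp
  finally show ?thesis .
qed

lemma PA_mult_closed: assumes f: "f \<in> carrier (path_alg m)" and g: "g \<in> carrier (path_alg m)"
  shows "f \<otimes>\<^bsub>path_alg m\<^esub> g \<in> carrier (path_alg m)"
proof -
  have ex: "\<exists>x y. f x \<noteq> 0 \<and> g y \<noteq> 0 \<and> path_conc m x y = Some z" if "(f \<otimes>\<^bsub>path_alg m\<^esub> g) z \<noteq> 0" for z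
  proof (rule ccontr)
    assume *: "\<not> ?thesis"
    have "(if path_conc m x y = Some z then f x * g y else 0) = 0" for x y using * by (cases "f x = 0"; cases "g y = 0") (auto simp del: split_paired_All split_paired_Ex)
    then have "(f \<otimes>\<^bsub>path_alg m\<^esub> g) z = 0" by (simp add: path_alg_def)
    with that show False by simp
  qed
  have "supp (f \<otimes>\<^bsub>path_alg m\<^esub> g) \<subseteq> (\<lambda>(x, y). the (path_conc m x y)) ` (supp f \<times> supp g)"
  proof
    fix z assume "z \<in> supp (f \<otimes>\<^bsub>path_alg m\<^esub> g)"
    then obtain x y where "f x \<noteq> 0" "g y \<noteq> 0" "path_conc m x y = Some z" using ex unfolding supp_def by blast
    then show "z \<in> (\<lambda>(x, y). the (path_conc m x y)) ` (supp f \<times> supp g)"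
      by (intro image_eqI[of _ _ "(x, y)"]) (auto simp: supp_def)
  qed
  then have 1: "finite (supp (f \<otimes>\<^bsub>path_alg m\<^esub> g))" using PA_D(1)[OF f] PA_D(1)[OF g] by (meson finite_SigmaI finite_imageI finite_subset)
  have 2: "valid_path m z" if nz: "(f \<otimes>\<^bsub>path_alg m\<^esub> g) z \<noteq> 0" for z
  proof -
    obtain x y where xy: "f x \<noteq> 0" "g y \<noteq> 0" "path_conc m x y = Some z" using ex[OF nz] by blast
    then have "valid_path m x" "valid_path m y" using f g by (auto simp: PA_simps(1) simp del: split_paired_All)
    then show ?thesis using xy(3) by (auto simp: path_conc_def valid_path_def valid_from_append split: if_splits)
  qed
  show ?thesis using 1 2 by (simp add: PA_simps)
qed

lemma PA_assoc:
  assumes f: "f \<in> carrier (path_alg m)" and g: "g \<in> carrier (path_alg m)" and h: "h \<in> carrier (path_alg m)"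
  shows "(f \<otimes>\<^bsub>path_alg m\<^esub> g) \<otimes>\<^bsub>path_alg m\<^esub> h = f \<otimes>\<^bsub>path_alg m\<^esub> (g \<otimes>\<^bsub>path_alg m\<^esub> h)"
proof
  fix z :: path
  obtain v l where z: "z = (v, l)" by (cases z)
  note fin = PA_D(1)[OF f] PA_D(1)[OF g] PA_D(1)[OF h] PA_D(1)[OF PA_mult_closed[OF f g]] PA_D(1)[OF PA_mult_closed[OF g h]]
  let ?n = "length l"
  define F where "F a b = f (v, take a l) * (g (path_end m v (take a l), take b (drop a l)) * h (path_end m v (take (a + b) l), drop (a + b) l))" for a b
  have "((f \<otimes>\<^bsub>path_alg m\<^esub> g) \<otimes>\<^bsub>path_alg m\<^esub> h) (v, l) = (\<Sum>k\<le>?n. \<Sum>a\<le>k. F a (k - a))"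
    unfolding PA_mult[OF fin(4,3)] unfolding PA_mult[OF fin(1,2)] sum_distrib_right
  proof (intro sum.cong refl, goal_cases)
    case (1 k)
    then show ?case by auto
  next
    case (2 k a)
    then have "a \<le> k" "k \<le> ?n" by auto
    then show ?case by (simp add: F_def drop_take min_def)
  qed
  also have "\<dots> = (\<Sum>(a, b)\<in>{(i, j). i + j \<le> ?n}. F a b)" by (rule sum.triangle_reindex_eq[symmetric])
  also have "{(i, j). i + j \<le> ?n} = (SIGMA a:{..?n}. {..?n - a})" by auto
  also have "(\<Sum>(a, b)\<in>(SIGMA a:{..?n}. {..?n - a}). F a b) = (\<Sum>a\<le>?n. \<Sum>b\<le>?n - a. F a b)"
    by (rule sum.Sigma[symmetric]) auto
  also have "\<dots> = (f \<otimes>\<^bsub>path_alg m\<^esub> (g \<otimes>\<^bsub>path_alg m\<^esub> h)) (v, l)"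
    unfolding PA_mult[OF fin(1,5)] unfolding PA_mult[OF fin(2,3)] sum_distrib_left
    by (intro sum.cong refl) (simp_all add: F_def path_end_append[symmetric] take_add add.commute)
  finally show "((f \<otimes>\<^bsub>path_alg m\<^esub> g) \<otimes>\<^bsub>path_alg m\<^esub> h) z = (f \<otimes>\<^bsub>path_alg m\<^esub> (g \<otimes>\<^bsub>path_alg m\<^esub> h)) z" by (simp add: z)
qed

lemma PA_add_closed: "f \<in> carrier (path_alg m) \<Longrightarrow> g \<in> carrier (path_alg m) \<Longrightarrow> (\<lambda>z. f z + g z) \<in> carrier (path_alg m)"
proof -
  assume f: "f \<in> carrier (path_alg m)" and g: "g \<in> carrier (path_alg m)"
  have "supp (\<lambda>z. f z + g z) \<subseteq> supp f \<union> supp g" by (auto simp: supp_def)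
  then have "finite (supp (\<lambda>z. f z + g z))" using PA_D(1)[OF f] PA_D(1)[OF g] by (meson finite_UnI finite_subset)
  then show ?thesis using f g by (simp add: PA_simps(1) del: split_paired_All) (metis add_0)
qed

lemma PA_smul_closed: "f \<in> carrier (path_alg m) \<Longrightarrow> path_smul c f \<in> carrier (path_alg m)"
proof -
  assume f: "f \<in> carrier (path_alg m)"
  have "supp (path_smul c f) \<subseteq> supp f" by (auto simp: supp_def path_smul_def)
  then have "finite (supp (path_smul c f))" using PA_D(1)[OF f] by (rule finite_subset)
  then show ?thesis using f by (auto simp: PA_simps path_smul_def)
qed

lemma PA_one_closed: "\<one>\<^bsub>path_alg m\<^esub> \<in> carrier (path_alg m :: (path \<Rightarrow> 'k::field) ring)"
proof -
  have "supp (\<one>\<^bsub>path_alg m\<^esub> :: path \<Rightarrow> 'k) \<subseteq> {..<m} \<times> {[]}" by (auto simp: supp_def PA_simps split: if_splits)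
  then have "finite (supp (\<one>\<^bsub>path_alg m\<^esub> :: path \<Rightarrow> 'k))" by (rule finite_subset) simp
  then show ?thesis by (auto simp: PA_simps valid_path_def split: if_splits)
qed

lemma PA_ring: "ring (path_alg m :: (path \<Rightarrow> 'k::field) ring)"
proof (rule ringI)
  let ?R = "path_alg m :: (path \<Rightarrow> 'k) ring"
  show "abelian_group ?R"
  proof (rule abelian_groupI)
    show "\<zero>\<^bsub>?R\<^esub> \<in> carrier ?R" by (simp add: PA_simps supp_def)
    fix f assume f: "f \<in> carrier ?R"
    show "\<exists>g\<in>carrier ?R. g \<oplus>\<^bsub>?R\<^esub> f = \<zero>\<^bsub>?R\<^esub>"
proof (rule bexI)
      show "path_smul (-1) f \<oplus>\<^bsub>?R\<^esub> f = \<zero>\<^bsub>?R\<^esub>" by (simp add: PA_simps(3,4) path_smul_def)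
      show "path_smul (-1) f \<in> carrier ?R" by (rule PA_smul_closed[OF f])
    qed
    fix g assume g: "g \<in> carrier ?R"
    show "f \<oplus>\<^bsub>?R\<^esub> g \<in> carrier ?R" using PA_add_closed[OF f g] by (simp add: PA_simps(4))
  qed (simp_all add: PA_simps(3,4) add_ac PA_simps(1) supp_def)
  show "Group.monoid ?R"
  proof (rule monoidI)
    fix f assume f: "f \<in> carrier ?R"
    note fin = PA_D(1)[OF f] PA_D(1)[OF PA_one_closed[of m]]
    show "\<one>\<^bsub>?R\<^esub> \<otimes>\<^bsub>?R\<^esub> f = f"
    proof
      fix z :: path obtain v l where z: "z = (v, l)" by (cases z)
      have "(\<one>\<^bsub>?R\<^esub> \<otimes>\<^bsub>?R\<^esub> f) (v, l) = (\<Sum>k\<le>length l. if k = 0 then f (v, l) else 0)"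
        unfolding PA_mult[OF fin(2,1)]
        by (intro sum.cong refl) (use PA_D(2)[OF f, of v l] in \<open>auto simp: PA_simps dest: valid_from_start\<close>)
      then show "(\<one>\<^bsub>?R\<^esub> \<otimes>\<^bsub>?R\<^esub> f) z = f z" by (simp add: z)
    qed
    show "f \<otimes>\<^bsub>?R\<^esub> \<one>\<^bsub>?R\<^esub> = f"
    proof
      fix z :: path obtain v l where z: "z = (v, l)" by (cases z)
      have "(f \<otimes>\<^bsub>?R\<^esub> \<one>\<^bsub>?R\<^esub>) (v, l) = (\<Sum>k\<le>length l. if k = length l then f (v, l) else 0)"
        unfolding PA_mult[OF fin(1,2)]
        by (intro sum.cong refl) (use PA_D(2)[OF f, of v l] in \<open>auto simp: PA_simps dest: valid_from_end\<close>)
      then show "(f \<otimes>\<^bsub>?R\<^esub> \<one>\<^bsub>?R\<^esub>) z = f z" by (simp add: z)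
    qed
  qed (simp_all add: PA_mult_closed PA_one_closed PA_assoc)
  fix f g h assume c: "f \<in> carrier ?R" "g \<in> carrier ?R" "h \<in> carrier ?R"
  note fin = PA_D(1)[OF c(1)] PA_D(1)[OF c(2)] PA_D(1)[OF c(3)] PA_D(1)[OF PA_add_closed[OF c(1,2)]]
  show "(f \<oplus>\<^bsub>?R\<^esub> g) \<otimes>\<^bsub>?R\<^esub> h = f \<otimes>\<^bsub>?R\<^esub> h \<oplus>\<^bsub>?R\<^esub> g \<otimes>\<^bsub>?R\<^esub> h"
    unfolding PA_simps(4) by (rule ext, rename_tac z, case_tac z) (simp add: PA_mult[OF fin(4,3)] PA_mult[OF fin(1,3)] PA_mult[OF fin(2,3)] sum.distrib distrib_right)
  show "h \<otimes>\<^bsub>?R\<^esub> (f \<oplus>\<^bsub>?R\<^esub> g) = h \<otimes>\<^bsub>?R\<^esub> f \<oplus>\<^bsub>?R\<^esub> h \<otimes>\<^bsub>?R\<^esub> g"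
    unfolding PA_simps(4) by (rule ext, rename_tac z, case_tac z) (simp add: PA_mult[OF fin(3,4)] PA_mult[OF fin(3,1)] PA_mult[OF fin(3,2)] sum.distrib distrib_left)
qed

lemma supp_pdelta: "supp (pdelta p :: path \<Rightarrow> 'k::field) = {p}"
  by (auto simp: supp_def pdelta_def)

lemma pdelta_closed: "valid_path m p \<Longrightarrow> pdelta p \<in> carrier (path_alg m :: (path \<Rightarrow> 'k::field) ring)"
  by (simp add: PA_simps supp_pdelta) (simp add: pdelta_def)

lemma pdelta_mult: "pdelta (v, l) \<otimes>\<^bsub>path_alg m\<^esub> pdelta (path_end m v l, l') = (pdelta (v, l @ l') :: path \<Rightarrow> 'k::field)"
proof
  fix z
  have "(pdelta (v, l) \<otimes>\<^bsub>path_alg m\<^esub> pdelta (path_end m v l, l') :: path \<Rightarrow> 'k) z =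
     (\<Sum>x\<in>{(v, l)}. \<Sum>y\<in>{(path_end m v l, l')}. if path_conc m x y = Some z then pdelta (v, l) x * pdelta (path_end m v l, l') y else 0)"
    by (simp only: path_alg_def supp_pdelta monoid.select_convs)
  then show "(pdelta (v, l) \<otimes>\<^bsub>path_alg m\<^esub> pdelta (path_end m v l, l') :: path \<Rightarrow> 'k) z = pdelta (v, l @ l') z"
    by (auto simp: path_conc_def pdelta_def)
qed

context qv
begin

definition nx :: "nat \<Rightarrow> nat" where "nx i = (i + 1) mod m"
definition pr :: "nat \<Rightarrow> nat" where "pr i = (i + m - 1) mod m"
definition rd :: "int \<Rightarrow> nat" where "rd j = nat (j mod int m)"

lemma rd_lt [simp]: "rd j < m"
  using m1 by (simp add: rd_def nat_less_iff)

lemma nx_lt [simp]: "nx j < m" "pr j < m"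
  using m1 by (simp_all add: nx_def pr_def)

lemma rd_nx: "rd (j + 1) = nx (rd j)"
proof -
  have "int (nx (rd j)) = (j mod int m + 1) mod int m"
    using m1 by (simp add: nx_def rd_def zmod_int add.commute)
  also have "\<dots> = (j + 1) mod int m" by (simp add: mod_simps)
  finally show ?thesis using m1 by (simp add: rd_def)
qed

lemma rd_pr: "rd (j - 1) = pr (rd j)"
proof -
  have "int (pr (rd j)) = (j mod int m + int m - 1) mod int m"
    using m1 by (simp add: pr_def rd_def zmod_int of_nat_diff)
  also have "\<dots> = (j - 1) mod int m" by (metis (no_types, lifting) add_diff_eq diff_add_eq mod_add_self2 mod_diff_left_eq)
  finally show ?thesis using m1 by (simp add: rd_def)
qed

lemma nx_pr [simp]: "v < m \<Longrightarrow> nx (pr v) = v" "v < m \<Longrightarrow> pr (nx v) = v"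
proof -
  assume v: "v < m"
  have r: "rd (int v) = v" using v by (simp add: rd_def)
  show "nx (pr v) = v" "pr (nx v) = v"
    using rd_nx[of "int v - 1"] rd_pr[of "int v"] rd_pr[of "int v + 1"] rd_nx[of "int v"] r by simp_all
qed

lemma rd_shift [simp]: "rd (j + int m) = rd j"
  by (simp add: rd_def)

lemma Q_rd: "Q j = q (rd j)"
  by (simp add: Q_def rd_def)

abbreviation PA :: "(path \<Rightarrow> 'k) ring" where "PA \<equiv> path_alg m"

text \<open>Coordinates modulo the relations: \<open>abar a\<close> at the vertex \<open>i\<close>
  counts as \<open>q i\<close> times \<open>a abar\<close>, and all paths that lie in the ideal are
  ignored.\<close>

definition t0 :: "(path \<Rightarrow> 'k) \<Rightarrow> 'k el" where
  "t0 f = El (\<lambda>k j. let i = rd j in case k of KE \<Rightarrow> f (i, []) | KA \<Rightarrow> f (i, [Aa i]) | KB \<Rightarrow> f (i, [Ab (pr i)])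
     | KP \<Rightarrow> f (i, [Aa i, Ab i]) + q i * f (i, [Ab (pr i), Aa (pr i)]))"

lemma t0_app [simp]: "cf (t0 f) KE j = f (rd j, [])" "cf (t0 f) KA j = f (rd j, [Aa (rd j)])" "cf (t0 f) KB j = f (rd j, [Ab (pr (rd j))])"
  "cf (t0 f) KP j = f (rd j, [Aa (rd j), Ab (rd j)]) + q (rd j) * f (rd j, [Ab (pr (rd j)), Aa (pr (rd j))])"
  by (simp_all add: t0_def Let_def)

lemma t0_V: "t0 f \<in> V"
  by (simp add: V_def t0_def)

lemma pr_eq: "(i + m - 1) mod m = pr i" "(i + m - Suc 0) mod m = pr i"
  by (simp_all add: pr_def)

lemma nx_eq: "(i + 1) mod m = nx i" "Suc i mod m = nx i"
  by (simp_all add: nx_def)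

text \<open>The coordinates only read paths of length at most two, so at most three cutting
  positions occur.\<close>

lemma t0_mult: assumes f: "f \<in> carrier PA" and g: "g \<in> carrier PA"
  shows "t0 (f \<otimes>\<^bsub>PA\<^esub> g) = t0 f \<star> t0 g"
proof -
  note fin = PA_mult[OF PA_D(1)[OF f] PA_D(1)[OF g]]
  have 1: "{..Suc 0} = {0, 1}" "{..Suc (Suc 0)} = {0, 1, 2 :: nat}" by auto
  show ?thesis
    by (rule el_eqI) (simp_all add: fin 1 rd_nx rd_pr nx_eq Q_rd numeral_2_eq_2 algebra_simps)
qed

lemma t0_hom: "ring_hom_ring PA CLr t0"
proof (rule ring_hom_ringI2)
  show "ring PA" by (rule PA_ring)
  show "ring CLr" by (rule CLr_ring)
  show "t0 \<in> ring_hom PA CLr"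
  proof (rule ring_hom_memI)
    fix f g assume "f \<in> carrier PA" "g \<in> carrier PA"
    then show "t0 (f \<otimes>\<^bsub>PA\<^esub> g) = t0 f \<otimes>\<^bsub>CLr\<^esub> t0 g" by (simp add: t0_mult)
    show "t0 (f \<oplus>\<^bsub>PA\<^esub> g) = t0 f \<oplus>\<^bsub>CLr\<^esub> t0 g" unfolding CLr_simps PA_simps by (rule el_eqI) (simp_all add: algebra_simps)
  next
    show "t0 \<one>\<^bsub>PA\<^esub> = \<one>\<^bsub>CLr\<^esub>" unfolding CLr_simps PA_simps by (rule el_eqI) (simp_all add: one1_def)
  qed (simp_all add: t0_V)
qed

text \<open>The linear section of \<open>t0\<close> whose values are the normal forms, with
  \<open>a abar\<close> representing the \<open>KP\<close> part.\<close>

definition sec :: "'k el \<Rightarrow> path \<Rightarrow> 'k" where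
  "sec y = (\<lambda>(v, l). if v < m then (if l = [] then cf y KE (int v) else if l = [Aa v] then cf y KA (int v)
     else if l = [Ab (pr v)] then cf y KB (int v) else if l = [Aa v, Ab v] then cf y KP (int v) else 0) else 0)"

lemma sec_closed: "sec y \<in> carrier PA"
proof -
  have "supp (sec y) \<subseteq> (\<Union>v\<in>{..<m}. {(v, []), (v, [Aa v]), (v, [Ab (pr v)]), (v, [Aa v, Ab v])})"
    by (auto simp: supp_def sec_def split: if_splits)
  then have "finite (supp (sec y))" by (rule finite_subset) simp
  moreover have "valid_path m z" if nz: "sec y z \<noteq> 0" for z
  proof -
    obtain v l where z: "z = (v, l)" by (cases z)
    have v: "v < m" "l = [] \<or> l = [Aa v] \<or> l = [Ab (pr v)] \<or> l = [Aa v, Ab v]"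
      using nz by (auto simp: sec_def z split: if_splits)
    then have "nx v < m" "nx (pr v) = v" "pr v < m" by simp_all
    then show ?thesis using v by (auto simp: z valid_path_def nx_eq)
  qed
  ultimately show ?thesis by (simp add: PA_simps(1) del: split_paired_All)
qed

lemma V_rd: "y \<in> V \<Longrightarrow> cf y k (int (rd j)) = cf y k j"
  by (rule V_D') (use m1 in \<open>simp_all add: rd_def cong_def\<close>)

lemma t0_sec: "y \<in> V \<Longrightarrow> t0 (sec y) = y"
  by (rule el_eqI) (simp_all add: sec_def V_rd)

section \<open>Reduction of paths modulo the relations\<close>

abbreviation II :: "(path \<Rightarrow> 'k) set" where "II \<equiv> rel_ideal m q"

lemma gens: assumes "i < m"
  shows "pdelta (i, [Aa i, Aa (nx i)]) \<in> II" "pdelta (i, [Ab (pr i), Ab (pr (pr i))]) \<in> II"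
   "(\<lambda>z. q i * pdelta (i, [Aa i, Ab i]) z - pdelta (i, [Ab (pr i), Aa (pr i)]) z) \<in> II"
   and "rel_gens m q \<subseteq> carrier PA"
proof -
  have p: "(i + 2 * m - 2) mod m = pr (pr i)" if "i < m" for i
  proof -
    have "int ((i + 2 * m - 2) mod m) = (int i + 2 * int m - 2) mod int m"
      using m1 by (simp add: zmod_int of_nat_diff)
    also have "\<dots> = (int i - 1 - 1) mod int m"
      by (metis (no_types, opaque_lifting) add_diff_eq diff_add_eq diff_diff_eq mod_add_self2 mult_2 one_add_one mod_mult_self1 mult.commute)
    also have "\<dots> = int (rd (int i - 1 - 1))" using m1 by (simp add: rd_def)
    also have "\<dots> = int (pr (pr i))" unfolding rd_pr[of "int i - 1"] rd_pr[of "int i"] using that by (simp add: rd_def)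
    finally show ?thesis by simp
  qed
  have vp: "valid_path m (i, [Aa i, Aa (nx i)])" "valid_path m (i, [Ab (pr i), Ab (pr (pr i))])" "valid_path m (i, [Aa i, Ab i])"
     "valid_path m (i, [Ab (pr i), Aa (pr i)])" if "i < m" for i
    using that nx_pr[OF that] nx_pr(1)[of "pr i"] by (simp_all add: valid_path_def nx_eq)
  have R: "(\<lambda>z. q i * pdelta (i, [Aa i, Ab i]) z - pdelta (i, [Ab (pr i), Aa (pr i)]) z) \<in> carrier PA" if i: "i < m" for i
  proof -
    have "(\<lambda>z. path_smul (q i) (pdelta (i, [Aa i, Ab i])) z + path_smul (-1) (pdelta (i, [Ab (pr i), Aa (pr i)])) z) \<in> carrier PA"
      by (intro PA_add_closed PA_smul_closed pdelta_closed vp i)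
    then show ?thesis by (simp add: path_smul_def)
  qed
  show G: "rel_gens m q \<subseteq> carrier PA"
    using R vp p pdelta_closed[where 'k = 'k and m = m] by (auto simp: rel_gens_def nx_eq pr_eq)
  interpret ring PA by (rule PA_ring)
  have "rel_gens m q \<subseteq> II" unfolding rel_ideal_def by (rule genideal_self[OF G])
  moreover have "pdelta (i, [Aa i, Aa (nx i)]) \<in> rel_gens m q" "pdelta (i, [Ab (pr i), Ab (pr (pr i))]) \<in> rel_gens m q"
   "(\<lambda>z. q i * pdelta (i, [Aa i, Ab i]) z - pdelta (i, [Ab (pr i), Aa (pr i)]) z) \<in> rel_gens m q"
    using assms p[OF assms] unfolding rel_gens_def by (auto simp: nx_eq pr_eq intro!: bexI[of _ i])
  ultimately show "pdelta (i, [Aa i, Aa (nx i)]) \<in> II" "pdelta (i, [Ab (pr i), Ab (pr (pr i))]) \<in> II"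
   "(\<lambda>z. q i * pdelta (i, [Aa i, Ab i]) z - pdelta (i, [Ab (pr i), Aa (pr i)]) z) \<in> II" by auto
qed

lemma II_ideal: "ideal II PA"
  unfolding rel_ideal_def by (rule ring.genideal_ideal[OF PA_ring gens(4)[of 0]]) (use m1 in simp)

lemma II_add: "f \<in> II \<Longrightarrow> g \<in> II \<Longrightarrow> (\<lambda>z. f z + g z) \<in> II"
  using additive_subgroup.a_closed[OF ideal.axioms(1)[OF II_ideal]] by (simp add: PA_simps(4))

text \<open>The ideal is generated in the sense of rings; it is stable under scalars because a
  scalar acts as left multiplication by that multiple of the identity.\<close>

lemma II_smul: assumes f: "f \<in> II" shows "path_smul c f \<in> II"
proof -
  have fc: "f \<in> carrier PA" using f ideal.Icarr[OF II_ideal] by blast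
  have c: "path_smul c \<one>\<^bsub>PA\<^esub> \<in> carrier PA" by (intro PA_smul_closed PA_one_closed)
  have "path_smul c \<one>\<^bsub>PA\<^esub> \<otimes>\<^bsub>PA\<^esub> f = path_smul c f"
  proof
    fix z :: path obtain v l where z: "z = (v, l)" by (cases z)
    have "(path_smul c \<one>\<^bsub>PA\<^esub> \<otimes>\<^bsub>PA\<^esub> f) (v, l) = c * (\<one>\<^bsub>PA\<^esub> \<otimes>\<^bsub>PA\<^esub> f) (v, l)"
      unfolding PA_mult[OF PA_D(1)[OF c] PA_D(1)[OF fc]] PA_mult[OF PA_D(1)[OF PA_one_closed] PA_D(1)[OF fc]]
      by (simp add: path_smul_def sum_distrib_left mult.assoc)
    then show "(path_smul c \<one>\<^bsub>PA\<^esub> \<otimes>\<^bsub>PA\<^esub> f) z = path_smul c f z"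
      by (simp add: z path_smul_def monoid.l_one[OF ring.is_monoid[OF PA_ring] fc])
  qed
  then show ?thesis using ideal.I_l_closed[OF II_ideal f c] by simp
qed

lemma II_ext: assumes "pdelta (v, l) \<in> II" "valid_path m (v, l @ l')" shows "pdelta (v, l @ l') \<in> II"
proof -
  have vp: "valid_path m (path_end m v l, l')" using assms(2) by (simp add: valid_path_def valid_from_append)
  show ?thesis using ideal.I_r_closed[OF II_ideal assms(1) pdelta_closed[OF vp]] by (simp only: pdelta_mult)
qed

lemma II_ext_left: assumes "pdelta (path_end m v l, l') \<in> II" "valid_path m (v, l @ l')" shows "pdelta (v, l @ l') \<in> II"
proof -
  have vp: "valid_path m (v, l)" using assms(2) by (simp add: valid_path_def valid_from_append)
  show ?thesis using ideal.I_l_closed[OF II_ideal assms(1) pdelta_closed[OF vp]] by (simp only: pdelta_mult)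
qed

lemma arr_cases: assumes "valid_from m v (a # l)" shows "v < m" "a = Aa v \<and> valid_from m (nx v) l \<or> a = Ab (pr v) \<and> valid_from m (pr v) l"
proof -
  show v: "v < m" using assms by simp
  show "a = Aa v \<and> valid_from m (nx v) l \<or> a = Ab (pr v) \<and> valid_from m (pr v) l"
  proof (cases a)
    case (Aa i)
    then show ?thesis using assms by (auto simp: nx_eq)
  next
    case (Ab i)
    then have "i < m" "nx i = v" "valid_from m i l" using assms by (auto simp: nx_eq)
    then show ?thesis using nx_pr(2)[of i] Ab by simp
  qed
qed

lemma pdelta_ba: assumes "v < m" and l: "valid_from m v ([Ab (pr v), Aa (pr v)] @ l)"
  shows "(\<lambda>z. pdelta (v, [Ab (pr v), Aa (pr v)] @ l) z - q v * pdelta (v, [Aa v, Ab v] @ l) z) \<in> II"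
proof -
  let ?r = "\<lambda>z. q v * pdelta (v, [Aa v, Ab v]) z - pdelta (v, [Ab (pr v), Aa (pr v)]) z :: 'k"
  have e: "path_end m v [Ab (pr v), Aa (pr v)] = v" "path_end m v [Aa v, Ab v] = v" using assms(1) by (simp_all add: nx_eq)
  have vl: "valid_path m (v, l)" using l e unfolding valid_path_def valid_from_append fst_conv snd_conv by (simp only:)
  have d: "finite (supp (pdelta p :: path \<Rightarrow> 'k))" for p by (simp add: supp_pdelta)
  have r: "?r \<in> carrier PA" using gens(3)[OF assms(1)] ideal.Icarr[OF II_ideal] by blast
  have "?r \<otimes>\<^bsub>PA\<^esub> pdelta (v, l) = (\<lambda>z. q v * (pdelta (v, [Aa v, Ab v]) \<otimes>\<^bsub>PA\<^esub> pdelta (v, l)) z - (pdelta (v, [Ab (pr v), Aa (pr v)]) \<otimes>\<^bsub>PA\<^esub> pdelta (v, l)) z)"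
  proof
    fix z :: path obtain w l1 where z: "z = (w, l1)" by (cases z)
    show "(?r \<otimes>\<^bsub>PA\<^esub> pdelta (v, l)) z = q v * (pdelta (v, [Aa v, Ab v]) \<otimes>\<^bsub>PA\<^esub> pdelta (v, l)) z - (pdelta (v, [Ab (pr v), Aa (pr v)]) \<otimes>\<^bsub>PA\<^esub> pdelta (v, l)) z"
      unfolding z PA_mult[OF PA_D(1)[OF r] d] PA_mult[OF d d] sum_distrib_left sum_subtractf[symmetric]
      by (intro sum.cong refl) (simp add: algebra_simps)
  qed
  also have "\<dots> = (\<lambda>z. q v * pdelta (v, [Aa v, Ab v] @ l) z - pdelta (v, [Ab (pr v), Aa (pr v)] @ l) z)"
    using pdelta_mult[where 'k = 'k and m = m and v = v and l = "[Aa v, Ab v]" and l' = l] pdelta_mult[where 'k = 'k and m = m and v = v and l = "[Ab (pr v), Aa (pr v)]" and l' = l] unfolding e by simp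
  finally have "(\<lambda>z. q v * pdelta (v, [Aa v, Ab v] @ l) z - pdelta (v, [Ab (pr v), Aa (pr v)] @ l) z) \<in> II"
    using ideal.I_r_closed[OF II_ideal gens(3)[OF assms(1)] pdelta_closed[OF vl]] by simp
  from II_smul[OF this, of "-1"] show ?thesis by (simp add: path_smul_def)
qed

text \<open>After \<open>a abar\<close>, a further \<open>abar\<close> creates the relation
  \<open>abar abar\<close>. A further \<open>a\<close> gives \<open>a abar a\<close>, which is a
  nonzero multiple of \<open>abar a a\<close> modulo the ideal and so contains the relation
  \<open>a a\<close>.\<close>

lemma pdelta_aab: assumes "v < m" "valid_from m v ([Aa v, Ab v] @ b # l)" shows "pdelta (v, [Aa v, Ab v] @ b # l) \<in> II"
proof -
  have "valid_from m v (b # l)" using assms by simp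
  then have vl: "b = Aa v \<and> valid_from m (nx v) l \<or> b = Ab (pr v) \<and> valid_from m (pr v) l" by (rule arr_cases(2))
  then show ?thesis
  proof (elim disjE conjE)
    assume b: "b = Ab (pr v)"
    have "pdelta (path_end m v [Aa v], [Ab v, Ab (pr v)]) \<in> II"
      using gens(2)[of "nx v"] assms(1) by (simp add: nx_eq)
    then have "pdelta (v, [Aa v] @ [Ab v, Ab (pr v)]) \<in> II" 
      by (rule II_ext_left) (use assms b in \<open>auto simp: valid_path_def nx_eq dest: valid_from_start\<close>)
    then have "pdelta (v, ([Aa v] @ [Ab v, Ab (pr v)]) @ l) \<in> II" by (rule II_ext) (use assms b in \<open>simp add: valid_path_def\<close>)
    then show ?thesis by (simp add: b)
  next
    assume b: "b = Aa v" and l: "valid_from m (nx v) l"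
    have v3: "valid_from m v ([Ab (pr v), Aa (pr v)] @ b # l)" using l b assms(1) by (simp add: nx_eq)
    have "pdelta (path_end m v [Ab (pr v)], [Aa (pr v), Aa v]) \<in> II"
      using gens(1)[of "pr v"] assms(1) by simp
    then have "pdelta (v, [Ab (pr v)] @ [Aa (pr v), Aa v]) \<in> II" 
      by (rule II_ext_left) (use assms(1) in \<open>simp add: valid_path_def nx_eq\<close>)
    then have "pdelta (v, ([Ab (pr v)] @ [Aa (pr v), Aa v]) @ l) \<in> II" by (rule II_ext) (use v3 b in \<open>simp add: valid_path_def\<close>)
    then have "path_smul (-1) (pdelta (v, [Ab (pr v), Aa (pr v)] @ b # l)) \<in> II" using b by (intro II_smul) simp
    from II_add[OF this pdelta_ba[OF assms(1) v3]] have "path_smul (- q v) (pdelta (v, [Aa v, Ab v] @ b # l)) \<in> II"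
      by (simp add: path_smul_def)
    from II_smul[OF this, of "- inverse (q v)"] show ?thesis using q0 assms(1) by (simp add: path_smul_def pdelta_def mult.assoc[symmetric])
  qed
qed

definition dev :: "(path \<Rightarrow> 'k) \<Rightarrow> path \<Rightarrow> 'k" where "dev f = (\<lambda>z. f z - sec (t0 f) z)"

text \<open>A path is either a normal form, or \<open>abar a\<close>, which reduces to one, or it
  contains a zero relation or has \<open>a abar\<close> or \<open>abar a\<close> followed by an
  arrow and lies in the ideal.\<close>

lemma dev_pdelta: assumes "valid_path m p" shows "dev (pdelta p) \<in> II"
proof -
  obtain v l where p: "p = (v, l)" by (cases p)
  have vl: "valid_from m v l" using assms by (simp add: p valid_path_def)
  have v: "v < m" using vl by (rule valid_from_start)
  have zero: "(\<lambda>z. 0) \<in> II" using additive_subgroup.zero_closed[OF ideal.axioms(1)[OF II_ideal]] by (simp add: PA_simps(3))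
  have rdv: "w < m \<Longrightarrow> rd (int w) = w" for w by (simp add: rd_def)
  consider "l = []" | "l = [Aa v]" | "l = [Ab (pr v)]" | "l = [Aa v, Ab v]" | "l = [Ab (pr v), Aa (pr v)]"
    | (d) l' where "l = [Aa v, Aa (nx v)] @ l'" | (e) l' where "l = [Ab (pr v), Ab (pr (pr v))] @ l'"
    | (f) b l' where "l = [Aa v, Ab v] @ b # l'" | (g) b l' where "l = [Ab (pr v), Aa (pr v)] @ b # l'"
  proof (cases l)
    case (Cons a l1)
    note c1 = arr_cases(2)[OF vl[unfolded Cons]]
    show ?thesis
    proof (cases l1)
      case Nil
      then show ?thesis using c1 Cons that(2,3) by auto
    next
      case l1: (Cons b l2)
      have "a = Aa v \<and> (b = Aa (nx v) \<or> b = Ab v) \<or> a = Ab (pr v) \<and> (b = Aa (pr v) \<or> b = Ab (pr (pr v)))"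
        using c1 arr_cases(2)[of "nx v" b l2] arr_cases(2)[of "pr v" b l2] l1 v by auto
      then show ?thesis using Cons l1 that(4-9) by (cases l2) auto
    qed
  qed (use that(1) in simp)
  then show ?thesis
  proof cases
    case 1
    then have "dev (pdelta p) = (\<lambda>z. 0)" using v by (auto simp: p dev_def sec_def pdelta_def fun_eq_iff rdv)
    then show ?thesis using zero by simp
  next
    case 2
    then have "dev (pdelta p) = (\<lambda>z. 0)" using v by (auto simp: p dev_def sec_def pdelta_def fun_eq_iff rdv)
    then show ?thesis using zero by simp
  next
    case 3
    then have "dev (pdelta p) = (\<lambda>z. 0)" using v by (auto simp: p dev_def sec_def pdelta_def fun_eq_iff rdv)
    then show ?thesis using zero by simp
  next
    case 4
    then have "dev (pdelta p) = (\<lambda>z. 0)" using v by (auto simp: p dev_def sec_def pdelta_def fun_eq_iff rdv)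
    then show ?thesis using zero by simp
  next
    case 5
    then have "dev (pdelta p) = (\<lambda>z. pdelta (v, [Ab (pr v), Aa (pr v)] @ []) z - q v * pdelta (v, [Aa v, Ab v] @ []) z)"
      using v by (auto simp: p dev_def sec_def pdelta_def fun_eq_iff rdv)
    moreover have "\<dots> \<in> II" by (rule pdelta_ba[OF v]) (use vl 5 in simp)
    ultimately show ?thesis by simp
  next
    case (d l')
    then have "dev (pdelta p) = pdelta p" using v by (auto simp: p dev_def sec_def pdelta_def fun_eq_iff rdv)
    moreover have "pdelta (v, [Aa v, Aa (nx v)] @ l') \<in> II" by (rule II_ext[OF gens(1)[OF v]]) (use vl d in \<open>simp add: valid_path_def nx_eq\<close>)
    ultimately show ?thesis by (simp add: p d)
  next
    case (e l')
    then have "dev (pdelta p) = pdelta p" using v by (auto simp: p dev_def sec_def pdelta_def fun_eq_iff rdv)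
    moreover have "pdelta (v, [Ab (pr v), Ab (pr (pr v))] @ l') \<in> II" by (rule II_ext[OF gens(2)[OF v]]) (use vl e in \<open>simp add: valid_path_def nx_eq\<close>)
    ultimately show ?thesis by (simp add: p e)
  next
    case (f b l')
    then have "dev (pdelta p) = pdelta p" using v by (auto simp: p dev_def sec_def pdelta_def fun_eq_iff rdv)
    moreover have "pdelta (v, [Aa v, Ab v] @ b # l') \<in> II" by (rule pdelta_aab[OF v]) (use vl f in \<open>simp only:\<close>)
    ultimately show ?thesis by (simp add: p f)
  next
    case (g b l')
    then have "dev (pdelta p) = pdelta p" using v by (auto simp: p dev_def sec_def pdelta_def fun_eq_iff rdv)
    moreover have "pdelta (v, [Ab (pr v), Aa (pr v)] @ b # l') \<in> II"
    proof -
      have vb: "valid_from m v ([Ab (pr v), Aa (pr v)] @ b # l')" using vl g by (simp only:)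
      then have vb2: "valid_from m v ([Aa v, Ab v] @ b # l')" using v by (simp add: nx_eq)
      have "path_smul (q v) (pdelta (v, [Aa v, Ab v] @ b # l')) \<in> II" by (rule II_smul[OF pdelta_aab[OF v vb2]])
      from II_add[OF pdelta_ba[OF v vb] this] show ?thesis by (simp add: path_smul_def)
    qed
    ultimately show ?thesis by (simp add: p g)
  qed
qed

lemma dev_add: "dev (\<lambda>z. f z + g z) = (\<lambda>z. dev f z + dev g z)"
  by (auto simp: dev_def sec_def fun_eq_iff algebra_simps)

lemma dev_smul: "dev (path_smul c f) = path_smul c (dev f)"
  by (auto simp: dev_def sec_def fun_eq_iff path_smul_def algebra_simps)

lemma dev_II: "f \<in> carrier PA \<Longrightarrow> dev f \<in> II"
proof (induction "card (supp f)" arbitrary: f)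
  case 0
  then have "f = (\<lambda>z. 0)" using PA_D(1)[OF 0(2)] by (auto simp: supp_def)
  then have "dev f = (\<lambda>z. 0)" by (auto simp: dev_def sec_def fun_eq_iff)
  then show ?case using additive_subgroup.zero_closed[OF ideal.axioms(1)[OF II_ideal]] by (simp add: PA_simps(3))
next
  case (Suc n)
  then obtain p where p: "p \<in> supp f" by (metis card.empty equals0I nat.distinct(1))
  have vp: "valid_path m p" using p Suc.prems by (simp add: PA_simps(1) supp_def del: split_paired_All)
  define g where "g = (\<lambda>z. f z + path_smul (- f p) (pdelta p) z)"
  have g: "g \<in> carrier PA" unfolding g_def by (intro PA_add_closed Suc.prems PA_smul_closed pdelta_closed vp)
  have "supp g = supp f - {p}" by (auto simp: supp_def g_def path_smul_def pdelta_def)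
  then have "card (supp g) = n" using Suc.hyps(2) p by simp
  then have 1: "dev g \<in> II" using Suc.hyps(1) g by simp
  have "f = (\<lambda>z. g z + path_smul (f p) (pdelta p) z)" by (simp add: g_def path_smul_def)
  then have "dev f = dev (\<lambda>z. g z + path_smul (f p) (pdelta p) z)" by (rule arg_cong)
  also have "\<dots> = (\<lambda>z. dev g z + path_smul (f p) (dev (pdelta p)) z)" unfolding dev_add dev_smul ..
  finally have "dev f = (\<lambda>z. dev g z + path_smul (f p) (dev (pdelta p)) z)" .
  then show ?case using II_add[OF 1 II_smul[OF dev_pdelta[OF vp], of "f p"]] by simp
qed

lemma t0_kernel_iff: "f \<in> a_kernel PA CLr t0 \<longleftrightarrow> f \<in> carrier PA \<and> t0 f = 0"
  by (simp add: a_kernel_def')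

lemma t0_zero_II: assumes "f \<in> carrier PA" "t0 f = 0" shows "f \<in> II"
proof -
  have "sec 0 z = 0" for z by (cases z) (simp add: sec_def)
  then have "dev f = f" unfolding dev_def assms(2) by simp
  then show "f \<in> II" using dev_II[OF assms(1)] by simp
qed

lemma II_kernel: "II \<subseteq> a_kernel PA CLr t0"
proof -
  interpret h: ring_hom_ring PA CLr t0 by (rule t0_hom)
  show ?thesis unfolding rel_ideal_def

  proof (rule h.R.genideal_minimal[OF h.kernel_is_ideal], rule subsetI)
    fix g assume g: "g \<in> rel_gens m q"
    have "0 < m" using m1 by simp
    then have gc: "g \<in> carrier PA" using subsetD[OF gens(4) g] by simp
    obtain i where i: "g = pdelta (i, [Aa i, Aa ((i + 1) mod m)]) \<or> g = pdelta (i, [Ab ((i + m - 1) mod m), Ab ((i + 2 * m - 2) mod m)])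
      \<or> g = (\<lambda>z. q i * pdelta (i, [Aa i, Ab i]) z - pdelta (i, [Ab ((i + m - 1) mod m), Aa ((i + m - 1) mod m)]) z)"
      using g unfolding rel_gens_def by blast
    have "t0 g = 0"
      using i
    proof (elim disjE)
      assume g: "g = pdelta (i, [Aa i, Aa ((i + 1) mod m)])"
      show "t0 g = 0" by (rule el_eqI) (simp_all add: pdelta_def g)
    next
      assume g: "g = pdelta (i, [Ab ((i + m - 1) mod m), Ab ((i + 2 * m - 2) mod m)])"
      show "t0 g = 0" by (rule el_eqI) (simp_all add: pdelta_def g)
    next
      assume g: "g = (\<lambda>z. q i * pdelta (i, [Aa i, Ab i]) z - pdelta (i, [Ab ((i + m - 1) mod m), Aa ((i + m - 1) mod m)]) z)"
      show "t0 g = 0"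
      proof (rule el_eqI)
        show "cf (t0 g) KP j = cf 0 KP j" for j
          by (cases "rd j = i") (simp_all add: pdelta_def g pr_eq)
      qed (simp_all add: pdelta_def g)
    qed
    then show "g \<in> a_kernel PA CLr t0" using gc t0_kernel_iff by simp
  qed
qed

lemma t0_kernel: "a_kernel PA CLr t0 = II"
  using II_kernel t0_kernel_iff t0_zero_II by blast

definition th :: "(path \<Rightarrow> 'k) set \<Rightarrow> 'k el" where "th Y = the_elem (t0 ` Y)"
definition th' :: "'k el \<Rightarrow> (path \<Rightarrow> 'k) set" where "th' y = II +>\<^bsub>PA\<^esub> sec y"

lemma Lam_kiso: "kiso (Lam m q) CLr (Lam_smul m q) scl th th'"
proof -
  interpret h: ring_hom_ring PA CLr t0 by (rule t0_hom)
  interpret I: ideal II PA by (rule II_ideal)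
  have iso: "th \<in> ring_iso (Lam m q) CLr"
  proof -
    have "t0 ` carrier PA = carrier CLr"
      using t0_V t0_sec sec_closed by (auto simp: image_iff) metis
    from h.FactRing_iso_set[OF this] show ?thesis unfolding t0_kernel Lam_def th_def[abs_def] .
  qed
  then have bij: "bij_betw th (carrier (Lam m q)) V" and hom: "th \<in> ring_hom (Lam m q) CLr"
    by (simp_all add: ring_iso_def)
  have ths: "th (II +>\<^bsub>PA\<^esub> f) = t0 f" if "f \<in> carrier PA" for f
    using h.the_elem_simp[OF that] unfolding t0_kernel th_def .
  have cl': "II +>\<^bsub>PA\<^esub> f \<in> carrier (Lam m q)" if "f \<in> carrier PA" for f
    using ring_hom_closed[OF I.rcos_ring_hom that] by (simp add: Lam_def)
  have a_repr: "II +>\<^bsub>PA\<^esub> f = II +>\<^bsub>PA\<^esub> x" if "x \<in> II +>\<^bsub>PA\<^esub> f" "f \<in> carrier PA" for x f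
    using abelian_group.a_repr_independence[OF ring.is_abelian_group[OF PA_ring] that I.additive_subgroup_axioms[THEN additive_subgroup.a_subgroup]] .
  have sm: "Lam_smul m q c Y \<in> carrier (Lam m q) \<and> th (Lam_smul m q c Y) = scl c (th Y)" if Y: "Y \<in> carrier (Lam m q)" for c Y
  proof -
    obtain f where f: "f \<in> carrier PA" "Y = II +>\<^bsub>PA\<^esub> f" using Y by (auto simp: Lam_def FactRing_def A_RCOSETS_def')
    \<comment> \<open>\<open>quot_smul\<close> acts through an arbitrarily chosen representative;
      the coset of \<open>x\<close> is again \<open>Y\<close>, so the choice does not
      matter.\<close>
    define x where "x = (SOME x. x \<in> Y)"
    have "f \<in> Y" unfolding f(2) by (rule I.a_rcos_self[OF f(1)])
    then have xY: "x \<in> Y" unfolding x_def by (rule someI[of "\<lambda>x. x \<in> Y"])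
    have xc: "x \<in> carrier PA" using xY f I.a_elemrcos_carrier[OF f(1)] by auto
    have Yx: "Y = II +>\<^bsub>PA\<^esub> x" using a_repr[OF _ f(1)] xY f by simp
    have "Lam_smul m q c Y = II +>\<^bsub>PA\<^esub> path_smul c x" by (simp add: Lam_smul_def quot_smul_def x_def)
    moreover have "t0 (path_smul c x) = scl c (t0 x)" by (rule el_eqI) (simp_all add: path_smul_def algebra_simps)
    ultimately show ?thesis using cl'[OF PA_smul_closed[OF xc]] ths[OF PA_smul_closed[OF xc]] ths[OF xc] Yx by simp
  qed
  have inv2: "th (th' y) = y" if "y \<in> V" for y unfolding th'_def by (simp add: ths[OF sec_closed] t0_sec that)
  have c1: "th x \<in> V" if "x \<in> carrier (Lam m q)" for x using bij_betwE[OF bij] that by blast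
  have c2: "th' y \<in> carrier (Lam m q)" for y unfolding th'_def by (rule cl'[OF sec_closed])
  have inv1: "th' (th x) = x" if x: "x \<in> carrier (Lam m q)" for x
    using bij_betw_imp_inj_on[OF bij] inv2[OF c1[OF x]] x c2[of "th x"] by (simp add: inj_on_def)
  show ?thesis
  proof (rule kiso.intro)
    show "ring (Lam m q)" unfolding Lam_def by (rule I.quotient_is_ring)
    show "ring CLr" by (rule CLr_ring)
    have h: "x \<in> carrier (Lam m q) \<Longrightarrow> x' \<in> carrier (Lam m q) \<Longrightarrow> th (x \<oplus>\<^bsub>Lam m q\<^esub> x') = th x \<oplus>\<^bsub>CLr\<^esub> th x'"
      "x \<in> carrier (Lam m q) \<Longrightarrow> x' \<in> carrier (Lam m q) \<Longrightarrow> th (x \<otimes>\<^bsub>Lam m q\<^esub> x') = th x \<otimes>\<^bsub>CLr\<^esub> th x'"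
      "th \<one>\<^bsub>Lam m q\<^esub> = \<one>\<^bsub>CLr\<^esub>" for x x'
      using ring_hom_add[OF hom] ring_hom_mult[OF hom] ring_hom_one[OF hom] by blast+
    show "kiso_axioms (Lam m q) CLr (Lam_smul m q) scl th th'"
      by (rule kiso_axioms.intro) (use sm c1 c2 inv1 inv2 in \<open>simp_all only: h CLr_simps V_cl\<close>)
  qed
qed

end

section \<open>Monoid subalgebras of the polynomial ring in two variables\<close>

definition cst :: "'k::field \<Rightarrow> 'k poly poly" where "cst c = [:[:c:]:]"

lemma smult_cst: "Polynomial.smult [:c:] p = cst c * p"
  by (simp add: cst_def)

lemma cst_simps: "cst 0 = 0" "cst 1 = 1" "cst (a + b) = cst a + cst b" "cst (a * b) = cst a * cst b" "cst (- a) = - cst a"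
  by (simp_all add: cst_def one_pCons)

abbreviation cf2 :: "'k::field poly poly \<Rightarrow> nat \<Rightarrow> nat \<Rightarrow> 'k" where
  "cf2 p s t \<equiv> Polynomial.coeff (Polynomial.coeff p t) s"

definition box :: "nat \<Rightarrow> 'k::field poly poly \<Rightarrow> bool" where
  "box L p \<longleftrightarrow> (\<forall>s t. cf2 p s t \<noteq> 0 \<longrightarrow> s \<le> L \<and> t \<le> L)"

lemma box_mult: assumes p: "box a p" and r: "box b r" shows "box (a + b) (p * r)"
  unfolding box_def
proof (intro allI impI)
  fix s t assume "cf2 (p * r) s t \<noteq> 0"
  then have "(\<Sum>j\<le>t. \<Sum>i\<le>s. cf2 p i j * cf2 r (s - i) (t - j)) \<noteq> 0"
    by (simp add: Polynomial.coeff_mult Polynomial.coeff_sum)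
  then obtain j where j: "j \<le> t" "(\<Sum>i\<le>s. cf2 p i j * cf2 r (s - i) (t - j)) \<noteq> 0"
    by (meson atMost_iff sum.not_neutral_contains_not_neutral)
  then obtain i where "i \<le> s" "cf2 p i j * cf2 r (s - i) (t - j) \<noteq> 0"
    by (meson atMost_iff sum.not_neutral_contains_not_neutral)
  then show "s \<le> a + b \<and> t \<le> a + b" using p r j(1) unfolding box_def by (smt (verit, best) add_mono le_add_diff_inverse mult_eq_0_iff)
qed

lemma box_power: "box a p \<Longrightarrow> box (n * a) (p ^ n)"
proof (induction n)
  case 0
  have "cf2 (1 :: 'a poly poly) s t = (if s = 0 \<and> t = 0 then 1 else 0)" for s t by (cases t; cases s) (simp_all add: one_pCons)
  then show ?case unfolding box_def power_0 by simp
qed (simp add: box_mult)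

lemma box_mono: "box a p \<Longrightarrow> a \<le> b \<Longrightarrow> box b p"
  unfolding box_def by (meson order_trans)

lemma box_ex: "\<exists>L. box L p"
proof
  let ?L = "Max ((\<lambda>t. Polynomial.degree (Polynomial.coeff p t)) ` {..Polynomial.degree p}) + Polynomial.degree p"
  show "box ?L p" unfolding box_def
  proof (intro allI impI)
    fix s t assume nz: "cf2 p s t \<noteq> 0"
    then have t: "t \<le> Polynomial.degree p" by (metis Polynomial.coeff_0 Polynomial.le_degree)
    have "s \<le> Polynomial.degree (Polynomial.coeff p t)" by (rule Polynomial.le_degree[OF nz])
    also have "\<dots> \<le> Max ((\<lambda>t. Polynomial.degree (Polynomial.coeff p t)) ` {..Polynomial.degree p})" by (rule Max_ge) (use t in auto)
    finally show "s \<le> ?L \<and> t \<le> ?L" using t by simp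
  qed
qed

definition xym :: "nat \<Rightarrow> nat \<Rightarrow> 'k::field poly poly" where
  "xym s t = Polynomial.monom (Polynomial.monom 1 s) t"

lemma cf2_xym: "cf2 (xym s t) s' t' = (if s = s' \<and> t = t' then 1 else 0)"
  by (simp add: xym_def)

lemma cf2_cst: "cf2 (cst c * p) s t = c * cf2 p s t"
  by (simp add: smult_cst[symmetric])

lemma cf2_eqI: "(\<And>s t. cf2 p s t = cf2 r s t) \<Longrightarrow> p = r"
  by (intro poly_eqI) auto

lemma box_sum: assumes "box L p"
  shows "p = (\<Sum>(s, t)\<in>{..L} \<times> {..L}. cst (cf2 p s t) * xym s t)"
proof (rule cf2_eqI)
  fix s t
  have "cf2 (\<Sum>(s, t)\<in>{..L} \<times> {..L}. cst (cf2 p s t) * xym s t) s t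
     = (\<Sum>x\<in>{..L} \<times> {..L}. cf2 (case x of (s, t) \<Rightarrow> cst (cf2 p s t) * xym s t) s t)"
    by (simp only: Polynomial.coeff_sum)
  also have "\<dots> = (\<Sum>x\<in>{..L} \<times> {..L}. if x = (s, t) then cf2 p s t else 0)"
    by (intro sum.cong refl) (auto simp: cf2_cst cf2_xym split: if_splits)
  also have "\<dots> = cf2 p s t" using assms by (auto simp: box_def)
  finally show "cf2 p s t = cf2 (\<Sum>(s, t)\<in>{..L} \<times> {..L}. cst (cf2 p s t) * xym s t) s t" by simp
qed

text \<open>A dimension count: the number of monomials in three elements grows like the cube of the
  exponent bound, while the polynomials in two variables that contain them form a space of quadratic
  dimension. Only nonzero coefficients are kept in \<open>T\<close>, as the descent through a prime
  chain needs them.\<close>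

lemma alg_dependent:
  fixes y0 y1 y2 :: "'k::field poly poly"
  shows "\<exists>T c. finite T \<and> T \<noteq> {} \<and> (\<forall>i\<in>T. c i \<noteq> 0) \<and> (\<Sum>(a, b, d)\<in>T. cst (c (a, b, d)) * (y2 ^ d * y1 ^ b) * y0 ^ a) = 0"
proof -
  interpret vs: vector_space "\<lambda>c (p :: 'k poly poly). cst c * p"
    by unfold_locales (simp_all add: cst_simps algebra_simps)
  obtain l0 l1 l2 where l: "box l0 y0" "box l1 y1" "box l2 y2" using box_ex by metis
  define D where "D = l0 + l1 + l2 + 1"
  have D: "box D y0" "box D y1" "box D y2" by (auto simp: D_def intro: box_mono[OF l(1)] box_mono[OF l(2)] box_mono[OF l(3)])
  \<comment> \<open>With exponents below \<open>M\<close> the products have degree at most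
    \<open>3 * M * D\<close> in each variable; this choice makes \<open>M ^ 3\<close> exceed the
    bound \<open>16 * M\<^sup>2 * D\<^sup>2\<close> on the dimension.\<close>
  define M where "M = 16 * D\<^sup>2 + 1"
  define I where "I = {..<M} \<times> {..<M} \<times> {..<M}"
  define v where "v = (\<lambda>(a, b, d). y2 ^ d * y1 ^ b * y0 ^ a)"
  define L where "L = 3 * M * D"
  define B where "B = (\<lambda>(s, t). xym s t :: 'k poly poly) ` ({..L} \<times> {..L})"
  have fB: "finite B" unfolding B_def by simp
  have "card B \<le> (L + 1) * (L + 1)"
    unfolding B_def by (rule order_trans[OF card_image_le]) simp_all
  also have "\<dots> \<le> (4 * M * D) * (4 * M * D)"
  proof -
    have "0 < M * D" by (simp add: M_def D_def)
    then have "L + 1 \<le> 4 * M * D" by (simp add: L_def)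
    then show ?thesis by (intro mult_mono) simp_all
  qed
  also have "\<dots> = M\<^sup>2 * (16 * D\<^sup>2)" by (simp add: power2_eq_square)
  also have "\<dots> < M\<^sup>2 * M" by (simp add: M_def)
  also have "\<dots> = card I" by (simp add: I_def power2_eq_square)
  finally have card: "card B < card I" .
  have sp: "v ` I \<subseteq> vs.span B"
  proof
    fix x assume "x \<in> v ` I"
    then obtain a b d where abd: "a < M" "b < M" "d < M" "x = y2 ^ d * y1 ^ b * y0 ^ a" by (auto simp: v_def I_def)
    have "box (d * D + b * D + a * D) x" unfolding abd(4) by (intro box_mult box_power D)
    moreover have "d * D + b * D + a * D \<le> M * D + M * D + M * D" using abd by (intro add_mono mult_le_mono1) auto
    ultimately have "box L x" by (intro box_mono[of _ x L]) (auto simp: L_def)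
    then have "x = (\<Sum>(s, t)\<in>{..L} \<times> {..L}. cst (cf2 x s t) * xym s t)" by (rule box_sum)
    also have "\<dots> \<in> vs.span B"
    proof (rule vs.span_sum)
      fix p assume "p \<in> {..L} \<times> {..L}"
      then show "(case p of (s, t) \<Rightarrow> cst (cf2 x s t) * xym s t) \<in> vs.span B"
      proof (cases p)
        case (Pair s t)
        then have "xym s t \<in> vs.span B" using \<open>p \<in> {..L} \<times> {..L}\<close> by (intro vs.span_base) (auto simp: B_def)
        then show ?thesis using vs.span_scale[of "xym s t" B "cf2 x s t"] Pair by simp
      qed
    qed
    finally show "x \<in> vs.span B" .
  qed
  have fin: "finite I" by (simp add: I_def)
  show ?thesis
  proof (cases "inj_on v I")
    case True
    have "vs.dependent (v ` I)"
    proof (rule ccontr)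
      assume "\<not> vs.dependent (v ` I)"
      then have "card (v ` I) \<le> card B" using vs.independent_span_bound[OF fB _ sp] by blast
      then show False using card card_image[OF True] by simp
    qed
    then obtain t u where t: "finite t" "t \<subseteq> v ` I" "(\<Sum>w\<in>t. cst (u w) * w) = 0" "\<exists>w\<in>t. u w \<noteq> 0"
      unfolding vs.dependent_explicit by blast
    define T where "T = {i \<in> I. v i \<in> t \<and> u (v i) \<noteq> 0}"
    obtain w where w: "w \<in> t" "u w \<noteq> 0" using t(4) by blast
    obtain i where "i \<in> I" "w = v i" using t(2) w(1) by blast
    then have "i \<in> T" using w by (simp add: T_def)
    then have "T \<noteq> {}" by blast
    moreover have "finite T" using fin by (simp add: T_def)
    moreover have "(\<Sum>i\<in>T. cst (u (v i)) * v i) = 0"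
    proof -
      have "(\<Sum>i\<in>T. cst (u (v i)) * v i) = (\<Sum>w\<in>v ` T. cst (u w) * w)"
        by (subst sum.reindex) (use True in \<open>auto simp: T_def inj_on_def\<close>)
      also have "\<dots> = (\<Sum>w\<in>t. cst (u w) * w)"
      proof (rule sum.mono_neutral_left)
        show "\<forall>x\<in>t - v ` T. cst (u x) * x = 0"
        proof
          fix x assume x: "x \<in> t - v ` T"
          then obtain i where i: "i \<in> I" "x = v i" using t(2) by blast
          then have "u x = 0" using x by (auto simp: T_def)
          then show "cst (u x) * x = 0" by (simp add: cst_simps)
        qed
      qed (use t(1) in \<open>auto simp: T_def\<close>)
      finally show ?thesis using t(3) by simp
    qed
    moreover have "(\<Sum>i\<in>T. cst (u (v i)) * v i) = (\<Sum>(a, b, d)\<in>T. cst ((u \<circ> v) (a, b, d)) * (y2 ^ d * y1 ^ b) * y0 ^ a)"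
      by (rule sum.cong) (auto simp: v_def mult.assoc)
    ultimately show ?thesis by (intro exI[of _ T] exI[of _ "u \<circ> v"]) (auto simp: T_def)
  next
    case False
    \<comment> \<open>Two coinciding products already give a relation, with coefficients 1 and
      -1.\<close>
    then obtain i j where ij: "i \<noteq> j" "v i = v j" unfolding inj_on_def by blast
    define c :: "nat \<times> nat \<times> nat \<Rightarrow> 'k" where "c k = (if k = i then 1 else - 1)" for k
    have "(\<Sum>(a, b, d)\<in>{i, j}. cst (c (a, b, d)) * (y2 ^ d * y1 ^ b) * y0 ^ a) = (\<Sum>k\<in>{i, j}. cst (c k) * v k)"
      by (rule sum.cong) (simp_all add: v_def case_prod_unfold mult.assoc)
    also have "\<dots> = cst (c i) * v i + cst (c j) * v j" using ij(1) by simp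
    also have "\<dots> = 0" unfolding ij(2) using ij(1) by (simp add: c_def cst_simps)
    finally show ?thesis by (intro exI[of _ "{i, j}"] exI[of _ c]) (simp add: c_def)
  qed
qed

text \<open>Prime ideals of the subring \<open>IM\<close> are described by subsets of the polynomial
  type, so that the chain argument can compute with its arithmetic and finite sums.\<close>

definition pset :: "'k::field poly poly set \<Rightarrow> 'k poly poly set \<Rightarrow> bool" where
  "pset IM P \<longleftrightarrow> P \<subseteq> IM \<and> 0 \<in> P \<and> (\<forall>a\<in>P. \<forall>b\<in>P. a + b \<in> P) \<and> (\<forall>a\<in>IM. \<forall>b\<in>P. a * b \<in> P)
    \<and> (\<forall>a\<in>IM. \<forall>b\<in>IM. a * b \<in> P \<longrightarrow> a \<in> P \<or> b \<in> P) \<and> 1 \<notin> P"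

locale imring =
  fixes IM :: "'k::field poly poly set"
  assumes Im_cl: "a \<in> IM \<Longrightarrow> b \<in> IM \<Longrightarrow> a + b \<in> IM" "a \<in> IM \<Longrightarrow> b \<in> IM \<Longrightarrow> a * b \<in> IM" "cst c \<in> IM"
begin

lemma Im_01: "0 \<in> IM" "1 \<in> IM"
  using Im_cl(3)[of 0] Im_cl(3)[of 1] by (simp_all add: cst_simps)

lemma Im_pow: "a \<in> IM \<Longrightarrow> a ^ n \<in> IM"
  by (induction n) (simp_all add: Im_cl Im_01)

lemma Im_sum: "(\<And>a. a \<in> A \<Longrightarrow> f a \<in> IM) \<Longrightarrow> (\<Sum>a\<in>A. f a) \<in> IM"
  by (induction A rule: infinite_finite_induct) (auto simp: Im_cl Im_01)

lemma pset_sum: "pset IM P \<Longrightarrow> (\<And>a. a \<in> A \<Longrightarrow> f a \<in> P) \<Longrightarrow> (\<Sum>a\<in>A. f a) \<in> P"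
  by (induction A rule: infinite_finite_induct) (auto simp: pset_def)

lemma pset_pow: "pset IM P \<Longrightarrow> a \<in> IM \<Longrightarrow> a \<notin> P \<Longrightarrow> a ^ n \<notin> P"
proof (induction n)
  case (Suc n)
  then have "a ^ n \<notin> P" "a ^ n \<in> IM" by (auto intro: Im_pow)
  then show ?case using Suc.prems unfolding pset_def by (metis power_Suc)
qed (simp add: pset_def)

lemma pset_cancel: assumes P: "pset IM P" and "a + b \<in> P" "b \<in> P" shows "a \<in> P"
proof -
  have "cst (-1) * b \<in> P" using P assms(3) Im_cl(3) unfolding pset_def by blast
  then have "(a + b) + cst (-1) * b \<in> P" using P assms(2) unfolding pset_def by blast
  then show ?thesis by (simp add: cst_simps)
qed

text \<open>Divide the relation by the least power of \<open>y\<close>. As \<open>y\<close> is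
  outside the prime \<open>P\<close>, the cofactor lies in \<open>P\<close>, hence in
  \<open>P'\<close>; there \<open>y\<close> vanishes, so the sum of the coefficients of the least
  power is in \<open>P'\<close>.\<close>

lemma prime_step:
  assumes P: "pset IM P" and P': "pset IM P'" and sub: "P \<subseteq> P'" and y: "y \<in> P'" "y \<notin> P"
    and T: "finite T" and g: "\<And>i. i \<in> T \<Longrightarrow> g i \<in> IM"
    and sum: "(\<Sum>i\<in>T. g i * y ^ fst i) \<in> P" and a0: "\<And>i. i \<in> T \<Longrightarrow> a0 \<le> fst i"
  shows "(\<Sum>i\<in>{i\<in>T. fst i = a0}. g i) \<in> P'"
proof -
  have yI: "y \<in> IM" using P' y by (auto simp: pset_def)
  define W where "W = (\<Sum>i\<in>T. g i * y ^ (fst i - a0))"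
  have WI: "W \<in> IM" unfolding W_def by (intro Im_sum Im_cl g Im_pow yI)
  have "(\<Sum>i\<in>T. g i * y ^ fst i) = y ^ a0 * W"
    unfolding W_def sum_distrib_left
  proof (rule sum.cong)
    fix i assume "i \<in> T"
    then have "fst i = a0 + (fst i - a0)" using a0 by simp
    then have "y ^ fst i = y ^ a0 * y ^ (fst i - a0)" by (metis power_add)
    then show "g i * y ^ fst i = y ^ a0 * (g i * y ^ (fst i - a0))" by simp
  qed simp
  then have "y ^ a0 * W \<in> P" using sum by simp
  then have "y ^ a0 \<in> P \<or> W \<in> P" using P Im_pow[OF yI] WI unfolding pset_def by blast
  then have W: "W \<in> P'" using pset_pow[OF P yI y(2)] sub by auto
  have "W = (\<Sum>i\<in>{i\<in>T. fst i = a0}. g i) + (\<Sum>i\<in>{i\<in>T. fst i \<noteq> a0}. g i * y ^ (fst i - a0))"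
  proof -
    have "T = {i\<in>T. fst i = a0} \<union> {i\<in>T. fst i \<noteq> a0}" by auto
    then have "W = (\<Sum>i\<in>{i\<in>T. fst i = a0} \<union> {i\<in>T. fst i \<noteq> a0}. g i * y ^ (fst i - a0))" by (simp add: W_def)
    also have "\<dots> = (\<Sum>i\<in>{i\<in>T. fst i = a0}. g i * y ^ (fst i - a0)) + (\<Sum>i\<in>{i\<in>T. fst i \<noteq> a0}. g i * y ^ (fst i - a0))"
      by (rule sum.union_disjoint) (use T in auto)
    finally show ?thesis by simp
  qed
  moreover have "(\<Sum>i\<in>{i\<in>T. fst i \<noteq> a0}. g i * y ^ (fst i - a0)) \<in> P'"
  proof (rule pset_sum[OF P'])
    fix i assume i: "i \<in> {i\<in>T. fst i \<noteq> a0}"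
    then have "fst i - a0 = Suc (fst i - a0 - 1)" using a0 by fastforce
    then have e: "g i * y ^ (fst i - a0) = (g i * y ^ (fst i - a0 - 1)) * y" by (metis mult.assoc power_Suc2)
    have "g i * y ^ (fst i - a0 - 1) \<in> IM" using i by (intro Im_cl g Im_pow yI) auto
    then show "g i * y ^ (fst i - a0) \<in> P'" unfolding e using P' y(1) unfolding pset_def by blast
  qed
  ultimately show ?thesis using pset_cancel[OF P'] W by simp
qed

text \<open>Three elements satisfy a polynomial relation; dividing out the lexicographically least monomial, one
  climbs with the remaining cofactor through the chain until a nonzero constant lies in the last prime.\<close>

lemma no_chain3:
  assumes P: "pset IM P0" "pset IM P1" "pset IM P2" "pset IM P3"
    and sub: "P0 \<subseteq> P1" "P1 \<subseteq> P2" "P2 \<subseteq> P3"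
    and y: "y0 \<in> P1" "y0 \<notin> P0" "y1 \<in> P2" "y1 \<notin> P1" "y2 \<in> P3" "y2 \<notin> P2"
  shows False
proof -
  have yI: "y0 \<in> IM" "y1 \<in> IM" "y2 \<in> IM" using P y by (auto simp: pset_def)
  obtain T c where T: "finite T" "T \<noteq> {}" "\<And>i. i \<in> T \<Longrightarrow> c i \<noteq> 0"
    "(\<Sum>(a, b, d)\<in>T. cst (c (a, b, d)) * (y2 ^ d * y1 ^ b) * y0 ^ a) = 0"
    using alg_dependent[of y2 y1 y0] by blast
  define a0 where "a0 = Min (fst ` T)"
  define T1 where "T1 = {i. (a0, i) \<in> T}"
  have "(\<Sum>i\<in>{i\<in>T. fst i = a0}. cst (c i) * (y2 ^ snd (snd i) * y1 ^ fst (snd i))) \<in> P1"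
  proof (rule prime_step[OF P(1,2) sub(1) y(1,2) T(1)])
    show "(\<Sum>i\<in>T. cst (c i) * (y2 ^ snd (snd i) * y1 ^ fst (snd i)) * y0 ^ fst i) \<in> P0"
      using T(4) P(1) by (simp add: case_prod_unfold pset_def)
    show "a0 \<le> fst i" if "i \<in> T" for i using T(1) that by (simp add: a0_def)
  qed (intro Im_cl Im_pow yI)
  also have "{i\<in>T. fst i = a0} = Pair a0 ` T1" by (auto simp: T1_def)
  also have "(\<Sum>i\<in>Pair a0 ` T1. cst (c i) * (y2 ^ snd (snd i) * y1 ^ fst (snd i))) = (\<Sum>i\<in>T1. (cst (c (a0, i)) * y2 ^ snd i) * y1 ^ fst i)"
    by (subst sum.reindex) (auto simp: inj_on_def mult.assoc)
  finally have s1: "(\<Sum>i\<in>T1. (cst (c (a0, i)) * y2 ^ snd i) * y1 ^ fst i) \<in> P1" .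
  have "a0 \<in> fst ` T" unfolding a0_def by (rule Min_in) (use T in auto)
  then have T1: "T1 \<noteq> {}" by (force simp: T1_def)
  have fT1: "finite T1" unfolding T1_def using finite_vimageI[OF T(1), of "Pair a0"] by (simp add: vimage_def inj_on_def)
  define b0 where "b0 = Min (fst ` T1)"
  define T2 where "T2 = {d. (b0, d) \<in> T1}"
  have "(\<Sum>i\<in>{i\<in>T1. fst i = b0}. cst (c (a0, i)) * y2 ^ snd i) \<in> P2"
  proof (rule prime_step[OF P(2,3) sub(2) y(3,4) fT1 _ s1])
    show "b0 \<le> fst i" if "i \<in> T1" for i using fT1 that by (simp add: b0_def)
  qed (intro Im_cl Im_pow yI)
  also have "{i\<in>T1. fst i = b0} = Pair b0 ` T2" by (auto simp: T2_def)
  also have "(\<Sum>i\<in>Pair b0 ` T2. cst (c (a0, i)) * y2 ^ snd i) = (\<Sum>d\<in>T2. cst (c (a0, b0, d)) * y2 ^ d)"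
    by (subst sum.reindex) (auto simp: inj_on_def)
  finally have s2: "(\<Sum>d\<in>T2. cst (c (a0, b0, d)) * y2 ^ d) \<in> P2" .
  have "b0 \<in> fst ` T1" unfolding b0_def by (rule Min_in) (use T1 fT1 in auto)
  then have T2: "T2 \<noteq> {}" by (force simp: T2_def)
  have fT2: "finite T2" unfolding T2_def using finite_vimageI[OF fT1, of "Pair b0"] by (simp add: vimage_def inj_on_def)
  define d0 where "d0 = Min T2"
  have d0: "d0 \<in> T2" unfolding d0_def by (rule Min_in) (use T2 fT2 in auto)
  \<comment> \<open>Exponents are paired with the unit value because \<open>prime_step\<close> reads
    the exponent of \<open>y\<close> as a first component.\<close>
  have "(\<Sum>i\<in>{i\<in>(\<lambda>d. (d, ())) ` T2. fst i = d0}. cst (c (a0, b0, fst i))) \<in> P3"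
  proof (rule prime_step[OF P(3,4) sub(3) y(5,6)])
    show "finite ((\<lambda>d. (d, ())) ` T2)" using fT2 by simp
    show "(\<Sum>i\<in>(\<lambda>d. (d, ())) ` T2. cst (c (a0, b0, fst i)) * y2 ^ fst i) \<in> P2"
      using s2 by (subst sum.reindex) (auto simp: inj_on_def)
    show "d0 \<le> fst i" if "i \<in> (\<lambda>d. (d, ())) ` T2" for i using fT2 that by (auto simp: d0_def)
  qed (intro Im_cl)
  also have "{i\<in>(\<lambda>d. (d, ())) ` T2. fst i = d0} = {(d0, ())}" using d0 by auto
  finally have "cst (c (a0, b0, d0)) \<in> P3" by simp
  moreover have "c (a0, b0, d0) \<noteq> 0" using T(3) d0 by (simp add: T2_def T1_def)
  ultimately have "cst (inverse (c (a0, b0, d0))) * cst (c (a0, b0, d0)) \<in> P3" "inverse (c (a0, b0, d0)) * c (a0, b0, d0) = 1"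
    using P(4) Im_cl(3) unfolding pset_def by auto
  then have "1 \<in> P3" by (simp only: cst_simps(4)[symmetric] cst_simps(2))
  then show False using P(4) by (simp add: pset_def)
qed

end

text \<open>An abstract algebra realised in K[x, y] as the span of the monomials with exponents in
  \<open>S\<close>. Closure of \<open>S\<close> under addition is implicit in the image being a
  subring.\<close>

locale monalg = ring H for H :: "('x, 'y) ring_scheme" (structure) +
  fixes sm :: "'k::field \<Rightarrow> 'x \<Rightarrow> 'x" and h :: "'x \<Rightarrow> 'k poly poly" and S :: "(nat \<times> nat) set"
  assumes inj: "inj_on h (carrier H)"
    and img: "h ` carrier H = {p. \<forall>s t. cf2 p s t \<noteq> 0 \<longrightarrow> (s, t) \<in> S}"
    and h_add: "x \<in> carrier H \<Longrightarrow> x' \<in> carrier H \<Longrightarrow> h (x \<oplus>\<^bsub>H\<^esub> x') = h x + h x'"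
    and h_mult: "x \<in> carrier H \<Longrightarrow> x' \<in> carrier H \<Longrightarrow> h (x \<otimes>\<^bsub>H\<^esub> x') = h x * h x'"
    and h_one: "h \<one>\<^bsub>H\<^esub> = 1"
    and sm_cl: "x \<in> carrier H \<Longrightarrow> sm c x \<in> carrier H"
    and h_sm: "x \<in> carrier H \<Longrightarrow> h (sm c x) = cst c * h x"
begin

lemma h_eq: "x \<in> carrier H \<Longrightarrow> x' \<in> carrier H \<Longrightarrow> h x = h x' \<Longrightarrow> x = x'"
  using inj by (auto simp: inj_on_def)

lemma h_zero: "h \<zero>\<^bsub>H\<^esub> = 0"
proof -
  have "h \<zero> = h \<zero> + h \<zero>" using h_add[of \<zero> \<zero>] by simp
  then show ?thesis by (simp only: add_cancel_right_right)
qed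

text \<open>Commutativity is pulled back along the injection into K[x, y].\<close>

lemma is_cring: "cring H"
proof (rule cringI)
  show "abelian_group H" ..
  show "Group.comm_monoid H"
    by (rule monoid.monoid_comm_monoidI) (auto intro!: h_eq simp: h_mult mult.commute is_monoid)
qed (simp add: l_distr)

lemma Im_imring: "imring (h ` carrier H)"
proof
  fix a b assume "a \<in> h ` carrier H" "b \<in> h ` carrier H"
  then obtain x y where "x \<in> carrier H" "y \<in> carrier H" "a = h x" "b = h y" by blast
  then show "a + b \<in> h ` carrier H" "a * b \<in> h ` carrier H"
    using imageI[OF a_closed, of x y h] imageI[OF m_closed, of x y h] by (simp_all add: h_add h_mult)
next
  fix c
  have "h (sm c \<one>) = cst c" by (simp add: h_sm h_one)
  then show "cst c \<in> h ` carrier H" using imageI[OF sm_cl[OF one_closed, of c], of h] by simp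
qed

lemma prime_pset: assumes P: "primeideal P H" shows "pset (h ` carrier H) (h ` P)"
proof -
  interpret P: primeideal P H by (rule P)
  have sub: "P \<subseteq> carrier H" by (rule P.a_subset)
  have mem: "h x \<in> h ` P \<longleftrightarrow> x \<in> P" if "x \<in> carrier H" for x
    using that sub h_eq by blast
  have z: "\<zero> \<in> P" by simp
  have "\<one> \<notin> P" using P.I_notcarr P.one_imp_carrier by blast
  then have "1 \<notin> h ` P" using mem[OF one_closed] h_one by simp
  moreover have "h ` P \<subseteq> h ` carrier H" using sub by (rule image_mono)
  moreover have "0 \<in> h ` P" using imageI[OF z, of h] h_zero by simp
  moreover have "h x + h y \<in> h ` P" if "x \<in> P" "y \<in> P" for x y
    using that sub h_add[of x y] P.a_closed[OF that] imageI[of "x \<oplus> y" P h] by auto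
  moreover have "h x * h y \<in> h ` P" if "x \<in> carrier H" "y \<in> P" for x y
    using that sub h_mult[of x y] P.I_l_closed[of y x] imageI[of "x \<otimes> y" P h] by auto
  moreover have "h x \<in> h ` P \<or> h y \<in> h ` P" if "x \<in> carrier H" "y \<in> carrier H" "h x * h y \<in> h ` P" for x y
  proof -
    have "x \<otimes> y \<in> P" using that h_mult[of x y] mem[of "x \<otimes> y"] by simp
    then show ?thesis using P.I_prime[OF that(1,2)] by auto
  qed
  ultimately show ?thesis unfolding pset_def ball_simps(9) by simp
qed

lemma krull_le: assumes "prime_chain H P n" shows "n \<le> 2"
proof (rule ccontr)
  assume n: "\<not> n \<le> 2"
  interpret I: imring "h ` carrier H" by (rule Im_imring)
  have p: "primeideal (P i) H" if "i \<le> 3" for i using assms n that by (simp add: prime_chain_def)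
  have s: "P i \<subset> P (Suc i)" if "i < 3" for i using assms n that by (simp add: prime_chain_def)
  have ex: "\<exists>y. y \<in> h ` P (Suc i) \<and> y \<notin> h ` P i" "h ` P i \<subseteq> h ` P (Suc i)" if "i < 3" for i
  proof -
    obtain x where x: "x \<in> P (Suc i)" "x \<notin> P i" using s[OF \<open>i < 3\<close>] by blast
    have "P i \<subseteq> carrier H" "P (Suc i) \<subseteq> carrier H" using p[of i] p[of "Suc i"] \<open>i < 3\<close>
      by (simp_all add: additive_subgroup.a_subset[OF ideal.axioms(1)[OF primeideal.axioms(1)]])
    then have "h x \<notin> h ` P i" using x h_eq by blast
    then show "\<exists>y. y \<in> h ` P (Suc i) \<and> y \<notin> h ` P i" using x by blast
    show "h ` P i \<subseteq> h ` P (Suc i)" using s[OF \<open>i < 3\<close>] by blast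
  qed
  obtain y0 y1 y2 where y: "y0 \<in> h ` P (Suc 0)" "y0 \<notin> h ` P 0" "y1 \<in> h ` P (Suc (Suc 0))" "y1 \<notin> h ` P (Suc 0)"
    "y2 \<in> h ` P (Suc (Suc (Suc 0)))" "y2 \<notin> h ` P (Suc (Suc 0))"
    using ex(1)[of 0] ex(1)[of "Suc 0"] ex(1)[of "Suc (Suc 0)"] by auto
  show False
    by (rule I.no_chain3[OF prime_pset prime_pset prime_pset prime_pset _ _ _ y]) (use p ex(2) in auto)
qed

lemma ker_prime:
  fixes g :: "'k poly poly \<Rightarrow> 'b::idom"
  assumes g: "\<And>a b. g (a + b) = g a + g b" "\<And>a b. g (a * b) = g a * g b" "g 1 = 1"
  shows "primeideal {x \<in> carrier H. g (h x) = 0} H"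
proof -
  define K where "K = {x \<in> carrier H. g (h x) = 0}"
  have K: "x \<in> K \<longleftrightarrow> x \<in> carrier H \<and> g (h x) = 0" for x by (simp add: K_def)
  have "g 0 = g 0 + g 0" using g(1)[of 0 0] by simp
  then have g0: "g 0 = 0" by (simp only: add_cancel_right_right)
  have id: "ideal K H"
  proof (rule idealI)
    show "ring H" by (rule ring_axioms)
    show "subgroup K (add_monoid H)"
    proof (rule group.subgroupI[OF add.is_group])
      show "K \<subseteq> carrier (add_monoid H)" using K by auto
      have "\<zero> \<in> K" by (simp add: K h_zero g0)
      then show "K \<noteq> {}" by blast
      fix x assume x: "x \<in> K"
      then have xc: "x \<in> carrier H" by (simp add: K)
      have "h x + h (\<ominus> x) = 0" using xc h_add[of x "\<ominus> x"] h_zero by (simp add: r_neg)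
      then have "g (h x) + g (h (\<ominus> x)) = 0" using g(1)[of "h x" "h (\<ominus> x)"] g0 by simp
      then have "\<ominus> x \<in> K" using x by (simp add: K)
      then show "inv\<^bsub>add_monoid H\<^esub> x \<in> K" by (simp only: a_inv_def)
      fix y assume "y \<in> K"
      then have "x \<oplus> y \<in> K" using x by (simp add: K h_add g(1))
      then show "x \<otimes>\<^bsub>add_monoid H\<^esub> y \<in> K" by simp
    qed
    show "x \<otimes> a \<in> K" "a \<otimes> x \<in> K" if "a \<in> K" "x \<in> carrier H" for a x
      using that by (simp_all add: K h_mult g(2))
  qed
  have "primeideal K H"
  proof (rule primeidealI[OF id is_cring])
    have "\<one> \<notin> K" by (simp add: K h_one g(3))
    then show "carrier H \<noteq> K" using one_closed by blast
    show "a \<in> K \<or> b \<in> K" if "a \<in> carrier H" "b \<in> carrier H" "a \<otimes> b \<in> K" for a b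
      using that by (simp add: K h_mult g(2))
  qed
  then show ?thesis by (simp only: K_def)
qed

lemma xym_ex: "(s, t) \<in> S \<Longrightarrow> \<exists>x\<in>carrier H. h x = xym s t"
proof -
  assume "(s, t) \<in> S"
  then have "xym s t \<in> h ` carrier H" unfolding img by (auto simp: cf2_xym split: if_splits)
  then show ?thesis by auto
qed

lemma krull_dim_eq:
  fixes N :: nat
  assumes N: "N > 0" "(N, 0) \<in> S" "(0, N) \<in> S"
  shows "krull_dim H = 2"
proof -
  \<comment> \<open>The identity, the evaluation at \<open>y = 0\<close> and the evaluation at the
    origin, all written as maps of K[x, y] into itself so that one lemma provides the three
    kernels.\<close>
  define G :: "nat \<Rightarrow> 'k poly poly \<Rightarrow> 'k poly poly" where
    "G i = (if i = 0 then (\<lambda>p. p) else if i = 1 then (\<lambda>p. [:poly p 0:]) else (\<lambda>p. [:[:poly (poly p 0) 0:]:]))" for i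
  have Gm: "G i (a + b) = G i a + G i b" "G i (a * b) = G i a * G i b" "G i 1 = 1" for i a b
    by (simp_all add: G_def one_pCons)
  define P where "P i = {x \<in> carrier H. G i (h x) = 0}" for i
  have pr: "primeideal (P i) H" for i unfolding P_def by (rule ker_prime) (simp_all add: Gm)
  obtain x where x: "x \<in> carrier H" "h x = xym N 0" using xym_ex[OF N(2)] by blast
  obtain y where y: "y \<in> carrier H" "h y = xym 0 N" using xym_ex[OF N(3)] by blast
  have P01: "P 0 \<subset> P 1"
  proof
    show "P 0 \<subseteq> P 1" by (auto simp: P_def G_def)
    have "y \<in> P 1" "y \<notin> P 0" using y N(1) by (simp_all add: P_def G_def xym_def poly_monom)
    then show "P 0 \<noteq> P 1" by auto
  qed
  have P12: "P 1 \<subset> P 2"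
  proof
    show "P 1 \<subseteq> P 2" by (auto simp: P_def G_def)
    have "x \<in> P 2" "x \<notin> P 1" using x N(1) by (simp_all add: P_def G_def xym_def poly_monom monom_0)
    then show "P 1 \<noteq> P 2" by auto
  qed
  have "P i \<subset> P (Suc i)" if "i < 2" for i
    using less_2_cases[OF that] P01 P12 by (elim disjE) (simp_all add: numeral_2_eq_2)
  then have "prime_chain H P 2" using pr by (simp add: prime_chain_def)
  show ?thesis unfolding krull_dim_def
  proof (rule antisym)
    show "(SUP n\<in>{n. \<exists>P. prime_chain H P n}. enat n) \<le> 2"
    proof (rule SUP_least)
      fix n assume "n \<in> {n. \<exists>P. prime_chain H P n}"
      then have "n \<le> 2" using krull_le by auto
      then have "enat n \<le> enat 2" by simp
      then show "enat n \<le> 2" by (simp add: numeral_eq_enat)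
    qed
    have "enat 2 \<le> (SUP n\<in>{n. \<exists>P. prime_chain H P n}. enat n)"
      by (rule SUP_upper) (use \<open>prime_chain H P 2\<close> in auto)
    then show "2 \<le> (SUP n\<in>{n. \<exists>P. prime_chain H P n}. enat n)" by (simp add: numeral_eq_enat)
  qed
qed

text \<open>The monomials with both exponents at most \<open>N\<close> generate: a larger exponent
  is lowered by splitting off the \<open>N\<close>-th power of its variable, and the periodicity
  assumption keeps the cofactor inside \<open>S\<close>.\<close>

lemma fin_gen:
  fixes N :: nat
  assumes N: "N > 0" "(N, 0) \<in> S" "(0, N) \<in> S"
    and sub: "\<And>s t. (s + N, t) \<in> S \<Longrightarrow> (s, t) \<in> S" "\<And>s t. (s, t + N) \<in> S \<Longrightarrow> (s, t) \<in> S"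
  shows "finitely_generated_kalg H sm"
proof -
  define G where "G = {x \<in> carrier H. \<exists>s t. s \<le> N \<and> t \<le> N \<and> h x = xym s t}"
  have "h ` G \<subseteq> (\<lambda>(s, t). xym s t) ` ({..N} \<times> {..N})" by (auto simp: G_def)
  then have "finite (h ` G)" by (rule finite_subset) simp
  moreover have "inj_on h G" using inj by (rule inj_on_subset) (auto simp: G_def)
  ultimately have fG: "finite G" by (rule finite_imageD)
  let ?K = "kalg_generated H sm G"
  have Kc: "?K \<subseteq> carrier H"
  proof
    fix x assume "x \<in> ?K"
    then show "x \<in> carrier H" by induction (auto simp: G_def sm_cl)
  qed
  have mon: "\<exists>x\<in>?K. h x = xym s t" if "(s, t) \<in> S" for s t
    using that
  proof (induction "s + t" arbitrary: s t rule: less_induct)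
    case less
    have xm: "xym (a + b) (c + d) = (xym a c * xym b d :: 'k poly poly)" for a b c d
      by (simp add: xym_def mult_monom)
    have gen: "\<exists>x\<in>?K. h x = xym a b" if "(a, b) \<in> S" "a \<le> N" "b \<le> N" for a b
      using xym_ex[OF that(1)] that by (auto simp: G_def intro!: kalg_generated.gen)
    consider "s \<le> N \<and> t \<le> N" | "s > N" | "t > N" by linarith
    then show ?case
    proof cases
      case 1
      then show ?thesis using gen less.prems by blast
    next
      case 2
      have "(s - N, t) \<in> S" using sub(1)[of "s - N" t] less.prems 2 by simp
      then obtain x where x: "x \<in> ?K" "h x = xym (s - N) t" using less.hyps[of "s - N" t] 2 N by auto
      obtain z where z: "z \<in> ?K" "h z = xym N 0" using gen[OF N(2)] by auto
      have "h (x \<otimes> z) = xym s t" using x z Kc xm[of "s - N" N t 0] 2 by (simp add: h_mult subset_iff)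
      then show ?thesis using kalg_generated.mult[OF x(1) z(1)] by blast
    next
      case 3
      have "(s, t - N) \<in> S" using sub(2)[of s "t - N"] less.prems 3 by simp
      then obtain x where x: "x \<in> ?K" "h x = xym s (t - N)" using less.hyps[of s "t - N"] 3 N by auto
      obtain z where z: "z \<in> ?K" "h z = xym 0 N" using gen[OF N(3)] by auto
      have "h (x \<otimes> z) = xym s t" using x z Kc xm[of s 0 "t - N" N] 3 by (simp add: h_mult subset_iff)
      then show ?thesis using kalg_generated.mult[OF x(1) z(1)] by blast
    qed
  qed
  \<comment> \<open>\<open>kalg_generated\<close> has no clause for zero; it arises as the scalar 0
    times the identity.\<close>
  have zero: "\<exists>x\<in>?K. h x = 0"
  proof
    show "sm 0 \<one> \<in> ?K" by (intro kalg_generated.smul kalg_generated.one)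
    show "h (sm 0 \<one>) = 0" by (simp add: h_sm cst_simps)
  qed
  have sum: "\<exists>x\<in>?K. h x = (\<Sum>a\<in>A. f a)" if "finite A" "\<And>a. a \<in> A \<Longrightarrow> \<exists>x\<in>?K. h x = f a" for A :: "(nat \<times> nat) set" and f
    using that
  proof (induction A rule: finite_induct)
    case (insert a A)
    have "\<exists>x\<in>?K. h x = f a" by (rule insert.prems) simp
    moreover have "\<exists>y\<in>?K. h y = (\<Sum>a\<in>A. f a)" by (rule insert.IH) (rule insert.prems, simp)
    ultimately obtain x y where "x \<in> ?K" "h x = f a" "y \<in> ?K" "h y = (\<Sum>a\<in>A. f a)" by blast
    note xy = this
    show ?case
    proof
      show "x \<oplus> y \<in> ?K" by (intro kalg_generated.add xy)
      show "h (x \<oplus> y) = (\<Sum>a\<in>insert a A. f a)" using insert.hyps xy h_add[of x y] subsetD[OF Kc, of x] subsetD[OF Kc, of y] by simp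
    qed
  qed (use zero in simp)
  have "x \<in> ?K" if x: "x \<in> carrier H" for x
  proof -
    obtain L where L: "box L (h x)" using box_ex by blast
    have "\<exists>z\<in>?K. h z = (\<Sum>p\<in>{..L} \<times> {..L}. case p of (s, t) \<Rightarrow> cst (cf2 (h x) s t) * xym s t)"
    proof (rule sum)
      fix p :: "nat \<times> nat"
      obtain s t where p: "p = (s, t)" by (cases p)
      show "\<exists>z\<in>?K. h z = (case p of (s, t) \<Rightarrow> cst (cf2 (h x) s t) * xym s t)"
      proof (cases "cf2 (h x) s t = 0")
        case True
        then show ?thesis using zero by (simp add: p cst_simps)
      next
        case False
        have "h x \<in> h ` carrier H" using x by simp
        then have "(s, t) \<in> S" using False unfolding img by blast
        then obtain z where "z \<in> ?K" "h z = xym s t" using mon by blast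
        note z = this
        show ?thesis
        proof
          show "sm (cf2 (h x) s t) z \<in> ?K" by (intro kalg_generated.smul z)
          show "h (sm (cf2 (h x) s t) z) = (case p of (s, t) \<Rightarrow> cst (cf2 (h x) s t) * xym s t)"
            using z h_sm[of z "cf2 (h x) s t"] subsetD[OF Kc, of z] by (simp add: p)
        qed
      qed
    qed simp
    then obtain z where "z \<in> ?K" "h z = h x" using box_sum[OF L] by auto
    then show ?thesis using h_eq[of z x] x Kc by auto
  qed
  then have "?K = carrier H" using Kc by blast
  then show ?thesis unfolding finitely_generated_kalg_def using fG by (intro exI[of _ G]) (auto simp: G_def)
qed

lemma iso_K: assumes S: "S = {(0, 0)}" shows "kalg_iso_to_K H sm"
proof -
  define \<phi> where "\<phi> c = sm c \<one>" for c
  have hp: "h (\<phi> c) = cst c" and pc: "\<phi> c \<in> carrier H" for c by (simp_all add: \<phi>_def h_sm h_one sm_cl)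
  have sur: "\<exists>x. y = \<phi> x" if y: "y \<in> carrier H" for y
  proof -
    have "h y \<in> h ` carrier H" using y by (rule imageI)
    then have z: "\<And>s t. cf2 (h y) s t \<noteq> 0 \<Longrightarrow> s = 0 \<and> t = 0" unfolding img S mem_Collect_eq by simp
    have c: "cf2 (cst (cf2 (h y) 0 0)) s t = (if s = 0 \<and> t = 0 then cf2 (h y) 0 0 else 0)" for s t
      by (cases s; cases t) (simp_all add: cst_def)
    have "h y = cst (cf2 (h y) 0 0)"
    proof (rule cf2_eqI)
      fix s t
      show "cf2 (h y) s t = cf2 (cst (cf2 (h y) 0 0)) s t" unfolding c using z[of s t] z[of t s] by (cases "s = 0 \<and> t = 0") auto
    qed
    then have "h y = h (\<phi> (cf2 (h y) 0 0))" by (simp only: hp)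
    then have "y = \<phi> (cf2 (h y) 0 0)" by (rule h_eq[OF y pc])
    then show ?thesis by (rule exI)
  qed
  have "bij_betw \<phi> UNIV (carrier H)"
    unfolding bij_betw_def
  proof
    show "inj \<phi>"
    proof (rule injI)
      fix c d assume "\<phi> c = \<phi> d"
      then have "cst c = cst d" using hp[of c] hp[of d] by simp
      then show "c = d" by (simp add: cst_def)
    qed
    show "range \<phi> = carrier H" using sur pc by blast
  qed
  moreover have "\<phi> \<in> ring_hom field_ring H"
  proof (rule ring_hom_memI)
    show "\<phi> x \<in> carrier H" for x by (rule pc)
    show "\<phi> (x \<otimes>\<^bsub>field_ring\<^esub> y) = \<phi> x \<otimes> \<phi> y" for x y
      by (rule h_eq) (simp_all add: field_ring_def pc hp h_mult cst_simps)
    show "\<phi> (x \<oplus>\<^bsub>field_ring\<^esub> y) = \<phi> x \<oplus> \<phi> y" for x y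
      by (rule h_eq) (simp_all add: field_ring_def pc hp h_add cst_simps)
    show "\<phi> \<one>\<^bsub>field_ring\<^esub> = \<one>"
      by (rule h_eq) (simp_all add: field_ring_def pc hp h_one cst_simps)
  qed
  moreover have "\<phi> (c * x) = sm c (\<phi> x)" for c x
    by (rule h_eq) (simp_all add: pc hp h_sm sm_cl cst_simps)
  ultimately show ?thesis unfolding kalg_iso_to_K_def by (intro exI[of _ \<phi>]) simp
qed

end

section \<open>Hochschild cohomology modulo nilpotent elements\<close>

context qv
begin

abbreviation "LM \<equiv> Lam m q"
abbreviation "LS \<equiv> Lam_smul m q"
abbreviation "CR \<equiv> cocycle_ring LM LS"
abbreviation "BR \<equiv> coboundary_ideal LM LS"
abbreviation "HR \<equiv> HH LM LS"
abbreviation "NR \<equiv> HH_nil LM LS"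
abbreviation "UU \<equiv> kiso.U CLr th th'"

interpretation K: kiso LM CLr LS scl th th'
  by (rule Lam_kiso)

lemmas UU_closed = K.U_closed[folded CC_def] and UU_mult = K.U_mult[folded CC_def] and UU_add = K.U_add[folded CC_def]
  and UU_one = K.U_one[folded CC_def] and UU_image = K.U_image[folded CC_def] and UU_hom = K.U_hom[folded CC_def]
  and UU_B = K.U_coboundary[folded BB_def]

lemma CR_ring: "ring CR"
  by (rule K.cocycle_ring_transfer[OF CC_ring[unfolded CC_def]])

lemma BR_ideal: "ideal BR CR"
proof -
  interpret h: ring_hom_ring CR CC UU
    by (rule ring_hom_ringI2[OF CR_ring CC_ring UU_hom])
  have "BR = {F \<in> carrier CR. UU F \<in> BB}" using UU_B by (auto simp: coboundary_ideal_def)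
  then show ?thesis using h.ideal_vimage[OF BB_ideal] by simp
qed

interpretation B: ideal BR CR by (rule BR_ideal)

definition Phi :: "(nat \<Rightarrow> (path \<Rightarrow> 'k) set list \<Rightarrow> (path \<Rightarrow> 'k) set) \<Rightarrow> 'k poly poly" where
  "Phi F = Psi (UU F)"

lemma Phi_hom: "F \<in> carrier CR \<Longrightarrow> G \<in> carrier CR \<Longrightarrow> Phi (F \<oplus>\<^bsub>CR\<^esub> G) = Phi F + Phi G"
  "F \<in> carrier CR \<Longrightarrow> G \<in> carrier CR \<Longrightarrow> Phi (F \<otimes>\<^bsub>CR\<^esub> G) = Phi F * Phi G"
  "Phi \<one>\<^bsub>CR\<^esub> = 1"
  by (simp_all only: Phi_def UU_add UU_mult UU_one UU_closed Psi_add Psi_mult Psi_one)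

lemma Phi_BR: assumes "F \<in> BR" shows "Phi F = 0"
  unfolding Phi_def by (rule Psi_BB, rule iffD2[OF UU_B[OF B.a_Hcarr[OF assms]] assms])

lemma Phi_cube: assumes F: "F \<in> carrier CR" and z: "Phi F = 0" shows "F \<otimes>\<^bsub>CR\<^esub> (F \<otimes>\<^bsub>CR\<^esub> F) \<in> BR"
proof -
  have c: "F \<otimes>\<^bsub>CR\<^esub> F \<in> carrier CR" "F \<otimes>\<^bsub>CR\<^esub> (F \<otimes>\<^bsub>CR\<^esub> F) \<in> carrier CR" using F by simp_all
  have "UU (F \<otimes>\<^bsub>CR\<^esub> (F \<otimes>\<^bsub>CR\<^esub> F)) \<in> BB"
    unfolding UU_mult[OF F c(1)] UU_mult[OF F F] using Psi_cube[OF UU_closed[OF F]] z by (simp add: Phi_def)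
  then show ?thesis using UU_B[OF c(2)] by simp
qed

lemma Phi_image: "Phi ` carrier CR = {p. \<forall>s t. cf2 p s t \<noteq> 0 \<longrightarrow> (s, t) \<in> SS}"
proof -
  have "Phi ` carrier CR = Psi ` (UU ` carrier CR)" unfolding image_image Phi_def ..
  then show ?thesis unfolding UU_image Psi_image sup_SS_def .
qed

lemma Lam_smul_zero: "LS c \<zero>\<^bsub>LM\<^esub> = \<zero>\<^bsub>LM\<^esub>"
proof -
  have "th (LS c \<zero>\<^bsub>LM\<^esub>) = th \<zero>\<^bsub>LM\<^esub>" using K.smhom[OF K.R.zero_closed, of c] K.th_zero by simp
  then show ?thesis using K.inv(1)[OF K.smcl(1)[OF K.R.zero_closed, of c]] K.inv(1)[OF K.R.zero_closed] by simp
qed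

lemma CR_smul: assumes F: "F \<in> carrier CR"
  shows "cocycle_smul LS c F \<in> carrier CR" "Phi (cocycle_smul LS c F) = cst c * Phi F"
proof -
  have U: "UU (cocycle_smul LS c F) = csm c (UU F)"
    using K.U_smul[OF F, of c] by (simp add: csm_def cocycle_smul_def)
  then show "Phi (cocycle_smul LS c F) = cst c * Phi F"
    by (simp add: Phi_def Psi_csm[OF UU_closed[OF F]] smult_cst)
  interpret sy: kiso CLr LM scl LS th' th by (rule K.kiso_sym)
  have "sy.U (csm c (UU F)) = cocycle_smul LS c (sy.U (UU F))"
    using sy.U_smul[OF UU_closed[OF F, unfolded CC_def], of c] Lam_smul_zero by (simp add: csm_def cocycle_smul_def)
  also have "sy.U (UU F) = F" by (rule sy.U_inv[OF F])
  finally have "cocycle_smul LS c F = sy.U (csm c (UU F))" by simp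
  then show "cocycle_smul LS c F \<in> carrier CR"
    using sy.U_closed[OF csm_closed[OF UU_closed[OF F], unfolded CC_def]] by simp
qed

definition hcR :: "nat \<Rightarrow> (nat \<Rightarrow> (path \<Rightarrow> 'k) set list \<Rightarrow> (path \<Rightarrow> 'k) set) \<Rightarrow> nat \<Rightarrow> (path \<Rightarrow> 'k) set list \<Rightarrow> (path \<Rightarrow> 'k) set" where
  "hcR n F = (\<lambda>k. if k = n then F k else zcoch LM)"

lemma zcoch_cocycle: "zcoch LM \<in> hcocycles LM LS n"
proof -
  have "\<zero>\<^bsub>CR\<^esub> \<in> carrier CR" by simp
  then have "\<zero>\<^bsub>CR\<^esub> n \<in> hcocycles LM LS n" by (rule K.C_D(1))
  then show ?thesis by (simp add: cocycle_ring_def)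
qed

lemma cut_closed: assumes F: "F \<in> carrier CR" shows "(\<lambda>k. if P k then F k else zcoch LM) \<in> carrier CR"
proof -
  have "{k. (if P k then F k else zcoch LM) \<noteq> zcoch LM} \<subseteq> {k. F k \<noteq> zcoch LM}" by auto
  then have "finite {k. (if P k then F k else zcoch LM) \<noteq> zcoch LM}" using K.C_D(3)[OF F] by (rule finite_subset)
  then show ?thesis using K.C_D(1)[OF F] zcoch_cocycle by (simp add: cocycle_ring_def)
qed

lemma hcR_closed: "F \<in> carrier CR \<Longrightarrow> hcR n F \<in> carrier CR"
  unfolding hcR_def by (rule cut_closed)

lemma hcR_Phi: assumes F: "F \<in> carrier CR" and z: "Phi F = 0" shows "Phi (hcR n F) = 0"
proof -
  have "UU (hcR n F) = hcomp n (UU F)"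
    by (rule ext) (simp add: K.U_def hcR_def hcomp_def K.pu_zcoch, simp add: zcoch_def)
  then show ?thesis using hcomp_Psi[OF UU_closed[OF F]] z by (simp add: Phi_def)
qed

lemma HR_ring: "ring HR"
  unfolding HH_def by (rule B.quotient_is_ring)

lemma HR_ex: assumes "Y \<in> carrier HR" obtains F where "F \<in> carrier CR" "Y = BR +>\<^bsub>CR\<^esub> F"
  using assms by (auto simp: HH_def FactRing_def A_RCOSETS_def')

lemma coset_hom: "(\<lambda>F. BR +>\<^bsub>CR\<^esub> F) \<in> ring_hom CR HR"
  unfolding HH_def by (rule B.rcos_ring_hom)

text \<open>The chosen representative is immaterial because \<open>Phi\<close> kills
  coboundaries.\<close>

definition h1 :: "(nat \<Rightarrow> (path \<Rightarrow> 'k) set list \<Rightarrow> (path \<Rightarrow> 'k) set) set \<Rightarrow> 'k poly poly" where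
  "h1 Y = Phi (SOME F. F \<in> Y)"

lemma coset_elem: assumes F: "F \<in> carrier CR" and G: "G \<in> BR +>\<^bsub>CR\<^esub> F" shows "G \<in> carrier CR" "Phi G = Phi F"
proof -
  obtain b where b: "b \<in> BR" "G = b \<oplus>\<^bsub>CR\<^esub> F" using G by (auto simp: a_r_coset_def')
  have bc: "b \<in> carrier CR" using b(1) B.a_subset by blast
  show "G \<in> carrier CR" unfolding b(2) using bc F by simp
  show "Phi G = Phi F" unfolding b(2) Phi_hom(1)[OF bc F] by (simp add: Phi_BR b(1))
qed

lemma h1_elem: assumes Y: "Y \<in> carrier HR" and G: "G \<in> Y" shows "G \<in> carrier CR" "h1 Y = Phi G"
proof -
  obtain F where F: "F \<in> carrier CR" "Y = BR +>\<^bsub>CR\<^esub> F" using Y by (rule HR_ex)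
  show "G \<in> carrier CR" using coset_elem(1)[OF F(1)] G F(2) by simp
  have "(SOME F. F \<in> Y) \<in> Y" using G by (rule someI[of "\<lambda>F. F \<in> Y"])
  then show "h1 Y = Phi G" using coset_elem(2)[OF F(1)] G F(2) by (simp add: h1_def)
qed

lemma coset_closed: "F \<in> carrier CR \<Longrightarrow> BR +>\<^bsub>CR\<^esub> F \<in> carrier HR"
  using ring_hom_closed[OF coset_hom] .

lemma h1_coset: "F \<in> carrier CR \<Longrightarrow> h1 (BR +>\<^bsub>CR\<^esub> F) = Phi F"
  by (rule h1_elem(2)[OF coset_closed]) (simp_all add: B.a_rcos_self)

definition PR :: "'k poly poly ring" where
  "PR = \<lparr>carrier = UNIV, monoid.mult = (*), one = 1, ring.zero = 0, ring.add = (+)\<rparr>"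

lemma PR_simps: "carrier PR = UNIV" "monoid.mult PR = (*)" "one PR = 1" "ring.zero PR = 0" "ring.add PR = (+)"
  by (simp_all add: PR_def)

lemma PR_ring: "ring PR"
proof (rule ringI)
  show "abelian_group PR"
  proof (rule abelian_groupI)
    fix x show "\<exists>y\<in>carrier PR. y \<oplus>\<^bsub>PR\<^esub> x = \<zero>\<^bsub>PR\<^esub>" by (rule bexI[of _ "- x"]) (simp_all add: PR_simps)
  qed (simp_all add: PR_simps add_ac)
  show "Group.monoid PR" by (rule monoidI) (simp_all add: PR_simps mult_ac)
qed (simp_all add: PR_simps algebra_simps)

lemma h1_hom: "Y \<in> carrier HR \<Longrightarrow> Z \<in> carrier HR \<Longrightarrow> h1 (Y \<oplus>\<^bsub>HR\<^esub> Z) = h1 Y + h1 Z"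
  "Y \<in> carrier HR \<Longrightarrow> Z \<in> carrier HR \<Longrightarrow> h1 (Y \<otimes>\<^bsub>HR\<^esub> Z) = h1 Y * h1 Z"
  "h1 \<one>\<^bsub>HR\<^esub> = 1"
proof -
  show "h1 \<one>\<^bsub>HR\<^esub> = 1" unfolding ring_hom_one[OF coset_hom, symmetric] using h1_coset[of "\<one>\<^bsub>CR\<^esub>"] Phi_hom(3) by simp
  assume "Y \<in> carrier HR" "Z \<in> carrier HR"
  then have YZ: "Y \<in> carrier HR" "Z \<in> carrier HR" .
  obtain F where F: "F \<in> carrier CR" "Y = BR +>\<^bsub>CR\<^esub> F" using YZ(1) by (rule HR_ex)
  obtain G where G: "G \<in> carrier CR" "Z = BR +>\<^bsub>CR\<^esub> G" using YZ(2) by (rule HR_ex)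
  show "h1 (Y \<oplus>\<^bsub>HR\<^esub> Z) = h1 Y + h1 Z"
    unfolding F(2) G(2) ring_hom_add[OF coset_hom F(1) G(1), symmetric] using F(1) G(1) by (simp add: h1_coset Phi_hom)
  show "h1 (Y \<otimes>\<^bsub>HR\<^esub> Z) = h1 Y * h1 Z"
    unfolding F(2) G(2) ring_hom_mult[OF coset_hom F(1) G(1), symmetric] using F(1) G(1) by (simp add: h1_coset Phi_hom)
qed

lemma h1_ring_hom: "ring_hom_ring HR PR h1"
  by (rule ring_hom_ringI2[OF HR_ring PR_ring], rule ring_hom_memI) (simp_all only: PR_simps h1_hom UNIV_I)

lemma h1_pow: "Y \<in> carrier HR \<Longrightarrow> h1 (Y [^]\<^bsub>HR\<^esub> (k::nat)) = h1 Y ^ k"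
proof (induction k)
  interpret H: ring HR by (rule HR_ring)
  case 0
  show ?case by (simp add: h1_hom)
next
  interpret H: ring HR by (rule HR_ring)
  case (Suc k)
  then show ?case by (simp add: h1_hom H.nat_pow_closed mult.commute)
qed

lemma kernel_iff: "Y \<in> a_kernel HR PR h1 \<longleftrightarrow> Y \<in> carrier HR \<and> h1 Y = 0"
  by (simp add: a_kernel_def' PR_simps)

text \<open>K[x, y] is reduced, so \<open>h1\<close> kills the generators of the nil ideal.
  Conversely, the homogeneous components of a kernel class lie in the kernel again and have
  vanishing cubes, and the class is their finite sum.\<close>

lemma HR_nil: "a_kernel HR PR h1 = NR"
proof (rule equalityI)
  interpret h: ring_hom_ring HR PR h1 by (rule h1_ring_hom)
  let ?G = "{Y. HH_homogeneous LM LS Y \<and> nilpotent_elem HR Y}"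
  have Gc: "?G \<subseteq> carrier HR" by (auto simp: nilpotent_elem_def)
  show "NR \<subseteq> a_kernel HR PR h1"
    unfolding HH_nil_def
  proof (rule h.R.genideal_minimal[OF h.kernel_is_ideal], rule subsetI)
    fix Y assume "Y \<in> ?G"
    then obtain k :: nat where Y: "Y \<in> carrier HR" "k > 0" "Y [^]\<^bsub>HR\<^esub> k = \<zero>\<^bsub>HR\<^esub>" by (auto simp: nilpotent_elem_def)
    have "h1 \<zero>\<^bsub>HR\<^esub> = h1 \<zero>\<^bsub>HR\<^esub> + h1 \<zero>\<^bsub>HR\<^esub>" using h1_hom(1)[OF h.R.zero_closed h.R.zero_closed] by simp
    then have "h1 \<zero>\<^bsub>HR\<^esub> = 0" by (simp only: add_cancel_right_right)
    then have "h1 Y ^ k = 0" using h1_pow[OF Y(1), of k] Y(3) by simp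
    then show "Y \<in> a_kernel HR PR h1" using Y(1) kernel_iff by simp
  qed
  have id: "ideal NR HR" unfolding HH_nil_def by (rule h.R.genideal_ideal[OF Gc])
  have gen: "?G \<subseteq> NR" unfolding HH_nil_def by (rule h.R.genideal_self[OF Gc])
  show "a_kernel HR PR h1 \<subseteq> NR"
  proof
    fix Y assume "Y \<in> a_kernel HR PR h1"
    then have Y: "Y \<in> carrier HR" "h1 Y = 0" by (simp_all only: kernel_iff)
    obtain F where F: "F \<in> carrier CR" "Y = BR +>\<^bsub>CR\<^esub> F" using Y(1) by (rule HR_ex)
    have Fz: "Phi F = 0" using h1_coset[OF F(1)] F(2) Y(2) by simp
    have comp: "BR +>\<^bsub>CR\<^esub> hcR n F \<in> NR" for n
    proof -
      let ?f = "hcR n F" and ?y = "BR +>\<^bsub>CR\<^esub> hcR n F"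
      have fc: "?f \<in> carrier CR" by (rule hcR_closed[OF F(1)])
      have yc: "?y \<in> carrier HR" by (rule coset_closed[OF fc])
      have "?f \<otimes>\<^bsub>CR\<^esub> (?f \<otimes>\<^bsub>CR\<^esub> ?f) \<in> BR" by (rule Phi_cube[OF fc hcR_Phi[OF F(1) Fz]])
      then have "BR +>\<^bsub>CR\<^esub> (?f \<otimes>\<^bsub>CR\<^esub> (?f \<otimes>\<^bsub>CR\<^esub> ?f)) = \<zero>\<^bsub>HR\<^esub>"
        by (simp add: HH_def FactRing_def B.a_rcos_const)
      moreover have "BR +>\<^bsub>CR\<^esub> (?f \<otimes>\<^bsub>CR\<^esub> (?f \<otimes>\<^bsub>CR\<^esub> ?f)) = ?y \<otimes>\<^bsub>HR\<^esub> (?y \<otimes>\<^bsub>HR\<^esub> ?y)"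
        using fc by (simp add: ring_hom_mult[OF coset_hom])
      ultimately have "?y [^]\<^bsub>HR\<^esub> (3::nat) = \<zero>\<^bsub>HR\<^esub>"
        using yc by (simp add: numeral_3_eq_3 h.R.m_assoc)
      then have "nilpotent_elem HR ?y" unfolding nilpotent_elem_def using yc by (intro conjI exI[of _ "3::nat"]) auto
      moreover have "?f \<in> ?y" by (rule B.a_rcos_self[OF fc])
      then have "HH_homogeneous LM LS ?y" unfolding HH_homogeneous_def using yc by (intro conjI exI[of _ n] exI[of _ ?f]) (auto simp: hcR_def)
      ultimately show ?thesis using gen by blast
    qed
    \<comment> \<open>Truncations below degree \<open>n\<close>: each arises from the previous one
      by adding a single homogeneous component, and for large \<open>n\<close> the truncation is
      \<open>F\<close> itself.\<close>
    define Ft where "Ft n = (\<lambda>k. if k < n then F k else zcoch LM)" for n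
    have Ftc: "Ft n \<in> carrier CR" for n unfolding Ft_def by (rule cut_closed[OF F(1)])
    have "BR +>\<^bsub>CR\<^esub> Ft n \<in> NR" for n
    proof (induction n)
      case 0
      have "Ft 0 = \<zero>\<^bsub>CR\<^esub>" by (simp add: Ft_def cocycle_ring_def)
      then have "BR +>\<^bsub>CR\<^esub> Ft 0 = \<zero>\<^bsub>HR\<^esub>" using B.a_rcos_const[of "\<zero>\<^bsub>CR\<^esub>"] by (simp add: HH_def FactRing_def)
      then show ?case using additive_subgroup.zero_closed[OF ideal.axioms(1)[OF id]] by simp
    next
      case (Suc n)
      have "Ft (Suc n) = Ft n \<oplus>\<^bsub>CR\<^esub> hcR n F"
      proof (intro ext)
        fix k xs
        have Fk: "F k xs \<in> carrier LM" by (rule K.C_D(4)[OF F(1)])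
        show "Ft (Suc n) k xs = (Ft n \<oplus>\<^bsub>CR\<^esub> hcR n F) k xs"
          using Fk by (cases k n rule: linorder_cases) (simp_all add: Ft_def cocycle_ring_def hcR_def zcoch_def)
      qed
      then have "BR +>\<^bsub>CR\<^esub> Ft (Suc n) = (BR +>\<^bsub>CR\<^esub> Ft n) \<oplus>\<^bsub>HR\<^esub> (BR +>\<^bsub>CR\<^esub> hcR n F)"
        using ring_hom_add[OF coset_hom Ftc hcR_closed[OF F(1)]] by simp
      then show ?case using additive_subgroup.a_closed[OF ideal.axioms(1)[OF id] Suc comp] by simp
    qed
    note Ftn = this
    obtain n where nb: "\<forall>k. F k \<noteq> zcoch LM \<longrightarrow> k < n"
      using K.C_D(3)[OF F(1)] unfolding finite_nat_set_iff_bounded by blast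
    have Fn: "Ft n = F"
    proof
      show "Ft n k = F k" for k using nb[rule_format, of k] by (cases "F k = zcoch LM") (simp_all add: Ft_def)
    qed
    show "Y \<in> NR" unfolding F(2) using Ftn[of n] unfolding Fn .
  qed
qed

definition hz :: "(nat \<Rightarrow> (path \<Rightarrow> 'k) set list \<Rightarrow> (path \<Rightarrow> 'k) set) set set \<Rightarrow> 'k poly poly" where
  "hz Z = the_elem (h1 ` Z)"

text \<open>The first isomorphism theorem for \<open>h1\<close>, whose kernel is the nil ideal by
  \<open>HR_nil\<close>; the scalar actions are compared through the representatives chosen by
  \<open>quot_smul\<close>.\<close>

lemma HH_red_monalg: "monalg (HH_red LM LS) (HH_red_smul LM LS) hz SS"
proof -
  interpret h: ring_hom_ring HR PR h1 by (rule h1_ring_hom)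
  have id: "ideal NR HR" using h.kernel_is_ideal by (simp only: HR_nil)
  interpret N: ideal NR HR by (rule id)
  have iso: "hz \<in> ring_iso (HH_red LM LS) (PR \<lparr> carrier := h1 ` carrier HR \<rparr>)"
    using h.FactRing_iso_set_aux unfolding HR_nil HH_red_def hz_def[abs_def] .
  have hom: "hz \<in> ring_hom (HH_red LM LS) (PR \<lparr> carrier := h1 ` carrier HR \<rparr>)"
    and bij: "bij_betw hz (carrier (HH_red LM LS)) (h1 ` carrier HR)"
    using iso by (simp_all add: ring_iso_def)
  have rg: "ring (HH_red LM LS)" unfolding HH_red_def by (rule N.quotient_is_ring)
  have hzs: "hz (NR +>\<^bsub>HR\<^esub> Y) = h1 Y" if "Y \<in> carrier HR" for Y
    using h.the_elem_simp[OF that] unfolding HR_nil hz_def .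
  have im: "h1 ` carrier HR = Phi ` carrier CR"
  proof (intro equalityI subsetI)
    fix p assume "p \<in> h1 ` carrier HR"
    then obtain Y where Y: "Y \<in> carrier HR" "p = h1 Y" by blast
    obtain F where F: "F \<in> carrier CR" "Y = BR +>\<^bsub>CR\<^esub> F" using Y(1) by (rule HR_ex)
    show "p \<in> Phi ` carrier CR" unfolding Y(2) F(2) h1_coset[OF F(1)] by (rule imageI[OF F(1)])
  next
    fix p assume "p \<in> Phi ` carrier CR"
    then obtain F where F: "F \<in> carrier CR" "p = Phi F" by blast
    show "p \<in> h1 ` carrier HR" unfolding F(2) h1_coset[OF F(1), symmetric] by (rule imageI[OF coset_closed[OF F(1)]])
  qed
  have cosc: "NR +>\<^bsub>HR\<^esub> Y \<in> carrier (HH_red LM LS)" if "Y \<in> carrier HR" for Y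
    using ring_hom_closed[OF N.rcos_ring_hom that] by (simp add: HH_red_def)
  have sm1: "HH_smul LM LS c Y \<in> carrier HR \<and> h1 (HH_smul LM LS c Y) = cst c * h1 Y" if Y: "Y \<in> carrier HR" for c Y
  proof -
    obtain F where F: "F \<in> carrier CR" "Y = BR +>\<^bsub>CR\<^esub> F" using Y by (rule HR_ex)
    have "F \<in> Y" unfolding F(2) by (rule B.a_rcos_self[OF F(1)])
    then have x: "(SOME x. x \<in> Y) \<in> Y" by (rule someI[of "\<lambda>x. x \<in> Y"])
    note xc = h1_elem[OF Y x]
    have "HH_smul LM LS c Y = BR +>\<^bsub>CR\<^esub> cocycle_smul LS c (SOME x. x \<in> Y)" by (simp add: HH_smul_def quot_smul_def)
    then show ?thesis using coset_closed[OF CR_smul(1)[OF xc(1)]] h1_coset[OF CR_smul(1)[OF xc(1)]] CR_smul(2)[OF xc(1)] xc(2) by simp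
  qed
  have sm2: "HH_red_smul LM LS c Z \<in> carrier (HH_red LM LS) \<and> hz (HH_red_smul LM LS c Z) = cst c * hz Z" if Z: "Z \<in> carrier (HH_red LM LS)" for c Z
  proof -
    obtain Y where Y: "Y \<in> carrier HR" "Z = NR +>\<^bsub>HR\<^esub> Y" using Z by (auto simp: HH_red_def FactRing_def A_RCOSETS_def')
    have "Y \<in> Z" unfolding Y(2) by (rule N.a_rcos_self[OF Y(1)])
    then have x: "(SOME x. x \<in> Z) \<in> Z" by (rule someI[of "\<lambda>x. x \<in> Z"])
    define x where "x = (SOME x. x \<in> Z)"
    have "x \<in> Z" unfolding x_def by (rule x)
    then have "x \<in> NR +>\<^bsub>HR\<^esub> Y" by (simp only: Y(2)[symmetric])
    then obtain b where b: "b \<in> NR" "x = b \<oplus>\<^bsub>HR\<^esub> Y" by (auto simp: a_r_coset_def')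
    have bk: "b \<in> carrier HR" "h1 b = 0" using b(1) unfolding HR_nil[symmetric] kernel_iff by simp_all
    have xc: "x \<in> carrier HR" "h1 x = hz Z" unfolding b(2) Y(2) hzs[OF Y(1)] h1_hom(1)[OF bk(1) Y(1)] bk(2) using bk(1) Y(1) by simp_all
    have "HH_red_smul LM LS c Z = NR +>\<^bsub>HR\<^esub> HH_smul LM LS c x" by (simp add: HH_red_smul_def quot_smul_def x_def)
    then show ?thesis using cosc[OF conjunct1[OF sm1[OF xc(1)]]] hzs[OF conjunct1[OF sm1[OF xc(1)]]] sm1[OF xc(1)] xc(2) by simp
  qed
  show ?thesis
  proof (rule monalg.intro[OF rg], rule monalg_axioms.intro)
    show "inj_on hz (carrier (HH_red LM LS))" by (rule bij_betw_imp_inj_on[OF bij])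
    show "hz ` carrier (HH_red LM LS) = {p. \<forall>s t. cf2 p s t \<noteq> 0 \<longrightarrow> (s, t) \<in> SS}"
      unfolding bij_betw_imp_surj_on[OF bij] im Phi_image ..
    show "hz \<one>\<^bsub>HH_red LM LS\<^esub> = 1" using ring_hom_one[OF hom] by (simp add: PR_simps)
  next
    fix x y assume xy: "x \<in> carrier (HH_red LM LS)" "y \<in> carrier (HH_red LM LS)"
    show "hz (x \<oplus>\<^bsub>HH_red LM LS\<^esub> y) = hz x + hz y" using ring_hom_add[OF hom xy] by (simp add: PR_simps)
    show "hz (x \<otimes>\<^bsub>HH_red LM LS\<^esub> y) = hz x * hz y" using ring_hom_mult[OF hom xy] by (simp add: PR_simps)
  qed (use sm2 in blast)+
qed

end

theorem theorem3p2:
  fixes m :: nat and q :: "nat \<Rightarrow> 'k::field"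
  assumes "m \<ge> 1" and "\<forall>i<m. q i \<noteq> 0"
  shows "(\<not> (\<exists>n::nat. n > 0 \<and> (\<Prod>i<m. q i) ^ n = 1) \<longrightarrow>
            kalg_iso_to_K (HH_red (Lam m q) (Lam_smul m q)) (HH_red_smul (Lam m q) (Lam_smul m q)))
       \<and> ((\<exists>n::nat. n > 0 \<and> (\<Prod>i<m. q i) ^ n = 1) \<longrightarrow>
            cring (HH_red (Lam m q) (Lam_smul m q)) \<and>
            finitely_generated_kalg (HH_red (Lam m q) (Lam_smul m q)) (HH_red_smul (Lam m q) (Lam_smul m q)) \<and>
            krull_dim (HH_red (Lam m q) (Lam_smul m q)) = 2)"
proof -
  interpret qv m q by unfold_locales (use assms in auto)
  interpret M: monalg "HH_red (Lam m q) (Lam_smul m q)" "HH_red_smul (Lam m q) (Lam_smul m q)" hz SS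
    by (rule HH_red_monalg)
  show ?thesis
  proof (intro conjI impI)
    assume "\<not> (\<exists>n::nat. n > 0 \<and> (\<Prod>i<m. q i) ^ n = 1)"
    then show "kalg_iso_to_K (HH_red (Lam m q) (Lam_smul m q)) (HH_red_smul (Lam m q) (Lam_smul m q))"
      by (intro M.iso_K SS_trivial) (simp only: zeta_def not_False_eq_True)
  next
    assume "\<exists>n::nat. n > 0 \<and> (\<Prod>i<m. q i) ^ n = 1"
    then obtain n where n: "n > 0" "zeta ^ n = 1" by (auto simp: zeta_def)
    \<comment> \<open>The period: \<open>n\<close> trivialises the powers of \<zeta>,
      \<open>m\<close> returns to the same vertex and 2 removes the signs.\<close>
    have N: "2 * n * m > 0" using n(1) assms(1) by simp
    show "cring (HH_red (Lam m q) (Lam_smul m q))" by (rule M.is_cring)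
    show "finitely_generated_kalg (HH_red (Lam m q) (Lam_smul m q)) (HH_red_smul (Lam m q) (Lam_smul m q))"
      by (rule M.fin_gen[OF N SS_period[OF n(2)]]) (rule SS_sub[OF n(2)], assumption)+
    show "krull_dim (HH_red (Lam m q) (Lam_smul m q)) = 2"
      by (rule M.krull_dim_eq[OF N SS_period[OF n(2)]])
  qed
qed

end
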